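(* Let $\lambda>1$ be fixed, and let $\lambda_\star<1$ satisfy $\lambda_\star e^{-\lambda_\star}=\lambda e^{-\lambda}$. Then, as $n\to\infty$, \[ \operatorname{diam}(G(n,\lambda/n)) = \frac{\log n}{\log\lambda} + 2\frac{\log n}{\log(1/\lambda_\star)} +O_{\mathrm p}(1). \]
   Context: $G(n,p)$ is the random graph with vertex set $\{1,\dots,n\}$ in which each possible edge is present independently with probability $p$. For a graph $G$, $\operatorname{diam}(G)=\max\{d(x,y): x,y\in V(G),\ d(x,y)<\infty\}$ is the largest graph distance between two vertices in the same component. $X_n=O_{\mathrm p}(f(n))$ means that $X_n/f(n)$ is bounded in probability, i.e. for every $\eta>0$ there is a constant $C$ with $\Pr(|X_n|>C f(n))\le\eta$ for all sufficiently large $n$. *)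

theory Defs
  imports "HOL-Probability.Probability" "HOL-Library.Extended_Nat"
begin

text \<open>A finite simple graph is given by a vertex set \<open>V\<close> and a set \<open>E\<close> of two-element
  subsets of \<open>V\<close>. A walk is the nonempty list of its vertices.\<close>

definition is_walk :: "'a set \<Rightarrow> 'a set set \<Rightarrow> 'a list \<Rightarrow> bool" where
  "is_walk V E xs \<longleftrightarrow>
     xs \<noteq> [] \<and> set xs \<subseteq> V \<and> (\<forall>i. Suc i < length xs \<longrightarrow> {xs ! i, xs ! Suc i} \<in> E)"

text \<open>In \<open>enat\<close> the infimum of the empty set is \<open>\<infinity>\<close>, so the distance of two vertices in
  different components is \<open>\<infinity>\<close>.\<close>

definition graph_dist :: "'a set \<Rightarrow> 'a set set \<Rightarrow> 'a \<Rightarrow> 'a \<Rightarrow> enat" where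
  "graph_dist V E x y =
     (INF xs \<in> {xs. is_walk V E xs \<and> hd xs = x \<and> last xs = y}. enat (length xs - 1))"

definition graph_diam :: "'a set \<Rightarrow> 'a set set \<Rightarrow> nat" where
  "graph_diam V E =
     Max {the_enat (graph_dist V E x y) | x y. x \<in> V \<and> y \<in> V \<and> graph_dist V E x y < \<infinity>}"

definition possible_edges :: "nat \<Rightarrow> nat set set" where
  "possible_edges n = {e. e \<subseteq> {1..n} \<and> card e = 2}"

text \<open>The distribution of the edge set of $G(n,p)$, whose vertex set is \<open>{1..n}\<close>; meaningful
  for \<open>0 \<le> p \<le> 1\<close>.\<close>

definition gnp :: "nat \<Rightarrow> real \<Rightarrow> nat set set pmf" where
  "gnp n p = map_pmf (\<lambda>present. {e \<in> possible_edges n. present e})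
                     (Pi_pmf (possible_edges n) False (\<lambda>_. bernoulli_pmf p))"

text \<open>$X_n = O_{\mathrm p}(f(n))$, where the random variable \<open>X n\<close> lives on its own probability
  space \<open>M n\<close>.\<close>

definition bigO_prob :: "(nat \<Rightarrow> 'a measure) \<Rightarrow> (nat \<Rightarrow> 'a \<Rightarrow> real) \<Rightarrow> (nat \<Rightarrow> real) \<Rightarrow> bool" where
  "bigO_prob M X f \<longleftrightarrow>
     (\<forall>\<eta>>0. \<exists>C. \<forall>\<^sub>F n in sequentially.
        measure (M n) {\<omega> \<in> space (M n). \<bar>X n \<omega>\<bar> > C * f n} \<le> \<eta>)"

end

theory Submission
  imports Defs "HOL-Real_Asymp.Real_Asymp"
begin

text \<open>Write \<open>p = l / n\<close> and \<open>f(x) = exp (l (x - 1))\<close>, whose smaller fixed point \<open>q = ls / l\<close> has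
  \<open>f'(q) = ls\<close>. As long as only polylogarithmically many vertices have been explored,
  breadth-first search in the random graph follows a Poisson branching process up to a factor \<open>1
  + o(1)\<close> for every sequence of layer sizes. Iterating \<open>f\<close> shows that the layers around a vertex
  stay nonempty but smaller than \<open>w\<close> for \<open>t\<close> steps with probability of order \<open>ls ^ (t - log l
  w)\<close>. Hence with high probability no vertex has thin layers for much longer than \<open>ln n / ln (1
  / ls) + log l w\<close> steps.

  Upper bound: once the layers around \<open>x\<close> and \<open>y\<close> have size \<open>w\<close>, those around \<open>x\<close> grow by a factor
  close to \<open>l\<close> per step and the chance of no contact with the layer around \<open>y\<close> after \<open>r\<close> more
  steps is at most about \<open>exp (- c w\<^sup>2 l ^ r / n)\<close>. This double exponential beats the number of
  pairs whose thin phases are shorter than the maximum, which only grows exponentially with the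
  time saved.

  Lower bound: count the pairs \<open>(v, u)\<close> for which the edge \<open>v u\<close> is a bridge to a thin branch of
  height exactly \<open>h = ln n / ln (1 / ls) - O(1)\<close>, while \<open>v\<close> lies in the giant component. Two
  such branches are disjoint, because nested bridges would give branches of different heights;
  hence the variance of their number is small. By a first moment bound most of the anchors \<open>v\<close>
  have distance at least \<open>log l n - O(1)\<close>, and the deepest vertices of the two branches are \<open>2 h
  + 2\<close> further apart.\<close>

subsection \<open>Independence in the random graph\<close>

text \<open>An error of \<open>O(1)\<close> in the diameter allows only constant factors to be lost
  in probabilities of order \<open>1 / n\<close>. This is possible because the stages of an
  exploration inspect disjoint sets of edges: conditioning on a layer is a finite sum over its
  values, and each Poisson comparison costs a factor \<open>distortion\<close> whose polylogarithmic
  powers tend to 1. The threshold \<open>w = width n\<close> is auxiliary and has to cancel. Two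
  thin phases last up to \<open>ln n / ln (1 / ls) + log l w\<close> steps each, but layers of size
  \<open>w\<close> meet as soon as \<open>w ^ 2 * l ^ r\<close> is of order \<open>n\<close>, that
  is after \<open>log l n - 2 * log l w\<close> steps. For the lower bound, membership in the giant
  component is not a local event. It is replaced by a large layer on the far side of the bridge.
  Such anchors are joined by a walk because the three bad events of the upper bound, with
  \<open>r = n\<close>, are unlikely as well; otherwise the distance could be infinite and would not
  count for the diameter.\<close>

definition gnp_prob :: "nat \<Rightarrow> real \<Rightarrow> (nat set set \<Rightarrow> bool) \<Rightarrow> real" where
  "gnp_prob n p A = measure_pmf.prob (gnp n p) {E. A E}"

text \<open>Measurability with respect to the indicators of the edges in \<open>D\<close>, stated
  pointwise so that no sigma-algebras are involved.\<close>

definition depends_on :: "(nat set set \<Rightarrow> bool) \<Rightarrow> nat set set \<Rightarrow> bool" where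
  "depends_on A D \<longleftrightarrow> (\<forall>E E'. E \<inter> D = E' \<inter> D \<longrightarrow> A E = A E')"

lemma depends_onD: "depends_on A D \<Longrightarrow> E \<inter> D = E' \<inter> D \<Longrightarrow> A E = A E'"
  unfolding depends_on_def by blast

lemma depends_on_mono: "depends_on A D \<Longrightarrow> D \<subseteq> D' \<Longrightarrow> depends_on A D'"
  unfolding depends_on_def by (metis inf.absorb_iff2 inf_assoc inf_commute)

lemma depends_on_const [simp]: "depends_on (\<lambda>_. c) D"
  by (simp add: depends_on_def)

lemma depends_on_conj:
  "depends_on A D \<Longrightarrow> depends_on B D \<Longrightarrow> depends_on (\<lambda>E. A E \<and> B E) D"
  unfolding depends_on_def by blast

lemma depends_on_disj:
  "depends_on A D \<Longrightarrow> depends_on B D \<Longrightarrow> depends_on (\<lambda>E. A E \<or> B E) D"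
  unfolding depends_on_def by blast

lemma depends_on_not: "depends_on A D \<Longrightarrow> depends_on (\<lambda>E. \<not> A E) D"
  unfolding depends_on_def by blast

lemma depends_on_ball:
  "(\<And>x. x \<in> X \<Longrightarrow> depends_on (A x) D) \<Longrightarrow> depends_on (\<lambda>E. \<forall>x\<in>X. A x E) D"
  unfolding depends_on_def by meson

lemma depends_on_edge: "e \<in> D \<Longrightarrow> depends_on (\<lambda>E. e \<in> E) D"
  unfolding depends_on_def by blast

lemma finite_possible_edges: "finite (possible_edges n)"
  by (rule finite_subset[of _ "Pow {1..n}"]) (auto simp: possible_edges_def)

lemma doubleton_possible_edge:
  "x \<in> {1..n} \<Longrightarrow> y \<in> {1..n} \<Longrightarrow> x \<noteq> y \<Longrightarrow> {x, y} \<in> possible_edges n"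
  by (auto simp: possible_edges_def)

lemma set_pmf_gnp: "set_pmf (gnp n p) \<subseteq> Pow (possible_edges n)"
  by (auto simp: gnp_def)

lemma finite_set_pmf_gnp: "finite (set_pmf (gnp n p))"
  by (rule finite_subset[OF set_pmf_gnp]) (simp add: finite_possible_edges)

lemma gnp_prob_nonneg [simp]: "0 \<le> gnp_prob n p A"
  by (simp add: gnp_prob_def)

lemma gnp_prob_le_1 [simp]: "gnp_prob n p A \<le> 1"
  by (simp add: gnp_prob_def)

lemma gnp_prob_True [simp]: "gnp_prob n p (\<lambda>_. True) = 1"
  by (simp add: gnp_prob_def)

lemma gnp_prob_False [simp]: "gnp_prob n p (\<lambda>_. False) = 0"
  by (simp add: gnp_prob_def)

lemma gnp_prob_mono:
  assumes "\<And>E. E \<subseteq> possible_edges n \<Longrightarrow> A E \<Longrightarrow> B E"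
  shows "gnp_prob n p A \<le> gnp_prob n p B"
proof -
  have "gnp_prob n p A = measure_pmf.prob (gnp n p) ({E. A E} \<inter> set_pmf (gnp n p))"
    unfolding gnp_prob_def by (simp add: measure_Int_set_pmf)
  also have "\<dots> \<le> gnp_prob n p B"
    unfolding gnp_prob_def using set_pmf_gnp[of n p] assms
    by (intro measure_pmf.finite_measure_mono) auto
  finally show ?thesis .
qed

lemma gnp_prob_cong:
  assumes "\<And>E. E \<subseteq> possible_edges n \<Longrightarrow> A E = B E"
  shows "gnp_prob n p A = gnp_prob n p B"
  using gnp_prob_mono[of n A B p] gnp_prob_mono[of n B A p] assms by (simp add: order_antisym)

lemma gnp_prob_eq_0:
  assumes "\<And>E. E \<subseteq> possible_edges n \<Longrightarrow> \<not> A E"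
  shows "gnp_prob n p A = 0"
  using gnp_prob_cong[of n A "\<lambda>_. False" p] assms by simp

lemma gnp_prob_not: "gnp_prob n p (\<lambda>E. \<not> A E) = 1 - gnp_prob n p A"
  using measure_pmf.prob_compl[of "{E. A E}" "gnp n p"]
  by (simp add: gnp_prob_def Compl_eq_Diff_UNIV[symmetric] Collect_neg_eq)

lemma gnp_prob_disj: "gnp_prob n p (\<lambda>E. A E \<or> B E) \<le> gnp_prob n p A + gnp_prob n p B"
  unfolding gnp_prob_def Collect_disj_eq by (rule measure_Un_le) auto

lemma gnp_prob_diff: "gnp_prob n p A - gnp_prob n p B \<le> gnp_prob n p (\<lambda>E. A E \<and> \<not> B E)"
proof -
  have "gnp_prob n p A \<le> gnp_prob n p (\<lambda>E. (A E \<and> \<not> B E) \<or> B E)"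
    by (rule gnp_prob_mono) auto
  also have "\<dots> \<le> gnp_prob n p (\<lambda>E. A E \<and> \<not> B E) + gnp_prob n p B"
    by (rule gnp_prob_disj)
  finally show ?thesis by simp
qed

lemma gnp_prob_Bex:
  assumes "finite I"
  shows "gnp_prob n p (\<lambda>E. \<exists>i\<in>I. A i E) \<le> (\<Sum>i\<in>I. gnp_prob n p (A i))"
  using assms
proof (induction I rule: finite_induct)
  case (insert i I)
  have "gnp_prob n p (\<lambda>E. \<exists>i\<in>insert i I. A i E) \<le> gnp_prob n p (A i)
      + gnp_prob n p (\<lambda>E. \<exists>i\<in>I. A i E)"
    using gnp_prob_disj[of n p "A i" "\<lambda>E. \<exists>i\<in>I. A i E"] by simp
  with insert show ?case by simp
qed simp

lemma gnp_prob_partition: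
  assumes "finite I" "\<And>E. E \<subseteq> possible_edges n \<Longrightarrow> h E \<in> I"
  shows "gnp_prob n p A = (\<Sum>i\<in>I. gnp_prob n p (\<lambda>E. h E = i \<and> A E))"
proof -
  have "gnp_prob n p A = gnp_prob n p (\<lambda>E. \<exists>i\<in>I. h E = i \<and> A E)"
    using assms by (intro gnp_prob_cong) auto
  also have "\<dots> = measure_pmf.prob (gnp n p) (\<Union>i\<in>I. {E. h E = i \<and> A E})"
    unfolding gnp_prob_def by (rule arg_cong[where f = "measure_pmf.prob (gnp n p)"]) auto
  also have "\<dots> = (\<Sum>i\<in>I. gnp_prob n p (\<lambda>E. h E = i \<and> A E))"
    unfolding gnp_prob_def
    by (rule measure_pmf.finite_measure_finite_Union) (auto simp: assms disjoint_family_on_def)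
  finally show ?thesis .
qed

lemma prob_pair_pmf_times:
  "measure_pmf.prob (pair_pmf M N) (A \<times> B) = measure_pmf.prob M A * measure_pmf.prob N B"
proof -
  have "measure_pmf.prob (pair_pmf M N) (A \<times> B) =
        measure_pmf.prob (pair_pmf M N) ((A \<times> B) \<inter> set_pmf (pair_pmf M N))"
    by (rule measure_Int_set_pmf[symmetric])
  also have "(A \<times> B) \<inter> set_pmf (pair_pmf M N) = (A \<inter> set_pmf M) \<times> (B \<inter> set_pmf N)"
    by auto
  also have "measure_pmf.prob (pair_pmf M N) \<dots> =
      measure_pmf.prob M (A \<inter> set_pmf M) * measure_pmf.prob N (B \<inter> set_pmf N)"
    by (rule measure_pmf_prob_product) (auto intro: countable_subset[OF _ countable_set_pmf])
  finally show ?thesis by (simp add: measure_Int_set_pmf)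
qed

text \<open>The product measure is split along \<open>D1\<close>. A random edge set is glued from
  its part inside \<open>D1\<close>, which decides \<open>A\<close>, and its part outside, which
  decides \<open>B\<close> because \<open>D2\<close> is disjoint from \<open>D1\<close>.\<close>

lemma gnp_prob_indep:
  assumes A: "depends_on A D1" and B: "depends_on B D2" and disj: "D1 \<inter> D2 = {}"
  shows "gnp_prob n p (\<lambda>E. A E \<and> B E) = gnp_prob n p A * gnp_prob n p B"
proof -
  define S where "S = possible_edges n \<inter> D1"
  define T where "T = possible_edges n - D1"
  let ?P = "\<lambda>S. Pi_pmf S False (\<lambda>_. bernoulli_pmf p)"
  have ST: "possible_edges n = S \<union> T" "S \<inter> T = {}" and fin: "finite S" "finite T"
    using finite_possible_edges[of n] by (auto simp: S_def T_def)
  define glue where "glue = (\<lambda>(f, g). {e \<in> S \<union> T. if e \<in> S then f e else g e})"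
  have gnp: "gnp n p = map_pmf glue (pair_pmf (?P S) (?P T))"
    unfolding gnp_def ST(1) Pi_pmf_union[OF fin ST(2)] map_pmf_comp glue_def
    by (rule arg_cong2[where f = map_pmf]) (auto simp: fun_eq_iff)
  have A': "A (glue (f, g)) = A {e \<in> S. f e}" for f g
    by (rule depends_onD[OF A]) (auto simp: glue_def S_def T_def)
  have B': "B (glue (f, g)) = B {e \<in> T. g e}" for f g
    by (rule depends_onD[OF B]) (use disj in \<open>auto simp: glue_def S_def T_def\<close>)
  have vA: "glue -` {E. A E} = {f. A {e \<in> S. f e}} \<times> UNIV" by (auto simp: A')
  have vB: "glue -` {E. B E} = UNIV \<times> {g. B {e \<in> T. g e}}" by (auto simp: B')
  have vAB: "glue -` {E. A E \<and> B E} = {f. A {e \<in> S. f e}} \<times> {g. B {e \<in> T. g e}}"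
    by (auto simp: A' B')
  show ?thesis
    unfolding gnp_prob_def gnp measure_map_pmf vA vB vAB prob_pair_pmf_times by simp
qed

lemma gnp_prob_edge:
  assumes "e \<in> possible_edges n" "0 \<le> p" "p \<le> 1"
  shows "gnp_prob n p (\<lambda>E. e \<in> E) = p"
proof -
  let ?P = "Pi_pmf (possible_edges n) False (\<lambda>_. bernoulli_pmf p)"
  have "gnp_prob n p (\<lambda>E. e \<in> E) = measure_pmf.prob (map_pmf (\<lambda>f. f e) ?P) {True}"
    unfolding gnp_prob_def gnp_def measure_map_pmf
    by (rule arg_cong[where f = "measure_pmf.prob ?P"]) (use assms in auto)
  also have "map_pmf (\<lambda>f. f e) ?P = bernoulli_pmf p"
    by (subst Pi_pmf_component) (use assms finite_possible_edges in auto)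
  also have "measure_pmf.prob (bernoulli_pmf p) {True} = p"
    using assms by (simp add: measure_pmf_single)
  finally show ?thesis .
qed

section \<open>One step of breadth-first search\<close>

definition nbrs :: "'a set set \<Rightarrow> 'a set \<Rightarrow> 'a set \<Rightarrow> 'a set" where
  "nbrs E F U = {u \<in> U. \<exists>f\<in>F. {u, f} \<in> E}"

definition crossing :: "'a set \<Rightarrow> 'a set \<Rightarrow> 'a set set" where
  "crossing F U = {{u, f} |u f. u \<in> U \<and> f \<in> F}"

lemma nbrs_subset: "nbrs E F U \<subseteq> U"
  by (auto simp: nbrs_def)

lemma depends_on_nbrs: "depends_on (\<lambda>E. A (nbrs E F U)) (crossing F U)"
  unfolding depends_on_def
proof (intro allI impI)
  fix E E' assume *: "E \<inter> crossing F U = E' \<inter> crossing F U"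
  have "\<And>u f. u \<in> U \<Longrightarrow> f \<in> F \<Longrightarrow> {u, f} \<in> E \<longleftrightarrow> {u, f} \<in> E'"
    using * by (auto simp: crossing_def set_eq_iff)
  hence "nbrs E F U = nbrs E' F U" by (auto simp: nbrs_def)
  thus "A (nbrs E F U) = A (nbrs E' F U)" by simp
qed

lemma gnp_prob_no_edges:
  assumes "finite F" "F \<subseteq> {1..n}" "u \<in> {1..n}" "u \<notin> F" "0 \<le> p" "p \<le> 1"
  shows "gnp_prob n p (\<lambda>E. \<forall>f\<in>F. {u, f} \<notin> E) = (1 - p) ^ card F"
  using assms(1,2,4)
proof (induction F rule: finite_induct)
  case (insert x F)
  have "gnp_prob n p (\<lambda>E. {u, x} \<notin> E \<and> (\<forall>f\<in>F. {u, f} \<notin> E)) =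
        gnp_prob n p (\<lambda>E. {u, x} \<notin> E) * gnp_prob n p (\<lambda>E. \<forall>f\<in>F. {u, f} \<notin> E)"
    by (rule gnp_prob_indep[where ?D1.0 = "{{u, x}}" and ?D2.0 = "{{u, f} |f. f \<in> F}"])
       (use insert in \<open>auto intro!: depends_on_not depends_on_edge depends_on_ball
          simp: doubleton_eq_iff\<close>)
  moreover have "gnp_prob n p (\<lambda>E. {u, x} \<notin> E) = 1 - p"
    unfolding gnp_prob_not
    by (subst gnp_prob_edge) (use insert assms in \<open>auto intro: doubleton_possible_edge\<close>)
  ultimately show ?case using insert by simp
qed simp

text \<open>Distinct vertices of \<open>U\<close> see disjoint sets of possible edges to
  \<open>F\<close>, so each joins the next layer independently, with probability
  \<open>1 - (1 - p) ^ card F\<close>.\<close>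

lemma gnp_prob_nbrs_eq:
  assumes "finite U" "F \<subseteq> {1..n}" "U \<subseteq> {1..n}" "F \<inter> U = {}" "F' \<subseteq> U" "0 \<le> p" "p \<le> 1"
  shows "gnp_prob n p (\<lambda>E. nbrs E F U = F') =
         (1 - (1 - p) ^ card F) ^ card F' * ((1 - p) ^ card F) ^ (card U - card F')"
proof -
  have finF: "finite F" using assms finite_subset by blast
  have 1: "gnp_prob n p (\<lambda>E. \<forall>u\<in>U. (\<exists>f\<in>F. {u, f} \<in> E) \<longleftrightarrow> u \<in> F') =
         (1 - (1 - p) ^ card F) ^ card F' * ((1 - p) ^ card F) ^ (card U - card F')"
    using assms(1,3,4,5)
  proof (induction U arbitrary: F' rule: finite_induct)
    case (insert u U)
    let ?A = "\<lambda>u F' E. (\<exists>f\<in>F. {u, f} \<in> E) \<longleftrightarrow> u \<in> F'"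
    have no: "gnp_prob n p (\<lambda>E. \<forall>f\<in>F. {u, f} \<notin> E) = (1 - p) ^ card F"
      using insert finF assms by (intro gnp_prob_no_edges) auto
    have single: "gnp_prob n p (?A u F') = (if u \<in> F' then 1 - (1 - p) ^ card F else (1 - p) ^
        card F)"
      using no gnp_prob_not[of n p "\<lambda>E. \<forall>f\<in>F. {u, f} \<notin> E"] by auto
    have dep: "depends_on (?A x F') {{x, f} |f. f \<in> F}" for x
    proof (cases "x \<in> F'")
      case True
      have "depends_on (\<lambda>E. \<not> (\<forall>f\<in>F. {x, f} \<notin> E)) {{x, f} |f. f \<in> F}"
        by (intro depends_on_not depends_on_ball depends_on_edge) auto
      with True show ?thesis by simp
    next
      case False
      have "depends_on (\<lambda>E. (\<forall>f\<in>F. {x, f} \<notin> E)) {{x, f} |f. f \<in> F}"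
        by (intro depends_on_not depends_on_ball depends_on_edge) auto
      with False show ?thesis by simp
    qed
    have "gnp_prob n p (\<lambda>E. ?A u F' E \<and> (\<forall>x\<in>U. ?A x F' E)) =
          gnp_prob n p (?A u F') * gnp_prob n p (\<lambda>E. \<forall>x\<in>U. ?A x F' E)"
    proof (rule gnp_prob_indep[where ?D1.0 = "{{u, f} |f. f \<in> F}" and ?D2.0 = "crossing F U"])
      show "depends_on (\<lambda>E. \<forall>x\<in>U. ?A x F' E) (crossing F U)"
        by (intro depends_on_ball depends_on_mono[OF dep]) (auto simp: crossing_def)
      show "{{u, f} |f. f \<in> F} \<inter> crossing F U = {}"
        using insert by (auto simp: crossing_def doubleton_eq_iff)
    qed (rule dep)
    \<comment> \<open>The induction hypothesis speaks of subsets of \<open>U\<close>; removing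
      \<open>u\<close> from \<open>F'\<close> is harmless because \<open>u\<close> is not in
      \<open>U\<close>.\<close>
    also have "gnp_prob n p (\<lambda>E. \<forall>x\<in>U. ?A x F' E) = gnp_prob n p (\<lambda>E. \<forall>x\<in>U. ?A x (F' - {u}) E)"
      using insert by (intro gnp_prob_cong) auto
    also have "\<dots> = (1 - (1 - p) ^ card F) ^ card (F' - {u}) *
                     ((1 - p) ^ card F) ^ (card U - card (F' - {u}))"
      using insert by (intro insert.IH) auto
    finally have eq: "gnp_prob n p (\<lambda>E. \<forall>x\<in>insert u U. ?A x F' E) =
      gnp_prob n p (?A u F') * ((1 - (1 - p) ^ card F) ^ card (F' - {u}) *
        ((1 - p) ^ card F) ^ (card U - card (F' - {u})))"
      by simp
    have finF': "finite F'" using insert.prems insert.hyps by (meson finite.insertI finite_subset)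
    show ?case
    proof (cases "u \<in> F'")
      case True
      define c where "c = card (F' - {u})"
      have "card F' = Suc c" unfolding c_def using True
        by (intro card.remove finF')
      moreover have "card (insert u U) = Suc (card U)" using insert.hyps by simp
      ultimately show ?thesis using True unfolding eq single c_def[symmetric] by simp
    next
      case False
      hence "F' - {u} = F'" "F' \<subseteq> U" using insert by auto
      moreover from this have "card F' \<le> card U" using insert.hyps by (simp add: card_mono)
      hence "card (insert u U) - card F' = Suc (card U - card F')" using insert.hyps by simp
      ultimately show ?thesis using False unfolding eq single by simp
    qed
  qed simp
  have "gnp_prob n p (\<lambda>E. nbrs E F U = F') = gnp_prob n p (\<lambda>E. \<forall>u\<in>U. (\<exists>f\<in>F. {u, f} \<in> E) \<longleftrightarrow> u \<in> F')"
    using assms by (intro gnp_prob_cong) (auto simp: nbrs_def)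
  with 1 show ?thesis by simp
qed

text \<open>Binomial law of the size of the next layer: each of \<open>m\<close> unexplored vertices
  misses all \<open>k\<close> frontier vertices with probability \<open>(1 - p) ^ k\<close>.\<close>

definition nbr_card_prob :: "real \<Rightarrow> nat \<Rightarrow> nat \<Rightarrow> nat \<Rightarrow> real" where
  "nbr_card_prob p m k j = real (m choose j) * (1 - (1 - p) ^ k) ^ j * ((1 - p) ^ k) ^ (m - j)"

lemma nbr_card_prob_nonneg: "0 \<le> p \<Longrightarrow> p \<le> 1 \<Longrightarrow> 0 \<le> nbr_card_prob p m k j"
  by (simp add: nbr_card_prob_def power_le_one)

lemma sum_Pow_card:
  fixes h :: "nat \<Rightarrow> real"
  assumes "finite U"
  shows "(\<Sum>A\<in>Pow U. h (card A)) = (\<Sum>j\<le>card U. real (card U choose j) * h j)"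
proof -
  have "(\<Sum>A\<in>Pow U. h (card A)) = (\<Sum>j\<le>card U. \<Sum>A\<in>{A\<in>Pow U. card A = j}. h (card A))"
    by (rule sum.group[symmetric]) (use assms in \<open>auto intro: card_mono\<close>)
  also have "\<dots> = (\<Sum>j\<le>card U. real (card U choose j) * h j)"
    using n_subsets[OF assms] by (intro sum.cong) auto
  finally show ?thesis .
qed

text \<open>Markov property of the exploration. The hypothesis \<open>dep\<close> says that the
  future never looks again at an edge between \<open>F\<close> and \<open>U\<close>; it is therefore
  independent of the layer just revealed, and total probability applies.\<close>

lemma gnp_prob_step:
  assumes "F \<subseteq> {1..n}" "U \<subseteq> {1..n}" "F \<inter> U = {}" "0 \<le> p" "p \<le> 1"
    and dep: "\<And>F'. F' \<subseteq> U \<Longrightarrow> depends_on (A F') (- crossing F U)"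
  shows "gnp_prob n p (\<lambda>E. A (nbrs E F U) E) =
         (\<Sum>F'\<in>Pow U. (1 - (1 - p) ^ card F) ^ card F' * ((1 - p) ^ card F) ^ (card U - card F')
            * gnp_prob n p (A F'))"
proof -
  have finU: "finite U" using assms finite_subset by blast
  have "gnp_prob n p (\<lambda>E. A (nbrs E F U) E) =
        (\<Sum>F'\<in>Pow U. gnp_prob n p (\<lambda>E. nbrs E F U = F' \<and> A (nbrs E F U) E))"
    by (rule gnp_prob_partition) (use finU nbrs_subset[of _ F U] in auto)
  also have "\<dots> = (\<Sum>F'\<in>Pow U. gnp_prob n p (\<lambda>E. nbrs E F U = F') * gnp_prob n p (A F'))"
  proof (intro sum.cong refl)
    fix F' assume "F' \<in> Pow U"
    have "gnp_prob n p (\<lambda>E. nbrs E F U = F' \<and> A (nbrs E F U) E) =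
          gnp_prob n p (\<lambda>E. nbrs E F U = F' \<and> A F' E)"
      by (intro gnp_prob_cong) auto
    also have "\<dots> = gnp_prob n p (\<lambda>E. nbrs E F U = F') * gnp_prob n p (A F')"
      by (rule gnp_prob_indep[OF depends_on_nbrs[of "\<lambda>X. X = F'"] dep]) (use \<open>F' \<in> Pow U\<close> in auto)
    finally show "gnp_prob n p (\<lambda>E. nbrs E F U = F' \<and> A (nbrs E F U) E) = \<dots>" .
  qed
  also have "\<dots> = (\<Sum>F'\<in>Pow U. (1 - (1 - p) ^ card F) ^ card F' * ((1 - p) ^ card F) ^ (card U -
      card F')
            * gnp_prob n p (A F'))"
    using assms finU by (intro sum.cong refl) (simp add: gnp_prob_nbrs_eq)
  finally show ?thesis .
qed

text \<open>When the future is bounded through the size of the layer alone, the sum over sets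
  collapses to a sum over sizes. Sizes outside \<open>S\<close> stand for explorations that have
  been killed. Members of \<open>S\<close> above \<open>card U\<close> do no harm, since their
  binomial coefficient is 0.\<close>

lemma gnp_prob_step_upper:
  assumes "F \<subseteq> {1..n}" "U \<subseteq> {1..n}" "F \<inter> U = {}" "0 \<le> p" "p \<le> 1"
    and dep: "\<And>F'. F' \<subseteq> U \<Longrightarrow> depends_on (A F') (- crossing F U)"
    and fin: "finite S" and nn: "\<And>j. j \<in> S \<Longrightarrow> 0 \<le> g j"
    and S: "\<And>F'. F' \<subseteq> U \<Longrightarrow> card F' \<in> S \<Longrightarrow> gnp_prob n p (A F') \<le> g (card F')"
    and nS: "\<And>F'. F' \<subseteq> U \<Longrightarrow> card F' \<notin> S \<Longrightarrow> gnp_prob n p (A F') = 0"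
  shows "gnp_prob n p (\<lambda>E. A (nbrs E F U) E) \<le> (\<Sum>j\<in>S. nbr_card_prob p (card U) (card F) j * g j)"
proof -
  have finU: "finite U" using assms finite_subset by blast
  let ?w = "\<lambda>j. (1 - (1 - p) ^ card F) ^ j * ((1 - p) ^ card F) ^ (card U - j)"
  have w: "0 \<le> ?w j" for j using assms(4,5) by (simp add: power_le_one)
  have "gnp_prob n p (\<lambda>E. A (nbrs E F U) E) = (\<Sum>F'\<in>Pow U. ?w (card F') * gnp_prob n p (A F'))"
    by (rule gnp_prob_step[OF assms(1-5) dep])
  also have "\<dots> \<le> (\<Sum>F'\<in>Pow U. ?w (card F') * (if card F' \<in> S then g (card F') else 0))"
    using S nS w by (intro sum_mono mult_left_mono) auto
  also have "\<dots> = (\<Sum>j\<le>card U. real (card U choose j) * (?w j * (if j \<in> S then g j else 0)))"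
    by (rule sum_Pow_card[OF finU])
  also have "\<dots> = (\<Sum>j\<in>{..card U} \<inter> S. nbr_card_prob p (card U) (card F) j * g j)"
    by (subst sum.inter_restrict) (auto intro!: sum.cong simp: nbr_card_prob_def)
  also have "\<dots> \<le> (\<Sum>j\<in>S. nbr_card_prob p (card U) (card F) j * g j)"
    using fin nn assms by (intro sum_mono2) (auto intro!: mult_nonneg_nonneg nbr_card_prob_nonneg)
  finally show ?thesis .
qed

lemma gnp_prob_step_lower:
  assumes "F \<subseteq> {1..n}" "U \<subseteq> {1..n}" "F \<inter> U = {}" "0 \<le> p" "p \<le> 1"
    and dep: "\<And>F'. F' \<subseteq> U \<Longrightarrow> depends_on (A F') (- crossing F U)"
    and fin: "finite S"
    and S: "\<And>F'. F' \<subseteq> U \<Longrightarrow> card F' \<in> S \<Longrightarrow> g (card F') \<le> gnp_prob n p (A F')"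
  shows "(\<Sum>j\<in>S. nbr_card_prob p (card U) (card F) j * g j) \<le> gnp_prob n p (\<lambda>E. A (nbrs E F U) E)"
proof -
  have finU: "finite U" using assms finite_subset by blast
  let ?w = "\<lambda>j. (1 - (1 - p) ^ card F) ^ j * ((1 - p) ^ card F) ^ (card U - j)"
  have w: "0 \<le> ?w j" for j using assms(4,5) by (simp add: power_le_one)
  have "(\<Sum>j\<in>S. nbr_card_prob p (card U) (card F) j * g j) =
        (\<Sum>j\<in>{..card U} \<inter> S. nbr_card_prob p (card U) (card F) j * g j)"
    using fin by (intro sum.mono_neutral_right) (auto simp: nbr_card_prob_def)
  also have "\<dots> = (\<Sum>j\<le>card U. real (card U choose j) * (?w j * (if j \<in> S then g j else 0)))"
    by (subst sum.inter_restrict) (auto intro!: sum.cong simp: nbr_card_prob_def)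
  also have "\<dots> = (\<Sum>F'\<in>Pow U. ?w (card F') * (if card F' \<in> S then g (card F') else 0))"
    by (rule sum_Pow_card[OF finU, symmetric])
  also have "\<dots> \<le> (\<Sum>F'\<in>Pow U. ?w (card F') * gnp_prob n p (A F'))"
    using S w by (intro sum_mono mult_left_mono) auto
  also have "\<dots> = gnp_prob n p (\<lambda>E. A (nbrs E F U) E)"
    by (rule gnp_prob_step[OF assms(1-5) dep, symmetric])
  finally show ?thesis .
qed

text \<open>Generating function of the binomial law, the source of the exponential moments in the
  deviation bounds below.\<close>

lemma sum_nbr_card_prob:
  "(\<Sum>j\<le>m. nbr_card_prob p m k j * s ^ j) = (1 - (1 - (1 - p) ^ k) * (1 - s)) ^ m"
proof -
  have "(1 - (1 - (1 - p) ^ k) * (1 - s)) ^ m = ((1 - (1 - p) ^ k) * s + (1 - p) ^ k) ^ m"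
    by (simp add: algebra_simps)
  also have "\<dots> = (\<Sum>j\<le>m. nbr_card_prob p m k j * s ^ j)"
    unfolding binomial_ring nbr_card_prob_def
    by (intro sum.cong refl) (simp add: power_mult_distrib mult_ac)
  finally show ?thesis ..
qed

subsection \<open>Poisson approximation and branching processes\<close>

definition pois :: "real \<Rightarrow> nat \<Rightarrow> real" where
  "pois \<mu> j = exp (- \<mu>) * \<mu> ^ j / fact j"

lemma pois_nonneg: "0 \<le> \<mu> \<Longrightarrow> 0 \<le> pois \<mu> j"
  by (simp add: pois_def)

lemma pois_pos: "0 < \<mu> \<Longrightarrow> 0 < pois \<mu> j"
  by (simp add: pois_def)

lemma pois_power_sums: "(\<lambda>j. pois \<mu> j * x ^ j) sums exp (\<mu> * (x - 1))"
proof -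
  have "(\<lambda>j. exp (- \<mu>) * ((\<mu> * x) ^ j /\<^sub>R fact j)) sums (exp (- \<mu>) * exp (\<mu> * x))"
    by (intro sums_mult exp_converges)
  thus ?thesis
    by (simp add: pois_def power_mult_distrib field_simps exp_diff[symmetric] exp_add[symmetric])
qed

section \<open>Comparison of binomial and Poisson probabilities\<close>

lemma one_minus_power_bounds:
  fixes p :: real
  assumes "0 \<le> p" "p \<le> 1"
  shows "1 - (1 - p) ^ k \<le> p * k"
    and "p * k * (1 - p * k) \<le> 1 - (1 - p) ^ k"
proof -
  show "1 - (1 - p) ^ k \<le> p * k"
    using Bernoulli_inequality[of "-p" k] assms by (simp add: mult.commute)
  have "(1 - p) ^ k \<le> exp (- p) ^ k"
    using exp_ge_add_one_self[of "-p"] assms by (intro power_mono) auto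
  also have "\<dots> = exp (- (p * k))" by (simp add: exp_of_nat_mult[symmetric] mult.commute)
  also have "\<dots> = 1 / exp (p * k)" by (simp add: exp_minus inverse_eq_divide)
  also have "\<dots> \<le> 1 / (1 + p * k)"
    using exp_ge_add_one_self[of "p * k"] assms
        by (intro divide_left_mono) (auto intro!: mult_pos_pos add_pos_nonneg)
  also have "\<dots> \<le> 1 - p * k * (1 - p * k)"
  proof -
    have "0 \<le> p * k" using assms by simp
    hence "1 \<le> (1 - p * k * (1 - p * k)) * (1 + p * k)"
    proof -
      have "(1 - p * k * (1 - p * k)) * (1 + p * k) = 1 + (p * k) ^ 3"
        by (simp add: algebra_simps power3_eq_cube)
      thus ?thesis using \<open>0 \<le> p * k\<close> by simp
    qed
    thus ?thesis using \<open>0 \<le> p * k\<close> by (simp add: divide_le_eq)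
  qed
  finally show "p * k * (1 - p * k) \<le> 1 - (1 - p) ^ k" by simp
qed

lemma exp_minus_twice_le: "0 \<le> y \<Longrightarrow> y \<le> 1/2 \<Longrightarrow> exp (- 2 * y) \<le> 1 - (y::real)"
proof -
  assume y: "0 \<le> y" "y \<le> 1/2"
  have "1 \<le> (1 + 2 * y) * (1 - y)" using y by (simp add: algebra_simps mult_left_le)
  moreover have "1 + 2 * y \<le> exp (2 * y)" by (rule exp_ge_add_one_self)
  ultimately have "1 \<le> exp (2 * y) * (1 - y)"
    using y mult_right_mono[of "1 + 2 * y" "exp (2 * y)" "1 - y"] by linarith
  thus ?thesis by (simp add: exp_minus field_simps)
qed

text \<open>The three factors are compared separately. Only the last one costs anything: at least
  \<open>n - 2 * b\<close> vertices must be missed instead of \<open>n\<close>, which changes the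
  exponent by at most \<open>2 * p * k * b\<close>.\<close>

lemma nbr_card_prob_upper:
  fixes l :: real and b n m k j :: nat
  assumes l: "0 \<le> l" "l \<le> real n" and n: "0 < n"
    and m: "m \<le> n" "n \<le> m + b" and kj: "k \<le> b" "j \<le> b"
  shows "nbr_card_prob (l / n) m k j \<le> exp (2 * l * b\<^sup>2 / n) * pois (l * k) j"
proof (cases "j \<le> m")
  case False
  thus ?thesis using l by (simp add: nbr_card_prob_def pois_nonneg binomial_eq_0)
next
  case True
  define p where "p = l / n"
  have p: "0 \<le> p" "p \<le> 1" and pn: "p * n = l" using l n by (auto simp: p_def)
  have 1: "real (m choose j) \<le> real n ^ j / fact j"
  proof -
    have "real (m choose j) * fact j \<le> real m ^ j"
      using binomial_fact_pow[of m j] by (metis of_nat_fact of_nat_le_iff of_nat_mult of_nat_power)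
    also have "\<dots> \<le> real n ^ j" using m by (intro power_mono) auto
    finally show ?thesis by (simp add: field_simps)
  qed
  have 2: "(1 - (1 - p) ^ k) ^ j \<le> (p * k) ^ j"
    using one_minus_power_bounds(1)[OF p, of k] p by (intro power_mono) (auto simp: power_le_one)
  have 3: "((1 - p) ^ k) ^ (m - j) \<le> exp (- (l * k)) * exp (2 * l * b\<^sup>2 / n)"
  proof -
    have "((1 - p) ^ k) ^ (m - j) \<le> (exp (- p) ^ k) ^ (m - j)"
      using exp_ge_add_one_self[of "-p"] p by (intro power_mono) auto
    also have "\<dots> = exp (- p * real k * real (m - j))"
      by (simp add: exp_of_nat_mult[symmetric] mult_ac)
    also have "\<dots> \<le> exp (- p * real k * (real n - 2 * real b))"
    proof -
      have "real n - 2 * real b \<le> real (m - j)" using m kj True by (simp add: of_nat_diff)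
      hence "p * real k * (real n - 2 * real b) \<le> p * real k * real (m - j)"
        using p by (intro mult_left_mono) auto
      thus ?thesis by simp
    qed
    also have "- p * real k * (real n - 2 * real b) = - (l * k) + 2 * p * k * b"
      using pn by (simp add: algebra_simps)
    also have "exp \<dots> \<le> exp (- (l * k) + 2 * l * b\<^sup>2 / n)"
    proof -
      have "2 * p * k * b \<le> 2 * p * b * b" using p kj by (intro mult_right_mono mult_left_mono) auto
      thus ?thesis by (simp add: p_def power2_eq_square)
    qed
    finally show ?thesis unfolding exp_add .
  qed
  have "nbr_card_prob p m k j \<le> (real n ^ j / fact j) * (p * k) ^ j * (exp (- (l * k)) * exp (2 *
      l * b\<^sup>2 / n))"
    unfolding nbr_card_prob_def using 1 2 3 p by (intro mult_mono) (auto simp: power_le_one)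
  also have "\<dots> = exp (2 * l * b\<^sup>2 / n) * (exp (- (l * k)) * (p * n * k) ^ j / fact j)"
    by (simp add: power_mult_distrib field_simps)
  finally show ?thesis unfolding pois_def pn p_def[symmetric] by simp
qed

text \<open>The summands of \<open>4 + 2 * l + 2 * l\<^sup>2\<close> are the losses in the three
  factors: the binomial coefficient against \<open>n ^ j / fact j\<close>, the success probability
  against \<open>p * k\<close>, and \<open>1 - p\<close> against \<open>exp (- p)\<close>.\<close>

lemma nbr_card_prob_lower:
  fixes l :: real and b n m k j :: nat
  assumes l: "0 \<le> l" "2 * l * b \<le> n" "4 * b \<le> n" and n: "0 < n" and b: "0 < b"
    and m: "m \<le> n" "n \<le> m + b" and kj: "k \<le> b" "j \<le> b"
  shows "exp (- ((4 + 2 * l + 2 * l\<^sup>2) * b\<^sup>2 / n)) * pois (l * k) j \<le> nbr_card_prob (l / n) m k j"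
proof -
  define p where "p = l / n"
  have "l * 1 \<le> l * b" using l b by (intro mult_left_mono) auto
  hence "2 * l \<le> n" using l by linarith
  hence p: "0 \<le> p" "p \<le> 1/2" and pn: "p * n = l" using l n by (auto simp: p_def field_simps)
  have jm: "j \<le> m" "j \<le> n" using m kj l by auto
  have pkb: "p * k \<le> p * b" using p kj by (intro mult_left_mono) auto
  have pb: "p * b \<le> 1/2" using l n by (simp add: p_def field_simps)
  have bn: "2 * real b / n \<le> 1/2" using l n by (simp add: field_simps)
  have 1: "real n ^ j / fact j * exp (- 4 * b\<^sup>2 / n) \<le> real (m choose j)"
  proof -
    have "exp (- 4 * b\<^sup>2 / n) = exp (- 2 * (2 * real b / n)) ^ b"
      by (simp add: exp_of_nat_mult[symmetric] power2_eq_square)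
    also have "\<dots> \<le> exp (- 2 * (2 * real b / n)) ^ j"
      using kj by (intro power_decreasing) auto
    also have "\<dots> \<le> (1 - 2 * real b / n) ^ j"
      using bn by (intro power_mono exp_minus_twice_le) auto
    finally have "real n ^ j * exp (- 4 * b\<^sup>2 / n) \<le> (real n * (1 - 2 * real b / n)) ^ j"
      unfolding power_mult_distrib by (intro mult_left_mono) auto
    also have "real n * (1 - 2 * real b / n) = real n - 2 * real b" using n
        by (simp add: field_simps)
    also have "(real n - 2 * real b) ^ j \<le> real (m - j + 1) ^ j"
      using l kj m jm by (intro power_mono) (auto simp: of_nat_diff)
    also have "\<dots> \<le> real (m choose j) * fact j"
    proof -
      have "real (m - j + 1) ^ j = (\<Prod>i<j. real (m - j + 1))" by simp
      also have "\<dots> \<le> (\<Prod>i<j. real (m - i))" using jm by (intro prod_mono) auto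
      also have "\<dots> = (\<Prod>i = 0..<j. real m - real i)"
        using jm by (intro prod.cong) auto
      also have "\<dots> = real (m choose j) * fact j"
        by (simp add: binomial_gbinomial gbinomial_prod_rev)
      finally show ?thesis .
    qed
    finally show ?thesis by (simp add: field_simps)
  qed
  have 2: "(p * k) ^ j * exp (- 2 * l * b\<^sup>2 / n) \<le> (1 - (1 - p) ^ k) ^ j"
  proof -
    have "exp (- 2 * l * b\<^sup>2 / n) = exp (- 2 * (p * b)) ^ b"
      by (simp add: exp_of_nat_mult[symmetric] power2_eq_square p_def)
    also have "\<dots> \<le> exp (- 2 * (p * b)) ^ j"
      using kj p by (intro power_decreasing) auto
    also have "\<dots> \<le> (1 - p * b) ^ j"
      using pb p by (intro power_mono exp_minus_twice_le) auto
    also have "\<dots> \<le> (1 - p * k) ^ j"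
      using pkb pb by (intro power_mono) auto
    finally have "(p * k) ^ j * exp (- 2 * l * b\<^sup>2 / n) \<le> (p * k * (1 - p * k)) ^ j"
      using p by (simp add: power_mult_distrib mult_left_mono)
    also have "\<dots> \<le> (1 - (1 - p) ^ k) ^ j"
      using one_minus_power_bounds(2)[of p k] p pkb pb by (intro power_mono) auto
    finally show ?thesis .
  qed
  have 3: "exp (- (l * k)) * exp (- 2 * l\<^sup>2 * b\<^sup>2 / n) \<le> ((1 - p) ^ k) ^ (m - j)"
  proof -
    have "exp (- p - 2 * p\<^sup>2) \<le> 1 - p"
    proof -
      have "ln (1 - p) \<ge> - p - 2 * p\<^sup>2" using ln_one_minus_pos_lower_bound[of p] p by simp
      thus ?thesis using p by (simp add: ln_ge_iff)
    qed
    hence "(exp (- p - 2 * p\<^sup>2) ^ k) ^ n \<le> ((1 - p) ^ k) ^ n" by (intro power_mono) auto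
    also have "\<dots> \<le> ((1 - p) ^ k) ^ (m - j)"
      using p m by (intro power_decreasing) (auto simp: power_le_one)
    also have "(exp (- p - 2 * p\<^sup>2) ^ k) ^ n = exp ((- p - 2 * p\<^sup>2) * k * n)"
      by (simp add: exp_of_nat_mult[symmetric] mult_ac)
    also have "(- p - 2 * p\<^sup>2) * k * n = - (l * k) - 2 * p * l * k"
      by (simp add: pn[symmetric] algebra_simps power2_eq_square)
    finally have "exp (- (l * k)) * exp (- (2 * p * l * k)) \<le> ((1 - p) ^ k) ^ (m - j)"
      by (simp add: exp_add[symmetric])
    moreover have "2 * p * l * k \<le> 2 * l\<^sup>2 * b\<^sup>2 / n"
    proof -
      have "2 * p * l * k \<le> 2 * p * l * (b * b)"
      proof -
        have "k \<le> b * b" using kj b by (meson le_square le_trans)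
        thus ?thesis using p l by (intro mult_left_mono) (auto simp flip: of_nat_mult)
      qed
      thus ?thesis by (simp add: p_def power2_eq_square)
    qed
    hence "exp (- 2 * l\<^sup>2 * b\<^sup>2 / n) \<le> exp (- (2 * p * l * k))" by simp
    hence "exp (- (l * k)) * exp (- 2 * l\<^sup>2 * b\<^sup>2 / n) \<le> exp (- (l * k)) * exp (- (2 * p * l * k))"
      by (intro mult_left_mono) auto
    ultimately show ?thesis by linarith
  qed
  have "exp (- ((4 + 2 * l + 2 * l\<^sup>2) * b\<^sup>2 / n)) * pois (l * k) j =
      (real n ^ j / fact j * exp (- 4 * b\<^sup>2 / n)) * ((p * k) ^ j * exp (- 2 * l * b\<^sup>2 / n)) *
      (exp (- (l * k)) * exp (- 2 * l\<^sup>2 * b\<^sup>2 / n))"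
  proof -
    have "- ((4 + 2 * l + 2 * l\<^sup>2) * b\<^sup>2 / n) = (- 4 * b\<^sup>2 / n) + ((- 2 * l * b\<^sup>2 / n)
        + (- 2 * l\<^sup>2 * b\<^sup>2 / n))"
      using n by (simp add: field_simps)
    hence "exp (- ((4 + 2 * l + 2 * l\<^sup>2) * b\<^sup>2 / n)) =
        exp (- 4 * b\<^sup>2 / n) * (exp (- 2 * l * b\<^sup>2 / n) * exp (- 2 * l\<^sup>2 * b\<^sup>2 / n))"
      by (simp only: exp_add)
    moreover have "pois (l * k) j = exp (- (l * k)) * (real n ^ j * (p * k) ^ j) / fact j"
      by (simp add: pois_def pn[symmetric] power_mult_distrib[symmetric] mult_ac)
    ultimately show ?thesis by simp
  qed
  also have "\<dots> \<le> nbr_card_prob p m k j"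
    unfolding nbr_card_prob_def using 1 2 3 p
    by (intro mult_mono) (auto simp: power_le_one)
  finally show ?thesis unfolding p_def .
qed

section \<open>Generating function of Poisson offspring; its iterates at 0 are the extinction
  probabilities\<close>

definition pgf :: "real \<Rightarrow> real \<Rightarrow> real" where
  "pgf l x = exp (l * (x - 1))"

lemma pgf_mono: "0 \<le> l \<Longrightarrow> x \<le> y \<Longrightarrow> pgf l x \<le> pgf l y"
  by (simp add: pgf_def mult_left_mono)

lemma pgf_iter_mono: "0 \<le> l \<Longrightarrow> x \<le> y \<Longrightarrow> (pgf l ^^ t) x \<le> (pgf l ^^ t) y"
  by (induction t) (auto simp: pgf_mono)

lemma pgf_iter_nonneg: "0 \<le> x \<Longrightarrow> 0 \<le> (pgf l ^^ t) x"
  by (cases t) (auto simp: pgf_def)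

lemma pgf_iter_fixed: "pgf l q = q \<Longrightarrow> (pgf l ^^ t) q = q"
  by (induction t) auto

lemma pgf_iter_le_one: "0 \<le> l \<Longrightarrow> x \<le> 1 \<Longrightarrow> (pgf l ^^ t) x \<le> 1"
  using pgf_iter_mono[of l x 1 t] pgf_iter_fixed[of l 1 t] by (simp add: pgf_def)

text \<open>Branching property: the families of the \<open>k\<close> individuals are independent, so
  their generating functions multiply.\<close>

lemma sums_pgf_power: "(\<lambda>j. pois (l * real k) j * x ^ j) sums (pgf l x ^ k)"
proof -
  have "pgf l x ^ k = exp (l * k * (x - 1))"
    by (simp add: pgf_def exp_of_nat_mult[symmetric] mult_ac)
  thus ?thesis using pois_power_sums[of "l * k" x] by simp
qed

text \<open>\<open>bp_iter l S g t k\<close> is the expectation of \<open>g Z\<^sub>t\<close>, restricted to the event that \<open>Z\<^sub>1, \<dots>,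
  Z\<^sub>t\<close> lie in \<open>S\<close>, for the generation sizes of a Poisson branching process with mean \<open>l\<close> and
  \<open>Z\<^sub>0 = k\<close>.\<close>

primrec bp_iter :: "real \<Rightarrow> nat set \<Rightarrow> (nat \<Rightarrow> real) \<Rightarrow> nat \<Rightarrow> nat \<Rightarrow> real" where
  "bp_iter l S g 0 = g"
| "bp_iter l S g (Suc t) = (\<lambda>k. \<Sum>j\<in>S. pois (l * real k) j * bp_iter l S g t j)"

lemma bp_iter_nonneg:
  assumes "0 \<le> l" "\<And>j. j \<in> S \<Longrightarrow> 0 \<le> g j" "k \<in> S"
  shows "0 \<le> bp_iter l S g t k"
  using assms(3)
  by (induction t arbitrary: k) (use assms in \<open>auto intro!: sum_nonneg mult_nonneg_nonneg
      pois_nonneg\<close>)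

text \<open>A Poisson step maps \<open>u ^ j - v ^ j\<close> to the same expression in
  \<open>pgf l u\<close> and \<open>pgf l v\<close>, and restricting the sum to \<open>S\<close>
  only decreases it. With \<open>v = 0\<close> the subtracted term removes the extinct histories,
  which dominate as soon as \<open>t\<close> is large.\<close>

lemma bp_iter_le_diff:
  assumes l: "0 \<le> l" and S: "finite S" and A: "0 \<le> A" and uv: "0 \<le> v" "v \<le> u"
    and g: "\<And>j. j \<in> S \<Longrightarrow> g j \<le> A * (u ^ j - v ^ j)" and k: "k \<in> S"
  shows "bp_iter l S g t k \<le> A * ((pgf l ^^ t) u ^ k - (pgf l ^^ t) v ^ k)"
  using k
proof (induction t arbitrary: k)
  case 0 thus ?case using g by simp
next
  case (Suc t)
  let ?u = "(pgf l ^^ t) u" and ?v = "(pgf l ^^ t) v"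
  have uv': "0 \<le> ?v" "?v \<le> ?u"
    using pgf_iter_nonneg pgf_iter_mono l uv by auto
  have sm: "(\<lambda>j. pois (l * real k) j * (A * (?u ^ j - ?v ^ j))) sums (A * (pgf l ?u ^ k - pgf l ?v
      ^ k))"
    using sums_mult[OF sums_diff[OF sums_pgf_power[of l k ?u] sums_pgf_power[of l k ?v]], of A]
    by (simp add: algebra_simps)
  have "bp_iter l S g (Suc t) k \<le> (\<Sum>j\<in>S. pois (l * real k) j * (A * (?u ^ j - ?v ^ j)))"
    using Suc l by (auto intro!: sum_mono mult_left_mono pois_nonneg)
  also have "\<dots> \<le> A * (pgf l ?u ^ k - pgf l ?v ^ k)"
    unfolding sums_unique[OF sm]
    by (rule sum_le_suminf[OF sums_summable[OF sm] S])
       (use l A uv' in \<open>auto intro!: mult_nonneg_nonneg pois_nonneg power_mono\<close>)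
  finally show ?case by simp
qed

text \<open>The variant without subtraction, for sets \<open>S\<close> that contain 0, where
  extinction is allowed.\<close>

lemma bp_iter_le_power:
  assumes l: "0 \<le> l" and S: "finite S" and A: "0 \<le> A" and u: "0 \<le> u"
    and g: "\<And>j. j \<in> S \<Longrightarrow> g j \<le> A * u ^ j" and k: "k \<in> S"
  shows "bp_iter l S g t k \<le> A * (pgf l ^^ t) u ^ k"
  using k
proof (induction t arbitrary: k)
  case 0 thus ?case using g by simp
next
  case (Suc t)
  let ?u = "(pgf l ^^ t) u"
  have u': "0 \<le> ?u" using pgf_iter_nonneg u by auto
  have sm: "(\<lambda>j. pois (l * real k) j * (A * ?u ^ j)) sums (A * pgf l ?u ^ k)"
    using sums_mult[OF sums_pgf_power[of l k ?u], of A] by (simp add: algebra_simps)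
  have "bp_iter l S g (Suc t) k \<le> (\<Sum>j\<in>S. pois (l * real k) j * (A * ?u ^ j))"
    using Suc l by (auto intro!: sum_mono mult_left_mono pois_nonneg)
  also have "\<dots> \<le> A * pgf l ?u ^ k"
    unfolding sums_unique[OF sm]
    by (rule sum_le_suminf[OF sums_summable[OF sm] S])
       (use l A u' in \<open>auto intro!: mult_nonneg_nonneg pois_nonneg\<close>)
  finally show ?case by simp
qed

text \<open>The difference of the two powers is the probability that the process started from
  \<open>k\<close> individuals dies out exactly at generation \<open>Suc t\<close>. The restricted
  process misses only histories that reach size \<open>w\<close> or more at one of \<open>t\<close>
  times and still die out, which has probability at most \<open>q ^ w\<close> each time.\<close>

lemma bp_iter_extinct_lower:
  assumes l: "0 \<le> l" and q: "pgf l q = q" "0 \<le> q" "q \<le> 1" and k: "k \<ge> 1"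
  shows "(pgf l ^^ Suc t) 0 ^ k - (pgf l ^^ t) 0 ^ k - t * q ^ w
           \<le> bp_iter l {1..<w} (\<lambda>j. exp (- (l * real j))) t k"
  using k
proof (induction t arbitrary: k)
  case 0
  have "pgf l 0 ^ k = exp (- (l * real k))"
    by (simp add: pgf_def exp_of_nat_mult[symmetric] mult.commute)
  thus ?case using 0 by simp
next
  case (Suc t)
  let ?b = "bp_iter l {1..<w} (\<lambda>j. exp (- (l * real j))) t"
  let ?u = "(pgf l ^^ Suc t) 0" and ?v = "(pgf l ^^ t) 0"
  define d where "d = (\<lambda>j. ?u ^ j - ?v ^ j)"
  have le: "0 \<le> ?v" "?v \<le> ?u" "?u \<le> q"
  proof -
    show "0 \<le> ?v" by (rule pgf_iter_nonneg) simp
    have "(pgf l ^^ t) 0 \<le> (pgf l ^^ t) (pgf l 0)"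
      by (rule pgf_iter_mono[OF l]) (simp add: pgf_def)
    thus "?v \<le> ?u" by (simp add: funpow_swap1)
    show "?u \<le> q" using pgf_iter_mono[OF l q(2), of "Suc t"] pgf_iter_fixed[OF q(1)] by metis
  qed
  have sm: "(\<lambda>j. pois (l * real k) j * d j) sums (pgf l ?u ^ k - pgf l ?v ^ k)"
    using sums_diff[OF sums_pgf_power[of l k ?u] sums_pgf_power[of l k ?v]]
    by (simp add: d_def algebra_simps)
  have sp: "pois (l * real k) sums 1"
    using pois_power_sums[of "l * real k" 1] by simp
  have p0: "0 \<le> pois (l * real k) j" for j using l by (intro pois_nonneg) auto
  have dq: "d j \<le> q ^ w" if "j \<ge> w" for j
  proof -
    have "d j \<le> ?u ^ j" using le by (simp add: d_def)
    also have "\<dots> \<le> q ^ j" using le by (intro power_mono) auto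
    also have "\<dots> \<le> q ^ w" using that q by (intro power_decreasing) auto
    finally show ?thesis .
  qed
  have s1: "(\<Sum>j\<in>{1..<w}. pois (l * real k) j) \<le> 1"
    unfolding sums_unique[OF sp]
    by (rule sum_le_suminf[OF sums_summable[OF sp]]) (use p0 in auto)
  \<comment> \<open>Outside \<open>{1..<w}\<close> the size 0 contributes nothing, because
    \<open>d 0 = 0\<close>, and sizes from \<open>w\<close> on are paid for by
    \<open>q ^ w\<close>.\<close>
  have le_tm: "pois (l * real k) j * d j \<le>
      (if j \<in> {1..<w} then pois (l * real k) j * d j else 0) + pois (l * real k) j * q ^ w" for j
  proof (cases "j \<in> {1..<w}")
    case False
    hence "j = 0 \<or> j \<ge> w" by auto
    thus ?thesis using False p0[of j] dq[of j] q
      by (auto simp: d_def intro: mult_left_mono)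
  qed (use p0 q in simp)
  have sm2: "(\<lambda>j. (if j \<in> {1..<w} then pois (l * real k) j * d j else 0)
      + pois (l * real k) j * q ^ w)
     sums ((\<Sum>j\<in>{1..<w}. pois (l * real k) j * d j) + 1 * q ^ w)"
    by (intro sums_add sums_If_finite_set sums_mult2 sp) auto
  have "pgf l ?u ^ k - pgf l ?v ^ k \<le> (\<Sum>j\<in>{1..<w}. pois (l * real k) j * d j) + 1 * q ^ w"
    by (rule sums_le[OF le_tm sm sm2])
  moreover have "(\<Sum>j\<in>{1..<w}. pois (l * real k) j * d j) - t * q ^ w \<le>
      (\<Sum>j\<in>{1..<w}. pois (l * real k) j * ?b j)"
  proof -
    have "(\<Sum>j\<in>{1..<w}. pois (l * real k) j * d j) - t * q ^ w \<le>
        (\<Sum>j\<in>{1..<w}. pois (l * real k) j * d j) - (t * q ^ w) * (\<Sum>j\<in>{1..<w}. pois (l * real k) j)"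
      using s1 q by (simp add: mult_left_le)
    also have "\<dots> = (\<Sum>j\<in>{1..<w}. pois (l * real k) j * (d j - t * q ^ w))"
      by (simp add: sum_distrib_left sum_subtractf algebra_simps)
    also have "\<dots> \<le> (\<Sum>j\<in>{1..<w}. pois (l * real k) j * ?b j)"
      using Suc.IH p0 by (intro sum_mono mult_left_mono) (auto simp: d_def)
    finally show ?thesis .
  qed
  ultimately show ?case by (simp add: algebra_simps)
qed

section \<open>Rates of escape from 1 and of convergence to the fixed point \<open>q\<close>\<close>

lemma one_minus_exp_ge: "0 \<le> y \<Longrightarrow> y / (1 + y) \<le> 1 - exp (- (y::real))"
proof -
  assume y: "0 \<le> y"
  have "exp (- y) = 1 / exp y" by (simp add: exp_minus inverse_eq_divide)
  also have "\<dots> \<le> 1 / (1 + y)"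
    using exp_ge_add_one_self[of y] y by (intro divide_left_mono) (auto intro!: mult_pos_pos
        add_pos_nonneg)
  finally show ?thesis using y by (simp add: field_simps)
qed

text \<open>The distance \<open>d\<close> of the iterates from \<open>q\<close> obeys
  \<open>d (Suc h) = q * (1 - exp (- (l * d h)))\<close>. By \<open>one_minus_exp_ge\<close> its
  reciprocal is bounded by an affine recursion with fixed point \<open>- A\<close>, which can be
  solved; so \<open>d h\<close> is at least of order \<open>(l * q) ^ h\<close>. As \<open>d\<close>
  shrinks by a factor at most \<open>l * q < 1\<close>, consecutive differences have the same
  order.\<close>

lemma extinction_gap_lower:
  assumes l: "0 < l" and q: "pgf l q = q" "0 < q" "l * q < 1"
  shows "\<exists>c>0. \<forall>h. c * (l * q) ^ h \<le> (pgf l ^^ Suc h) 0 - (pgf l ^^ h) 0"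
proof -
  define A where "A = l / (1 - l * q)"
  define d where "d = (\<lambda>h. q - (pgf l ^^ h) 0)"
  have lq: "0 < l * q" using l q by simp
  have A: "0 < A" using l q by (simp add: A_def)
  have dS: "d (Suc h) = q * (1 - exp (- (l * d h)))" for h
  proof -
    have "(pgf l ^^ Suc h) 0 = exp (l * (q - 1)) * exp (- (l * d h))"
      unfolding exp_add[symmetric] by (simp add: pgf_def d_def algebra_simps)
    thus ?thesis using q by (simp add: d_def pgf_def algebra_simps)
  qed
  have pos: "0 < d h" for h
  proof (induction h)
    case (Suc h)
    thus ?case unfolding dS using q l by simp
  qed (use q in \<open>simp add: d_def\<close>)
  have inv: "1 / d h \<le> (1 / q + A) / (l * q) ^ h - A" for h
  proof (induction h)
    case 0 thus ?case by (simp add: d_def)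
  next
    case (Suc h)
    have "q * (l * d h / (1 + l * d h)) \<le> d (Suc h)"
      unfolding dS using one_minus_exp_ge[of "l * d h"] pos[of h] l q by (intro mult_left_mono) auto
    hence "1 / d (Suc h) \<le> 1 / (q * (l * d h / (1 + l * d h)))"
      using pos[of h] pos[of "Suc h"] l q
      by (intro divide_left_mono) (auto intro!: mult_pos_pos divide_pos_pos add_pos_pos)
    also have "\<dots> = (1 / d h + l) / (l * q)"
      using pos[of h] l q by (simp add: field_simps)
    also have "\<dots> \<le> ((1 / q + A) / (l * q) ^ h - A + l) / (l * q)"
      using Suc lq by (intro divide_right_mono) auto
    also have "\<dots> = (1 / q + A) / (l * q) ^ Suc h - A"
    proof -
      have "A * (1 - l * q) = l" using q by (simp add: A_def)
      hence "l - A = - A * (l * q)" by (simp add: algebra_simps)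
      hence "(l - A) / (l * q) = - A" using lq by (metis less_irrefl nonzero_mult_div_cancel_right)
      hence "(X - A + l) / (l * q) = X / (l * q) - A" for X
        by (simp add: diff_divide_distrib add_divide_distrib)
      thus ?thesis by (simp add: mult.commute)
    qed
    finally show ?case .
  qed
  define c where "c = (1 - l * q) / (1 / q + A)"
  have c: "c > 0" using q A by (simp add: c_def add_pos_pos)
  have "c * (l * q) ^ h \<le> (pgf l ^^ Suc h) 0 - (pgf l ^^ h) 0" for h
  proof -
    have "1 / d h \<le> (1 / q + A) / (l * q) ^ h" using inv[of h] A by linarith
    hence "(l * q) ^ h / (1 / q + A) \<le> d h"
    proof -
      have *: "0 < D \<Longrightarrow> 0 < P \<Longrightarrow> 0 < W \<Longrightarrow> 1 / D \<le> W / P \<Longrightarrow> P / W \<le> D" for D P W :: real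
        by (simp add: field_simps)
      have "0 < 1 / q" using q(2) by simp
      hence "0 < 1 / q + A" using A by linarith
      thus "1 / d h \<le> (1 / q + A) / (l * q) ^ h \<Longrightarrow> (l * q) ^ h / (1 / q + A) \<le> d h"
        by (rule *[OF pos zero_less_power[OF lq]])
    qed
    hence "c * (l * q) ^ h \<le> (1 - l * q) * d h"
      using q mult_left_mono[of "(l * q) ^ h / (1 / q + A)" "d h" "1 - l * q"] by (simp add: c_def)
    also have "\<dots> \<le> d h - d (Suc h)"
    proof -
      have "1 - exp (- (l * d h)) \<le> l * d h" using exp_ge_add_one_self[of "- (l * d h)"] by linarith
      hence "d (Suc h) \<le> q * (l * d h)" unfolding dS using q by (intro mult_left_mono) auto
      thus ?thesis by (simp add: algebra_simps)
    qed
    also have "\<dots> = (pgf l ^^ Suc h) 0 - (pgf l ^^ h) 0" by (simp add: d_def)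
    finally show ?thesis .
  qed
  with c show ?thesis by blast
qed

text \<open>The bound \<open>1 - exp (- y) <= y\<close> makes each step a contraction towards
  \<open>q\<close> with factor \<open>l * q\<close>, the derivative of \<open>pgf l\<close> at
  \<open>q\<close>.\<close>

lemma extinction_iter_le:
  assumes l: "0 < l" and q: "pgf l q = q" "0 < q" "q \<le> 1"
  shows "q - (pgf l ^^ h) 0 \<le> (l * q) ^ h"
proof (induction h)
  case (Suc h)
  let ?d = "q - (pgf l ^^ h) 0"
  have "(pgf l ^^ Suc h) 0 = exp (l * (q - 1)) * exp (- (l * ?d))"
    unfolding exp_add[symmetric] by (simp add: pgf_def algebra_simps)
  hence "q - (pgf l ^^ Suc h) 0 = q * (1 - exp (- (l * ?d)))" using q
      by (simp add: pgf_def algebra_simps)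
  also have "\<dots> \<le> q * (l * ?d)"
    using exp_ge_add_one_self[of "- (l * ?d)"] q by (intro mult_left_mono) auto
  also have "\<dots> \<le> q * (l * (l * q) ^ h)" using Suc l q by (intro mult_left_mono) auto
  finally show ?case by (simp add: mult_ac)
qed (use q in simp)

text \<open>The distance of the iterates to the repelling fixed point \<open>1\<close> grows by a factor about \<open>l\<close>
  per step, so that \<open>w \<le> l ^ m\<close> steps lead from \<open>exp (- 1 / w)\<close> to a point bounded away from
  \<open>1\<close>.\<close>

lemma pgf_iter_escape:
  assumes l: "1 < l" and q: "q < 1"
  shows "\<exists>x. q < x \<and> x < 1 \<and>
    (\<forall>w m. 1 \<le> w \<longrightarrow> w \<le> l ^ m \<longrightarrow> (pgf l ^^ m) (exp (- (1 / w))) \<le> x)"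
proof -
  \<comment> \<open>\<open>Z\<close> bounds the reciprocal distance to 1 after \<open>m\<close>
    steps: the term \<open>(w + 1) / l ^ m\<close> is at most 2 and \<open>l / (l - 1)\<close> is
    the fixed point of \<open>y / l + 1\<close>. The maximum in \<open>x\<close> keeps
    \<open>x\<close> above \<open>q\<close>.\<close>
  define Z where "Z = 2 + l / (l - 1)"
  define x where "x = max (1 - 1 / Z) ((1 + q) / 2)"
  have Z: "Z > 0" using l by (simp add: Z_def add_pos_pos)
  have "(pgf l ^^ m) (exp (- (1 / w))) \<le> x" if w: "1 \<le> w" "w \<le> l ^ m" for w m
  proof -
    define e where "e = (\<lambda>t. 1 - (pgf l ^^ t) (exp (- (1 / w))))"
    have eS: "e (Suc t) = 1 - exp (- (l * e t))" for t
      by (simp add: e_def pgf_def algebra_simps)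
    have pos: "0 < e t" for t
    proof (induction t)
      case (Suc t)
      thus ?case unfolding eS using l by simp
    qed (use w in \<open>simp add: e_def\<close>)
    have inv: "1 / e t \<le> (w + 1) / l ^ t + l / (l - 1)" for t
    proof (induction t)
      case 0
      have "(1 / w) / (1 + 1 / w) \<le> e 0" using one_minus_exp_ge[of "1 / w"] w by (simp add: e_def)
      hence "1 / (w + 1) \<le> e 0" using w by (simp add: field_simps)
      hence "1 / e 0 \<le> w + 1" using pos[of 0] w by (simp add: field_simps)
      moreover have "0 \<le> l / (l - 1)" using l by simp
      ultimately show ?case by simp
    next
      case (Suc t)
      have "l * e t / (1 + l * e t) \<le> e (Suc t)"
        unfolding eS using one_minus_exp_ge[of "l * e t"] pos[of t] l by auto
      hence "1 / e (Suc t) \<le> 1 / (l * e t / (1 + l * e t))"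
        using pos[of t] pos[of "Suc t"] l
        by (intro divide_left_mono) (auto intro!: mult_pos_pos divide_pos_pos add_pos_pos)
      also have "\<dots> = (1 / e t) / l + 1" using pos[of t] l by (simp add: field_simps)
      also have "\<dots> \<le> ((w + 1) / l ^ t + l / (l - 1)) / l + 1"
        using Suc l by (intro add_right_mono divide_right_mono) auto
      also have "\<dots> = (w + 1) / l ^ Suc t + l / (l - 1)"
      proof -
        have "l / (l - 1) / l + 1 = l / (l - 1)" using l by (simp add: field_simps)
        thus ?thesis by (simp add: add_divide_distrib mult.commute)
      qed
      finally show ?case .
    qed
    have "(w + 1) / l ^ m \<le> 2"
      using w l by (simp add: divide_le_eq)
    hence "1 / e m \<le> Z" using inv[of m] by (simp add: Z_def)
    hence "1 / Z \<le> e m" using pos[of m] Z by (simp add: field_simps)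
    thus ?thesis by (simp add: e_def x_def)
  qed
  moreover have "q < x" "x < 1" using q Z by (simp_all add: x_def less_max_iff_disj)
  ultimately show ?thesis by blast
qed

text \<open>Convexity with denominators cleared: a weighted sum of the tangent inequalities at
  \<open>x\<close>, evaluated at \<open>q\<close> and at \<open>y\<close>.\<close>

lemma pgf_chord:
  assumes "0 \<le> l" "q \<le> x" "x \<le> y"
  shows "pgf l x * (y - q) \<le> pgf l q * (y - x) + pgf l y * (x - q)"
proof -
  have "pgf l x * (1 + l * (z - x)) \<le> pgf l z" for z
  proof -
    have "pgf l z = pgf l x * exp (l * (z - x))"
      unfolding pgf_def exp_add[symmetric] by (simp add: algebra_simps)
    thus ?thesis using exp_ge_add_one_self[of "l * (z - x)"] by (simp add: pgf_def)
  qed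
  note t = this
  have "pgf l x * (y - q) = pgf l x * (1 + l * (q - x)) * (y - x) + pgf l x * (1
      + l * (y - x)) * (x - q)"
    by (simp add: algebra_simps)
  also have "\<dots> \<le> pgf l q * (y - x) + pgf l y * (x - q)"
    using assms by (intro add_mono mult_right_mono t) auto
  finally show ?thesis .
qed

text \<open>Strict convexity: the chord between the fixed points \<open>q\<close> and 1 is the
  diagonal, and the graph lies strictly below it.\<close>

lemma pgf_less_self:
  assumes l: "0 < l" and q: "pgf l q = q" "q < x" "x < 1"
  shows "pgf l x < x"
proof -
  have t: "pgf l x * (1 + l * (z - x)) < pgf l z" if "z \<noteq> x" for z
  proof -
    have "pgf l z = pgf l x * exp (l * (z - x))"
      unfolding pgf_def exp_add[symmetric] by (simp add: algebra_simps)
    moreover have "1 + l * (z - x) < exp (l * (z - x))"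
    proof -
      have "l * (z - x) \<noteq> 0" using that l by simp
      moreover have "exp (l * (z - x)) \<noteq> 1 + l * (z - x)"
        using ln_eq_minus_one[of "exp (l * (z - x))"] \<open>l * (z - x) \<noteq> 0\<close> by auto
      ultimately show ?thesis using exp_ge_add_one_self[of "l * (z - x)"] by linarith
    qed
    ultimately show ?thesis by (simp add: pgf_def)
  qed
  have "pgf l x * (1 - q) = pgf l x * (1 + l * (q - x)) * (1 - x) + pgf l x * (1
      + l * (1 - x)) * (x - q)"
    by (simp add: algebra_simps)
  also have "\<dots> < pgf l q * (1 - x) + pgf l 1 * (x - q)"
    using q by (intro add_strict_mono mult_strict_right_mono t) auto
  also have "\<dots> = x * (1 - q)" using q by (simp add: pgf_def algebra_simps)
  finally show ?thesis using q by simp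
qed

text \<open>The exact rate is found in two rounds. Convexity first gives contraction by the chord
  slope \<open>\<theta> < 1\<close>, which may be worse than \<open>l * q\<close> but makes the
  distances \<open>d\<close> summable. Then \<open>d (Suc t) = q * (exp (l * d t) - 1) <= l * q * d
  t * exp (l * d t)\<close>, and the product of the correction factors is bounded through the sum of
  the \<open>d t\<close>.\<close>

lemma pgf_iter_converge:
  assumes l: "0 < l" and q: "pgf l q = q" "0 < q" and x: "q < x" "x < 1"
  shows "\<exists>C>0. \<forall>t. (pgf l ^^ t) x - q \<le> C * (l * q) ^ t"
proof -
  define \<theta> where "\<theta> = (pgf l x - q) / (x - q)"
  define d where "d = (\<lambda>t. (pgf l ^^ t) x - q)"
  have lt: "pgf l x < x" by (rule pgf_less_self[OF l q(1) x])
  have \<theta>1: "\<theta> < 1" using lt x by (simp add: \<theta>_def)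
  have \<theta>0: "0 \<le> \<theta>"
    using pgf_mono[of l q x] l q x by (simp add: \<theta>_def)
  have d0: "0 \<le> d t" for t
    using pgf_iter_mono[of l q x t] pgf_iter_fixed[OF q(1), of t] l x by (simp add: d_def)
  have dx: "d t \<le> x - q" for t
  proof (induction t)
    case (Suc t)
    hence "(pgf l ^^ Suc t) x \<le> pgf l x" using l by (auto simp: d_def intro: pgf_mono)
    thus ?case using lt by (simp add: d_def)
  qed (simp add: d_def)
  have contr: "d t \<le> \<theta> ^ t * (x - q)" for t
  proof (induction t)
    case (Suc t)
    have "pgf l ((pgf l ^^ t) x) * (x - q) \<le> pgf l q * (x - (pgf l ^^ t) x)
        + pgf l x * ((pgf l ^^ t) x - q)"
      using l d0[of t] dx[of t] by (intro pgf_chord) (auto simp: d_def)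
    hence "d (Suc t) * (x - q) \<le> (pgf l x - q) * d t"
      using q by (simp add: d_def algebra_simps)
    hence "d (Suc t) \<le> \<theta> * d t" using x by (simp add: \<theta>_def field_simps)
    also have "\<dots> \<le> \<theta> * (\<theta> ^ t * (x - q))" using Suc \<theta>0 by (intro mult_left_mono) auto
    finally show ?case by (simp add: mult_ac)
  qed (simp add: d_def)
  have gsum: "(\<Sum>i<t. d i) \<le> (x - q) / (1 - \<theta>)" for t
  proof -
    have "(\<Sum>i<t. d i) \<le> (\<Sum>i<t. \<theta> ^ i * (x - q))" by (intro sum_mono contr)
    also have "\<dots> = (1 - \<theta> ^ t) / (1 - \<theta>) * (x - q)"
      using \<theta>1 by (simp add: sum_distrib_right[symmetric] sum_gp_strict)
    also have "\<dots> \<le> 1 / (1 - \<theta>) * (x - q)"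
      using \<theta>0 \<theta>1 x by (intro mult_right_mono divide_right_mono) auto
    finally show ?thesis by simp
  qed
  have prod: "d t \<le> (x - q) * (l * q) ^ t * exp (l * (\<Sum>i<t. d i))" for t
  proof (induction t)
    case (Suc t)
    have "(pgf l ^^ Suc t) x = exp (l * (q - 1)) * exp (l * d t)"
      unfolding exp_add[symmetric] by (simp add: pgf_def d_def algebra_simps)
    hence "d (Suc t) = q * (exp (l * d t) - 1)" using q by (simp add: d_def pgf_def algebra_simps)
    also have "exp (l * d t) - 1 \<le> l * d t * exp (l * d t)"
    proof -
      have "(1 - l * d t) * exp (l * d t) \<le> exp (- (l * d t)) * exp (l * d t)"
        using exp_ge_add_one_self[of "- (l * d t)"] by (intro mult_right_mono) auto
      thus ?thesis by (simp add: exp_add[symmetric] algebra_simps)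
    qed
    also have "q * (l * d t * exp (l * d t)) \<le>
       q * (l * ((x - q) * (l * q) ^ t * exp (l * (\<Sum>i<t. d i))) * exp (l * d t))"
      using Suc l q by (intro mult_left_mono mult_right_mono) auto
    finally show ?case using q by (simp add: mult_ac exp_add[symmetric] algebra_simps)
  qed (simp add: d_def)
  define C where "C = (x - q) * exp (l * ((x - q) / (1 - \<theta>)))"
  have "d t \<le> C * (l * q) ^ t" for t
  proof -
    have "l * (\<Sum>i<t. d i) \<le> l * ((x - q) / (1 - \<theta>))"
      by (rule mult_left_mono[OF gsum]) (use l in simp)
    hence "exp (l * (\<Sum>i<t. d i)) \<le> exp (l * ((x - q) / (1 - \<theta>)))" by simp
    hence "(x - q) * (l * q) ^ t * exp (l * (\<Sum>i<t. d i)) \<le>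
        (x - q) * (l * q) ^ t * exp (l * ((x - q) / (1 - \<theta>)))"
      by (rule mult_left_mono) (use x l q(2) in simp)
    with prod[of t] show ?thesis by (simp add: C_def mult_ac)
  qed
  moreover have "C > 0" using x by (simp add: C_def)
  ultimately show ?thesis by (auto simp: d_def)
qed

text \<open>After \<open>m\<close> steps the upper iterate has left the neighbourhood of 1; the
  remaining \<open>t\<close> steps bring it to \<open>q\<close> at rate \<open>(l * q) ^ t\<close>.
  The lower iterate is as close to \<open>q\<close> from below, which adds 1 to the
  constant.\<close>

lemma thin_iter_bound:
  assumes l: "1 < l" and q: "pgf l q = q" "0 < q" "q < 1"
  shows "\<exists>C>0. \<forall>w m t. 1 \<le> w \<longrightarrow> w \<le> l ^ m \<longrightarrow>
     (pgf l ^^ (m + t)) (exp (- (1 / w))) - (pgf l ^^ (m + t)) 0 \<le> C * (l * q) ^ t"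
proof -
  obtain x where x: "q < x" "x < 1"
    and xw: "\<And>w m. 1 \<le> w \<Longrightarrow> w \<le> l ^ m \<Longrightarrow> (pgf l ^^ m) (exp (- (1 / w))) \<le> x"
    using pgf_iter_escape[OF l q(3)] by blast
  obtain C where C: "C > 0" "\<And>t. (pgf l ^^ t) x - q \<le> C * (l * q) ^ t"
    using pgf_iter_converge[OF _ q(1,2) x] l by auto
  have "(pgf l ^^ (m + t)) (exp (- (1 / w))) - (pgf l ^^ (m + t)) 0 \<le> (C + 1) * (l * q) ^ t"
    if w: "1 \<le> w" "w \<le> l ^ m" for w m t
  proof -
    have "(pgf l ^^ (m + t)) (exp (- (1 / w))) = (pgf l ^^ t) ((pgf l ^^ m) (exp (- (1 / w))))"
      by (metis add.commute comp_apply funpow_add)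
    also have "\<dots> \<le> (pgf l ^^ t) x" using l xw[OF w] by (intro pgf_iter_mono) auto
    also have "\<dots> \<le> q + C * (l * q) ^ t" using C(2)[of t] by simp
    finally have 1: "(pgf l ^^ (m + t)) (exp (- (1 / w))) \<le> q + C * (l * q) ^ t" .
    have "(pgf l ^^ t) 0 \<le> (pgf l ^^ t) ((pgf l ^^ m) 0)"
      using l by (intro pgf_iter_mono pgf_iter_nonneg) auto
    also have "\<dots> = (pgf l ^^ (m + t)) 0"
      by (metis add.commute comp_apply funpow_add)
    finally have "q - (l * q) ^ t \<le> (pgf l ^^ (m + t)) 0"
      using extinction_iter_le[of l q t] l q by linarith
    with 1 show ?thesis by (simp add: algebra_simps)
  qed
  thus ?thesis using C(1) by (intro exI[of _ "C + 1"]) auto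
qed

subsection \<open>Exploring the random graph\<close>

text \<open>\<open>F\<close> is the frontier and \<open>U\<close> the unexplored set. The recursion
  peels off the first step, so that inductions can condition on it; \<open>layer_Suc\<close> peels
  off the last one instead.\<close>

primrec layer :: "'a set set \<Rightarrow> nat \<Rightarrow> 'a set \<Rightarrow> 'a set \<Rightarrow> 'a set" where
  "layer E 0 F U = F"
| "layer E (Suc i) F U = layer E i (nbrs E F U) (U - nbrs E F U)"

primrec unexplored :: "'a set set \<Rightarrow> nat \<Rightarrow> 'a set \<Rightarrow> 'a set \<Rightarrow> 'a set" where
  "unexplored E 0 F U = U"
| "unexplored E (Suc i) F U = unexplored E i (nbrs E F U) (U - nbrs E F U)"

lemma layer_Suc: "layer E (Suc i) F U = nbrs E (layer E i F U) (unexplored E i F U)"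
  by (induction i arbitrary: F U) simp_all

lemma unexplored_Suc:
  "unexplored E (Suc i) F U = unexplored E i F U - layer E (Suc i) F U"
  by (induction i arbitrary: F U) simp_all

lemma unexplored_eq: "unexplored E i F U = U - (\<Union>j\<in>{1..i}. layer E j F U)"
proof (induction i)
  case (Suc i)
  show ?case unfolding unexplored_Suc Suc by (auto simp: atLeastAtMostSuc_conv simp del:
      layer.simps)
qed simp

lemma layer_Suc_subset: "layer E (Suc i) F U \<subseteq> unexplored E i F U"
  unfolding layer_Suc by (rule nbrs_subset)

lemma unexplored_subset: "unexplored E i F U \<subseteq> U"
  unfolding unexplored_eq by blast

lemma layer_subset: "0 < i \<Longrightarrow> layer E i F U \<subseteq> U"
  using layer_Suc_subset[of E "i - 1" F U] unexplored_subset[of E "i - 1" F U] by auto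

lemma layer_unexplored_disjoint:
  assumes "F \<inter> U = {}" "i \<le> j" shows "layer E i F U \<inter> unexplored E j F U = {}"
proof (cases "i = 0")
  case True thus ?thesis using assms unexplored_subset[of E j F U] by auto
next
  case False thus ?thesis unfolding unexplored_eq using assms by auto
qed

lemma layer_disjoint:
  assumes "F \<inter> U = {}" "i < j" shows "layer E i F U \<inter> layer E j F U = {}"
proof -
  have "i \<le> j - 1" using assms(2) by simp
  from layer_unexplored_disjoint[OF assms(1) this, of E] layer_Suc_subset[of E "j - 1" F U] assms(2)
  show ?thesis by (auto simp del: layer.simps)
qed

lemma layer_empty_mono: "layer E i F U = {} \<Longrightarrow> i \<le> j \<Longrightarrow> layer E j F U = {}"
  by (rotate_tac, induction j rule: dec_induct) (simp_all add: layer_Suc nbrs_def del: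
      layer.simps(2))

section \<open>Edges inspected by an exploration\<close>

definition edges_within :: "'a set \<Rightarrow> 'a set set" where
  "edges_within A = {e. e \<subseteq> A}"

lemma edges_within_mono: "A \<subseteq> B \<Longrightarrow> edges_within A \<subseteq> edges_within B"
  by (auto simp: edges_within_def)

lemma crossing_subset_within: "crossing F U \<subseteq> edges_within (F \<union> U)"
  by (auto simp: crossing_def edges_within_def)

lemma edges_within_subset_compl: "A \<inter> F = {} \<Longrightarrow> edges_within A \<subseteq> - crossing F U"
  by (auto simp: crossing_def edges_within_def)

text \<open>Exploration is adaptive: which edges come next depends on the outcome of the current
  step. Locality survives because all of them lie in \<open>D\<close> whatever the outcome.\<close>

lemma depends_on_bind_nbrs:
  assumes "crossing F U \<subseteq> D" "\<And>F'. F' \<subseteq> U \<Longrightarrow> depends_on (A F') D"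
  shows "depends_on (\<lambda>E. A (nbrs E F U) E) D"
  unfolding depends_on_def
proof (intro allI impI)
  fix E E' assume *: "E \<inter> D = E' \<inter> D"
  have "E \<inter> crossing F U = E' \<inter> crossing F U" using * assms(1) by blast
  hence "nbrs E F U = nbrs E' F U"
    using depends_onD[OF depends_on_nbrs[of "\<lambda>X. X = nbrs E F U"]] by metis
  moreover have "A (nbrs E F U) E = A (nbrs E F U) E'"
    by (rule depends_onD[OF assms(2) *]) (rule nbrs_subset)
  ultimately show "A (nbrs E F U) E = A (nbrs E' F U) E'" by simp
qed

lemma depends_on_layer:
  "depends_on (\<lambda>E. A (layer E i F U) (unexplored E i F U)) (edges_within (F \<union> U))"
proof (induction i arbitrary: F U)
  case (Suc i)
  have "depends_on (\<lambda>E. A (layer E i F' (U - F')) (unexplored E i F' (U - F'))) (edges_within (F \<union>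
      U))"
    if "F' \<subseteq> U" for F'
    by (rule depends_on_mono[OF Suc]) (use that in \<open>auto simp: edges_within_def\<close>)
  from depends_on_bind_nbrs[OF crossing_subset_within this] show ?case by simp
qed simp

lemma gnp_prob_card_nbrs:
  assumes "F \<subseteq> {1..n}" "U \<subseteq> {1..n}" "F \<inter> U = {}" "0 \<le> p" "p \<le> 1"
  shows "gnp_prob n p (\<lambda>E. card (nbrs E F U) = j) = nbr_card_prob p (card U) (card F) j"
proof (rule antisym)
  show "gnp_prob n p (\<lambda>E. card (nbrs E F U) = j) \<le> nbr_card_prob p (card U) (card F) j"
    using gnp_prob_step_upper[OF assms, of "\<lambda>F' E. card F' = j" "{j}" "\<lambda>_. 1"] by simp
  show "nbr_card_prob p (card U) (card F) j \<le> gnp_prob n p (\<lambda>E. card (nbrs E F U) = j)"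
    using gnp_prob_step_lower[OF assms, of "\<lambda>F' E. card F' = j" "{j}" "\<lambda>_. 1"] by simp
qed

text \<open>For futures with a bound \<open>s\<close> that is uniform over the admissible layers;
  the distribution of the layer then plays no further part than the probability of
  \<open>P\<close>.\<close>

lemma gnp_prob_step_mult:
  assumes "F \<subseteq> {1..n}" "U \<subseteq> {1..n}" "F \<inter> U = {}" "0 \<le> p" "p \<le> 1"
    and dep: "\<And>F'. F' \<subseteq> U \<Longrightarrow> depends_on (A F') (- crossing F U)"
    and le: "\<And>F'. F' \<subseteq> U \<Longrightarrow> P F' \<Longrightarrow> gnp_prob n p (A F') \<le> s"
  shows "gnp_prob n p (\<lambda>E. P (nbrs E F U) \<and> A (nbrs E F U) E)
      \<le> gnp_prob n p (\<lambda>E. P (nbrs E F U)) * s"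
proof -
  let ?w = "\<lambda>F'. (1 - (1 - p) ^ card F) ^ card F' * ((1 - p) ^ card F) ^ (card U - card F')"
  have w: "0 \<le> ?w F'" for F' using assms(4,5) by (simp add: power_le_one)
  have "gnp_prob n p (\<lambda>E. P (nbrs E F U) \<and> A (nbrs E F U) E) =
      (\<Sum>F'\<in>Pow U. ?w F' * gnp_prob n p (\<lambda>E. P F' \<and> A F' E))"
    by (rule gnp_prob_step[OF assms(1-5), where A = "\<lambda>F' E. P F' \<and> A F' E"])
       (intro depends_on_conj depends_on_const dep)
  also have "\<dots> \<le> (\<Sum>F'\<in>Pow U. ?w F' * (gnp_prob n p (\<lambda>E. P F') * s))"
  proof (intro sum_mono mult_left_mono w)
    fix F' assume "F' \<in> Pow U"
    thus "gnp_prob n p (\<lambda>E. P F' \<and> A F' E) \<le> gnp_prob n p (\<lambda>E. P F') * s"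
      using le[of F'] by (cases "P F'") auto
  qed
  also have "\<dots> = (\<Sum>F'\<in>Pow U. ?w F' * gnp_prob n p (\<lambda>E. P F')) * s"
    by (simp only: sum_distrib_right mult.assoc)
  also have "(\<Sum>F'\<in>Pow U. ?w F' * gnp_prob n p (\<lambda>E. P F')) = gnp_prob n p (\<lambda>E. P (nbrs E F U))"
    by (rule gnp_prob_step[OF assms(1-5), where A = "\<lambda>F' E. P F'", symmetric]) simp
  finally show ?thesis .
qed

text \<open>\<open>explore_avoiding v\<close> is the exploration of a branch that hangs off \<open>v\<close>: only its root may
  be adjacent to \<open>v\<close>.\<close>

primrec explore :: "nat set \<Rightarrow> (nat set \<Rightarrow> nat set \<Rightarrow> nat set set \<Rightarrow> bool) \<Rightarrow> nat \<Rightarrow>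
    nat set \<Rightarrow> nat set \<Rightarrow> nat set set \<Rightarrow> bool" where
  "explore S Q 0 F U E \<longleftrightarrow> card F \<in> S \<and> Q F U E"
| "explore S Q (Suc t) F U E \<longleftrightarrow> card F \<in> S \<and> explore S Q t (nbrs E F U) (U - nbrs E F U) E"

primrec explore_avoiding :: "nat \<Rightarrow> nat set \<Rightarrow> (nat set \<Rightarrow> nat set \<Rightarrow> nat set set \<Rightarrow> bool) \<Rightarrow> nat \<Rightarrow>
    nat set \<Rightarrow> nat set \<Rightarrow> nat set set \<Rightarrow> bool" where
  "explore_avoiding v S Q 0 F U E \<longleftrightarrow> card F \<in> S \<and> Q F U E"
| "explore_avoiding v S Q (Suc t) F U E \<longleftrightarrow> card F \<in> S \<and> (\<forall>f\<in>nbrs E F U. {v, f} \<notin> E) \<and>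
     explore_avoiding v S Q t (nbrs E F U) (U - nbrs E F U) E"

lemma explore_iff:
  "explore S Q t F U E \<longleftrightarrow> (\<forall>i\<le>t. card (layer E i F U) \<in> S)
      \<and> Q (layer E t F U) (unexplored E t F U) E"
proof (induction t arbitrary: F U)
  case (Suc t)
  have "(\<forall>i\<le>Suc t. card (layer E i F U) \<in> S) \<longleftrightarrow> card F \<in> S \<and>
     (\<forall>i\<le>t. card (layer E (Suc i) F U) \<in> S)"
    by (metis Suc_le_mono layer.simps(1) not0_implies_Suc zero_le)
  thus ?case using Suc by auto
qed simp

lemma explore_avoiding_iff:
  "explore_avoiding v S Q t F U E \<longleftrightarrow> explore S Q t F U E \<and> (\<forall>i\<in>{1..t}. \<forall>f\<in>layer E i F U. {v, f} \<notin> E)"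
proof (induction t arbitrary: F U)
  case (Suc t)
  have "(\<forall>i\<in>{1..Suc t}. \<forall>f\<in>layer E i F U. {v, f} \<notin> E) \<longleftrightarrow>
     (\<forall>f\<in>nbrs E F U. {v, f} \<notin> E) \<and> (\<forall>i\<in>{1..t}. \<forall>f\<in>layer E (Suc i) F U. {v, f} \<notin> E)"
  proof -
    have "(\<forall>i\<in>{1..Suc t}. P i) \<longleftrightarrow> P 1 \<and> (\<forall>i\<in>{1..t}. P (Suc i))" for P
    proof (intro iffI conjI ballI)
      fix i assume P: "P 1 \<and> (\<forall>i\<in>{1..t}. P (Suc i))" and i: "i \<in> {1..Suc t}"
      show "P i"
      proof (cases "i = 1")
        case False
        hence "i - 1 \<in> {1..t}" "i = Suc (i - 1)" using i by auto
        thus ?thesis using P by metis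
      qed (use P in simp)
    qed auto
    from this[of "\<lambda>i. \<forall>f\<in>layer E i F U. {v, f} \<notin> E"] show ?thesis by simp
  qed
  thus ?case using Suc by auto
qed simp

text \<open>\<open>X\<close> holds vertices outside the exploration whose edges the final condition
  may inspect, for instance a layer around another vertex that must not be touched.\<close>

lemma depends_on_explore:
  assumes "\<And>F U. F \<inter> U = {} \<Longrightarrow> (F \<union> U) \<inter> X = {} \<Longrightarrow> depends_on (Q F U) (edges_within (F \<union> U \<union> X))"
    and "F \<inter> U = {}" "(F \<union> U) \<inter> X = {}"
  shows "depends_on (explore S Q t F U) (edges_within (F \<union> U \<union> X))"
  using assms(2,3)
proof (induction t arbitrary: F U)
  case 0
  thus ?case using assms(1)[of F U] by (auto intro!: depends_on_conj simp: fun_eq_iff)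
next
  case (Suc t)
  have "depends_on (explore S Q t F' (U - F')) (edges_within (F \<union> U \<union> X))" if "F' \<subseteq> U" for F'
    by (rule depends_on_mono[OF Suc.IH]) (use that Suc.prems in \<open>auto intro!: edges_within_mono\<close>)
  hence "depends_on (\<lambda>E. card F \<in> S \<and> explore S Q t (nbrs E F U) (U - nbrs E F U) E) (edges_within
      (F \<union> U \<union> X))"
    by (intro depends_on_conj depends_on_const
         depends_on_bind_nbrs[where A = "\<lambda>F' E. explore S Q t F' (U - F') E"])
       (auto intro: subsetD[OF crossing_subset_within] simp: edges_within_def crossing_def)
  moreover have "explore S Q (Suc t) F U = (\<lambda>E. card F \<in> S
      \<and> explore S Q t (nbrs E F U) (U - nbrs E F U) E)"
    by (simp add: fun_eq_iff)
  ultimately show ?case by simp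
qed

text \<open>Edges from \<open>v\<close> to the frontier \<open>F\<close> are left out of the edge
  set: those to later frontiers have been tested when these were revealed, and the bridge from
  \<open>v\<close> to the root stays independent of the exploration.\<close>

lemma depends_on_explore_avoiding:
  assumes "\<And>F U. F \<inter> U = {} \<Longrightarrow> v \<notin> F \<union> U \<Longrightarrow>
      depends_on (Q F U) (edges_within (F \<union> U) \<union> edges_within (insert v U))"
    and "F \<inter> U = {}" "v \<notin> F \<union> U"
  shows "depends_on (explore_avoiding v S Q t F U) (edges_within (F \<union> U) \<union> edges_within (insert v
      U))"
  using assms(2,3)
proof (induction t arbitrary: F U)
  case 0
  thus ?case using assms(1)[of F U] by (auto intro!: depends_on_conj simp: fun_eq_iff)
next
  case (Suc t)
  let ?D = "edges_within (F \<union> U) \<union> edges_within (insert v U)"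
  have "depends_on (\<lambda>E. (\<forall>f\<in>F'. {v, f} \<notin> E) \<and> explore_avoiding v S Q t F' (U - F') E) ?D"
    if "F' \<subseteq> U" for F'
    using that Suc.prems
    by (intro depends_on_conj depends_on_ball depends_on_not depends_on_edge
          depends_on_mono[OF Suc.IH]) (auto simp: edges_within_def)
  hence "depends_on (\<lambda>E. card F \<in> S \<and> ((\<forall>f\<in>nbrs E F U. {v, f} \<notin> E) \<and>
       explore_avoiding v S Q t (nbrs E F U) (U - nbrs E F U) E)) ?D"
    by (intro depends_on_conj[OF depends_on_const]
         depends_on_bind_nbrs[where A = "\<lambda>F' E. (\<forall>f\<in>F'. {v, f} \<notin> E)
             \<and> explore_avoiding v S Q t F' (U - F') E"])
       (auto simp: edges_within_def crossing_def)
  moreover have "explore_avoiding v S Q (Suc t) F U = (\<lambda>E. card F \<in> S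
      \<and> ((\<forall>f\<in>nbrs E F U. {v, f} \<notin> E) \<and>
       explore_avoiding v S Q t (nbrs E F U) (U - nbrs E F U) E))"
    by (simp add: fun_eq_iff)
  ultimately show ?case by simp
qed

text \<open>Each step trades a binomial transition probability for a Poisson one at the price
  \<open>\<kappa>\<close>. The number \<open>c\<close> bounds the vertices used up at the end;
  \<open>n + t * w <= card U + c\<close> reserves \<open>w\<close> of them for each step still to
  come.\<close>

lemma explore_prob_upper:
  fixes l :: real and n b c w :: nat
  defines "\<kappa> \<equiv> exp (2 * l * b\<^sup>2 / n)"
  assumes l: "0 \<le> l" "l \<le> real n" and n: "0 < n" and S: "S \<subseteq> {..w}" and w: "w \<le> b" "c \<le> b"
    and dep: "\<And>F U. F \<inter> U = {} \<Longrightarrow> (F \<union> U) \<inter> X = {} \<Longrightarrow> depends_on (Q F U) (edges_within (F \<union> U \<union> X))"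
    and Q: "\<And>F U. F \<subseteq> {1..n} \<Longrightarrow> U \<subseteq> {1..n} \<Longrightarrow> F \<inter> U = {} \<Longrightarrow> (F \<union> U) \<inter> X = {} \<Longrightarrow> card F \<in> S \<Longrightarrow>
       n \<le> card U + c \<Longrightarrow> gnp_prob n (l / n) (Q F U) \<le> g (card F)"
    and g: "\<And>j. j \<in> S \<Longrightarrow> 0 \<le> g j"
    and F: "F \<subseteq> {1..n}" "U \<subseteq> {1..n}" "F \<inter> U = {}" "(F \<union> U) \<inter> X = {}" "card F \<in> S" "n + t * w
        \<le> card U + c"
  shows "gnp_prob n (l / n) (explore S Q t F U) \<le> \<kappa> ^ t * bp_iter l S g t (card F)"
  using F
proof (induction t arbitrary: F U)
  case 0
  have "gnp_prob n (l / n) (explore S Q 0 F U) \<le> gnp_prob n (l / n) (Q F U)"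
    by (rule gnp_prob_mono) simp
  also have "\<dots> \<le> g (card F)" using 0 by (intro Q) auto
  finally show ?case by (simp del: explore.simps)
next
  case (Suc t)
  have finS: "finite S" using S finite_subset by blast
  have finU: "finite U" using Suc.prems finite_subset by blast
  have p: "0 \<le> l / n" "l / n \<le> 1" using l n by auto
  have \<kappa>0: "0 \<le> \<kappa>" by (simp add: \<kappa>_def)
  have "gnp_prob n (l / n) (explore S Q (Suc t) F U) \<le>
        gnp_prob n (l / n) (\<lambda>E. explore S Q t (nbrs E F U) (U - nbrs E F U) E)"
    by (rule gnp_prob_mono) simp
  also have "\<dots> \<le> (\<Sum>j\<in>S. nbr_card_prob (l / n) (card U) (card F) j * (\<kappa> ^ t * bp_iter l S g t j))"
  proof (rule gnp_prob_step_upper[where A = "\<lambda>F' E. explore S Q t F' (U - F') E"])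
    fix F' assume F': "F' \<subseteq> U"
    have "depends_on (explore S Q t F' (U - F')) (edges_within (F' \<union> (U - F') \<union> X))"
      by (rule depends_on_explore[OF dep]) (use F' Suc.prems in auto)
    thus "depends_on (explore S Q t F' (U - F')) (- crossing F U)"
      by (rule depends_on_mono) (use F' Suc.prems in \<open>intro edges_within_subset_compl; blast\<close>)
    show "gnp_prob n (l / n) (explore S Q t F' (U - F')) \<le> \<kappa> ^ t * bp_iter l S g t (card F')"
      if "card F' \<in> S"
    proof (rule Suc.IH)
      have "card F' \<le> w" using that S by auto
      moreover have "card (U - F') = card U - card F'"
        using F' finU by (simp add: card_Diff_subset finite_subset)
      moreover have "card F' \<le> card U" using F' finU by (simp add: card_mono)
      ultimately show "n + t * w \<le> card (U - F') + c" using Suc.prems by simp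
    qed (use F' that Suc.prems in auto)
    show "gnp_prob n (l / n) (explore S Q t F' (U - F')) = 0" if "card F' \<notin> S"
      using that by (intro gnp_prob_eq_0) (cases t; simp)
  qed (use Suc.prems p finS g l \<kappa>0 in \<open>auto intro!: mult_nonneg_nonneg bp_iter_nonneg\<close>)
  also have "\<dots> \<le> (\<Sum>j\<in>S. (\<kappa> * pois (l * card F) j) * (\<kappa> ^ t * bp_iter l S g t j))"
  proof (intro sum_mono mult_right_mono)
    fix j assume j: "j \<in> S"
    show "nbr_card_prob (l / n) (card U) (card F) j \<le> \<kappa> * pois (l * card F) j"
      unfolding \<kappa>_def
    proof (rule nbr_card_prob_upper[OF l n])
      show "card U \<le> n" using Suc.prems(2) card_mono[of "{1..n}" U] by simp
    qed (use Suc.prems j S w in auto)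
    show "0 \<le> \<kappa> ^ t * bp_iter l S g t j"
      using \<kappa>0 g l j by (auto intro!: mult_nonneg_nonneg bp_iter_nonneg)
  qed
  also have "\<dots> = \<kappa> ^ Suc t * bp_iter l S g (Suc t) (card F)"
    by (simp add: sum_distrib_left mult_ac)
  finally show ?case .
qed

text \<open>Besides the Poisson comparison every step pays \<open>(1 - l / n) ^ w\<close>, because
  the at most \<open>w\<close> new vertices must not be adjacent to \<open>v\<close>. These edges
  are independent of the rest of the exploration.\<close>

lemma explore_prob_lower:
  fixes l :: real and n b c w :: nat
  defines "\<kappa> \<equiv> exp (- ((4 + 2 * l + 2 * l\<^sup>2) * b\<^sup>2 / n))"
  assumes l: "0 \<le> l" "2 * l * b \<le> n" "4 * b \<le> n" and n: "0 < n" and b: "0 < b"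
    and S: "S \<subseteq> {..w}" and w: "w \<le> b" "c \<le> b" and v: "v \<in> {1..n}"
    and dep: "\<And>F U. F \<inter> U = {} \<Longrightarrow> v \<notin> F \<union> U \<Longrightarrow>
      depends_on (Q F U) (edges_within (F \<union> U) \<union> edges_within (insert v U))"
    and Q: "\<And>F U. F \<subseteq> {1..n} \<Longrightarrow> U \<subseteq> {1..n} \<Longrightarrow> F \<inter> U = {} \<Longrightarrow> v \<notin> F \<union> U \<Longrightarrow> card F \<in> S \<Longrightarrow>
       n \<le> card U + c \<Longrightarrow> g (card F) \<le> gnp_prob n (l / n) (Q F U)"
    and g: "\<And>j. j \<in> S \<Longrightarrow> 0 \<le> g j"
    and F: "F \<subseteq> {1..n}" "U \<subseteq> {1..n}" "F \<inter> U = {}" "v \<notin> F \<union> U" "card F \<in> S" "n + t * w \<le> card U + c"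
  shows "((1 - l / n) ^ w * \<kappa>) ^ t * bp_iter l S g t (card F)
      \<le> gnp_prob n (l / n) (explore_avoiding v S Q t F U)"
  using F
proof (induction t arbitrary: F U)
  case 0
  have "gnp_prob n (l / n) (explore_avoiding v S Q 0 F U) = gnp_prob n (l / n) (Q F U)"
    using 0 by (intro gnp_prob_cong) simp
  thus ?case using Q[of F U] 0 by simp
next
  case (Suc t)
  have finS: "finite S" using S finite_subset by blast
  have finU: "finite U" using Suc.prems finite_subset by blast
  have "l * 1 \<le> l * b" using l b by (intro mult_left_mono) auto
  hence "l \<le> n" using l by linarith
  hence p: "0 \<le> l / n" "l / n \<le> 1" using l n by auto
  define r where "r = (1 - l / n) ^ w"
  have r: "0 \<le> r" using p by (simp add: r_def)
  have \<kappa>0: "0 \<le> \<kappa>" by (simp add: \<kappa>_def)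
  have bp0: "0 \<le> bp_iter l S g t j" if "j \<in> S" for j
    using that g l by (intro bp_iter_nonneg) auto
  have "(r * \<kappa>) ^ Suc t * bp_iter l S g (Suc t) (card F) =
     (\<Sum>j\<in>S. (\<kappa> * pois (l * card F) j) * (r * ((r * \<kappa>) ^ t * bp_iter l S g t j)))"
    by (simp add: sum_distrib_left mult_ac)
  also have "\<dots> \<le> (\<Sum>j\<in>S. nbr_card_prob (l / n) (card U) (card F) j * (r * ((r * \<kappa>) ^ t * bp_iter l
      S g t j)))"
  proof (intro sum_mono mult_right_mono)
    fix j assume j: "j \<in> S"
    show "\<kappa> * pois (l * card F) j \<le> nbr_card_prob (l / n) (card U) (card F) j"
      unfolding \<kappa>_def
    proof (rule nbr_card_prob_lower[OF l n b])
      show "card U \<le> n" using Suc.prems(2) card_mono[of "{1..n}" U] by simp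
    qed (use Suc.prems j S w in auto)
    show "0 \<le> r * ((r * \<kappa>) ^ t * bp_iter l S g t j)"
      using \<kappa>0 r bp0[OF j] by simp
  qed
  also have "\<dots> \<le> gnp_prob n (l / n) (\<lambda>E. (\<forall>f\<in>nbrs E F U. {v, f} \<notin> E) \<and>
      explore_avoiding v S Q t (nbrs E F U) (U - nbrs E F U) E)"
  proof (rule gnp_prob_step_lower[where A = "\<lambda>F' E. (\<forall>f\<in>F'. {v, f} \<notin> E)
      \<and> explore_avoiding v S Q t F' (U - F') E"])
    fix F' assume F': "F' \<subseteq> U"
    have dep1: "depends_on (explore_avoiding v S Q t F' (U - F'))
        (edges_within (F' \<union> (U - F')) \<union> edges_within (insert v (U - F')))"
      by (rule depends_on_explore_avoiding[OF dep]) (use F' Suc.prems in auto)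
    have dep2: "depends_on (\<lambda>E. \<forall>f\<in>F'. {v, f} \<notin> E) {{v, f} |f. f \<in> F'}"
      by (intro depends_on_ball depends_on_not depends_on_edge) auto
    show "depends_on (\<lambda>E. (\<forall>f\<in>F'. {v, f} \<notin> E)
        \<and> explore_avoiding v S Q t F' (U - F') E) (- crossing F U)"
    proof (intro depends_on_conj depends_on_mono[OF dep1] depends_on_mono[OF dep2] Un_least)
      show "edges_within (F' \<union> (U - F')) \<subseteq> - crossing F U" "edges_within (insert v (U - F')) \<subseteq> -
          crossing F U"
        using F' Suc.prems(3,4) by (intro edges_within_subset_compl; blast)+
      show "{{v, f} |f. f \<in> F'} \<subseteq> - crossing F U"
        using F' Suc.prems(3,4) by (auto simp: crossing_def doubleton_eq_iff)
    qed
    show "r * ((r * \<kappa>) ^ t * bp_iter l S g t (card F')) \<le>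
       gnp_prob n (l / n) (\<lambda>E. (\<forall>f\<in>F'. {v, f} \<notin> E) \<and> explore_avoiding v S Q t F' (U - F') E)"
      if "card F' \<in> S"
    proof -
      have w': "card F' \<le> w" using that S by auto
      have c: "card (U - F') = card U - card F'"
        using F' finU by (simp add: card_Diff_subset finite_subset)
      have "card F' \<le> card U" using F' finU by (simp add: card_mono)
      hence IH: "(r * \<kappa>) ^ t * bp_iter l S g t (card F')
          \<le> gnp_prob n (l / n) (explore_avoiding v S Q t F' (U - F'))"
        unfolding r_def using F' that Suc.prems w' c by (intro Suc.IH) auto
      have "gnp_prob n (l / n) (\<lambda>E. (\<forall>f\<in>F'. {v, f} \<notin> E) \<and> explore_avoiding v S Q t F' (U - F') E) =
         gnp_prob n (l / n) (\<lambda>E. \<forall>f\<in>F'. {v, f} \<notin> E) * gnp_prob n (l / n) (explore_avoiding v S Q t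
             F' (U - F'))"
        by (rule gnp_prob_indep[OF dep2 dep1])
           (use F' Suc.prems in \<open>auto simp: edges_within_def\<close>)
      also have "gnp_prob n (l / n) (\<lambda>E. \<forall>f\<in>F'. {v, f} \<notin> E) = (1 - l / n) ^ card F'"
        using F' Suc.prems finU v p by (intro gnp_prob_no_edges) (auto intro: finite_subset)
      finally have eq: "gnp_prob n (l / n) (\<lambda>E. (\<forall>f\<in>F'. {v, f} \<notin> E)
          \<and> explore_avoiding v S Q t F' (U - F') E) =
         (1 - l / n) ^ card F' * gnp_prob n (l / n) (explore_avoiding v S Q t F' (U - F'))" .
      have "r \<le> (1 - l / n) ^ card F'"
        unfolding r_def using p w' by (intro power_decreasing) auto
      thus ?thesis unfolding eq
        using IH r \<kappa>0 bp0[OF that] by (intro mult_mono) auto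
    qed
  qed (use Suc.prems p finS in auto)
  also have "\<dots> = gnp_prob n (l / n) (explore_avoiding v S Q (Suc t) F U)"
    using Suc.prems by (intro gnp_prob_cong) simp
  finally show ?case unfolding r_def .
qed

subsection \<open>Growth of large layers\<close>

text \<open>Markov's inequality for the exponential moment \<open>s ^ card\<close>. A value
  \<open>s < 1\<close> controls lower tails and \<open>s > 1\<close> upper tails.\<close>

lemma gnp_prob_nbrs_markov:
  assumes "F \<subseteq> {1..n}" "U \<subseteq> {1..n}" "F \<inter> U = {}" "0 \<le> p" "p \<le> 1"
    and s: "0 < s" and C: "0 \<le> C" and J: "\<And>j. j \<in> J \<Longrightarrow> 1 \<le> C * s ^ j"
  shows "gnp_prob n p (\<lambda>E. card (nbrs E F U) \<in> J) \<le>
    C * exp (- (real (card U) * (1 - (1 - p) ^ card F) * (1 - s)))"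
proof -
  have finU: "finite U" using assms finite_subset by blast
  define m where "m = card U"
  let ?\<pi> = "1 - (1 - p) ^ card F"
  have \<pi>: "0 \<le> ?\<pi>" "?\<pi> \<le> 1" using assms(4,5) by (auto simp: power_le_one)
  have "gnp_prob n p (\<lambda>E. card (nbrs E F U) \<in> J) \<le>
      (\<Sum>j\<in>{..m}. nbr_card_prob p (card U) (card F) j * (C * s ^ j))"
  proof (rule gnp_prob_step_upper[OF assms(1-5), where A = "\<lambda>F' E. card F' \<in> J"])
    fix F' assume F': "F' \<subseteq> U"
    show "gnp_prob n p (\<lambda>E. card F' \<in> J) \<le> C * s ^ card F'"
      using J[of "card F'"] C s by (cases "card F' \<in> J") auto
    show "gnp_prob n p (\<lambda>E. card F' \<in> J) = 0" if "card F' \<notin> {..m}"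
      using that card_mono[OF finU F'] by (auto simp: m_def)
  qed (use C s in auto)
  also have "\<dots> = C * (\<Sum>j\<le>m. nbr_card_prob p m (card F) j * s ^ j)"
    by (simp add: sum_distrib_left mult_ac m_def)
  also have "\<dots> = C * (1 - ?\<pi> * (1 - s)) ^ m" by (simp only: sum_nbr_card_prob)
  also have "\<dots> \<le> C * exp (- (?\<pi> * (1 - s))) ^ m"
  proof (intro mult_left_mono power_mono C)
    show "1 - ?\<pi> * (1 - s) \<le> exp (- (?\<pi> * (1 - s)))"
      using exp_ge_add_one_self[of "- (?\<pi> * (1 - s))"] by simp
    have "?\<pi> * (1 - s) \<le> 1 * 1"
    proof (cases "s \<le> 1")
      case True
      thus ?thesis using \<pi> s by (intro mult_mono) auto
    next
      case False
      hence "?\<pi> * (1 - s) \<le> 0" using \<pi> by (intro mult_nonneg_nonpos) auto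
      thus ?thesis by simp
    qed
    thus "0 \<le> 1 - ?\<pi> * (1 - s)" by simp
  qed
  also have "exp (- (?\<pi> * (1 - s))) ^ m = exp (- (real m * ?\<pi> * (1 - s)))"
    by (simp add: exp_of_nat_mult[symmetric] mult_ac)
  finally show ?thesis unfolding m_def .
qed

text \<open>Chernoff bounds with \<open>s = exp (- \<epsilon>)\<close> and
  \<open>s = exp \<epsilon>\<close>. The mean lies between
  \<open>(1 - 2 * \<epsilon>) * l * k\<close> and \<open>l * k\<close>: one
  \<open>\<epsilon>\<close> is lost to vertices missing from \<open>U\<close>, another to vertices
  with several neighbours in \<open>F\<close>. The tolerance \<open>3 * \<epsilon>\<close> leaves
  one more for the fluctuation.\<close>

lemma nbrs_deviation:
  fixes l \<epsilon> :: real and n :: nat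
  assumes F: "F \<subseteq> {1..n}" "U \<subseteq> {1..n}" "F \<inter> U = {}" and l: "0 \<le> l" "l \<le> real n" and n: "0 < n"
    and \<epsilon>: "0 < \<epsilon>" "\<epsilon> \<le> 1/3" and U: "n * (1 - \<epsilon>) \<le> card U" and k: "l / n * card F \<le> \<epsilon>"
  shows "gnp_prob n (l / n) (\<lambda>E. \<not> (l * (1 - 3 * \<epsilon>) * card F \<le> card (nbrs E F U) \<and>
            card (nbrs E F U) \<le> l * (1 + 3 * \<epsilon>) * card F)) \<le> 2 * exp (- (l * card F * \<epsilon>\<^sup>2 / 2))"
proof -
  define p where "p = l / n"
  define k where "k = card F"
  define \<pi> where "\<pi> = 1 - (1 - p) ^ k"
  define \<mu> where "\<mu> = real (card U) * \<pi>"
  have p: "0 \<le> p" "p \<le> 1" and pn: "n * p = l" using l n by (auto simp: p_def)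
  have cU: "card U \<le> n" using F(2) card_mono[of "{1..n}" U] by simp
  have pk: "0 \<le> p * k" "p * k \<le> \<epsilon>" using l k unfolding k_def p_def
      by (simp_all only: mult_nonneg_nonneg divide_nonneg_nonneg of_nat_0_le_iff)
  have \<pi>0: "0 \<le> \<pi>" using p by (simp add: \<pi>_def power_le_one)
  have \<mu>u: "\<mu> \<le> l * k"
  proof -
    have "\<mu> \<le> real n * (p * k)"
      unfolding \<mu>_def \<pi>_def using cU one_minus_power_bounds(1)[OF p, of k] \<pi>0
      by (intro mult_mono) (auto simp: \<pi>_def)
    thus ?thesis using pn by (simp add: mult.assoc[symmetric])
  qed
  have \<mu>l: "l * k * (1 - 2 * \<epsilon>) \<le> \<mu>"
  proof -
    have "(real n * (1 - \<epsilon>)) * (p * k * (1 - p * k)) \<le> \<mu>"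
      unfolding \<mu>_def \<pi>_def using U one_minus_power_bounds(2)[OF p, of k] pk \<epsilon>
      by (intro mult_mono) (auto intro!: mult_nonneg_nonneg)
    moreover have "(real n * (1 - \<epsilon>)) * (p * k * (1 - \<epsilon>))
        \<le> (real n * (1 - \<epsilon>)) * (p * k * (1 - p * k))"
      using pk \<epsilon> by (intro mult_left_mono) auto
    moreover have "(real n * (1 - \<epsilon>)) * (p * k * (1 - \<epsilon>)) = l * k * (1 - \<epsilon>)\<^sup>2"
      unfolding pn[symmetric] by (simp add: power2_eq_square algebra_simps)
    moreover have "l * k * (1 - 2 * \<epsilon>) \<le> l * k * (1 - \<epsilon>)\<^sup>2"
      using l by (intro mult_left_mono) (auto simp: power2_eq_square algebra_simps)
    ultimately show ?thesis by linarith
  qed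
  have lk: "0 \<le> l * k" using l by simp
  have low: "gnp_prob n p (\<lambda>E. card (nbrs E F U) \<in> {j. real j < l * (1 - 3 * \<epsilon>) * k})
      \<le> exp (- (l * k * \<epsilon>\<^sup>2 / 2))"
  proof -
    have "gnp_prob n p (\<lambda>E. card (nbrs E F U) \<in> {j. real j < l * (1 - 3 * \<epsilon>) * k}) \<le>
       exp (\<epsilon> * (l * (1 - 3 * \<epsilon>) * k)) * exp (- (real (card U) * (1 - (1 - p) ^ card F) * (1 - exp
           (- \<epsilon>))))"
    proof (rule gnp_prob_nbrs_markov[OF F p])
      fix j assume "j \<in> {j. real j < l * (1 - 3 * \<epsilon>) * k}"
      hence "0 \<le> \<epsilon> * (l * (1 - 3 * \<epsilon>) * k) - \<epsilon> * j" using \<epsilon> by (simp flip: right_diff_distrib)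
      hence "1 \<le> exp (\<epsilon> * (l * (1 - 3 * \<epsilon>) * k) - \<epsilon> * j)" by simp
      thus "1 \<le> exp (\<epsilon> * (l * (1 - 3 * \<epsilon>) * k)) * exp (- \<epsilon>) ^ j"
        by (simp add: exp_of_nat_mult[symmetric] exp_add[symmetric] algebra_simps)
    qed auto
    also have "\<dots> = exp (\<epsilon> * (l * (1 - 3 * \<epsilon>) * k) - \<mu> * (1 - exp (- \<epsilon>)))"
      unfolding \<mu>_def \<pi>_def k_def exp_add[symmetric] by simp
    also have "\<dots> \<le> exp (- (l * k * \<epsilon>\<^sup>2 / 2))"
    proof -
      have e: "\<epsilon> - \<epsilon>\<^sup>2 / 2 \<le> 1 - exp (- \<epsilon>)"
      proof -
        have "exp (- \<epsilon>) = 1 / exp \<epsilon>" by (simp add: exp_minus inverse_eq_divide)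
        also have "\<dots> \<le> 1 / (1 + \<epsilon> + \<epsilon>\<^sup>2 / 2)"
          using exp_lower_Taylor_quadratic[of \<epsilon>] \<epsilon>
          by (intro divide_left_mono) (auto intro!: mult_pos_pos add_pos_pos)
        also have "\<dots> \<le> 1 - \<epsilon> + \<epsilon>\<^sup>2 / 2"
        proof -
          have "(1 - \<epsilon> + \<epsilon>\<^sup>2 / 2) * (1 + \<epsilon> + \<epsilon>\<^sup>2 / 2) = 1 + \<epsilon> ^ 4 / 4"
            by (simp add: algebra_simps power2_eq_square power4_eq_xxxx)
          hence "1 \<le> (1 - \<epsilon> + \<epsilon>\<^sup>2 / 2) * (1 + \<epsilon> + \<epsilon>\<^sup>2 / 2)" by simp
          moreover have "0 < 1 + \<epsilon> + \<epsilon>\<^sup>2 / 2" using \<epsilon> by (simp add: add_pos_pos)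
          ultimately show ?thesis by (simp only: divide_le_eq if_True)
        qed
        finally show ?thesis by simp
      qed
      have "\<epsilon>\<^sup>2 \<le> \<epsilon> * 1" unfolding power2_eq_square using \<epsilon> by (intro mult_left_mono) auto
      hence e0: "0 \<le> \<epsilon> - \<epsilon>\<^sup>2 / 2" using \<epsilon> by simp
      have "l * k * (1 - 2 * \<epsilon>) * (\<epsilon> - \<epsilon>\<^sup>2 / 2) \<le> \<mu> * (1 - exp (- \<epsilon>))"
        using \<mu>l e e0 lk \<epsilon> \<pi>0 by (intro mult_mono) (auto simp: \<mu>_def)
      moreover have "\<epsilon> * (l * (1 - 3 * \<epsilon>) * k) - l * k * (1 - 2 * \<epsilon>) * (\<epsilon> - \<epsilon>\<^sup>2 / 2)
          = l * k * (- \<epsilon>\<^sup>2 / 2 - \<epsilon> ^ 3)"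
        by (simp add: algebra_simps power2_eq_square power3_eq_cube)
      moreover have "l * k * (- \<epsilon>\<^sup>2 / 2 - \<epsilon> ^ 3) \<le> l * k * (- \<epsilon>\<^sup>2 / 2)"
        using lk \<epsilon> by (intro mult_left_mono) auto
      ultimately show ?thesis by simp
    qed
    finally show ?thesis .
  qed
  have up: "gnp_prob n p (\<lambda>E. card (nbrs E F U) \<in> {j. l * (1 + 3 * \<epsilon>) * k < real j})
      \<le> exp (- (l * k * \<epsilon>\<^sup>2 / 2))"
  proof -
    have "gnp_prob n p (\<lambda>E. card (nbrs E F U) \<in> {j. l * (1 + 3 * \<epsilon>) * k < real j}) \<le>
       exp (- (\<epsilon> * (l * (1 + 3 * \<epsilon>) * k))) * exp (- (real (card U) * (1 - (1 - p) ^ card F) * (1 -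
           exp \<epsilon>)))"
    proof (rule gnp_prob_nbrs_markov[OF F p])
      fix j assume "j \<in> {j. l * (1 + 3 * \<epsilon>) * k < real j}"
      hence "0 \<le> \<epsilon> * j - \<epsilon> * (l * (1 + 3 * \<epsilon>) * k)" using \<epsilon> by (simp flip: right_diff_distrib)
      hence "1 \<le> exp (\<epsilon> * j - \<epsilon> * (l * (1 + 3 * \<epsilon>) * k))" by simp
      thus "1 \<le> exp (- (\<epsilon> * (l * (1 + 3 * \<epsilon>) * k))) * exp \<epsilon> ^ j"
        by (simp add: exp_of_nat_mult[symmetric] exp_add[symmetric] algebra_simps)
    qed auto
    also have "\<dots> = exp (\<mu> * (exp \<epsilon> - 1) - \<epsilon> * (l * (1 + 3 * \<epsilon>) * k))"
      by (simp add: \<mu>_def \<pi>_def k_def exp_add[symmetric] algebra_simps)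
    also have "\<dots> \<le> exp (- (l * k * \<epsilon>\<^sup>2 / 2))"
    proof -
      have e: "exp \<epsilon> - 1 \<le> \<epsilon> + \<epsilon>\<^sup>2" using exp_bound[of \<epsilon>] \<epsilon> by simp
      have "\<mu> * (exp \<epsilon> - 1) \<le> l * k * (\<epsilon> + \<epsilon>\<^sup>2)"
        using \<mu>u e lk \<epsilon> by (intro mult_mono) auto
      moreover have "l * k * (\<epsilon> + \<epsilon>\<^sup>2) - \<epsilon> * (l * (1 + 3 * \<epsilon>) * k) = l * k * (- 2 * \<epsilon>\<^sup>2)"
        by (simp add: algebra_simps power2_eq_square)
      moreover have "l * k * (- 2 * \<epsilon>\<^sup>2) \<le> l * k * (- \<epsilon>\<^sup>2 / 2)"
        using lk by (intro mult_left_mono) auto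
      ultimately show ?thesis by simp
    qed
    finally show ?thesis .
  qed
  have "gnp_prob n p (\<lambda>E. \<not> (l * (1 - 3 * \<epsilon>) * k \<le> card (nbrs E F U) \<and>
            card (nbrs E F U) \<le> l * (1 + 3 * \<epsilon>) * k)) \<le>
     gnp_prob n p (\<lambda>E. card (nbrs E F U) \<in> {j. real j < l * (1 - 3 * \<epsilon>) * k} \<or>
       card (nbrs E F U) \<in> {j. l * (1 + 3 * \<epsilon>) * k < real j})"
    by (rule gnp_prob_mono) auto
  also have "\<dots> \<le> exp (- (l * k * \<epsilon>\<^sup>2 / 2)) + exp (- (l * k * \<epsilon>\<^sup>2 / 2))"
    by (intro order_trans[OF gnp_prob_disj] add_mono low up)
  finally show ?thesis unfolding p_def k_def by simp
qed

section \<open>Contact of a growing layer with a fixed set\<close>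

definition no_contact :: "nat \<Rightarrow> nat set \<Rightarrow> nat set \<Rightarrow> nat set \<Rightarrow> nat set set \<Rightarrow> bool" where
  "no_contact r F U Y E \<longleftrightarrow> (\<forall>y\<in>Y. \<forall>f\<in>layer E r F U. {y, f} \<notin> E)"

lemma no_contact_Suc: "no_contact (Suc r) F U Y E = no_contact r (nbrs E F U) (U - nbrs E F U) Y E"
  by (simp add: no_contact_def)

lemma depends_on_no_contact: "depends_on (no_contact r F U Y) (edges_within (F \<union> U \<union> Y))"
proof (induction r arbitrary: F U)
  case 0
  have "depends_on (\<lambda>E. \<forall>y\<in>Y. \<forall>f\<in>F. {y, f} \<notin> E) (edges_within (F \<union> U \<union> Y))"
    by (intro depends_on_ball depends_on_not depends_on_edge) (auto simp: edges_within_def)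
  moreover have "no_contact 0 F U Y = (\<lambda>E. \<forall>y\<in>Y. \<forall>f\<in>F. {y, f} \<notin> E)"
    by (simp add: no_contact_def fun_eq_iff)
  ultimately show ?case by simp
next
  case (Suc r)
  have "depends_on (no_contact r F' (U - F') Y) (edges_within (F \<union> U \<union> Y))" if "F' \<subseteq> U" for F'
    by (rule depends_on_mono[OF Suc]) (use that in \<open>auto intro!: edges_within_mono\<close>)
  from depends_on_bind_nbrs[OF _ this, of F U "\<lambda>F'. F'"] show ?case
    by (auto simp: no_contact_Suc[abs_def] edges_within_def crossing_def)
qed

text \<open>\<open>a\<close> and \<open>b\<close> are deterministic bounds for the size of the
  current layer, multiplied at each step by \<open>l * (1 - 3 * \<epsilon>)\<close> and
  \<open>l * (1 + 3 * \<epsilon>)\<close>. The former is at least 1, so layers stay above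
  \<open>w\<close> and every step fails with at most the same small probability; the latter
  guarantees that enough vertices remain unexplored. In the end all edges between the last layer and
  \<open>Y\<close> have to be absent.\<close>

lemma no_contact_prob:
  fixes l \<epsilon> a b :: real and n w r :: nat
  assumes l: "0 \<le> l" "l \<le> real n" and n: "0 < n"
    and \<epsilon>: "0 < \<epsilon>" "\<epsilon> \<le> 1/3" "1 \<le> l * (1 - 3 * \<epsilon>)"
    and Y: "Y \<subseteq> {1..n}" and w: "w \<le> a" "0 \<le> b"
    and F: "F \<subseteq> {1..n}" "U \<subseteq> {1..n}" "F \<inter> U = {}" "(F \<union> U) \<inter> Y = {}" "a \<le> card F" "card F \<le> b"
    and U: "n * (1 - \<epsilon>) + r * b * (l * (1 + 3 * \<epsilon>)) ^ r \<le> card U"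
    and b: "l / n * b * (l * (1 + 3 * \<epsilon>)) ^ r \<le> \<epsilon>"
  shows "gnp_prob n (l / n) (no_contact r F U Y) \<le>
      r * (2 * exp (- (l * w * \<epsilon>\<^sup>2 / 2))) + exp (- (l / n * a * (l * (1 - 3 * \<epsilon>)) ^ r * card Y))"
  using w F U b
proof (induction r arbitrary: F U a b)
  case 0
  have p: "0 \<le> l / n" "l / n \<le> 1" using l n by auto
  have "gnp_prob n (l / n) (no_contact 0 F U Y) \<le> gnp_prob n (l / n) (\<lambda>E. nbrs E F Y = {})"
    by (rule gnp_prob_mono) (auto simp: no_contact_def nbrs_def)
  also have "\<dots> = ((1 - l / n) ^ card F) ^ card Y"
    using 0 Y p by (subst gnp_prob_nbrs_eq) (auto intro: finite_subset)
  also have "\<dots> \<le> (exp (- (l / n)) ^ card F) ^ card Y"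
    using exp_ge_add_one_self[of "- (l / n)"] p by (intro power_mono) auto
  also have "\<dots> = exp (- (l / n * card F * card Y))"
    by (simp add: exp_of_nat_mult[symmetric] mult_ac)
  also have "\<dots> \<le> exp (- (l / n * a * card Y))"
    using 0 p by (simp add: mult_mono mult_right_mono mult_left_mono del: times_divide_eq_left)
  finally show ?case by simp
next
  case (Suc r)
  have p: "0 \<le> l / n" "l / n \<le> 1" using l n by auto
  define g where "g = l * (1 - 3 * \<epsilon>)"
  define G where "G = l * (1 + 3 * \<epsilon>)"
  define \<xi> where "\<xi> = 2 * exp (- (l * w * \<epsilon>\<^sup>2 / 2))"
  define B where "B = real r * \<xi> + exp (- (l / n * (a * g) * g ^ r * card Y))"
  have "g \<le> G" using l \<epsilon> by (simp add: g_def G_def mult_left_mono)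
  hence G: "1 \<le> G" "1 \<le> g" using \<epsilon> by (auto simp: g_def)
  have G1: "1 \<le> G ^ k" for k using G by simp
  define W where "W = (\<lambda>F' :: nat set. l * (1 - 3 * \<epsilon>) * card F \<le> card F' \<and> real (card F')
      \<le> l * (1 + 3 * \<epsilon>) * card F)"
  have finU: "finite U" using Suc.prems finite_subset by blast
  have b0: "0 \<le> b" by fact
  have "gnp_prob n (l / n) (no_contact (Suc r) F U Y) \<le>
     gnp_prob n (l / n) (\<lambda>E. \<not> W (nbrs E F U) \<or> (W (nbrs E F U)
         \<and> no_contact r (nbrs E F U) (U - nbrs E F U) Y E))"
    by (rule gnp_prob_mono) (auto simp: no_contact_Suc)
  also have "\<dots> \<le> gnp_prob n (l / n) (\<lambda>E. \<not> W (nbrs E F U)) +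
     gnp_prob n (l / n) (\<lambda>E. W (nbrs E F U) \<and> no_contact r (nbrs E F U) (U - nbrs E F U) Y E)"
    by (rule gnp_prob_disj)
  also have "\<dots> \<le> \<xi> + B"
  proof (rule add_mono)
    have "gnp_prob n (l / n) (\<lambda>E. \<not> W (nbrs E F U)) \<le> 2 * exp (- (l * card F * \<epsilon>\<^sup>2 / 2))"
      unfolding W_def
    proof (rule nbrs_deviation[OF _ _ _ l n \<epsilon>(1,2)])
      have "0 \<le> real (Suc r) * b * G ^ Suc r" using b0 G by simp
      thus "n * (1 - \<epsilon>) \<le> card U" using Suc.prems unfolding G_def by linarith
      have "l / n * card F \<le> l / n * b" using p Suc.prems by (intro mult_left_mono) auto
      also have "\<dots> \<le> l / n * b * G ^ Suc r"
        using mult_left_mono[OF G1[of "Suc r"] mult_nonneg_nonneg[OF p(1) b0]]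
            by (simp only: mult_1_right)
      also have "\<dots> \<le> \<epsilon>" using Suc.prems unfolding G_def by simp
      finally show "l / n * card F \<le> \<epsilon>" .
    qed (use Suc.prems in auto)
    also have "\<dots> \<le> \<xi>"
    proof -
      have "l * w * \<epsilon>\<^sup>2 / 2 \<le> l * card F * \<epsilon>\<^sup>2 / 2"
        using Suc.prems l by (intro divide_right_mono mult_right_mono mult_left_mono) auto
      thus ?thesis by (simp add: \<xi>_def)
    qed
    finally show "gnp_prob n (l / n) (\<lambda>E. \<not> W (nbrs E F U)) \<le> \<xi>" .
  next
    have "gnp_prob n (l / n) (\<lambda>E. W (nbrs E F U) \<and> no_contact r (nbrs E F U) (U - nbrs E F U) Y E) \<le>
      gnp_prob n (l / n) (\<lambda>E. W (nbrs E F U)) * B"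
    proof (rule gnp_prob_step_mult[where A = "\<lambda>F' E. no_contact r F' (U - F') Y E"])
      fix F' assume F': "F' \<subseteq> U"
      show "depends_on (no_contact r F' (U - F') Y) (- crossing F U)"
        by (rule depends_on_mono[OF depends_on_no_contact edges_within_subset_compl]) (use F'
            Suc.prems in blast)
      assume W: "W F'"
      have "gnp_prob n (l / n) (no_contact r F' (U - F') Y) \<le>
        real r * (2 * exp (- (l * w * \<epsilon>\<^sup>2 / 2)))
            + exp (- (l / n * (a * g) * (l * (1 - 3 * \<epsilon>)) ^ r * card Y))"
      proof (rule Suc.IH[where b = "b * G"])
        show "real w \<le> a * g"
          using Suc.prems(1) mult_left_mono[OF G(2), of a] by (smt (verit) of_nat_0_le_iff)
        show "0 \<le> b * G" using b0 G by simp
        show "F' \<subseteq> {1..n}" "U - F' \<subseteq> {1..n}" "F' \<inter> (U - F') = {}" "(F' \<union> (U - F')) \<inter> Y = {}"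
          using F' Suc.prems by auto
        have "a * g \<le> card F * g" using Suc.prems G by (intro mult_right_mono) auto
        thus "a * g \<le> card F'" using W by (simp add: W_def g_def mult.commute)
        have "card F * G \<le> b * G" using Suc.prems G by (intro mult_right_mono) auto
        thus F'b: "card F' \<le> b * G" using W by (simp add: W_def G_def mult.commute)
        have "card F' \<le> card U" using F' finU by (simp add: card_mono)
        hence cd: "real (card (U - F')) = real (card U) - card F'"
          using F' finU by (simp add: card_Diff_subset finite_subset)
        have "b * G * 1 \<le> b * G * G ^ r" using b0 G G1[of r] by (intro mult_left_mono) auto
        hence "real r * (b * G) * G ^ r + b * G \<le> real (Suc r) * b * G ^ Suc r"
          by (simp add: algebra_simps)
        thus "real n * (1 - \<epsilon>) + real r * (b * G) * (l * (1 + 3 * \<epsilon>)) ^ r \<le> card (U - F')"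
          using Suc.prems(9) F'b cd unfolding G_def by linarith
        show "l / n * (b * G) * (l * (1 + 3 * \<epsilon>)) ^ r \<le> \<epsilon>"
          using Suc.prems(10) unfolding G_def by (simp add: mult_ac)
      qed
      thus "gnp_prob n (l / n) (no_contact r F' (U - F') Y) \<le> B"
        by (simp add: B_def \<xi>_def g_def)
    qed (use Suc.prems p in auto)
    also have "\<dots> \<le> B" by (rule mult_left_le_one_le) (auto simp: B_def \<xi>_def)
    finally show "gnp_prob n (l / n) (\<lambda>E. W (nbrs E F U)
        \<and> no_contact r (nbrs E F U) (U - nbrs E F U) Y E) \<le> B" .
  qed
  also have "\<xi> + B = Suc r * \<xi> + exp (- (l / n * a * g ^ Suc r * card Y))"
    by (simp add: B_def algebra_simps)
  finally show ?case unfolding \<xi>_def g_def .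
qed

text \<open>Layers of size at least \<open>width n\<close> concentrate so well that the relative error \<open>1 / ln n\<close>
  per step is exceeded with superpolynomially small probability, and over \<open>O(ln n)\<close> steps these
  errors only contribute a constant factor.\<close>

definition width :: "nat \<Rightarrow> nat" where
  "width n = nat \<lceil>ln (real n) ^ 5\<rceil>"

text \<open>The power 9 covers every number of vertices used up below, of which the largest is of
  order \<open>ln n ^ 8\<close> (\<open>T * w'\<close> in the lower bound), while
  \<open>(budget n) ^ 2 / n\<close> still tends to 0.\<close>

definition budget :: "nat \<Rightarrow> nat" where
  "budget n = nat \<lceil>ln (real n) ^ 9\<rceil>"

lemma width_bounds:
  assumes "1 \<le> ln (real n)"
  shows "ln n ^ 5 \<le> width n" "width n \<le> ln n ^ 5 + 1" "1 \<le> width n"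
proof -
  have *: "1 \<le> ln (real n) ^ 5" using assms by (rule one_le_power)
  hence "0 \<le> \<lceil>ln (real n) ^ 5\<rceil>" by linarith
  hence "real (width n) = real_of_int \<lceil>ln (real n) ^ 5\<rceil>" by (simp add: width_def)
  with * show "ln n ^ 5 \<le> width n" "width n \<le> ln n ^ 5 + 1" by linarith+
  with * show "1 \<le> width n" by linarith
qed

lemma budget_bounds:
  assumes "1 \<le> ln (real n)"
  shows "ln n ^ 9 \<le> budget n" "budget n \<le> ln n ^ 9 + 1" "1 \<le> budget n"
proof -
  have *: "1 \<le> ln (real n) ^ 9" using assms by (rule one_le_power)
  hence "0 \<le> \<lceil>ln (real n) ^ 9\<rceil>" by linarith
  hence "real (budget n) = real_of_int \<lceil>ln (real n) ^ 9\<rceil>" by (simp add: budget_def)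
  with * show "ln n ^ 9 \<le> budget n" "budget n \<le> ln n ^ 9 + 1" by linarith+
  with * show "1 \<le> budget n" by linarith
qed

text \<open>As long as \<open>width n * l ^ r <= n / ln n ^ 3\<close>, growth with relative error
  \<open>1 / ln n\<close> can be controlled. For larger \<open>r\<close> the event contains the
  absence of contact at the last controllable radius, whose probability is already below
  \<open>2 / n ^ 5\<close>. This is why all radii up to \<open>r\<close> are required and why the
  bound holds for every \<open>r\<close>.\<close>

lemma no_contact_all_prob:
  fixes l :: real and M :: nat
  assumes l: "1 < l"
  shows "\<exists>c>0. \<forall>\<^sub>F n in sequentially. \<forall>F U Y r.
    F \<subseteq> {1..n} \<longrightarrow> U \<subseteq> {1..n} \<longrightarrow> Y \<subseteq> {1..n} \<longrightarrow> F \<inter> U = {} \<longrightarrow> (F \<union> U) \<inter> Y = {} \<longrightarrow>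
    width n \<le> card F \<longrightarrow> card F \<le> M * width n \<longrightarrow> width n \<le> card Y \<longrightarrow> n \<le> card U + budget n \<longrightarrow>
    gnp_prob n (l / n) (\<lambda>E. \<forall>i\<le>r. no_contact i F U Y E)
      \<le> 2 / n ^ 5 + exp (- (c * (real (width n))\<^sup>2 * l ^ r / n))"
proof -
  \<comment> \<open>Controllable radii satisfy \<open>r <= ln n / ln l\<close>, so the accumulated
    errors \<open>(1 + 3 / ln n) ^ r\<close> and \<open>(1 - 3 / ln n) ^ r\<close> stay below
    \<open>exp (3 / ln l)\<close> and above \<open>exp (- (6 / ln l))\<close>.\<close>
  define K where "K = exp (3 / ln l)"
  define c where "c = l * exp (- (6 / ln l))"
  have ll: "0 < ln l" using l by simp
  have c: "c > 0" using l by (simp add: c_def)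
  have ev: "\<forall>\<^sub>F n::nat in sequentially. l \<le> n" "\<forall>\<^sub>F n::nat in sequentially. 6 \<le> ln n"
     "\<forall>\<^sub>F n::nat in sequentially. 1 \<le> l * (1 - 3 * (1 / ln n))"
     "\<forall>\<^sub>F n::nat in sequentially. (ln n ^ 9 + 1) + (real M * K / ln l) * (n / (ln n)^2) \<le> n / ln n"
     "\<forall>\<^sub>F n::nat in sequentially. l * M * K \<le> (ln n)^2"
     "\<forall>\<^sub>F n::nat in sequentially. (ln n / ln l) * (2 * exp (- (l * ln n ^ 3 / 2))) \<le> 1 / n ^ 5"
     "\<forall>\<^sub>F n::nat in sequentially. ln n ^ 5 + 1 \<le> n / ln n ^ 3"
     "\<forall>\<^sub>F n::nat in sequentially. 5 * l \<le> c * ln n"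
    subgoal by real_asymp
    subgoal by real_asymp
    subgoal using l by real_asymp
    subgoal by real_asymp
    subgoal by real_asymp
    subgoal using l ll by real_asymp
    subgoal by real_asymp
    subgoal using c by real_asymp
    done
  show ?thesis
  proof (intro exI[of _ c] conjI c)
    show "\<forall>\<^sub>F n in sequentially. \<forall>F U Y r.
    F \<subseteq> {1..n} \<longrightarrow> U \<subseteq> {1..n} \<longrightarrow> Y \<subseteq> {1..n} \<longrightarrow> F \<inter> U = {} \<longrightarrow> (F \<union> U) \<inter> Y = {} \<longrightarrow>
    width n \<le> card F \<longrightarrow> card F \<le> M * width n \<longrightarrow> width n \<le> card Y \<longrightarrow> n \<le> card U + budget n \<longrightarrow>
    gnp_prob n (l / n) (\<lambda>E. \<forall>i\<le>r. no_contact i F U Y E)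
      \<le> 2 / n ^ 5 + exp (- (c * (real (width n))\<^sup>2 * l ^ r / n))"
      using ev
    proof eventually_elim
      case (elim n)
      define L where "L = ln (real n)"
      define \<epsilon> where "\<epsilon> = 1 / L"
      define w where "w = width n"
      have n0: "0 < n" using elim(2) by (cases "n = 0") auto
      have L: "6 \<le> L" using elim unfolding L_def by simp
      hence \<epsilon>: "0 < \<epsilon>" "\<epsilon> \<le> 1/3" "3 * \<epsilon> \<le> 1/2" by (auto simp: \<epsilon>_def field_simps)
      have \<epsilon>l: "1 \<le> l * (1 - 3 * \<epsilon>)" using elim by (simp add: \<epsilon>_def L_def)
      have w: "L ^ 5 \<le> w" "w \<le> L ^ 5 + 1" "1 \<le> w"
        using width_bounds[of n] L by (auto simp: w_def L_def)
      show ?case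
      proof (intro allI impI)
        fix F U Y r
        assume V: "F \<subseteq> {1..n}" "U \<subseteq> {1..n}" "Y \<subseteq> {1..n}" "F \<inter> U = {}" "(F \<union> U) \<inter> Y = {}"
          and cF: "width n \<le> card F" "card F \<le> M * width n" and cY: "width n \<le> card Y"
          and cU: "n \<le> card U + budget n"
        have main: "gnp_prob n (l / n) (no_contact r F U Y) \<le> 1 / n ^ 5
            + exp (- (c * (real w)\<^sup>2 * l ^ r / n))"
          if r: "real w * l ^ r \<le> n / L ^ 3" for r
        proof -
          have L3: "1 \<le> L ^ 3" using L by simp
          have "1 * l ^ r \<le> real w * l ^ r" using w l by (intro mult_right_mono) auto
          also have "\<dots> \<le> n / L ^ 3" by fact
          also have "\<dots> \<le> n" using L3 L by (simp add: divide_le_eq mult_le_cancel_left1)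
          finally have "l ^ r \<le> n" by simp
          hence "ln (l ^ r) \<le> L" unfolding L_def using l n0 by (subst ln_le_cancel_iff) auto
          hence rL: "r * ln l \<le> L" using l by (simp add: ln_realpow)
          hence rL': "r \<le> L / ln l" using ll by (simp add: field_simps)
          have r\<epsilon>: "r * \<epsilon> \<le> 1 / ln l"
            using rL ll L by (simp add: \<epsilon>_def field_simps)
          define g where "g = l * (1 - 3 * \<epsilon>)"
          define G where "G = l * (1 + 3 * \<epsilon>)"
          have Gr: "G ^ r \<le> K * l ^ r"
          proof -
            have "(1 + 3 * \<epsilon>) ^ r \<le> exp (3 * \<epsilon>) ^ r"
              using exp_ge_add_one_self[of "3 * \<epsilon>"] \<epsilon> by (intro power_mono) auto
            also have "\<dots> = exp (3 * (r * \<epsilon>))" by (simp add: exp_of_nat_mult[symmetric] mult_ac)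
            also have "\<dots> \<le> K" using r\<epsilon> unfolding K_def by simp
            finally have "(1 + 3 * \<epsilon>) ^ r * l ^ r \<le> K * l ^ r" using l
                by (intro mult_right_mono) auto
            thus ?thesis by (simp add: G_def power_mult_distrib mult_ac)
          qed
          have gr: "exp (- (6 / ln l)) * l ^ r \<le> g ^ r"
          proof -
            have "exp (- (6 / ln l)) \<le> exp (- 2 * (3 * (r * \<epsilon>)))" using r\<epsilon> by simp
            also have "\<dots> = exp (- 2 * (3 * \<epsilon>)) ^ r"
                by (simp add: exp_of_nat_mult[symmetric] mult_ac)
            also have "\<dots> \<le> (1 - 3 * \<epsilon>) ^ r"
              using \<epsilon> by (intro power_mono exp_minus_twice_le) auto
            finally have "exp (- (6 / ln l)) * l ^ r \<le> (1 - 3 * \<epsilon>) ^ r * l ^ r"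
              using l by (intro mult_right_mono) auto
            thus ?thesis by (simp add: g_def power_mult_distrib mult_ac)
          qed
          have MwG: "real M * w * G ^ r \<le> M * K * (n / L ^ 3)"
          proof -
            have "real M * w * G ^ r \<le> real M * w * (K * l ^ r)"
              using Gr by (intro mult_left_mono) auto
            also have "\<dots> = (M * K) * (real w * l ^ r)" by simp
            also have "\<dots> \<le> (M * K) * (n / L ^ 3)" using r
                by (intro mult_left_mono) (auto simp: K_def)
            finally show ?thesis .
          qed
          have "gnp_prob n (l / n) (no_contact r F U Y) \<le>
             r * (2 * exp (- (l * w * \<epsilon>\<^sup>2 / 2)))
                 + exp (- (l / n * real w * (l * (1 - 3 * \<epsilon>)) ^ r * card Y))"
          proof (rule no_contact_prob[where b = "real M * w"])
            have "r * (real M * w) * G ^ r = r * (real M * w * G ^ r)" by simp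
            also have "\<dots> \<le> (L / ln l) * (M * K * (n / L ^ 3))"
            proof (rule mult_mono[OF rL' MwG])
              show "0 \<le> L / ln l" using L ll by simp
              show "0 \<le> real M * w * G ^ r" using l \<epsilon> by (simp add: G_def)
            qed
            also have "\<dots> = (real M * K / ln l) * (n / L\<^sup>2)"
              using L by (simp add: field_simps power2_eq_square power3_eq_cube)
            also have "\<dots> \<le> n / L - (L ^ 9 + 1)" using elim(4) unfolding L_def by simp
            also have "\<dots> \<le> n * \<epsilon> - budget n"
              using budget_bounds(2)[of n] L unfolding L_def \<epsilon>_def by simp
            finally show "n * (1 - \<epsilon>) + r * (real M * w) * (l * (1 + 3 * \<epsilon>)) ^ r \<le> card U"
              using cU unfolding G_def by (simp add: algebra_simps)
            have "l / n * (real M * w) * G ^ r = l / n * (real M * w * G ^ r)" by simp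
            also have "\<dots> \<le> l / n * (M * K * (n / L ^ 3))" using MwG l n0
                by (intro mult_left_mono) auto
            also have "\<dots> = l * M * K / L ^ 3" using n0 by simp
            also have "\<dots> \<le> L\<^sup>2 / L ^ 3" using elim(5) L unfolding L_def
                by (intro divide_right_mono) auto
            also have "\<dots> = \<epsilon>" using L by (simp add: \<epsilon>_def power2_eq_square power3_eq_cube)
            finally show "l / n * (real M * w) * (l * (1 + 3 * \<epsilon>)) ^ r \<le> \<epsilon>" unfolding G_def .
            show "card F \<le> real M * w" using cF unfolding w_def by (metis of_nat_le_iff of_nat_mult)
          qed (use V cF cY l elim(1) n0 \<epsilon> \<epsilon>l in \<open>auto simp: w_def\<close>)
          also have "r * (2 * exp (- (l * w * \<epsilon>\<^sup>2 / 2)))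
              \<le> (L / ln l) * (2 * exp (- (l * L ^ 3 / 2)))"
          proof (rule mult_mono[OF rL'])
            have "L ^ 3 = L ^ 5 * \<epsilon>\<^sup>2" using L by (simp add: \<epsilon>_def field_simps eval_nat_numeral)
            also have "\<dots> \<le> w * \<epsilon>\<^sup>2" using w by (intro mult_right_mono) auto
            finally have "l * L ^ 3 \<le> l * (w * \<epsilon>\<^sup>2)" using l by (intro mult_left_mono) auto
            thus "2 * exp (- (l * w * \<epsilon>\<^sup>2 / 2)) \<le> 2 * exp (- (l * L ^ 3 / 2))"
                by (simp add: mult_ac)
          qed (use L ll in auto)
          also have "\<dots> \<le> 1 / n ^ 5" using elim(6) unfolding L_def by simp
          also have "exp (- (l / n * real w * (l * (1 - 3 * \<epsilon>)) ^ r * card Y))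
              \<le> exp (- (c * (real w)\<^sup>2 * l ^ r / n))"
          proof -
            have "c * (real w)\<^sup>2 * l ^ r / n = l / n * real w * (exp (- (6 / ln l)) * l ^ r) * w"
              by (simp add: c_def power2_eq_square)
            also have "\<dots> \<le> l / n * real w * g ^ r * card Y"
              using l gr cY \<epsilon>l unfolding w_def g_def
              by (intro mult_mono mult_left_mono) (auto intro!: mult_nonneg_nonneg)
            finally show ?thesis unfolding g_def by simp
          qed
          finally show ?thesis by simp
        qed
        show "gnp_prob n (l / n) (\<lambda>E. \<forall>i\<le>r. no_contact i F U Y E)
           \<le> 2 / n ^ 5 + exp (- (c * (real (width n))\<^sup>2 * l ^ r / n))"
        proof (cases "real w * l ^ r \<le> n / L ^ 3")
          case True
          have "gnp_prob n (l / n) (\<lambda>E. \<forall>i\<le>r. no_contact i F U Y E)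
              \<le> gnp_prob n (l / n) (no_contact r F U Y)"
            by (rule gnp_prob_mono) auto
          also have "\<dots> \<le> 1 / n ^ 5 + exp (- (c * (real w)\<^sup>2 * l ^ r / n))" by (rule main[OF True])
          also have "1 / real (n ^ 5) \<le> 2 / real (n ^ 5)" by (simp add: divide_right_mono)
          finally show ?thesis by (simp add: w_def)
        next
          case False
          have w0: "real w * l ^ 0 \<le> n / L ^ 3" using elim(7) w unfolding L_def by simp
          \<comment> \<open>At the last controllable radius \<open>k\<close> the product
            \<open>w * l ^ Suc k\<close> exceeds \<open>n / L ^ 3\<close>, so the exponent is at
            least of order \<open>L ^ 5 / L ^ 3 = L ^ 2\<close> and beats
            \<open>5 * L\<close>.\<close>
          have "\<exists>k\<ge>0. k < r \<and> (\<forall>i\<in>{0..k}. real w * l ^ i \<le> n / L ^ 3) \<and> \<not> real w * l ^ Suc k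
              \<le> n / L ^ 3"
            using ex_least_nat_less[of "\<lambda>i. \<not> real w * l ^ i \<le> n / L ^ 3" r] False w0 by force
          then obtain k where k: "k < r" "real w * l ^ k
              \<le> n / L ^ 3" "n / L ^ 3 < real w * l ^ Suc k"
            by force
          have "gnp_prob n (l / n) (\<lambda>E. \<forall>i\<le>r. no_contact i F U Y E)
              \<le> gnp_prob n (l / n) (no_contact k F U Y)"
            using k by (intro gnp_prob_mono) auto
          also have "\<dots> \<le> 1 / n ^ 5 + exp (- (c * (real w)\<^sup>2 * l ^ k / n))" by (rule main[OF k(2)])
          also have "exp (- (c * (real w)\<^sup>2 * l ^ k / n)) \<le> 1 / n ^ 5"
          proof -
            have "5 * L * l \<le> c * L * L" using elim(8) L unfolding L_def[symmetric]
              using mult_left_mono[of "5 * l" "c * L" L] by (simp add: mult_ac)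
            also have "\<dots> = c * (L ^ 5 * (1 / L ^ 3))" using L
                by (simp add: field_simps eval_nat_numeral)
            also have "\<dots> \<le> c * (real w * (1 / L ^ 3))"
              using w c L by (intro mult_left_mono mult_right_mono) auto
            also have "\<dots> = c * (real w / n * (n / L ^ 3))" using n0 by simp
            also have "\<dots> \<le> c * (real w / n * (real w * l ^ Suc k))"
              using k c by (intro mult_left_mono) auto
            also have "\<dots> = (c * (real w)\<^sup>2 * l ^ k / n) * l" by (simp add: power2_eq_square)
            finally have "5 * L \<le> c * (real w)\<^sup>2 * l ^ k / n" using l
                by (simp only: mult_le_cancel_right_pos)
            hence "exp (- (c * (real w)\<^sup>2 * l ^ k / n)) \<le> exp (- (5 * L))" by simp
            also have "\<dots> = 1 / exp L ^ 5"
              by (simp add: exp_minus inverse_eq_divide exp_of_nat_mult[symmetric])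
            also have "exp L = n" using n0 by (simp add: L_def)
            finally show ?thesis by simp
          qed
          finally have "gnp_prob n (l / n) (\<lambda>E. \<forall>i\<le>r. no_contact i F U Y E) \<le> 2 / n ^ 5" by simp
          also have "\<dots> \<le> 2 / n ^ 5 + exp (- (c * (real (width n))\<^sup>2 * l ^ r / n))" by simp
          finally show ?thesis .
        qed
      qed
    qed
  qed
qed

subsection \<open>Distances and layers\<close>

text \<open>Distance at most \<open>k\<close>, as a relation: monotone in \<open>k\<close>, additive
  under concatenation and free of \<open>enat\<close> arithmetic. The vertex set is a parameter
  because walks inside subsets are considered later.\<close>

definition reach :: "'a set \<Rightarrow> 'a set set \<Rightarrow> nat \<Rightarrow> 'a \<Rightarrow> 'a \<Rightarrow> bool" where
  "reach V E k x y \<longleftrightarrow> (\<exists>xs. is_walk V E xs \<and> hd xs = x \<and> last xs = y \<and> length xs \<le> Suc k)"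

lemma graph_dist_le_iff: "graph_dist V E x y \<le> enat k \<longleftrightarrow> reach V E k x y"
proof -
  have "graph_dist V E x y \<le> enat k \<longleftrightarrow> graph_dist V E x y < enat (Suc k)"
    by (cases "graph_dist V E x y") auto
  also have "\<dots> \<longleftrightarrow> (\<exists>xs. is_walk V E xs \<and> hd xs = x \<and> last xs = y \<and> length xs - 1 < Suc k)"
    unfolding graph_dist_def INF_less_iff by auto
  also have "\<dots> \<longleftrightarrow> reach V E k x y"
    unfolding reach_def by (rule ex_cong1) (auto simp: is_walk_def)
  finally show ?thesis .
qed

lemma graph_dist_finite_iff: "graph_dist V E x y < \<infinity> \<longleftrightarrow> (\<exists>k. reach V E k x y)"
  unfolding graph_dist_le_iff[symmetric] by (cases "graph_dist V E x y") auto

lemma reach_mono: "reach V E k x y \<Longrightarrow> k \<le> k' \<Longrightarrow> reach V E k' x y"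
  unfolding reach_def by (metis Suc_le_mono le_trans)

lemma reach_refl: "x \<in> V \<Longrightarrow> reach V E k x x"
  unfolding reach_def by (intro exI[of _ "[x]"]) (auto simp: is_walk_def)

lemma reach_in: "reach V E k x y \<Longrightarrow> x \<in> V \<and> y \<in> V"
  unfolding reach_def is_walk_def by (meson hd_in_set last_in_set subsetD)

lemma reach_edge: "{x, y} \<in> E \<Longrightarrow> x \<in> V \<Longrightarrow> y \<in> V \<Longrightarrow> reach V E 1 x y"
  unfolding reach_def by (intro exI[of _ "[x, y]"]) (auto simp: is_walk_def less_Suc_eq)

lemma is_walk_rev: "is_walk V E xs \<Longrightarrow> is_walk V E (rev xs)"
  unfolding is_walk_def
proof (intro conjI allI impI)
  fix i assume w: "xs \<noteq> [] \<and> set xs \<subseteq> V \<and> (\<forall>i. Suc i < length xs \<longrightarrow> {xs ! i, xs ! Suc i} \<in> E)"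
    and i: "Suc i < length (rev xs)"
  define j where "j = length xs - Suc (Suc i)"
  have "rev xs ! Suc i = xs ! j" "rev xs ! i = xs ! Suc j" "Suc j < length xs"
    using i by (auto simp: rev_nth j_def Suc_diff_Suc)
  thus "{rev xs ! i, rev xs ! Suc i} \<in> E" using w by (simp add: insert_commute)
qed auto

lemma reach_sym: "reach V E k x y \<Longrightarrow> reach V E k y x"
  unfolding reach_def
proof -
  assume "\<exists>xs. is_walk V E xs \<and> hd xs = x \<and> last xs = y \<and> length xs \<le> Suc k"
  then obtain xs where "is_walk V E xs" "hd xs = x" "last xs = y" "length xs \<le> Suc k" by blast
  thus "\<exists>xs. is_walk V E xs \<and> hd xs = y \<and> last xs = x \<and> length xs \<le> Suc k"
    using is_walk_rev[of V E xs] by (intro exI[of _ "rev xs"]) (auto simp: hd_rev last_rev)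
qed

lemma is_walk_Cons:
  "is_walk V E (x # xs) \<longleftrightarrow> x \<in> V \<and> (xs = [] \<or> (is_walk V E xs \<and> {x, hd xs} \<in> E))"
proof (cases xs)
  case Nil thus ?thesis by (auto simp: is_walk_def)
next
  case (Cons y ys)
  have "(\<forall>i. Suc i < length (x # xs) \<longrightarrow> {(x # xs) ! i, (x # xs) ! Suc i} \<in> E) \<longleftrightarrow>
     {x, y} \<in> E \<and> (\<forall>i. Suc i < length xs \<longrightarrow> {xs ! i, xs ! Suc i} \<in> E)"
    (is "?L \<longleftrightarrow> ?R")
  proof
    assume L: ?L
    show ?R using L[rule_format, of 0] L[rule_format, of "Suc _"] Cons by auto
  next
    assume R: ?R
    show ?L
    proof (intro allI impI)
      fix i assume "Suc i < length (x # xs)"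
      thus "{(x # xs) ! i, (x # xs) ! Suc i} \<in> E" using R Cons by (cases i) auto
    qed
  qed
  thus ?thesis unfolding is_walk_def using Cons by auto
qed

lemma is_walk_append:
  "is_walk V E xs \<Longrightarrow> is_walk V E (last xs # ys) \<Longrightarrow> is_walk V E (xs @ ys)"
proof (induction xs)
  case (Cons x xs)
  show ?case
  proof (cases "xs = []")
    case True thus ?thesis using Cons by simp
  next
    case False
    thus ?thesis using Cons by (simp add: is_walk_Cons)
  qed
qed (simp add: is_walk_def)

lemma reach_trans:
  assumes "reach V E k x y" "reach V E k' y z" shows "reach V E (k + k') x z"
proof -
  obtain xs where xs: "is_walk V E xs" "hd xs = x" "last xs = y" "length xs \<le> Suc k"
    using assms(1) by (auto simp: reach_def)
  obtain ys where ys: "is_walk V E ys" "hd ys = y" "last ys = z" "length ys \<le> Suc k'"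
    using assms(2) by (auto simp: reach_def)
  have ne: "xs \<noteq> []" "ys \<noteq> []" using xs ys by (auto simp: is_walk_def)
  hence "ys = last xs # tl ys" using xs ys by (cases ys) auto
  hence "is_walk V E (xs @ tl ys)" using xs(1) ys(1) by (metis is_walk_append)
  moreover have "hd (xs @ tl ys) = x" using xs ne by simp
  moreover have "last (xs @ tl ys) = z"
    using xs ys ne by (cases ys) (auto simp: last_append)
  moreover have "length (xs @ tl ys) \<le> Suc (k + k')" using xs ys ne by (cases ys) auto
  ultimately show ?thesis unfolding reach_def by blast
qed

lemma reach_step: "reach V E k x y \<Longrightarrow> {y, z} \<in> E \<Longrightarrow> z \<in> V \<Longrightarrow> reach V E (Suc k) x z"
  using reach_trans[of V E k x y 1 z] reach_edge[of y z E V] reach_in[of V E k x y] by simp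

lemma reach_SucE:
  assumes "reach V E (Suc k) x z" "x \<noteq> z"
  obtains y where "reach V E k x y" "{y, z} \<in> E" "z \<in> V"
proof -
  obtain xs where xs: "is_walk V E xs" "hd xs = z" "last xs = x" "length xs \<le> Suc (Suc k)"
    using reach_sym[OF assms(1)] by (auto simp: reach_def)
  obtain ys where ys: "xs = z # ys" using xs by (cases xs) (auto simp: is_walk_def)
  have "ys \<noteq> []" using xs ys assms by auto
  hence w: "is_walk V E ys" "{z, hd ys} \<in> E" "z \<in> V" using xs ys by (auto simp: is_walk_Cons)
  have "reach V E k (hd ys) x"
    unfolding reach_def using w xs ys \<open>ys \<noteq> []\<close> by (intro exI[of _ ys]) auto
  from that[OF reach_sym[OF this]] w show ?thesis by (simp add: insert_commute)
qed

lemma layer_reach: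
  assumes "x \<in> V" "y \<in> layer E i {x} (V - {x})" shows "reach V E i x y"
  using assms(2)
proof (induction i arbitrary: y)
  case 0 thus ?case using assms reach_refl by simp
next
  case (Suc i)
  obtain f where f: "f \<in> layer E i {x} (V - {x})" "{y, f} \<in> E"
    using Suc.prems unfolding layer_Suc nbrs_def by blast
  moreover have "y \<in> V" using layer_subset[of "Suc i" E "{x}" "V - {x}"] Suc.prems
      by (auto simp del: layer.simps)
  ultimately show ?case using Suc.IH reach_step by (metis insert_commute)
qed

lemma reach_layer:
  assumes "reach V E k x y" shows "\<exists>i\<le>k. y \<in> layer E i {x} (V - {x})"
  using assms
proof (induction k arbitrary: y)
  case 0
  then obtain xs where xs: "is_walk V E xs" "hd xs = x" "last xs = y" "length xs \<le> 1"
    by (auto simp: reach_def)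
  hence "xs = [x]" by (cases xs) (auto simp: is_walk_def)
  thus ?case using xs by simp
next
  case (Suc k)
  show ?case
  proof (cases "x = y")
    case True thus ?thesis by (intro exI[of _ 0]) simp
  next
    case False
    then obtain z where z: "reach V E k x z" "{z, y} \<in> E" "y \<in> V"
      using reach_SucE[OF Suc.prems] by blast
    obtain i where i: "i \<le> k" "z \<in> layer E i {x} (V - {x})" using Suc.IH[OF z(1)] by blast
    show ?thesis
    proof (cases "y \<in> unexplored E i {x} (V - {x})")
      case True
      hence "y \<in> layer E (Suc i) {x} (V - {x})"
        unfolding layer_Suc nbrs_def using i z by (auto simp: insert_commute)
      thus ?thesis using i by (intro exI[of _ "Suc i"]) auto
    next
      case nu: False
      then obtain j where "j \<in> {1..i}" "y \<in> layer E j {x} (V - {x})"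
        unfolding unexplored_eq using z False by auto
      thus ?thesis using i by (intro exI[of _ j]) auto
    qed
  qed
qed

text \<open>The tool for distances from below: a potential that changes by at most 1 along edges
  cannot grow faster than a walk.\<close>

lemma reach_potential:
  fixes \<phi> :: "'a \<Rightarrow> int"
  assumes "reach V E k x y"
    and \<phi>: "\<And>a b. a \<in> V \<Longrightarrow> b \<in> V \<Longrightarrow> {a, b} \<in> E \<Longrightarrow> \<phi> b \<le> \<phi> a + 1"
  shows "\<phi> y \<le> \<phi> x + int k"
  using assms(1)
proof (induction k arbitrary: y)
  case 0
  then obtain xs where xs: "is_walk V E xs" "hd xs = x" "last xs = y" "length xs \<le> 1"
    by (auto simp: reach_def)
  hence "xs = [x]" by (cases xs) (auto simp: is_walk_def)
  thus ?case using xs by simp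
next
  case (Suc k)
  show ?case
  proof (cases "x = y")
    case False
    then obtain z where z: "reach V E k x z" "{z, y} \<in> E" "y \<in> V"
      using reach_SucE[OF Suc.prems] by blast
    thus ?thesis using Suc.IH[OF z(1)] \<phi>[of z y] reach_in[OF z(1)] by simp
  qed simp
qed

text \<open>Lets an exploration of the whole graph be rerun inside what an earlier exploration has
  left over, where the edges are still independent of the past.\<close>

lemma layer_restrict:
  assumes "U' \<subseteq> U" "\<And>i. 1 \<le> i \<Longrightarrow> i \<le> k \<Longrightarrow> layer E i F U \<subseteq> U'"
  shows "i \<le> k \<Longrightarrow> layer E i F U' = layer E i F U \<and> unexplored E i F U' = unexplored E i F U \<inter> U'"
proof (induction i)
  case 0 thus ?case using assms by auto
next
  case (Suc i)
  hence IH: "layer E i F U' = layer E i F U" "unexplored E i F U' = unexplored E i F U \<inter> U'" by auto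
  have sub: "layer E (Suc i) F U \<subseteq> U'" using Suc by (intro assms) auto
  have "layer E (Suc i) F U' = layer E (Suc i) F U"
    using sub unfolding layer_Suc IH nbrs_def by blast
  thus ?case unfolding unexplored_Suc IH by blast
qed

lemma layer_add: "layer E (i + j) F U = layer E j (layer E i F U) (unexplored E i F U)"
proof (induction i arbitrary: F U)
  case (Suc i)
  show ?case using Suc[of "nbrs E F U" "U - nbrs E F U"] by simp
qed simp

text \<open>\<open>separated n w W t s r x y\<close>: the layers around \<open>y\<close> first reach size \<open>w\<close> at radius \<open>t + 1\<close>,
  those around \<open>x\<close> in the remaining graph at radius \<open>s + 1\<close>, and \<open>r\<close> further layers around \<open>x\<close>
  do not touch the outermost layer around \<open>y\<close>.\<close>

definition hits :: "nat \<Rightarrow> nat \<Rightarrow> (nat set \<Rightarrow> nat set \<Rightarrow> nat set set \<Rightarrow> bool) \<Rightarrow>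
    nat set \<Rightarrow> nat set \<Rightarrow> nat set set \<Rightarrow> bool" where
  "hits w W \<Psi> F U E \<longleftrightarrow> card (nbrs E F U) \<in> {w..W} \<and> \<Psi> (nbrs E F U) (U - nbrs E F U) E"

definition separated :: "nat \<Rightarrow> nat \<Rightarrow> nat \<Rightarrow> nat \<Rightarrow> nat \<Rightarrow> nat \<Rightarrow> nat \<Rightarrow> nat \<Rightarrow> nat set set \<Rightarrow> bool" where
  "separated n w W t s r x y =
    explore {1..<w} (hits w W (\<lambda>Y U E. x \<in> U \<and>
      explore {1..<w} (hits w W (\<lambda>X U' E. \<forall>i\<le>r. no_contact i X U' Y E)) s {x} (U - {x}) E)) t {y}
          ({1..n} - {y})"

lemma explore_hits_iff:
  "explore S (hits w W \<Psi>) t F U E \<longleftrightarrow> (\<forall>i\<le>t. card (layer E i F U) \<in> S) \<and>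
     card (layer E (Suc t) F U) \<in> {w..W} \<and> \<Psi> (layer E (Suc t) F U) (unexplored E (Suc t) F U) E"
  unfolding explore_iff hits_def layer_Suc unexplored_Suc by auto

text \<open>If \<open>x\<close> and \<open>y\<close> are that far apart, the ball of radius
  \<open>s + r + 2\<close> around \<open>x\<close> misses the ball of radius \<open>t + 1\<close>
  around \<open>y\<close>. Hence the layers around \<open>x\<close> are the same in the remaining
  graph, and an edge of contact would close a walk of length at most
  \<open>(s + 1 + r) + 1 + (t + 1)\<close>.\<close>

lemma separatedI:
  assumes xy: "x \<in> {1..n}" "y \<in> {1..n}"
    and y: "\<And>i. i \<le> t \<Longrightarrow> card (layer E i {y} ({1..n} - {y})) \<in> {1..<w}"
      "card (layer E (Suc t) {y} ({1..n} - {y})) \<in> {w..W}"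
    and x: "\<And>i. i \<le> s \<Longrightarrow> card (layer E i {x} ({1..n} - {x})) \<in> {1..<w}"
      "card (layer E (Suc s) {x} ({1..n} - {x})) \<in> {w..W}"
    and far: "\<not> reach {1..n} E (s + t + r + 3) x y"
  shows "separated n w W t s r x y E"
proof -
  let ?V = "{1..n}"
  let ?Y = "layer E (Suc t) {y} (?V - {y})" and ?U = "unexplored E (Suc t) {y} (?V - {y})"
  have Yfar: "\<not> reach ?V E (s + r + 2) x z" if "z \<in> layer E i {y} (?V - {y})" "i \<le> Suc t" for i z
  proof
    assume "reach ?V E (s + r + 2) x z"
    moreover have "reach ?V E (Suc t) z y"
      by (rule reach_mono[OF reach_sym[OF layer_reach[OF xy(2) that(1)]] that(2)])
    ultimately have "reach ?V E (s + r + 2 + Suc t) x y" by (rule reach_trans)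
    thus False using far by (simp add: add_ac eval_nat_numeral)
  qed
  have in_U: "z \<in> ?U" if "z \<in> ?V" "reach ?V E (s + r + 2) x z" for z
  proof (rule ccontr)
    assume "z \<notin> ?U"
    hence "z = y \<or> (\<exists>j\<in>{1..Suc t}. z \<in> layer E j {y} (?V - {y}))"
      unfolding unexplored_eq using that by blast
    hence "\<exists>j\<le>Suc t. z \<in> layer E j {y} (?V - {y})"
    proof
      assume "z = y" thus ?thesis by (intro exI[of _ 0]) simp
    qed auto
    then obtain j where "j \<le> Suc t" "z \<in> layer E j {y} (?V - {y})" by blast
    thus False using Yfar[of z j] that(2) by simp
  qed
  have xU: "x \<in> ?U" by (rule in_U[OF xy(1) reach_refl[OF xy(1)]])
  have sub: "layer E i {x} (?V - {x}) \<subseteq> ?U - {x}" if "1 \<le> i" "i \<le> s + r + 1" for i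
  proof
    fix z assume z: "z \<in> layer E i {x} (?V - {x})"
    have "z \<in> ?V - {x}" using layer_subset[of i E "{x}" "?V - {x}"] that z by auto
    moreover have "reach ?V E (s + r + 2) x z"
      by (rule reach_mono[OF layer_reach[OF xy(1) z]]) (use that in simp)
    ultimately show "z \<in> ?U - {x}" using in_U[of z] by simp
  qed
  have eq: "layer E i {x} (?U - {x}) = layer E i {x} (?V - {x})" if "i \<le> s + r + 1" for i
    using layer_restrict[of "?U - {x}" "?V - {x}" "s + r + 1" E "{x}" i, OF _ sub that]
      unexplored_subset[of E "Suc t" "{y}" "?V - {y}"]
          by (auto simp del: layer.simps unexplored.simps)
  have "no_contact i (layer E (Suc s) {x} (?U - {x})) (unexplored E (Suc s) {x} (?U - {x})) ?Y E"
    if "i \<le> r" for i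
    unfolding no_contact_def layer_add[symmetric]
  proof (intro ballI notI)
    fix z f assume z: "z \<in> ?Y" and f: "f \<in> layer E (Suc s + i) {x} (?U - {x})" and e: "{z, f} \<in> E"
    have "f \<in> layer E (Suc s + i) {x} (?V - {x})" using f eq[of "Suc s + i"] that by simp
    hence "reach ?V E (s + r + 1) x f"
      by (rule reach_mono[OF layer_reach[OF xy(1)]]) (use that in simp)
    moreover have "z \<in> ?V" using layer_subset[of "Suc t" E "{y}" "?V - {y}"] z by auto
    ultimately have "reach ?V E (s + r + 2) x z"
      using reach_step[of ?V E "s + r + 1" x f z] e by (simp add: insert_commute)
    thus False using Yfar[OF z] by simp
  qed
  thus ?thesis
    unfolding separated_def explore_hits_iff using y x xU eq
    by (simp del: layer.simps unexplored.simps)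
qed

subsection \<open>The upper bound\<close>

text \<open>For the branching process with one ancestor this is the expectation of
  \<open>exp (- Z / w)\<close> over the event that generation \<open>t\<close> has positive size
  \<open>Z\<close>. Up to a factor \<open>exp 1\<close> it bounds the probability of
  \<open>1 <= Z <= w\<close>.\<close>

definition thin_gap :: "real \<Rightarrow> nat \<Rightarrow> nat \<Rightarrow> real" where
  "thin_gap l w t = (pgf l ^^ t) (exp (- (1 / real w))) - (pgf l ^^ t) 0"

text \<open>\<open>distortion\<close> bounds, in both directions, the ratio of a one-step transition probability of
  the exploration to its Poisson counterpart as long as at most \<open>budget n\<close> vertices are used
  up.\<close>

definition distortion :: "real \<Rightarrow> nat \<Rightarrow> real" where
  "distortion l n = exp ((4 + 2 * l + 2 * l\<^sup>2) * (budget n)\<^sup>2 / n)"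

lemma thin_gap_nonneg: "0 \<le> l \<Longrightarrow> 0 \<le> thin_gap l w t"
  by (simp add: thin_gap_def pgf_iter_mono)

lemma thin_gap_le_1: "0 \<le> l \<Longrightarrow> thin_gap l w t \<le> 1"
  using pgf_iter_le_one[where l = l and x = "exp (- (1 / real w))" and t
      = t] pgf_iter_nonneg[where x = 0 and l = l and t = t] by (simp add: thin_gap_def)

lemma distortion_ge_1: "0 \<le> l \<Longrightarrow> 1 \<le> distortion l n"
  by (simp add: distortion_def)

lemma exp_le_distortion: "0 \<le> (l::real) \<Longrightarrow> exp (2 * l * (budget n)\<^sup>2 / n) \<le> distortion l n"
  unfolding distortion_def exp_le_cancel_iff by (intro divide_right_mono mult_right_mono) auto

lemma exp_one_power_ge:
  assumes "0 < w" "j \<le> w" shows "1 \<le> exp 1 * exp (- (1 / real w)) ^ j"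
proof -
  have "0 \<le> 1 - real j / w" using assms by simp
  hence "1 \<le> exp (1 - real j / w)" by simp
  also have "\<dots> = exp 1 * exp (- (1 / real w)) ^ j"
    by (simp add: exp_of_nat_mult[symmetric] exp_add[symmetric])
  finally show ?thesis .
qed

text \<open>On \<open>{1..<w}\<close> the constant 1 is at most
  \<open>exp 1 * (exp (- (1 / w)) ^ j - 0 ^ j)\<close>, a difference of powers that
  \<open>bp_iter_le_diff\<close> propagates.\<close>

lemma explore_thin_prob:
  fixes l s :: real and n c w t :: nat
  assumes l: "0 \<le> l" "l \<le> real n" and n: "0 < n" and w: "2 \<le> w" "w \<le> budget n" "c \<le> budget n"
    and s: "0 \<le> s"
    and dep: "\<And>F U. F \<inter> U = {} \<Longrightarrow> (F \<union> U) \<inter> X = {} \<Longrightarrow> depends_on (Q F U) (edges_within (F \<union> U \<union> X))"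
    and Q: "\<And>F U. F \<subseteq> {1..n} \<Longrightarrow> U \<subseteq> {1..n} \<Longrightarrow> F \<inter> U = {} \<Longrightarrow> (F \<union> U) \<inter> X = {} \<Longrightarrow>
      card F \<in> {1..<w} \<Longrightarrow> n \<le> card U + c \<Longrightarrow> gnp_prob n (l / n) (Q F U) \<le> s"
    and U: "x \<in> {1..n}" "U \<subseteq> {1..n}" "x \<notin> U" "insert x U \<inter> X = {}" "n + t * w \<le> card U + c"
  shows "gnp_prob n (l / n) (explore {1..<w} Q t {x} U)
      \<le> distortion l n ^ t * (s * exp 1 * thin_gap l w t)"
proof -
  let ?\<kappa> = "exp (2 * l * (budget n)\<^sup>2 / n)"
  have "gnp_prob n (l / n) (explore {1..<w} Q t {x} U) \<le>
      ?\<kappa> ^ t * bp_iter l {1..<w} (\<lambda>_. s) t (card {x})"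
    by (rule explore_prob_upper[where w = w and c = c and X = X])
       (use l n w s dep Q U in auto)
  also have "bp_iter l {1..<w} (\<lambda>_. s) t (card {x}) \<le> (s * exp 1) *
     ((pgf l ^^ t) (exp (- (1 / real w))) ^ card {x} - (pgf l ^^ t) 0 ^ card {x})"
  proof (rule bp_iter_le_diff)
    fix j assume j: "j \<in> {1..<w}"
    have "s * 1 \<le> s * (exp 1 * exp (- (1 / real w)) ^ j)"
      using exp_one_power_ge[of w j] j s by (intro mult_left_mono) auto
    moreover have "(0::real) ^ j = 0" using j by simp
    ultimately show "s \<le> s * exp 1 * (exp (- (1 / real w)) ^ j - 0 ^ j)"
        by (simp only: diff_zero mult.assoc mult_1_right)
  qed (use l s w in auto)
  also have "\<dots> = s * exp 1 * thin_gap l w t" by (simp add: thin_gap_def)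
  also have "?\<kappa> ^ t \<le> distortion l n ^ t" by (intro power_mono exp_le_distortion l) auto
  finally show ?thesis using s l thin_gap_nonneg[of l w t]
    by (auto simp: mult_left_mono mult_right_mono)
qed

lemma depends_on_hits:
  assumes "\<And>F U. F \<inter> U = {} \<Longrightarrow> (F \<union> U) \<inter> X = {} \<Longrightarrow> depends_on (\<Psi> F U) (edges_within (F \<union> U \<union> X))"
    and "F \<inter> U = {}" "(F \<union> U) \<inter> X = {}"
  shows "depends_on (hits w W \<Psi> F U) (edges_within (F \<union> U \<union> X))"
proof -
  have "depends_on (\<lambda>E. (card F' \<in> {w..W} \<and> \<Psi> F' (U - F') E)) (edges_within (F \<union> U \<union> X))"
    if "F' \<subseteq> U" for F'
    by (intro depends_on_conj depends_on_const depends_on_mono[OF assms(1)[of F' "U - F'"]])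
       (use that assms in \<open>auto intro!: edges_within_mono\<close>)
  from depends_on_bind_nbrs[OF _ this, of F U "\<lambda>F'. F'"]
  have "depends_on (\<lambda>E. card (nbrs E F U) \<in> {w..W}
      \<and> \<Psi> (nbrs E F U) (U - nbrs E F U) E) (edges_within (F \<union> U \<union> X))"
    by (auto simp: edges_within_def crossing_def)
  thus ?thesis unfolding hits_def[abs_def] .
qed

lemma explore_hits_prob:
  fixes l s :: real and n c w W t :: nat
  assumes l: "0 \<le> l" "l \<le> real n" and n: "0 < n" and w: "2 \<le> w" "w \<le> budget n" "c \<le> budget n"
    and s: "0 \<le> s"
    and dep: "\<And>F U. F \<inter> U = {} \<Longrightarrow> (F \<union> U) \<inter> X = {} \<Longrightarrow> depends_on (\<Psi> F U) (edges_within (F \<union> U \<union> X))"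
    and \<Psi>: "\<And>F U. F \<subseteq> {1..n} \<Longrightarrow> U \<subseteq> {1..n} \<Longrightarrow> F \<inter> U = {} \<Longrightarrow> (F \<union> U) \<inter> X = {} \<Longrightarrow>
      card F \<in> {w..W} \<Longrightarrow> n \<le> card U + c + W \<Longrightarrow> gnp_prob n (l / n) (\<Psi> F U) \<le> s"
    and U: "x \<in> {1..n}" "U \<subseteq> {1..n}" "x \<notin> U" "insert x U \<inter> X = {}" "n + t * w \<le> card U + c"
  shows "gnp_prob n (l / n) (explore {1..<w} (hits w W \<Psi>) t {x} U)
      \<le> distortion l n ^ t * (s * exp 1 * thin_gap l w t)"
proof (rule explore_thin_prob[OF l n w s _ _ U])
  show "depends_on (hits w W \<Psi> F U) (edges_within (F \<union> U \<union> X))"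
      if "F \<inter> U = {}" "(F \<union> U) \<inter> X = {}" for F U
    by (rule depends_on_hits[OF dep that])
  fix F U assume F: "F \<subseteq> {1..n}" "U \<subseteq> {1..n}" "F \<inter> U = {}" "(F \<union> U) \<inter> X
      = {}" "card F \<in> {1..<w}" "n \<le> card U + c"
  have p: "0 \<le> l / n" "l / n \<le> 1" using l n by auto
  have finU: "finite U" using F finite_subset by blast
  have "gnp_prob n (l / n) (hits w W \<Psi> F U) \<le> gnp_prob n (l / n) (\<lambda>E. card (nbrs E F U) \<in> {w..W})
      * s"
    unfolding hits_def
  proof (rule gnp_prob_step_mult[OF F(1-3) p, where P = "\<lambda>F'. card F' \<in> {w..W}" and A
      = "\<lambda>F' E. \<Psi> F' (U - F') E"])
    fix F' assume F': "F' \<subseteq> U"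
    have "depends_on (\<Psi> F' (U - F')) (edges_within (F' \<union> (U - F') \<union> X))"
      by (rule dep) (use F F' in auto)
    thus "depends_on (\<Psi> F' (U - F')) (- crossing F U)"
      by (rule depends_on_mono[OF _ edges_within_subset_compl]) (use F F' in blast)
    assume c: "card F' \<in> {w..W}"
    show "gnp_prob n (l / n) (\<Psi> F' (U - F')) \<le> s"
    proof (rule \<Psi>)
      have "card (U - F') = card U - card F'"
        using F' finU by (simp add: card_Diff_subset finite_subset)
      thus "n \<le> card (U - F') + c + W" using F(6) c by auto
    qed (use F F' c in auto)
  qed
  \<comment> \<open>Jumping to the window \<open>{w..W}\<close> in a given step need not be
    unlikely; the smallness comes from the thin phase before it.\<close>
  also have "\<dots> \<le> 1 * s" using s by (intro mult_right_mono) auto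
  finally show "gnp_prob n (l / n) (hits w W \<Psi> F U) \<le> s" by simp
qed

text \<open>The exploration around \<open>y\<close>, the one around \<open>x\<close> in the
  remainder and the growth phase inspect disjoint edges, so three bounds multiply. Each thin phase
  contributes one factor \<open>exp 1\<close>.\<close>

lemma separated_prob:
  fixes l \<zeta> :: real and n w W s t r :: nat
  assumes l: "0 \<le> l" "l \<le> real n" and n: "0 < n" and w: "2 \<le> w" "(s + t) * w + 2 * W + 2
      \<le> budget n" "w \<le> W"
    and \<zeta>: "0 \<le> \<zeta>"
    and nc: "\<And>F U Y. F \<subseteq> {1..n} \<Longrightarrow> U \<subseteq> {1..n} \<Longrightarrow> Y \<subseteq> {1..n} \<Longrightarrow> F \<inter> U = {} \<Longrightarrow> (F \<union> U) \<inter> Y = {} \<Longrightarrow>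
      card F \<in> {w..W} \<Longrightarrow> w \<le> card Y \<Longrightarrow> n \<le> card U + budget n \<Longrightarrow>
      gnp_prob n (l / n) (\<lambda>E. \<forall>i\<le>r. no_contact i F U Y E) \<le> \<zeta>"
    and xy: "x \<in> {1..n}" "y \<in> {1..n}"
  shows "gnp_prob n (l / n) (separated n w W t s r x y) \<le>
    distortion l n ^ (s + t) * (exp 1)\<^sup>2 * thin_gap l w s * thin_gap l w t * \<zeta>"
proof -
  define inner where "inner = (\<lambda>Y U E. explore {1..<w} (hits w W (\<lambda>X U' E. \<forall>i\<le>r. no_contact i X U'
      Y E)) s {x} (U - {x}) E)"
  have sep: "separated n w W t s r x y =
      explore {1..<w} (hits w W (\<lambda>Y U E. x \<in> U \<and> inner Y U E)) t {y} ({1..n} - {y})"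
    by (simp only: separated_def inner_def)
  define s1 where "s1 = distortion l n ^ s * (\<zeta> * exp 1 * thin_gap l w s)"
  have s1: "0 \<le> s1" using l \<zeta> thin_gap_nonneg distortion_ge_1[of l n] by (simp add: s1_def)
  have depn: "depends_on (\<lambda>E. \<forall>i\<le>r. no_contact i F U Y E) (edges_within (F \<union> U \<union> Y))" for F U Y
  proof -
    have "depends_on (\<lambda>E. \<forall>i\<in>{..r}. no_contact i F U Y E) (edges_within (F \<union> U \<union> Y))"
      by (intro depends_on_ball depends_on_no_contact)
    thus ?thesis by (simp add: Ball_def)
  qed
  have dep: "depends_on (\<lambda>E. x \<in> U \<and> inner Y U E) (edges_within (Y \<union> U \<union> {}))"
      if "Y \<inter> U = {}" for Y U
  proof (cases "x \<in> U")
    case True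
    have "depends_on (inner Y U) (edges_within ({x} \<union> (U - {x}) \<union> Y))"
      unfolding inner_def
      by (rule depends_on_explore[OF depends_on_hits[OF depn]]) (use that True in auto)
    moreover have "{x} \<union> (U - {x}) \<union> Y = Y \<union> U \<union> {}" using True by auto
    ultimately show ?thesis using True by simp
  qed simp
  have "gnp_prob n (l / n) (separated n w W t s r x y)
      \<le> distortion l n ^ t * (s1 * exp 1 * thin_gap l w t)"
    unfolding sep
  proof (rule explore_hits_prob[OF l n w(1) _ _ s1, where c = "t * w + 1" and X = "{}"])
    show "depends_on (\<lambda>E. x \<in> U \<and> inner Y U E) (edges_within (Y \<union> U \<union> {}))" if "Y \<inter> U = {}" for Y U
      by (rule dep[OF that])
    fix Y U assume Y: "Y \<subseteq> {1..n}" "U \<subseteq> {1..n}" "Y \<inter> U = {}" "card Y \<in> {w..W}" "n \<le> card U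
        + (t * w + 1) + W"
    show "gnp_prob n (l / n) (\<lambda>E. x \<in> U \<and> inner Y U E) \<le> s1"
    proof (cases "x \<in> U")
      case True
      have "gnp_prob n (l / n) (inner Y U) \<le> s1"
        unfolding inner_def s1_def
      proof (rule explore_hits_prob[OF l n w(1) _ _ \<zeta>, where c = "s * w + t * w + 2 + W" and X = Y])
        show "gnp_prob n (l / n) (\<lambda>E. \<forall>i\<le>r. no_contact i F U' Y E) \<le> \<zeta>"
          if "F \<subseteq> {1..n}" "U' \<subseteq> {1..n}" "F \<inter> U' = {}" "(F \<union> U') \<inter> Y = {}" "card F \<in> {w..W}"
            "n \<le> card U' + (s * w + t * w + 2 + W) + W" for F U'
          using that Y w by (intro nc) (auto simp: algebra_simps)
        have "card (U - {x}) = card U - 1" using True by simp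
        moreover have "card U > 0" using True Y by (auto simp: card_gt_0_iff intro: finite_subset)
        ultimately show "n + s * w \<le> card (U - {x}) + (s * w + t * w + 2 + W)" using Y by auto
      qed (use depn True Y w xy in \<open>auto simp: algebra_simps\<close>)
      thus ?thesis using True by simp
    qed (use s1 in simp)
  next
    show "n + t * w \<le> card ({1..n} - {y}) + (t * w + 1)" using xy by simp
  qed (use w xy in \<open>auto simp: algebra_simps\<close>)
  also have "\<dots> = distortion l n ^ (s + t) * (exp 1)\<^sup>2 * thin_gap l w s * thin_gap l w t * \<zeta>"
    by (simp add: s1_def power_add power2_eq_square mult_ac)
  finally show ?thesis .
qed

text \<open>Exponential moment with base 2: a layer smaller than \<open>w\<close> has a successor of
  mean at most \<open>l * w\<close>, and \<open>2 ^ W\<close> is at least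
  \<open>exp ((l + 1) * w)\<close> because \<open>ln 2 >= 1/2\<close>.\<close>

lemma jump_prob:
  fixes l :: real and n c w W t :: nat
  assumes l: "0 \<le> l" "l \<le> real n" and n: "0 < n" and w: "2 \<le> w" "t * w + 1 \<le> budget n" "w
      \<le> budget n"
    and W: "2 * (l + 1) * w \<le> W" and x: "x \<in> {1..n}"
  shows "gnp_prob n (l / n) (\<lambda>E. (\<forall>i\<le>t. card (layer E i {x} ({1..n} - {x})) \<in> {1..<w}) \<and>
      W < card (layer E (Suc t) {x} ({1..n} - {x}))) \<le> distortion l n ^ t * exp 1 * exp (- real w)"
proof -
  have p: "0 \<le> l / n" "l / n \<le> 1" using l n by auto
  define Q where "Q = (\<lambda>F U (E :: nat set set). card (nbrs E F U) \<in> {W<..})"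
  have "gnp_prob n (l / n) (explore {1..<w} Q t {x} ({1..n} - {x})) \<le>
     distortion l n ^ t * (exp (- real w) * exp 1 * thin_gap l w t)"
  proof (rule explore_thin_prob[OF l n w(1), where c = "t * w + 1" and X = "{}"])
    show "depends_on (Q F U) (edges_within (F \<union> U \<union> {}))" for F U
      unfolding Q_def using depends_on_mono[OF depends_on_nbrs crossing_subset_within] by simp
    fix F U assume F: "F \<subseteq> {1..n}" "U \<subseteq> {1..n}" "F \<inter> U = {}" "card F \<in> {1..<w}"
    have cU: "card U \<le> n" using F(2) card_mono[of "{1..n}" U] by simp
    have "gnp_prob n (l / n) (Q F U) \<le> exp (- (ln 2 * W)) * exp (- (real (card U) * (1 - (1 - l /
        n) ^ card F) * (1 - 2)))"
      unfolding Q_def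
    proof (rule gnp_prob_nbrs_markov[OF F(1-3) p])
      fix j assume "j \<in> {W<..}"
      hence "0 \<le> ln 2 * (real j - W)" by simp
      hence "1 \<le> exp (ln 2 * (real j - W))" by simp
      also have "\<dots> = exp (- (ln 2 * W)) * exp (real j * ln 2)"
        by (simp add: exp_add[symmetric] algebra_simps)
      also have "exp (real j * ln 2) = 2 ^ j" by (subst exp_of_nat_mult) simp
      finally show "1 \<le> exp (- (ln 2 * W)) * 2 ^ j" .
    qed auto
    also have "\<dots> \<le> exp (- real w)"
    proof -
      have "real (card U) * (1 - (1 - l / n) ^ card F) \<le> real n * (l / n * card F)"
        using cU one_minus_power_bounds(1)[OF p, of "card F"] p
            by (intro mult_mono) (auto simp: power_le_one)
      also have "\<dots> = l * card F" using n by simp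
      also have "\<dots> \<le> l * w" using F l by (intro mult_left_mono) auto
      finally have 1: "real (card U) * (1 - (1 - l / n) ^ card F) \<le> l * w" .
      have "(1/2) * (2 * (l + 1) * w) \<le> ln 2 * W"
        using W ln2_ge_two_thirds l by (intro mult_mono) auto
      with 1 show ?thesis unfolding exp_add[symmetric] by (simp add: algebra_simps)
    qed
    finally show "gnp_prob n (l / n) (Q F U) \<le> exp (- real w)" .
  qed (use w x in auto)
  also have "\<dots> \<le> distortion l n ^ t * (exp (- real w) * exp 1 * 1)"
    using l thin_gap_le_1[of l w t] distortion_ge_1[of l n] by (intro mult_left_mono) auto
  finally have "gnp_prob n (l / n) (explore {1..<w} Q t {x} ({1..n} - {x}))
      \<le> distortion l n ^ t * exp 1 * exp (- real w)"
    by (simp add: mult_ac)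
  thus ?thesis unfolding explore_iff Q_def layer_Suc[symmetric] by (simp only: greaterThan_iff)
qed

lemma thin_prob:
  fixes l :: real and n w t :: nat
  assumes l: "0 \<le> l" "l \<le> real n" and n: "0 < n" and w: "2 \<le> w" "t * w + 1 \<le> budget n" "w
      \<le> budget n"
    and x: "x \<in> {1..n}"
  shows "gnp_prob n (l / n) (\<lambda>E. \<forall>i\<le>t. card (layer E i {x} ({1..n} - {x})) \<in> {1..<w})
     \<le> distortion l n ^ t * exp 1 * thin_gap l w t"
proof -
  have "gnp_prob n (l / n) (explore {1..<w} (\<lambda>_ _ _. True) t {x} ({1..n} - {x})) \<le>
     distortion l n ^ t * (1 * exp 1 * thin_gap l w t)"
    by (rule explore_thin_prob[OF l n w(1), where c = "t * w + 1" and X = "{}"]) (use w x in auto)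
  thus ?thesis unfolding explore_iff by (simp add: mult.assoc)
qed

section \<open>Three bad events and what holds outside them\<close>

definition shell :: "nat \<Rightarrow> nat set set \<Rightarrow> nat \<Rightarrow> nat \<Rightarrow> nat set" where
  "shell n E x i = layer E i {x} ({1..n} - {x})"

definition thin_event :: "nat \<Rightarrow> nat \<Rightarrow> nat \<Rightarrow> nat set set \<Rightarrow> bool" where
  "thin_event n w T E \<longleftrightarrow> (\<exists>x\<in>{1..n}. \<forall>i\<le>T. card (shell n E x i) \<in> {1..<w})"

definition jump_event :: "nat \<Rightarrow> nat \<Rightarrow> nat \<Rightarrow> nat \<Rightarrow> nat set set \<Rightarrow> bool" where
  "jump_event n w W T E \<longleftrightarrow> (\<exists>x\<in>{1..n}. \<exists>t\<in>{..<T}. (\<forall>i\<le>t. card (shell n E x i) \<in> {1..<w}) \<and>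
     W < card (shell n E x (Suc t)))"

definition separated_event :: "nat \<Rightarrow> nat \<Rightarrow> nat \<Rightarrow> nat \<Rightarrow> (nat \<Rightarrow> nat \<Rightarrow> nat) \<Rightarrow> nat set set \<Rightarrow> bool" where
  "separated_event n w W T R E \<longleftrightarrow>
     (\<exists>(x, y)\<in>{1..n} \<times> {1..n}. \<exists>(s, t)\<in>{..<T} \<times> {..<T}. separated n w W t s (R s t) x y E)"

lemma finite_shell: "finite (shell n E x i)"
proof (cases "i = 0")
  case False
  hence "shell n E x i \<subseteq> {1..n}"
    using layer_subset[of i E "{x}" "{1..n} - {x}"] by (auto simp: shell_def)
  thus ?thesis by (rule finite_subset) simp
qed (simp add: shell_def)

text \<open>Considers the first radius at which the layer size leaves \<open>{1..<w}\<close>. It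
  exists up to \<open>T\<close> without \<open>thin_event\<close>, and excluding
  \<open>jump_event\<close> keeps the size there at most \<open>W\<close> unless it is 0.\<close>

lemma first_hit:
  assumes w: "2 \<le> w" and nt: "\<not> thin_event n w T E" and nj: "\<not> jump_event n w W T E" and x: "x \<in>
      {1..n}"
  obtains (extinct) i where "i \<le> T" "shell n E x i = {}" "\<And>j. j < i \<Longrightarrow> card (shell n E x j) < w"
  | (hit) t where "t < T" "\<And>i. i \<le> t \<Longrightarrow> card (shell n E x i) \<in> {1..<w}"
      "card (shell n E x (Suc t)) \<in> {w..W}"
proof -
  obtain i0 where i0: "i0 \<le> T" "card (shell n E x i0) \<notin> {1..<w}"
    using nt x unfolding thin_event_def by blast
  define i where "i = (LEAST i. card (shell n E x i) \<notin> {1..<w})"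
  have i: "card (shell n E x i) \<notin> {1..<w}" unfolding i_def by (rule LeastI[of _ i0]) (rule i0)
  have iT: "i \<le> T" using Least_le[of "\<lambda>i. card (shell n E x i) \<notin> {1..<w}" i0] i0
      unfolding i_def by simp
  have less: "card (shell n E x j) \<in> {1..<w}" if "j < i" for j
    using not_less_Least[of j "\<lambda>i. card (shell n E x i) \<notin> {1..<w}"] that unfolding i_def by blast
  have "i \<noteq> 0" using i w by (intro notI) (simp add: shell_def)
  then obtain t where t: "i = Suc t" by (cases i) auto
  show thesis
  proof (cases "card (shell n E x i) = 0")
    case True
    hence "shell n E x i = {}" using finite_shell by simp
    thus thesis using extinct[of i] iT less by simp
  next
    case False
    hence "w \<le> card (shell n E x (Suc t))" using i t by simp
    moreover have "card (shell n E x (Suc t)) \<le> W"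
      using nj x iT t less unfolding jump_event_def
          by (meson Suc_le_lessD lessThan_iff less_Suc_eq_le not_le)
    ultimately show thesis using hit[of t] iT t less by simp
  qed
qed

text \<open>Vertices in different components are separated for every \<open>r\<close>; excluding a
  single value of \<open>r\<close> therefore connects all vertices whose explorations become large.
  The lower bound needs this to obtain finite distances.\<close>

lemma hits_connected:
  assumes w: "2 \<le> w" and nt: "\<not> thin_event n w T E" and nj: "\<not> jump_event n w W T E"
    and ns: "\<not> separated_event n w W T (\<lambda>_ _. r) E"
    and x: "x \<in> {1..n}" "y \<in> {1..n}" and big: "\<And>i. i \<le> T \<Longrightarrow> shell n E x i = {}
        \<Longrightarrow> \<exists>j<i. w \<le> card (shell n E x j)"
    "\<And>i. i \<le> T \<Longrightarrow> shell n E y i = {} \<Longrightarrow> \<exists>j<i. w \<le> card (shell n E y j)"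
  shows "\<exists>k. reach {1..n} E k x y"
proof (rule ccontr)
  assume no: "\<not> ?thesis"
  obtain s where s: "s < T" "\<And>i. i \<le> s \<Longrightarrow> card (shell n E x i) \<in> {1..<w}" "card (shell n E x (Suc
      s)) \<in> {w..W}"
    by (rule first_hit[OF w nt nj x(1)]) (use big(1) in \<open>meson not_le\<close>)+
  obtain t where t: "t < T" "\<And>i. i \<le> t \<Longrightarrow> card (shell n E y i) \<in> {1..<w}" "card (shell n E y (Suc
      t)) \<in> {w..W}"
    by (rule first_hit[OF w nt nj x(2)]) (use big(2) in \<open>meson not_le\<close>)+
  have "separated n w W t s r x y E"
    by (rule separatedI[OF x]) (use s t no in \<open>auto simp: shell_def simp del: layer.simps\<close>)
  thus False using ns x s t unfolding separated_event_def by blast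
qed

text \<open>Suppose two vertices of one component are at distance more than \<open>D\<close>. An
  exploration that dies out by radius \<open>T <= D\<close> would have found the other vertex, so
  both become large, at radii \<open>Suc s\<close> and \<open>Suc t\<close>. The radius left for the
  growth phase is \<open>D - s - t - 3\<close>; short thin phases thus give the growth phase more
  time.\<close>

lemma diam_le:
  assumes n: "0 < n" and w: "2 \<le> w" and nt: "\<not> thin_event n w T E" and nj: "\<not> jump_event n w W T E"
    and ns: "\<not> separated_event n w W T (\<lambda>s t. D - s - t - 3) E" and D: "2 * T + 3 \<le> D"
  shows "graph_diam {1..n} E \<le> D"
proof -
  let ?V = "{1..n}"
  define A where "A = {the_enat (graph_dist ?V E x y) |x y. x \<in> ?V \<and> y \<in> ?V
      \<and> graph_dist ?V E x y < \<infinity>}"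
  have "A \<subseteq> (\<lambda>(x, y). the_enat (graph_dist ?V E x y)) ` (?V \<times> ?V)" by (auto simp: A_def)
  hence fin: "finite A" by (rule finite_subset) simp
  have "graph_dist ?V E 1 1 \<le> enat 0" unfolding graph_dist_le_iff
      by (rule reach_refl) (use n in simp)
  hence "graph_dist ?V E 1 1 < \<infinity>" by (metis enat_ord_code(4) order_le_less_trans)
  hence "the_enat (graph_dist ?V E 1 1) \<in> A"
    unfolding A_def mem_Collect_eq by (intro exI[of _ 1] conjI refl) (use n in auto)
  hence ne: "A \<noteq> {}" by blast
  have "a \<le> D" if "a \<in> A" for a
  proof (rule ccontr)
    assume "\<not> a \<le> D"
    then obtain x y where xy: "x \<in> ?V" "y \<in> ?V" "graph_dist ?V E x y < \<infinity>" "D < the_enat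
        (graph_dist ?V E x y)"
      using \<open>a \<in> A\<close> unfolding A_def mem_Collect_eq by (metis not_le)
    then obtain d where d: "graph_dist ?V E x y = enat d" "D < d" by auto
    have far: "\<not> reach ?V E D x y" using d by (simp add: graph_dist_le_iff[symmetric])
    have rd: "reach ?V E d x y" using d by (simp add: graph_dist_le_iff[symmetric])
    have noext: False
      if ass: "i \<le> T" "shell n E u i = {}" "reach ?V E d u v" "\<not> reach ?V E D u v" "u \<in> ?V" for i
          u v
    proof -
      obtain j where j: "j \<le> d" "v \<in> layer E j {u} (?V - {u})" using reach_layer[OF ass(3)] by blast
      have "j < i" using layer_empty_mono[of E i "{u}" "?V - {u}" j] ass(2) j
          by (force simp: shell_def)
      hence "reach ?V E D u v"
        using layer_reach[OF ass(5) j(2)] reach_mono[of ?V E j u v D] ass(1) D by simp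
      thus False using ass by simp
    qed
    obtain s where s: "s < T" "\<And>i. i \<le> s \<Longrightarrow> card (shell n E x i) \<in> {1..<w}" "card (shell n E x (Suc
        s)) \<in> {w..W}"
    proof (rule first_hit[OF w nt nj xy(1)])
      fix i assume "i \<le> T" "shell n E x i = {}"
      from noext[OF this rd far xy(1)] show thesis by simp
    qed (use that in simp)
    obtain t where t: "t < T" "\<And>i. i \<le> t \<Longrightarrow> card (shell n E y i) \<in> {1..<w}" "card (shell n E y (Suc
        t)) \<in> {w..W}"
    proof (rule first_hit[OF w nt nj xy(2)])
      have far': "\<not> reach ?V E D y x" using far reach_sym[of ?V E D y x] by blast
      fix i assume "i \<le> T" "shell n E y i = {}"
      from noext[OF this reach_sym[OF rd] far' xy(2)] show thesis by simp
    qed (use that in simp)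
    have "s + t + (D - s - t - 3) + 3 = D" using D s t by simp
    hence "separated n w W t s (D - s - t - 3) x y E"
      by (intro separatedI[OF xy(1,2)]) (use s t far in \<open>auto simp: shell_def simp del:
          layer.simps\<close>)
    thus False using ns xy s t unfolding separated_event_def by blast
  qed
  thus ?thesis unfolding graph_diam_def A_def[symmetric] using fin ne by simp
qed

section \<open>Time scales and asymptotic estimates\<close>

definition growth_time :: "real \<Rightarrow> nat \<Rightarrow> nat" where
  "growth_time l n = nat \<lceil>log l (width n)\<rceil>"

definition extinction_time :: "real \<Rightarrow> nat \<Rightarrow> nat" where
  "extinction_time ls n = nat \<lceil>ln n / ln (1 / ls)\<rceil>"

lemma growth_time_bounds:
  fixes l :: real
  assumes l: "1 < l" and n: "1 \<le> ln (real n)"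
  shows "width n \<le> l ^ growth_time l n" "l ^ growth_time l n \<le> l * width n"
    "growth_time l n \<le> log l (width n) + 1"
proof -
  have w: "1 \<le> real (width n)" using width_bounds(3)[OF n] by simp
  hence lg: "0 \<le> log l (width n)" using l by (simp add: zero_le_log_cancel_iff)
  have le: "log l (width n) \<le> growth_time l n" unfolding growth_time_def by linarith
  show up: "growth_time l n \<le> log l (width n) + 1" unfolding growth_time_def using lg by linarith
  have "width n = l powr log l (width n)" using l w by simp
  also have "\<dots> \<le> l powr growth_time l n" using l le by (intro powr_mono) auto
  finally show "width n \<le> l ^ growth_time l n" using l by (simp add: powr_realpow)
  have "l ^ growth_time l n = l powr growth_time l n" using l by (simp add: powr_realpow)
  also have "\<dots> \<le> l powr (log l (width n) + 1)" using l up by (intro powr_mono) auto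
  also have "\<dots> = l * width n" using l w by (simp add: powr_add)
  finally show "l ^ growth_time l n \<le> l * width n" .
qed

lemma extinction_time_bounds:
  assumes ls: "0 < ls" "ls < 1" and n: "0 < n"
  shows "ln n / ln (1 / ls) \<le> extinction_time ls n" "extinction_time ls n \<le> ln n / ln (1 / ls) + 1"
    "n * ls ^ extinction_time ls n \<le> 1"
proof -
  have L: "0 < ln (1 / ls)" using ls by simp
  have nn: "0 \<le> ln (real n)" using n by simp
  have "0 \<le> ln n / ln (1 / ls)" using L nn by (intro divide_nonneg_nonneg) auto
  thus up: "ln n / ln (1 / ls) \<le> extinction_time ls n" "extinction_time ls n \<le> ln n / ln (1 / ls)
      + 1"
    unfolding extinction_time_def by linarith+
  have "ln n \<le> extinction_time ls n * ln (1 / ls)" using up(1) L by (simp add: field_simps)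
  also have "\<dots> = ln ((1 / ls) ^ extinction_time ls n)" using ls by (simp add: ln_realpow)
  finally have "real n \<le> (1 / ls) ^ extinction_time ls n" using n ls
      by (subst (asm) ln_le_cancel_iff) auto
  thus "n * ls ^ extinction_time ls n \<le> 1" using ls by (simp add: power_divide field_simps)
qed

lemma power_over_fact_le_exp:
  assumes "0 \<le> (y::real)" shows "y ^ q / fact q \<le> exp y"
proof -
  have "(\<Sum>i\<in>{q}. y ^ i /\<^sub>R fact i) \<le> (\<Sum>i. y ^ i /\<^sub>R fact i)"
    by (rule sum_le_suminf) (use assms summable_exp[of y] in auto)
  thus ?thesis by (simp add: exp_def field_simps)
qed

lemma exp_minus_le: "0 < (y::real) \<Longrightarrow> exp (- y) \<le> fact q / y ^ q"
  using power_over_fact_le_exp[of y q] by (simp add: exp_minus field_simps)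

lemma sum_half_powers: "(\<Sum>s<T. (1 / 2 :: real) ^ (T - s)) \<le> 1"
proof -
  have "(\<Sum>s<T. (1 / 2 :: real) ^ (T - s)) = (\<Sum>i<T. (1 / 2) ^ Suc i)"
    by (subst sum.nat_diff_reindex[symmetric]) (auto intro!: sum.cong simp: Suc_diff_Suc)
  also have "\<dots> = 1 - (1 / 2) ^ T" by (induction T) (auto simp: field_simps)
  finally show ?thesis by simp
qed

text \<open>The inequality \<open>exp (- y) <= fact q / y ^ q\<close> turns the double exponential
  into \<open>l ^ (- q)\<close> per unit of time saved. Since \<open>l ^ q >= 2 * B\<close>, this
  beats the growth \<open>B\<close> and leaves two geometric series of ratio 1/2.\<close>

lemma double_exponential_sum:
  fixes l B z :: real
  assumes "0 < B" "1 < l" "0 < z" "2 * B \<le> l ^ q"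
  shows "(\<Sum>s<T. \<Sum>t<T. B ^ (T - s) * B ^ (T - t) * exp (- (z * l ^ ((T - s) + (T - t)))))
      \<le> fact q / z ^ q"
proof -
  have "B ^ a * B ^ b * exp (- (z * l ^ (a + b)))
      \<le> fact q / z ^ q * ((1 / 2) ^ a * (1 / 2) ^ b)" for a b
  proof -
    have "B ^ a * B ^ b * exp (- (z * l ^ (a + b))) \<le> B ^ (a + b) * (fact q / (z * l ^ (a
        + b)) ^ q)"
      unfolding power_add[symmetric] using assms by (intro mult_left_mono exp_minus_le) auto
    also have "\<dots> = fact q / z ^ q * (B / l ^ q) ^ (a + b)"
      by (simp add: power_mult_distrib power_divide power_mult[symmetric] mult.commute)
    also have "\<dots> \<le> fact q / z ^ q * (1 / 2) ^ (a + b)"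
      using assms by (intro mult_left_mono power_mono) (auto simp: field_simps)
    finally show ?thesis by (simp add: power_add)
  qed
  hence "(\<Sum>s<T. \<Sum>t<T. B ^ (T - s) * B ^ (T - t) * exp (- (z * l ^ ((T - s) + (T - t))))) \<le>
     (\<Sum>s<T. \<Sum>t<T. fact q / z ^ q * ((1 / 2) ^ (T - s) * (1 / 2) ^ (T - t)))"
    by (intro sum_mono)
  also have "\<dots> = fact q / z ^ q * ((\<Sum>s<T. (1 / 2) ^ (T - s)) * (\<Sum>t<T. (1 / 2) ^ (T - t)))"
    unfolding sum_product unfolding sum_distrib_left ..
  also have "\<dots> \<le> fact q / z ^ q * (1 * 1)"
    using assms sum_half_powers[of T] by (intro mult_left_mono mult_mono) (auto intro: sum_nonneg)
  finally show ?thesis by simp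
qed

text \<open>The exponent \<open>k * (budget n) ^ 2 / n\<close> tends to 0 for polylogarithmic
  \<open>k\<close>. The constant 9 is generous and covers all exponents used below, such as
  \<open>2 * h + 4\<close> with \<open>h <= ln n ^ 2\<close>.\<close>

lemma distortion_power_le:
  assumes l: "0 < l" and \<delta>: "0 < \<delta>"
  shows "\<forall>\<^sub>F n in sequentially. \<forall>k. real k \<le> 9 * ln n ^ 2 \<longrightarrow> distortion l n ^ k \<le> 1 + \<delta>"
proof -
  define c where "c = 4 + 2 * l + 2 * l\<^sup>2"
  have c: "0 < c" using l by (simp add: c_def add_pos_pos)
  have "\<forall>\<^sub>F n::nat in sequentially. exp (9 * ln n ^ 2 * (c * (ln n ^ 9 + 1)\<^sup>2 / n)) \<le> 1 + \<delta>"
    using c \<delta> by real_asymp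
  moreover have "\<forall>\<^sub>F n::nat in sequentially. 1 \<le> ln n" by real_asymp
  ultimately show ?thesis
  proof eventually_elim
    case (elim n)
    show ?case
    proof (intro allI impI)
      fix k assume k: "real k \<le> 9 * ln n ^ 2"
      have "distortion l n ^ k = exp (k * (c * (budget n)\<^sup>2 / n))"
        unfolding distortion_def c_def[symmetric] by (simp add: exp_of_nat_mult[symmetric])
      also have "\<dots> \<le> exp (9 * ln n ^ 2 * (c * (ln n ^ 9 + 1)\<^sup>2 / n))"
        unfolding exp_le_cancel_iff
      proof (rule mult_mono[OF k])
        have "real (budget n) ^ 2 \<le> (ln n ^ 9 + 1) ^ 2"
          using budget_bounds(2)[OF elim(2)] by (intro power_mono) auto
        thus "c * real ((budget n)\<^sup>2) / n \<le> c * (ln n ^ 9 + 1)\<^sup>2 / n"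
          using c by (intro divide_right_mono mult_left_mono) auto
      qed (use c in auto)
      also have "\<dots> \<le> 1 + \<delta>" by fact
      finally show "distortion l n ^ k \<le> 1 + \<delta>" .
    qed
  qed
qed

text \<open>Cutoff for the thin phases, chosen so that the probability that some vertex is still
  thin at this radius is of order \<open>ls ^ C\<close>, uniformly in large
  \<open>n\<close>.\<close>

definition horizon :: "real \<Rightarrow> real \<Rightarrow> nat \<Rightarrow> nat \<Rightarrow> nat" where
  "horizon l ls C n = growth_time l n + extinction_time ls n + C"

lemma width_ge_2:
  assumes "2 \<le> ln (real n)" shows "2 \<le> width n"
proof -
  have "ln (real n) ^ 1 \<le> ln (real n) ^ 5" using assms by (intro power_increasing) auto
  hence "2 \<le> real (width n)" using width_bounds(1)[of n] assms by simp
  thus ?thesis by simp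
qed

text \<open>The expected number of thin vertices, in terms of the time saved before the horizon.
  Beyond the growth time the decay is \<open>ls\<close> per step and
  \<open>n * ls ^ extinction_time <= 1\<close>. Before the growth time the trivial bound
  \<open>n\<close> suffices, because \<open>(1 / ls) ^ extinction_time\<close> already exceeds
  it.\<close>

lemma thin_gap_bound:
  assumes l: "1 < l" and ls: "0 < ls" "ls < 1" and q: "pgf l (ls / l) = ls / l"
  shows "\<exists>C\<ge>1. \<forall>\<^sub>F n in sequentially. \<forall>K s. s \<le> horizon l ls K n \<longrightarrow>
     n * thin_gap l (width n) s \<le> C * ls ^ K * (1 / ls) ^ (horizon l ls K n - s)"
proof -
  have "0 < ls / l" "ls / l < 1" using l ls by (auto simp: field_simps)
  then obtain C0 where C0: "0 < C0" "\<And>w m t. 1 \<le> w \<Longrightarrow> w \<le> l ^ m \<Longrightarrow>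
     (pgf l ^^ (m + t)) (exp (- (1 / w))) - (pgf l ^^ (m + t)) 0 \<le> C0 * (l * (ls / l)) ^ t"
    using thin_iter_bound[OF l q] by blast
  define C where "C = max 1 C0"
  have "\<forall>\<^sub>F n::nat in sequentially. 1 \<le> ln n" by real_asymp
  hence "\<forall>\<^sub>F n in sequentially. \<forall>K s. s \<le> horizon l ls K n \<longrightarrow>
     n * thin_gap l (width n) s \<le> C * ls ^ K * (1 / ls) ^ (horizon l ls K n - s)"
  proof eventually_elim
    case (elim n)
    have n0: "0 < n" using elim by (cases "n = 0") auto
    let ?m = "growth_time l n" and ?e = "extinction_time ls n"
    have ne: "n * ls ^ ?e \<le> 1" by (rule extinction_time_bounds[OF ls n0])
    show ?case
    proof (intro allI impI)
      fix K s assume s: "s \<le> horizon l ls K n"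
      have inv: "ls ^ a * (1 / ls) ^ a = 1" for a using ls
          by (simp add: power_mult_distrib[symmetric])
      show "n * thin_gap l (width n) s \<le> C * ls ^ K * (1 / ls) ^ (horizon l ls K n - s)"
      proof (cases "?m \<le> s")
        case True
        define t where "t = s - ?m"
        have st: "s = ?m + t" and t: "t \<le> ?e + K" using True s by (auto simp: t_def horizon_def)
        have "thin_gap l (width n) s \<le> C0 * (l * (ls / l)) ^ t"
          unfolding thin_gap_def st
          using growth_time_bounds[OF l elim] width_bounds[OF elim] by (intro C0(2)) auto
        also have "\<dots> \<le> C * ls ^ t" using l ls by (simp add: C_def mult_right_mono)
        also have "ls ^ t = ls ^ (?e + K) * (1 / ls) ^ (?e + K - t)"
        proof -
          have "ls ^ (?e + K) = ls ^ t * ls ^ (?e + K - t)" using t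
              by (simp add: power_add[symmetric])
          thus ?thesis using inv[of "?e + K - t"] by simp
        qed
        finally have "n * thin_gap l (width n) s \<le> n * (C * (ls ^ (?e + K) * (1 / ls) ^ (?e
            + K - t)))"
          by (intro mult_left_mono) auto
        also have "\<dots> = (n * ls ^ ?e) * (C * ls ^ K * (1 / ls) ^ (?e + K - t))"
          by (simp add: power_add mult_ac)
        also have "\<dots> \<le> 1 * (C * ls ^ K * (1 / ls) ^ (?e + K - t))"
          using ls ne by (intro mult_right_mono) (auto simp: C_def)
        also have "?e + K - t = horizon l ls K n - s" using st by (simp add: horizon_def)
        finally show ?thesis by simp
      next
        case False
        have "n * thin_gap l (width n) s \<le> real n * 1"
          using l thin_gap_le_1[of l "width n" s] by (intro mult_left_mono) auto
        also have "\<dots> = (n * ls ^ ?e) * (1 / ls) ^ ?e" using inv[of ?e] by simp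
        also have "\<dots> \<le> 1 * (1 / ls) ^ ?e" using ne ls by (intro mult_right_mono) auto
        also have "\<dots> = ls ^ K * (1 / ls) ^ (K + ?e)" using inv[of K] by (simp add: power_add)
        also have "\<dots> \<le> C * (ls ^ K * (1 / ls) ^ (K + ?e))"
          using mult_right_mono[of 1 C "ls ^ K * (1 / ls) ^ (K + ?e)"] ls by (simp add: C_def)
        also have "\<dots> \<le> C * (ls ^ K * (1 / ls) ^ (horizon l ls K n - s))"
          using ls False by (intro mult_left_mono power_increasing) (auto simp: horizon_def C_def)
        finally show ?thesis by (simp add: mult.assoc)
      qed
    qed
  qed
  moreover have "1 \<le> C" by (simp add: C_def)
  ultimately show ?thesis by blast
qed

text \<open>The horizon is \<open>ln n / ln (1 / ls)\<close> up to a term of order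
  \<open>ln (ln n)\<close>. The last inequality says that twice the horizon stays below the claimed
  diameter, since \<open>log l n\<close> absorbs this term.\<close>

lemma horizon_small:
  fixes l ls :: real
  assumes l: "1 < l" and ls: "0 < ls" "ls < 1"
  shows "\<forall>\<^sub>F n in sequentially. horizon l ls K n \<le> ln n ^ 2 \<and>
     2 * horizon l ls K n * width n + 2 * (M * width n) + 2 \<le> budget n \<and>
     2 * horizon l ls K n + 3 \<le> log l n + 2 * (ln n / ln (1 / ls))"
proof -
  define a where "a = ln (1 / ls)"
  have a: "0 < a" using ls by (simp add: a_def)
  have ll: "0 < ln l" using l by simp
  have "\<forall>\<^sub>F n::nat in sequentially. 1 \<le> ln n"
    "\<forall>\<^sub>F n::nat in sequentially. (ln (ln n ^ 5 + 1) / ln l + 1) + (ln n / a + 1) + K \<le> ln n ^ 2"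
    "\<forall>\<^sub>F n::nat in sequentially. 2 * ln n ^ 2 * (ln n ^ 5 + 1) + 2 * (M * (ln n ^ 5 + 1)) + 2
        \<le> ln n ^ 9"
    "\<forall>\<^sub>F n::nat in sequentially. 2 * ((ln (ln n ^ 5 + 1) / ln l + 1) + (ln n / a + 1) + K) + 3
        \<le> ln n / ln l + 2 * (ln n / a)"
    subgoal by real_asymp
    subgoal using a ll by real_asymp
    subgoal by real_asymp
    subgoal using a ll by real_asymp
    done
  thus ?thesis
  proof eventually_elim
    case (elim n)
    have n0: "0 < n" using elim(1) by (cases "n = 0") auto
    have w: "1 \<le> real (width n)" "real (width n) \<le> ln n ^ 5 + 1"
        using width_bounds[OF elim(1)] by auto
    have "growth_time l n \<le> log l (width n) + 1" by (rule growth_time_bounds[OF l elim(1)])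
    also have "log l (width n) \<le> ln (ln n ^ 5 + 1) / ln l"
      unfolding log_def using ll w by (intro divide_right_mono) (auto simp: ln_le_cancel_iff)
    finally have h: "horizon l ls K n \<le> (ln (ln n ^ 5 + 1) / ln l + 1) + (ln n / a + 1) + K"
      using extinction_time_bounds(2)[OF ls n0] unfolding horizon_def a_def by simp
    hence h2: "horizon l ls K n \<le> ln n ^ 2" using elim(2) by linarith
    have "2 * horizon l ls K n * width n \<le> 2 * ln n ^ 2 * (ln n ^ 5 + 1)"
      using h2 w by (auto intro!: mult_mono)
    moreover have "2 * (real M * width n) \<le> 2 * (M * (ln n ^ 5 + 1))"
      using w by (intro mult_left_mono) auto
    ultimately have "real (2 * horizon l ls K n * width n + 2 * (M * width n) + 2) \<le> budget n"
      using elim(3) budget_bounds(1)[OF elim(1)] by simp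
    hence "2 * horizon l ls K n * width n + 2 * (M * width n) + 2 \<le> budget n"
        by (simp only: of_nat_le_iff)
    moreover have "2 * horizon l ls K n + 3 \<le> log l n + 2 * (ln n / ln (1 / ls))"
      using elim(4) h unfolding log_def a_def by simp
    ultimately show ?case using h2 by simp
  qed
qed

text \<open>Union bound over the \<open>n\<close> starting vertices. The constant is chosen before
  \<open>K\<close>, so \<open>K\<close> can later make the bound as small as desired.\<close>

lemma thin_event_prob:
  assumes l: "1 < l" and ls: "0 < ls" "ls < 1" and q: "pgf l (ls / l) = ls / l"
  shows "\<exists>C>0. \<forall>K. \<forall>\<^sub>F n in sequentially.
     gnp_prob n (l / n) (thin_event n (width n) (horizon l ls K n)) \<le> C * ls ^ K"
proof -
  obtain C where C: "C \<ge> 1" "\<forall>\<^sub>F n in sequentially. \<forall>K s. s \<le> horizon l ls K n \<longrightarrow>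
     n * thin_gap l (width n) s \<le> C * ls ^ K * (1 / ls) ^ (horizon l ls K n - s)"
    using thin_gap_bound[OF assms] by blast
  have "\<forall>\<^sub>F n in sequentially.
     gnp_prob n (l / n) (thin_event n (width n) (horizon l ls K n))
         \<le> (2 * exp 1 * C) * ls ^ K" for K
  proof -
    have "\<forall>\<^sub>F n::nat in sequentially. 2 \<le> ln n" "\<forall>\<^sub>F n::nat in sequentially. l \<le> n"
      by real_asymp+
    moreover have "\<forall>\<^sub>F n in sequentially. \<forall>k. real k \<le> 9 * ln n ^ 2 \<longrightarrow> distortion l n ^ k \<le> 1 + 1"
      by (rule distortion_power_le) (use l in auto)
    ultimately show ?thesis using C(2) horizon_small[OF l ls, of K 0]
    proof eventually_elim
      case (elim n)
      let ?T = "horizon l ls K n" and ?w = "width n"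
      have L1: "1 \<le> ln (real n)" using elim(1) by simp
    have w: "2 \<le> ?w" using elim(1) by (rule width_ge_2)
      have n0: "0 < n" using elim(1) by (cases "n = 0") auto
      have bud: "2 * ?T * ?w + 2 \<le> budget n" using elim(5) by simp
      have T1: "1 \<le> ?T"
      proof -
        have "1 < real (?w)" using w by simp
        hence "0 < log l ?w" using l by simp
        thus ?thesis unfolding horizon_def growth_time_def by linarith
      qed
      have "1 * ?w \<le> ?T * ?w" using T1 by (rule mult_right_mono) simp
      hence "?w \<le> budget n" using bud by linarith
      moreover have "?T * ?w + 1 \<le> budget n" using bud by simp
      ultimately have each: "gnp_prob n (l / n) (\<lambda>E. \<forall>i\<le>?T. card (shell n E x i) \<in> {1..<?w})
         \<le> distortion l n ^ ?T * exp 1 * thin_gap l ?w ?T" if "x \<in> {1..n}" for x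
        unfolding shell_def using l elim(2) n0 w that by (intro thin_prob) auto
      have "gnp_prob n (l / n) (thin_event n ?w ?T) \<le>
          (\<Sum>x\<in>{1..n}. gnp_prob n (l / n) (\<lambda>E. \<forall>i\<le>?T. card (shell n E x i) \<in> {1..<?w}))"
        unfolding thin_event_def by (rule gnp_prob_Bex) simp
      also have "\<dots> \<le> (\<Sum>x\<in>{1..n}. distortion l n ^ ?T * exp 1 * thin_gap l ?w ?T)"
        by (rule sum_mono) (rule each)
      also have "\<dots> = distortion l n ^ ?T * exp 1 * (n * thin_gap l ?w ?T)" by simp
      also have "\<dots> \<le> 2 * exp 1 * (C * ls ^ K)"
      proof (rule mult_mono)
        have "0 \<le> ln (real n) ^ 2" by simp
        hence "real ?T \<le> 9 * ln n ^ 2" using elim(5) by linarith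
        thus "distortion l n ^ ?T * exp 1 \<le> 2 * exp 1" using elim(3) by simp
        show "n * thin_gap l ?w ?T \<le> C * ls ^ K" using elim(4)[rule_format, of ?T K] by simp
      qed (use l thin_gap_nonneg in auto)
      finally show ?case by (simp add: mult_ac)
    qed
  qed
  thus ?thesis using C(1) by (intro exI[of _ "2 * exp 1 * C"]) auto
qed

lemma jump_event_prob:
  assumes l: "1 < l" and ls: "0 < ls" "ls < 1" and M: "2 * (l + 1) \<le> real M" and \<delta>: "0 < \<delta>"
  shows "\<forall>\<^sub>F n in sequentially.
     gnp_prob n (l / n) (jump_event n (width n) (M * width n) (horizon l ls K n)) \<le> \<delta>"
proof -
  have "\<forall>\<^sub>F n::nat in sequentially. 2 \<le> ln n" "\<forall>\<^sub>F n::nat in sequentially. l \<le> n"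
    "\<forall>\<^sub>F n::nat in sequentially. n * (ln n ^ 2 * (2 * exp 1 * exp (- (ln n ^ 5)))) \<le> \<delta>"
    subgoal by real_asymp
    subgoal by real_asymp
    subgoal using \<delta> by real_asymp
    done
  moreover have "\<forall>\<^sub>F n in sequentially. \<forall>k. real k \<le> 9 * ln n ^ 2 \<longrightarrow> distortion l n ^ k \<le> 1 + 1"
    by (rule distortion_power_le) (use l in auto)
  ultimately show ?thesis using horizon_small[OF l ls, of K M]
  proof eventually_elim
    case (elim n)
    let ?T = "horizon l ls K n" and ?w = "width n"
    have L1: "1 \<le> ln (real n)" using elim(1) by simp
    have w: "2 \<le> ?w" using elim(1) by (rule width_ge_2)
    have n0: "0 < n" using elim(1) by (cases "n = 0") auto
    have "0 \<le> real M - 1" using M l by simp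
    hence M1: "1 \<le> M" using M l by linarith
    have "1 * ?w \<le> M * ?w" using M1 by (rule mult_right_mono) simp
    hence wb: "?w \<le> budget n" using elim(5)[THEN conjunct2, THEN conjunct1] by linarith
    have each: "gnp_prob n (l / n) (\<lambda>E. (\<forall>i\<le>t. card (shell n E x i) \<in> {1..<?w}) \<and>
        M * ?w < card (shell n E x (Suc t))) \<le> 2 * exp 1 * exp (- (ln n ^ 5))"
      if x: "x \<in> {1..n}" and t: "t \<in> {..<?T}" for x t
    proof -
      have "t * ?w \<le> ?T * ?w" using t by (intro mult_right_mono) auto
      hence "t * ?w + 1 \<le> budget n" using elim(5)[THEN conjunct2, THEN conjunct1] by linarith
      hence "gnp_prob n (l / n) (\<lambda>E. (\<forall>i\<le>t. card (shell n E x i) \<in> {1..<?w}) \<and>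
        M * ?w < card (shell n E x (Suc t))) \<le> distortion l n ^ t * exp 1 * exp (- real ?w)"
        unfolding shell_def using l elim(2) n0 w x wb M
        by (intro jump_prob) (auto intro!: mult_right_mono)
      also have "\<dots> \<le> 2 * exp 1 * exp (- (ln n ^ 5))"
      proof (intro mult_mono)
        have "real t \<le> real ?T" using t by simp
        moreover have "0 \<le> ln (real n) ^ 2" by simp
        ultimately have "real t \<le> 9 * ln n ^ 2" using elim(5) by linarith
        thus "distortion l n ^ t \<le> 2" using elim(4) by simp
        show "exp (- real ?w) \<le> exp (- (ln n ^ 5))" using width_bounds(1)[OF L1] by simp
      qed auto
      finally show ?thesis .
    qed
    have "gnp_prob n (l / n) (jump_event n ?w (M * ?w) ?T) \<le>
       (\<Sum>x\<in>{1..n}. gnp_prob n (l / n) (\<lambda>E. \<exists>t\<in>{..<?T}. (\<forall>i\<le>t. card (shell n E x i) \<in> {1..<?w}) \<and>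
        M * ?w < card (shell n E x (Suc t))))"
      unfolding jump_event_def by (rule gnp_prob_Bex) simp
    also have "\<dots> \<le> (\<Sum>x\<in>{1..n}. \<Sum>t\<in>{..<?T}. 2 * exp 1 * exp (- (ln n ^ 5)))"
      by (intro sum_mono order_trans[OF gnp_prob_Bex] each) auto
    also have "\<dots> = n * (?T * (2 * exp 1 * exp (- (ln n ^ 5))))" by simp
    also have "\<dots> \<le> n * (ln n ^ 2 * (2 * exp 1 * exp (- (ln n ^ 5))))"
      using elim(5) by (intro mult_left_mono mult_right_mono) auto
    also have "\<dots> \<le> \<delta>" by fact
    finally show ?case .
  qed
qed

text \<open>Union bound over pairs of vertices and pairs of thin phases, with one factor
  \<open>n\<close> attached to each thin gap. The growth times \<open>R\<close> are left open,
  because the two tail bounds use different ones.\<close>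

lemma separated_event_prob:
  assumes l: "1 < l" and ls: "0 < ls" "ls < 1"
  shows "\<exists>c>0. \<forall>K. \<forall>\<^sub>F n in sequentially. \<forall>R.
     gnp_prob n (l / n) (separated_event n (width n) (M * width n) (horizon l ls K n) R) \<le>
     (\<Sum>s<horizon l ls K n. \<Sum>t<horizon l ls K n. 2 * (exp 1)\<^sup>2 * (n * thin_gap l (width n) s) * (n
         * thin_gap l (width n) t) *
        (2 / n ^ 5 + exp (- (c * (real (width n))\<^sup>2 * l ^ R s t / n))))"
proof -
  \<comment> \<open>\<open>M\<close> is arbitrary here; passing to \<open>M + 1\<close> only
    enlarges the event and ensures \<open>w <= W\<close> as \<open>separated_prob\<close>
    demands.\<close>
  obtain c where c: "c > 0" "\<forall>\<^sub>F n in sequentially. \<forall>F U Y r.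
    F \<subseteq> {1..n} \<longrightarrow> U \<subseteq> {1..n} \<longrightarrow> Y \<subseteq> {1..n} \<longrightarrow> F \<inter> U = {} \<longrightarrow> (F \<union> U) \<inter> Y = {} \<longrightarrow>
    width n \<le> card F \<longrightarrow> card F \<le> (M + 1) * width n \<longrightarrow> width n \<le> card Y \<longrightarrow> n \<le> card U + budget n \<longrightarrow>
    gnp_prob n (l / n) (\<lambda>E. \<forall>i\<le>r. no_contact i F U Y E)
      \<le> 2 / n ^ 5 + exp (- (c * (real (width n))\<^sup>2 * l ^ r / n))"
    using no_contact_all_prob[OF l, of "M + 1"] by blast
  have "\<forall>\<^sub>F n in sequentially. \<forall>R.
     gnp_prob n (l / n) (separated_event n (width n) (M * width n) (horizon l ls K n) R) \<le>
     (\<Sum>s<horizon l ls K n. \<Sum>t<horizon l ls K n. 2 * (exp 1)\<^sup>2 * (n * thin_gap l (width n) s) * (n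
         * thin_gap l (width n) t) *
        (2 / n ^ 5 + exp (- (c * (real (width n))\<^sup>2 * l ^ R s t / n))))" for K
  proof -
    have "\<forall>\<^sub>F n::nat in sequentially. 2 \<le> ln n" "\<forall>\<^sub>F n::nat in sequentially. l \<le> n"
      by real_asymp+
    moreover have "\<forall>\<^sub>F n in sequentially. \<forall>k. real k \<le> 9 * ln n ^ 2 \<longrightarrow> distortion l n ^ k \<le> 1 + 1"
      by (rule distortion_power_le) (use l in auto)
    ultimately show ?thesis using c(2) horizon_small[OF l ls, of K "M + 1"]
    proof eventually_elim
      case (elim n)
      let ?T = "horizon l ls K n" and ?w = "width n"
      let ?\<zeta> = "\<lambda>r. 2 / n ^ 5 + exp (- (c * (real ?w)\<^sup>2 * l ^ r / n))"
      have L1: "1 \<le> ln (real n)" using elim(1) by simp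
    have w: "2 \<le> ?w" using elim(1) by (rule width_ge_2)
      have n0: "0 < n" using elim(1) by (cases "n = 0") auto
      have each: "gnp_prob n (l / n) (separated n ?w (M * ?w) t s r x y) \<le>
          2 * (exp 1)\<^sup>2 * thin_gap l ?w s * thin_gap l ?w t * ?\<zeta> r"
        if xy: "x \<in> {1..n}" "y \<in> {1..n}" and st: "s < ?T" "t < ?T" for x y s t r
      proof -
        have "(s + t) * ?w \<le> (2 * ?T) * ?w" using st by (intro mult_right_mono) auto
        hence bud: "(s + t) * ?w + 2 * ((M + 1) * ?w) + 2 \<le> budget n" using elim(5) by linarith
        have "gnp_prob n (l / n) (separated n ?w (M * ?w) t s r x y) \<le>
          gnp_prob n (l / n) (separated n ?w ((M + 1) * ?w) t s r x y)"
          unfolding separated_def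
          by (rule gnp_prob_mono) (auto simp: explore_hits_iff)
        also have "\<dots> \<le> distortion l n ^ (s + t) * (exp 1)\<^sup>2 * thin_gap l ?w s * thin_gap l ?w t *
            ?\<zeta> r"
          using l elim(2,4) n0 w bud xy by (intro separated_prob) auto
        also have "\<dots> \<le> 2 * (exp 1)\<^sup>2 * thin_gap l ?w s * thin_gap l ?w t * ?\<zeta> r"
        proof (intro mult_right_mono)
          have "real (s + t) \<le> real (2 * ?T)" using st by simp
          moreover have "0 \<le> ln (real n) ^ 2" by simp
          ultimately have "real (s + t) \<le> 9 * ln n ^ 2" using elim(5) by simp
          thus "distortion l n ^ (s + t) \<le> 2" using elim(3) by simp
        qed (use l thin_gap_nonneg in auto)
        finally show ?thesis .
      qed
      show ?case
      proof
        fix R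
        have "gnp_prob n (l / n) (separated_event n ?w (M * ?w) ?T R) \<le>
          (\<Sum>(x, y)\<in>{1..n} \<times> {1..n}. gnp_prob n (l / n) (\<lambda>E. \<exists>(s, t)\<in>{..<?T} \<times> {..<?T}. separated n
              ?w (M * ?w) t s (R s t) x y E))"
          unfolding separated_event_def
          using gnp_prob_Bex[of "{1..n} \<times> {1..n}" n "l / n" "\<lambda>(x, y) E. \<exists>(s, t)\<in>{..<?T} \<times> {..<?T}.
              separated n ?w (M * ?w) t s (R s t) x y E"]
          by (simp add: case_prod_unfold)
        also have "\<dots> \<le> (\<Sum>(x, y)\<in>{1..n} \<times> {1..n}. \<Sum>(s, t)\<in>{..<?T} \<times> {..<?T}.
            2 * (exp 1)\<^sup>2 * thin_gap l ?w s * thin_gap l ?w t * ?\<zeta> (R s t))"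
        proof (rule sum_mono, clarify)
          fix x y assume xy: "x \<in> {1..n}" "y \<in> {1..n}"
          have "gnp_prob n (l / n) (\<lambda>E. \<exists>(s, t)\<in>{..<?T} \<times> {..<?T}. separated n ?w (M * ?w) t s (R
              s t) x y E) \<le>
            (\<Sum>(s, t)\<in>{..<?T} \<times> {..<?T}. gnp_prob n (l / n) (separated n ?w (M * ?w) t s (R s t) x
                y))"
            using gnp_prob_Bex[of "{..<?T} \<times> {..<?T}" n "l / n" "\<lambda>(s, t) E. separated n ?w (M *
                ?w) t s (R s t) x y E"]
            by (simp add: case_prod_unfold)
          also have "\<dots> \<le> (\<Sum>(s, t)\<in>{..<?T} \<times> {..<?T}. 2 * (exp 1)\<^sup>2 * thin_gap l ?w s * thin_gap l
              ?w t * ?\<zeta> (R s t))"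
            using each[OF xy] by (intro sum_mono) auto
          finally show "gnp_prob n (l / n) (\<lambda>E. \<exists>(s, t)\<in>{..<?T} \<times> {..<?T}. separated n ?w (M * ?w)
              t s (R s t) x y E) \<le> \<dots>" .
        qed
        also have "\<dots> = (n * n) * (\<Sum>s<?T. \<Sum>t<?T. 2 * (exp 1)\<^sup>2 * thin_gap l ?w s * thin_gap l ?w t
            * ?\<zeta> (R s t))"
          by (simp add: sum.cartesian_product[symmetric])
        also have "\<dots> = (\<Sum>s<?T. \<Sum>t<?T. 2 * (exp 1)\<^sup>2 * (n * thin_gap l ?w s) * (n * thin_gap l ?w
            t) * ?\<zeta> (R s t))"
          unfolding sum_distrib_left by (intro sum.cong refl) (simp add: mult_ac)
        finally show "gnp_prob n (l / n) (separated_event n ?w (M * ?w) ?T R) \<le> \<dots>" .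
      qed
    qed
  qed
  thus ?thesis using c(1) by blast
qed

lemma exists_power_le:
  fixes ls A \<eta> :: real
  assumes "0 < ls" "ls < 1" "0 < A" "0 < \<eta>"
  shows "\<exists>K. A * ls ^ K \<le> \<eta>"
proof -
  obtain K where "ls ^ K < \<eta> / A" using real_arch_pow_inv[of "\<eta> / A" ls] assms by auto
  thus ?thesis using assms by (intro exI[of _ K]) (simp add: field_simps)
qed

text \<open>With \<open>r = n\<close> the exponent \<open>c * l ^ n / n\<close> is so large that the
  trivial bound \<open>n\<close> for the thin gaps is enough. Only \<open>thin_event\<close> forces
  a choice of \<open>K\<close>.\<close>

lemma connected_tail:
  fixes l ls :: real
  assumes l: "1 < l" and ls: "0 < ls" "ls < 1" and q: "pgf l (ls / l) = ls / l"
    and M: "2 * (l + 1) \<le> real M" and \<eta>: "0 < \<eta>"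
  shows "\<exists>K. \<forall>\<^sub>F n in sequentially. gnp_prob n (l / n) (\<lambda>E.
     thin_event n (width n) (horizon l ls K n) E \<or>
     jump_event n (width n) (M * width n) (horizon l ls K n) E \<or>
     separated_event n (width n) (M * width n) (horizon l ls K n) (\<lambda>_ _. n) E) \<le> \<eta>"
proof -
  obtain A where A: "A > 0" "\<And>K. \<forall>\<^sub>F n in sequentially.
     gnp_prob n (l / n) (thin_event n (width n) (horizon l ls K n)) \<le> A * ls ^ K"
    using thin_event_prob[OF l ls q] by blast
  obtain K where K: "A * ls ^ K \<le> \<eta> / 3" using exists_power_le[OF ls A(1), of "\<eta> / 3"] \<eta> by auto
  obtain c where c: "c > 0" "\<And>K. \<forall>\<^sub>F n in sequentially. \<forall>R.
     gnp_prob n (l / n) (separated_event n (width n) (M * width n) (horizon l ls K n) R) \<le>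
     (\<Sum>s<horizon l ls K n. \<Sum>t<horizon l ls K n. 2 * (exp 1)\<^sup>2 * (n * thin_gap l (width n) s) * (n
         * thin_gap l (width n) t) *
        (2 / n ^ 5 + exp (- (c * (real (width n))\<^sup>2 * l ^ R s t / n))))"
    using separated_event_prob[OF l ls, of M] by blast
  have "\<forall>\<^sub>F n::nat in sequentially. 1 \<le> ln n"
    "\<forall>\<^sub>F n::nat in sequentially. (ln n ^ 2)\<^sup>2 * (2 * (exp 1)\<^sup>2 * n * n * (2 / n ^ 5
        + exp (- (c * l ^ n / n)))) \<le> \<eta> / 3"
    subgoal by real_asymp
    subgoal using c l \<eta> by real_asymp
    done
  hence "\<forall>\<^sub>F n in sequentially. gnp_prob n (l / n) (\<lambda>E.
     thin_event n (width n) (horizon l ls K n) E \<or>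
     jump_event n (width n) (M * width n) (horizon l ls K n) E \<or>
     separated_event n (width n) (M * width n) (horizon l ls K n) (\<lambda>_ _. n) E) \<le> \<eta>"
    using A(2)[of K] jump_event_prob[OF l ls M, of "\<eta> / 3" K, OF divide_pos_pos[OF \<eta>], simplified]
        c(2)[of K]
      horizon_small[OF l ls, of K M]
  proof eventually_elim
    case (elim n)
    let ?T = "horizon l ls K n" and ?w = "width n"
    have n0: "0 < n" using elim(1) by (cases "n = 0") auto
    have w1: "1 \<le> real ?w" using width_bounds(3)[OF elim(1)] by simp
    have "gnp_prob n (l / n) (separated_event n ?w (M * ?w) ?T (\<lambda>_ _. n)) \<le>
      (\<Sum>s<?T. \<Sum>t<?T. 2 * (exp 1)\<^sup>2 * (n * thin_gap l ?w s) * (n * thin_gap l ?w t) *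
        (2 / n ^ 5 + exp (- (c * (real ?w)\<^sup>2 * l ^ n / n))))"
      using elim(5) by simp
    also have "\<dots> \<le> (\<Sum>s<?T. \<Sum>t<?T. 2 * (exp 1)\<^sup>2 * n * n * (2 / n ^ 5 + exp (- (c * l ^ n / n))))"
    proof (intro sum_mono mult_mono)
      fix s t
      show "real n * thin_gap l ?w s \<le> n" "real n * thin_gap l ?w t \<le> n"
        using l thin_gap_le_1[of l ?w s] thin_gap_le_1[of l ?w t] mult_left_mono[of _ 1 "real n"]
            by auto
      have "1 \<le> (real ?w)\<^sup>2" using w1 by (rule one_le_power)
      hence "c * 1 * l ^ n / n \<le> c * (real ?w)\<^sup>2 * l ^ n / n"
        using c l by (intro divide_right_mono mult_right_mono mult_left_mono) auto
      thus "2 / real (n ^ 5) + exp (- (c * (real ?w)\<^sup>2 * l ^ n / n)) \<le> 2 / real (n ^ 5)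
          + exp (- (c * l ^ n / n))"
        by simp
    qed (use l thin_gap_nonneg in auto)
    also have "\<dots> = (real ?T)\<^sup>2 * (2 * (exp 1)\<^sup>2 * n * n * (2 / n ^ 5 + exp (- (c * l ^ n / n))))"
      by (simp add: power2_eq_square)
    also have "\<dots> \<le> (ln n ^ 2)\<^sup>2 * (2 * (exp 1)\<^sup>2 * n * n * (2 / n ^ 5 + exp (- (c * l ^ n / n))))"
      using elim(6) by (intro mult_right_mono power_mono) (auto intro!: add_nonneg_nonneg)
    also have "\<dots> \<le> \<eta> / 3" by fact
    finally have sep: "gnp_prob n (l / n) (separated_event n ?w (M * ?w) ?T (\<lambda>_ _. n)) \<le> \<eta> / 3" .
    have "gnp_prob n (l / n) (\<lambda>E. thin_event n ?w ?T E \<or> jump_event n ?w (M * ?w) ?T E \<or>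
        separated_event n ?w (M * ?w) ?T (\<lambda>_ _. n) E) \<le>
      gnp_prob n (l / n) (thin_event n ?w ?T) + (gnp_prob n (l / n) (jump_event n ?w (M * ?w) ?T) +
        gnp_prob n (l / n) (separated_event n ?w (M * ?w) ?T (\<lambda>_ _. n)))"
      by (rule order_trans[OF gnp_prob_disj] add_left_mono gnp_prob_disj)+
    thus ?case using elim(3,4) K sep by linarith
  qed
  thus ?thesis by blast
qed

text \<open>\<open>K\<close> makes thin vertices unlikely, \<open>p\<close> makes
  \<open>l ^ p\<close> beat the factor \<open>1 / ls\<close> of the pair count, and finally
  \<open>C\<close> makes \<open>z\<close>, the contact exponent for two thin phases of full length,
  so large that the double sum is below \<open>\<eta> / 4\<close>.\<close>

lemma diam_upper_tail:
  fixes l ls :: real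
  assumes l: "1 < l" and ls: "0 < ls" "ls < 1" and q: "pgf l (ls / l) = ls / l" and \<eta>: "0 < \<eta>"
  shows "\<exists>C. \<forall>\<^sub>F n in sequentially. gnp_prob n (l / n) (\<lambda>E.
     \<not> graph_diam {1..n} E \<le> nat \<lceil>log l n + 2 * (ln n / ln (1 / ls))\<rceil> + C) \<le> \<eta>"
proof -
  define M where "M = nat \<lceil>2 * (l + 1)\<rceil>"
  have M: "2 * (l + 1) \<le> real M" unfolding M_def using l by linarith
  obtain A where A: "A > 0" "\<And>K. \<forall>\<^sub>F n in sequentially.
     gnp_prob n (l / n) (thin_event n (width n) (horizon l ls K n)) \<le> A * ls ^ K"
    using thin_event_prob[OF l ls q] by blast
  obtain K where K: "A * ls ^ K \<le> \<eta> / 4" using exists_power_le[OF ls A(1), of "\<eta> / 4"] \<eta> by auto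
  obtain c where c: "c > 0" "\<And>K. \<forall>\<^sub>F n in sequentially. \<forall>R.
     gnp_prob n (l / n) (separated_event n (width n) (M * width n) (horizon l ls K n) R) \<le>
     (\<Sum>s<horizon l ls K n. \<Sum>t<horizon l ls K n. 2 * (exp 1)\<^sup>2 * (n * thin_gap l (width n) s) * (n
         * thin_gap l (width n) t) *
        (2 / n ^ 5 + exp (- (c * (real (width n))\<^sup>2 * l ^ R s t / n))))"
    using separated_event_prob[OF l ls, of M] by blast
  obtain C1 where C1: "C1 \<ge> 1" "\<forall>\<^sub>F n in sequentially. \<forall>K s. s \<le> horizon l ls K n \<longrightarrow>
     n * thin_gap l (width n) s \<le> C1 * ls ^ K * (1 / ls) ^ (horizon l ls K n - s)"
    using thin_gap_bound[OF l ls q] by blast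
  obtain p where p: "2 * (1 / ls) < l ^ p" using real_arch_pow[OF l] by blast
  define G where "G = 2 * (exp 1)\<^sup>2 * (C1 * ls ^ K)\<^sup>2"
  have G: "0 < G" using C1 ls by (simp add: G_def)
  define Z where "Z = max 1 (G * fact p / (\<eta> / 4))"
  obtain C where C: "l ^ (2 * K + 7) * Z / c < l ^ C" using real_arch_pow[OF l] by blast
  \<comment> \<open>Of the exponent \<open>2 * K + 7\<close>, \<open>2 * K + 3\<close> comes from
    the two cutoffs and the three extra edges of \<open>separatedI\<close>, and 4 from rounding up
    two growth times and two extinction times.\<close>
  define z where "z = c * l ^ C / l ^ (2 * K + 7)"
  have zZ: "Z \<le> z" using C c l by (simp add: z_def field_simps)
  have z1: "1 \<le> z" using zZ by (simp add: Z_def)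
  have p0: "p \<noteq> 0" using p ls by (intro notI) (simp add: field_simps)
  have Gz: "G * (fact p / z ^ p) \<le> \<eta> / 4"
  proof -
    have "G * fact p / (\<eta> / 4) \<le> z" using zZ by (simp add: Z_def)
    also have "z = z ^ 1" by simp
    also have "\<dots> \<le> z ^ p" using z1 p0 by (intro power_increasing) auto
    finally show ?thesis using \<eta> z1 by (simp add: field_simps)
  qed
  have "\<forall>\<^sub>F n::nat in sequentially. 2 \<le> ln n"
    "\<forall>\<^sub>F n::nat in sequentially. (ln n ^ 2)\<^sup>2 * (2 * (exp 1)\<^sup>2 * n * n * (2 / n ^ 5)) \<le> \<eta> / 4"
    subgoal by real_asymp
    subgoal using \<eta> by real_asymp
    done
  hence "\<forall>\<^sub>F n in sequentially. gnp_prob n (l / n) (\<lambda>E.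
     \<not> graph_diam {1..n} E \<le> nat \<lceil>log l n + 2 * (ln n / ln (1 / ls))\<rceil> + C) \<le> \<eta>"
    using A(2)[of K] jump_event_prob[OF l ls M, of "\<eta> / 4" K, OF divide_pos_pos[OF \<eta>], simplified]
        c(2)[of K]
      horizon_small[OF l ls, of K M] C1(2)
  proof eventually_elim
    case (elim n)
    let ?T = "horizon l ls K n" and ?w = "width n"
    define x where "x = log l n + 2 * (ln n / ln (1 / ls))"
    define D where "D = nat \<lceil>x\<rceil> + C"
    define R where "R = (\<lambda>s t. D - s - t - 3)"
    have n0: "0 < n" using elim(1) by (cases "n = 0") auto
    have L1: "1 \<le> ln (real n)" using elim(1) by simp
    have Tx: "2 * ?T + 3 \<le> x" using elim(6) by (simp add: x_def)
    have xD: "x + C \<le> D" unfolding D_def by linarith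
    have TD: "2 * ?T + 3 \<le> D" using Tx xD by linarith
    \<comment> \<open>Here the auxiliary width cancels: \<open>l ^ growth_time\<close> is at most
      \<open>l * width n\<close>, and the contact exponent carries the square of the width.\<close>
    have key: "z \<le> c * (real ?w)\<^sup>2 * l ^ (D - 2 * ?T - 3) / n"
    proof -
      have "real n * l ^ C * l ^ (2 * ?T + 3)
          = (l ^ growth_time l n)\<^sup>2 * l powr (2 * extinction_time ls n) * n * l ^ C * l ^ (2 * K
          + 3)"
      proof -
        have "2 * ?T + 3 = (growth_time l n + growth_time l n) + (extinction_time ls n
            + extinction_time ls n) + (2 * K + 3)"
          by (simp add: horizon_def)
        hence "l ^ (2 * ?T + 3) = (l ^ growth_time l n)\<^sup>2 * (l ^ extinction_time ls n * l ^
            extinction_time ls n) * l ^ (2 * K + 3)"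
          by (simp only: power_add power2_eq_square)
        also have "l ^ extinction_time ls n * l ^ extinction_time ls n
            = l powr (2 * extinction_time ls n)"
          using l by (simp add: powr_realpow[symmetric] powr_add[symmetric])
        finally show ?thesis by (simp only: mult_ac)
      qed
      also have "\<dots> \<le> (l * ?w)\<^sup>2 * l powr (2 * (ln n / ln (1 / ls)) + 2) * n * l ^ C * l ^ (2 * K
          + 3)"
        using growth_time_bounds(2)[OF l L1] extinction_time_bounds(2)[OF ls n0] l
        by (intro mult_right_mono mult_mono power_mono powr_mono) auto
      also have "\<dots> = (l powr (x + C)) * (real ?w)\<^sup>2 * l ^ (2 * K + 7)"
      proof -
        have "l powr (x + C) = n * l powr (2 * (ln n / ln (1 / ls))) * l ^ C"
          using l n0 by (simp add: x_def powr_add powr_realpow)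
        moreover have "l powr (2 * (ln n / ln (1 / ls)) + 2)
            = l powr (2 * (ln n / ln (1 / ls))) * l\<^sup>2"
          using l by (simp add: powr_add powr_realpow)
        ultimately show ?thesis by (simp add: power_add power_mult_distrib eval_nat_numeral)
      qed
      also have "\<dots> \<le> l ^ D * (real ?w)\<^sup>2 * l ^ (2 * K + 7)"
      proof -
        have "l powr (x + C) \<le> l powr D" using l xD by (intro powr_mono) auto
        thus ?thesis using l by (intro mult_right_mono) (auto simp: powr_realpow)
      qed
      also have "l ^ D = l ^ (D - 2 * ?T - 3) * l ^ (2 * ?T + 3)"
        using TD by (simp add: power_add[symmetric])
      finally have "(real n * l ^ C) * l ^ (2 * ?T + 3) \<le>
         (l ^ (D - 2 * ?T - 3) * (real ?w)\<^sup>2 * l ^ (2 * K + 7)) * l ^ (2 * ?T + 3)"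
             by (simp add: mult_ac)
      hence "real n * l ^ C \<le> l ^ (D - 2 * ?T - 3) * (real ?w)\<^sup>2 * l ^ (2 * K + 7)"
        using l by (simp only: mult_le_cancel_right_pos zero_less_power)
      hence "c * (real n * l ^ C) \<le> c * (l ^ (D - 2 * ?T - 3) * (real ?w)\<^sup>2 * l ^ (2 * K + 7))"
        using c by (intro mult_left_mono) auto
      thus ?thesis using l n0 unfolding z_def
          by (simp add: divide_le_eq pos_le_divide_eq mult_ac del: power_add)
    qed
    have RR: "c * (real ?w)\<^sup>2 * l ^ R s t / n \<ge> z * l ^ ((?T - s) + (?T - t))"
        if "s < ?T" "t < ?T" for s t
    proof -
      have "R s t = (D - 2 * ?T - 3) + ((?T - s) + (?T - t))" using that TD by (simp add: R_def)
      hence eq: "c * (real ?w)\<^sup>2 * l ^ R s t / n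
          = (c * (real ?w)\<^sup>2 * l ^ (D - 2 * ?T - 3) / n) * l ^ ((?T - s) + (?T - t))"
        by (simp add: power_add)
      show ?thesis unfolding eq by (rule mult_right_mono[OF key]) (use l in simp)
    qed
    have "gnp_prob n (l / n) (separated_event n ?w (M * ?w) ?T R) \<le>
      (\<Sum>s<?T. \<Sum>t<?T. 2 * (exp 1)\<^sup>2 * (n * thin_gap l ?w s) * (n * thin_gap l ?w t) *
        (2 / n ^ 5 + exp (- (c * (real ?w)\<^sup>2 * l ^ R s t / n))))"
      using elim(5) by blast
    \<comment> \<open>The term with \<open>n ^ 5\<close> is summed with the trivial bound
      \<open>n\<close> for both gaps; only the exponential term needs the bounds in terms of the
      time saved.\<close>
    also have "\<dots> \<le> (\<Sum>s<?T. \<Sum>t<?T. 2 * (exp 1)\<^sup>2 * n * n * (2 / n ^ 5) +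
         G * ((1 / ls) ^ (?T - s) * (1 / ls) ^ (?T - t) * exp (- (z * l ^ ((?T - s) + (?T - t))))))"
    proof (intro sum_mono)
      fix s t assume st: "s \<in> {..<?T}" "t \<in> {..<?T}"
      define a where "a = n * thin_gap l ?w s"
      define b where "b = n * thin_gap l ?w t"
      have ab: "0 \<le> a" "a \<le> n" "0 \<le> b" "b \<le> n"
        using l thin_gap_le_1[of l ?w s] thin_gap_le_1[of l ?w t] thin_gap_nonneg[of l ?w s]
            thin_gap_nonneg[of l ?w t]
          mult_left_mono[of _ 1 "real n"] by (auto simp: a_def b_def)
      have a': "a \<le> C1 * ls ^ K * (1 / ls) ^ (?T - s)" and b': "b
          \<le> C1 * ls ^ K * (1 / ls) ^ (?T - t)"
        using elim(7)[rule_format, of s K] elim(7)[rule_format, of t K] st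
            by (auto simp: a_def b_def)
      define e where "e = exp (- (c * (real ?w)\<^sup>2 * l ^ R s t / n))"
      have e: "0 \<le> e" "e \<le> exp (- (z * l ^ ((?T - s) + (?T - t))))" using RR[of s t] st
          by (auto simp: e_def)
      have "2 * (exp 1)\<^sup>2 * a * b * (2 / n ^ 5) \<le> 2 * (exp 1)\<^sup>2 * n * n * (2 / n ^ 5)"
        using ab by (intro mult_right_mono mult_mono) auto
      moreover have "2 * (exp 1)\<^sup>2 * a * b * e
          \<le> 2 * (exp 1)\<^sup>2 * (C1 * ls ^ K * (1 / ls) ^ (?T - s)) *
          (C1 * ls ^ K * (1 / ls) ^ (?T - t)) * exp (- (z * l ^ ((?T - s) + (?T - t))))"
        using ab a' b' e ls C1 by (intro mult_mono[OF mult_mono[OF mult_mono]]) auto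
      moreover have "2 * (exp 1)\<^sup>2 * (C1 * ls ^ K * (1 / ls) ^ (?T - s)) *
          (C1 * ls ^ K * (1 / ls) ^ (?T - t)) * exp (- (z * l ^ ((?T - s) + (?T - t)))) =
          G * ((1 / ls) ^ (?T - s) * (1 / ls) ^ (?T - t) * exp (- (z * l ^ ((?T - s) + (?T - t)))))"
        unfolding G_def power2_eq_square by (simp only: mult_ac)
      ultimately show "2 * (exp 1)\<^sup>2 * a * b * (2 / real (n ^ 5) + e)
          \<le> 2 * (exp 1)\<^sup>2 * n * n * (2 / n ^ 5) +
         G * ((1 / ls) ^ (?T - s) * (1 / ls) ^ (?T - t) * exp (- (z * l ^ ((?T - s) + (?T - t)))))"
        unfolding distrib_left by linarith
    qed
    also have "\<dots> = (real ?T)\<^sup>2 * (2 * (exp 1)\<^sup>2 * n * n * (2 / n ^ 5)) +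
       G * (\<Sum>s<?T. \<Sum>t<?T. (1 / ls) ^ (?T - s) * (1 / ls) ^ (?T - t) * exp (- (z * l ^ ((?T - s)
           + (?T - t)))))"
      by (simp add: sum.distrib sum_distrib_left[symmetric] power2_eq_square)
    also have "\<dots> \<le> (ln n ^ 2)\<^sup>2 * (2 * (exp 1)\<^sup>2 * n * n * (2 / n ^ 5)) + G * (fact p / z ^ p)"
      using elim(6) G l ls z1 p
      by (intro add_mono mult_right_mono power_mono mult_left_mono double_exponential_sum) auto
    also have "\<dots> \<le> \<eta> / 4 + \<eta> / 4" using elim(2) Gz by linarith
    finally have sep: "gnp_prob n (l / n) (separated_event n ?w (M * ?w) ?T R) \<le> \<eta> / 4 + \<eta> / 4" .
    have "gnp_prob n (l / n) (\<lambda>E. \<not> graph_diam {1..n} E \<le> D) \<le>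
      gnp_prob n (l / n) (\<lambda>E. thin_event n ?w ?T E \<or> jump_event n ?w (M * ?w) ?T E \<or>
        separated_event n ?w (M * ?w) ?T R E)"
      using diam_le[OF n0 width_ge_2[OF elim(1)] _ _ _ TD] unfolding R_def
          by (intro gnp_prob_mono) blast
    also have "\<dots> \<le>
      gnp_prob n (l / n) (thin_event n ?w ?T) + (gnp_prob n (l / n) (jump_event n ?w (M * ?w) ?T) +
        gnp_prob n (l / n) (separated_event n ?w (M * ?w) ?T R))"
      by (rule order_trans[OF gnp_prob_disj] add_left_mono gnp_prob_disj)+
    finally show ?case using elim(3,4) K sep unfolding D_def x_def by linarith
  qed
  thus ?thesis by blast
qed

subsection \<open>Hanging branches\<close>

lemma reach_closed:
  assumes "reach X E k a b" "a \<in> Z"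
    and "\<And>x y. x \<in> X \<Longrightarrow> x \<in> Z \<Longrightarrow> y \<in> X \<Longrightarrow> {x, y} \<in> E \<Longrightarrow> y \<in> Z"
  shows "b \<in> Z"
proof (rule ccontr)
  assume "b \<notin> Z"
  define \<phi> where "\<phi> = (\<lambda>z. if z \<in> Z then 0 else int k + 1)"
  have "\<phi> b \<le> \<phi> a + int k"
  proof (rule reach_potential[OF assms(1)])
    fix x y assume "x \<in> X" "y \<in> X" "{x, y} \<in> E"
    thus "\<phi> y \<le> \<phi> x + 1"
      using assms(3)[of x y] by (cases "x \<in> Z") (simp_all add: \<phi>_def)
  qed
  thus False using \<open>b \<notin> Z\<close> assms(2) by (simp add: \<phi>_def)
qed

text \<open>The graph is cut by the bridge between \<open>v\<close> and \<open>u\<close> into a part \<open>C\<close> of height exactly \<open>h\<close>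
  over \<open>u\<close> and the rest, which contains \<open>v\<close>.\<close>

definition hanging :: "'a set \<Rightarrow> 'a set set \<Rightarrow> nat \<Rightarrow> 'a \<Rightarrow> 'a \<Rightarrow> 'a set \<Rightarrow> ('a \<Rightarrow> nat) \<Rightarrow> bool" where
  "hanging V E h v u C lev \<longleftrightarrow> C \<subseteq> V \<and> u \<in> C \<and> v \<in> V \<and> v \<notin> C \<and> {v, u} \<in> E \<and> lev u = 0 \<and>
     (\<forall>x\<in>C. reach C E (lev x) u x \<and> lev x \<le> h) \<and> (\<exists>x\<in>C. lev x = h) \<and>
     (\<forall>x\<in>C. \<forall>y\<in>C. {x, y} \<in> E \<longrightarrow> lev y \<le> lev x + 1) \<and>
     (\<forall>x\<in>C. \<forall>y\<in>V - C. {x, y} \<in> E \<longrightarrow> x = u \<and> y = v)"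

lemma hangingD:
  assumes "hanging V E h v u C lev"
  shows "C \<subseteq> V" "u \<in> C" "v \<in> V" "v \<notin> C" "{v, u} \<in> E" "lev u = 0"
    "\<And>x. x \<in> C \<Longrightarrow> reach C E (lev x) u x" "\<And>x. x \<in> C \<Longrightarrow> lev x \<le> h" "\<exists>x\<in>C. lev x = h"
    "\<And>x y. x \<in> C \<Longrightarrow> y \<in> C \<Longrightarrow> {x, y} \<in> E \<Longrightarrow> lev y \<le> lev x + 1"
    "\<And>x y. x \<in> C \<Longrightarrow> y \<in> V \<Longrightarrow> y \<notin> C \<Longrightarrow> {x, y} \<in> E \<Longrightarrow> x = u \<and> y = v"
  using assms unfolding hanging_def by blast+

lemma hanging_connected:
  assumes "hanging V E h v u C lev" "x \<in> C" "y \<in> C" shows "\<exists>k. reach C E k x y"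
  using reach_trans[OF reach_sym[OF hangingD(7)[OF assms(1,2)]] hangingD(7)[OF assms(1,3)]] by blast

text \<open>\<open>C'\<close> is connected and meets \<open>C\<close>, and the only way out of
  \<open>C\<close> is the bridge. A walk inside \<open>C'\<close> that does not have both ends of
  the bridge at its disposal stays in \<open>C\<close>.\<close>

lemma hanging_subset:
  assumes a: "hanging V E h v u C lev" and b: "hanging V E h v' u' C' lev'"
    and z: "z \<in> C" "z \<in> C'" and n: "\<not> (u \<in> C' \<and> v \<in> C')"
  shows "C' \<subseteq> C"
proof
  fix x assume "x \<in> C'"
  then obtain k where "reach C' E k z x" using hanging_connected[OF b z(2)] by blast
  thus "x \<in> C"
  proof (rule reach_closed)
    fix x y assume "x \<in> C'" "x \<in> C" "y \<in> C'" "{x, y} \<in> E"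
    thus "y \<in> C" using hangingD(11)[OF a, of x y] hangingD(1)[OF b] n by blast
  qed (rule z)
qed

text \<open>The root of the larger branch lies outside the smaller one, so a walk from it must first
  enter through the bridge and then climb \<open>h\<close> levels. This exceeds the height
  \<open>h\<close> of the larger branch; equality of the two heights is essential.\<close>

lemma hanging_not_nested:
  assumes a: "hanging V E h v u C lev" and b: "hanging V E h v' u' C' lev'"
    and vC: "v \<in> C'" and sub: "C \<subseteq> C'"
  shows False
proof -
  have v': "v' \<notin> C'" "v' \<in> V" "{v', u'} \<in> E" using hangingD(3-5)[OF b] by auto
  have "u' \<notin> C"
  proof
    assume "u' \<in> C"
    hence "v' = v" using hangingD(11)[OF a, of u' v'] v' sub by (auto simp: insert_commute)
    thus False using v' vC by simp
  qed
  obtain z where z: "z \<in> C" "lev z = h" using hangingD(9)[OF a] by blast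
  define \<phi> where "\<phi> = (\<lambda>x. if x \<in> C then int (lev x) else - 1)"
  have "reach C' E (lev' z) u' z" using hangingD(7)[OF b] z sub by blast
  hence "\<phi> z \<le> \<phi> u' + int (lev' z)"
  proof (rule reach_potential)
    fix x y assume xy: "x \<in> C'" "y \<in> C'" "{x, y} \<in> E"
    show "\<phi> y \<le> \<phi> x + 1"
    proof (cases "x \<in> C"; cases "y \<in> C")
      assume "x \<in> C" "y \<in> C"
      thus ?thesis using hangingD(10)[OF a, of x y] xy by (simp add: \<phi>_def)
    next
      assume "x \<notin> C" "y \<in> C"
      hence "y = u" using hangingD(11)[OF a, of y x] xy hangingD(1)[OF b]
          by (auto simp: insert_commute)
      thus ?thesis using \<open>x \<notin> C\<close> hangingD(2,6)[OF a] by (simp add: \<phi>_def)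
    qed (auto simp: \<phi>_def)
  qed
  moreover have "lev' z \<le> h" using hangingD(8)[OF b] z sub by blast
  ultimately show False using z \<open>u' \<notin> C\<close> by (simp add: \<phi>_def)
qed

text \<open>\<open>A\<close> is connected on the side of \<open>v\<close>. If the bridge of
  \<open>C'\<close> has an end in \<open>C\<close>, then \<open>A\<close>, which avoids
  \<open>C\<close>, cannot use that bridge to leave \<open>C'\<close>.\<close>

lemma hanging_side_subset:
  assumes a: "hanging V E h v u C lev" and b: "hanging V E h v' u' C' lev'"
    and A: "A \<subseteq> V - C" "v \<in> A" "\<And>x. x \<in> A \<Longrightarrow> \<exists>k. reach A E k v x"
    and v: "v \<in> C'" and n: "u' \<in> C \<or> v' \<in> C"
  shows "A \<subseteq> C'"
proof
  fix x assume "x \<in> A"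
  then obtain k where "reach A E k v x" using A by blast
  thus "x \<in> C'"
  proof (rule reach_closed)
    fix x y assume "x \<in> A" "x \<in> C'" "y \<in> A" "{x, y} \<in> E"
    thus "y \<in> C'" using hangingD(11)[OF b, of x y] A n by blast
  qed (rule v)
qed

text \<open>If \<open>v\<close> were in \<open>C'\<close>, the edge to \<open>u\<close> would leave
  \<open>C'\<close> and hence be the bridge of \<open>C'\<close>, traversed in the opposite
  direction. Then the whole large side \<open>A\<close> would lie in \<open>C'\<close>, which is too
  small.\<close>

lemma hanging_disjoint_vertex:
  assumes a: "hanging V E h v u C lev" and b: "hanging V E h v' u' C' lev'"
    and A: "A \<subseteq> V - C" "v \<in> A" "\<And>x. x \<in> A \<Longrightarrow> \<exists>k. reach A E k v x" "card C' < card A" and fin: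
        "finite V"
    and dj: "C \<inter> C' = {}"
  shows "v \<notin> C'"
proof
  assume v: "v \<in> C'"
  have "v = u' \<and> u = v'"
    using hangingD(11)[OF b v, of u] hangingD(1,2,5)[OF a] dj by blast
  hence "A \<subseteq> C'" using hanging_side_subset[OF a b A(1-3) v] hangingD(2)[OF a] by blast
  moreover have "finite C'" using hangingD(1)[OF b] fin finite_subset by blast
  ultimately show False using A(4) card_mono[of C' A] by simp
qed

text \<open>Suppose the branches meet. If each contains the bridge of the other, the large side
  \<open>A\<close> is swallowed by the small set \<open>C'\<close>; if exactly one does, the
  branches are nested; if neither does, the branches coincide and so do their bridges.\<close>

lemma hanging_compatible:
  assumes a: "hanging V E h v u C lev" and b: "hanging V E h v' u' C' lev'" and fin: "finite V"
    and A: "A \<subseteq> V - C" "v \<in> A" "\<And>x. x \<in> A \<Longrightarrow> \<exists>k. reach A E k v x" "card C' < card A"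
    and A': "A' \<subseteq> V - C'" "v' \<in> A'" "\<And>x. x \<in> A' \<Longrightarrow> \<exists>k. reach A' E k v' x" "card C < card A'"
    and ne: "(v, u) \<noteq> (v', u')"
  shows "C \<inter> C' = {} \<and> v \<notin> C' \<and> v' \<notin> C"
proof -
  have dj: "C \<inter> C' = {}"
  proof (rule ccontr)
    assume "C \<inter> C' \<noteq> {}"
    then obtain z where z: "z \<in> C" "z \<in> C'" by blast
    note s1 = hanging_subset[OF a b z] and s2 = hanging_subset[OF b a z(2,1)]
    show False
    proof (cases "u \<in> C' \<and> v \<in> C'"; cases "u' \<in> C \<and> v' \<in> C")
      assume *: "u \<in> C' \<and> v \<in> C'" "u' \<in> C \<and> v' \<in> C"
      hence "A \<subseteq> C'" using hanging_side_subset[OF a b A(1-3)] by blast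
      moreover have "finite C'" using hangingD(1)[OF b] fin finite_subset by blast
      ultimately show False using A(4) card_mono[of C' A] by simp
    next
      assume "u \<in> C' \<and> v \<in> C'" "\<not> (u' \<in> C \<and> v' \<in> C)"
      thus False using hanging_not_nested[OF a b] s2 by blast
    next
      assume "\<not> (u \<in> C' \<and> v \<in> C')" "u' \<in> C \<and> v' \<in> C"
      thus False using hanging_not_nested[OF b a] s1 by blast
    next
      assume "\<not> (u \<in> C' \<and> v \<in> C')" "\<not> (u' \<in> C \<and> v' \<in> C)"
      hence "C = C'" using s1 s2 by blast
      hence "u = u' \<and> v = v'"
        using hangingD(11)[OF b, of u v] hangingD(2-5)[OF a] by (auto simp: insert_commute)
      thus False using ne by simp
    qed
  qed
  have dj': "C' \<inter> C = {}" using dj by blast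
  show ?thesis
    using dj hanging_disjoint_vertex[OF a b A fin dj] hanging_disjoint_vertex[OF b a A' fin dj']
        by blast
qed

text \<open>The potential is minus the level minus 1 on \<open>C\<close>, the truncated distance
  from \<open>v\<close> on the rest, and \<open>r + 2\<close> plus the level on \<open>C'\<close>.
  It rises by at most 1 along edges, from \<open>- h - 1\<close> at \<open>x\<close> to
  \<open>r + 2 + h\<close> at \<open>y\<close>.\<close>

lemma hanging_distance:
  assumes a: "hanging V E h v u C lev" and b: "hanging V E h v' u' C' lev'"
    and c: "C \<inter> C' = {}" "v \<notin> C'" "v' \<notin> C"
    and far: "\<not> reach (V - C - C') E r v v'"
    and xy: "x \<in> C" "lev x = h" "y \<in> C'" "lev' y = h" and k: "reach V E k x y"
  shows "2 * h + r + 3 \<le> k"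
proof -
  define W where "W = V - C - C'"
  \<comment> \<open>Truncation at \<open>r + 1\<close> keeps \<open>d\<close> finite and 1-Lipschitz
    also at vertices that cannot be reached from \<open>v\<close> within \<open>W\<close>.\<close>
  define d where "d = (\<lambda>z. if reach W E r v z then LEAST i. reach W E i v z else r + 1)"
  define \<phi> where "\<phi> = (\<lambda>z. if z \<in> C then - int (lev z) - 1
     else if z \<in> C' then int r + 2 + int (lev' z) else int (d z))"
  have vW: "v \<in> W" "v' \<in> W" using hangingD(3,4)[OF a] hangingD(3,4)[OF b] c by (auto simp: W_def)
  have d_le: "d z \<le> i" if "reach W E i v z" for z i
  proof (cases "reach W E r v z")
    case True
    thus ?thesis using that Least_le[of "\<lambda>i. reach W E i v z" i] by (simp add: d_def)
  next
    case False
    hence "\<not> i \<le> r" using that reach_mono by metis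
    thus ?thesis using False by (simp add: d_def)
  qed
  have d_max: "d z \<le> r + 1" for z
    using d_le[of r z] by (cases "reach W E r v z") (auto simp: d_def)
  have d_step: "d z' \<le> d z + 1" if "z \<in> W" "z' \<in> W" "{z, z'} \<in> E" for z z'
  proof (cases "reach W E r v z")
    case True
    hence "reach W E (d z) v z" unfolding d_def using LeastI[of "\<lambda>i. reach W E i v z" r] by simp
    from d_le[OF reach_step[OF this that(3,2)]] show ?thesis by simp
  next
    case False
    hence "d z = r + 1" by (simp add: d_def)
    thus ?thesis using d_max[of z'] by simp
  qed
  have dv: "d v = 0" using d_le[OF reach_refl[OF vW(1), of E 0]] by simp
  have dv': "d v' = r + 1" using far by (simp add: d_def W_def)
  have edgeC: "p = u \<and> q = v" if "p \<in> C" "q \<in> V" "q \<notin> C" "{p, q} \<in> E" for p q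
    using hangingD(11)[OF a that] .
  have edgeC': "p = u' \<and> q = v'" if "p \<in> C'" "q \<in> V" "q \<notin> C'" "{p, q} \<in> E" for p q
    using hangingD(11)[OF b that] .
  have u: "u \<in> C" "u' \<in> C'" "lev u = 0" "lev' u' = 0"
      using hangingD(2,6)[OF a] hangingD(2,6)[OF b] by auto
  have "\<phi> y \<le> \<phi> x + int k"
  proof (rule reach_potential[OF k])
    fix p q assume pq: "p \<in> V" "q \<in> V" "{p, q} \<in> E"
    hence qp: "{q, p} \<in> E" by (simp add: insert_commute)
    consider "p \<in> C" | "p \<in> C'" | "p \<in> W" using pq by (auto simp: W_def)
    thus "\<phi> q \<le> \<phi> p + 1"
    proof cases
      case 1
      show ?thesis
      proof (cases "q \<in> C")
        case True
        thus ?thesis using 1 hangingD(10)[OF a, of q p] qp by (simp add: \<phi>_def)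
      next
        case False
        hence "p = u" "q = v" using edgeC[of p q] 1 pq by auto
        thus ?thesis using False c u dv by (simp add: \<phi>_def)
      qed
    next
      case 2
      show ?thesis
      proof (cases "q \<in> C'")
        case True
        thus ?thesis using 2 hangingD(10)[OF b, of p q] pq c by (auto simp: \<phi>_def)
      next
        case False
        hence "p = u'" "q = v'" using edgeC'[of p q] 2 pq by auto
        thus ?thesis using False c u dv' by (auto simp: \<phi>_def)
      qed
    next
      case 3
      hence p: "p \<notin> C" "p \<notin> C'" by (auto simp: W_def)
      consider "q \<in> C" | "q \<in> C'" | "q \<in> W" using pq by (auto simp: W_def)
      thus ?thesis
      proof cases
        case 1
        thus ?thesis using p by (simp add: \<phi>_def)
      next
        case 2
        hence "q = u'" "p = v'" using edgeC'[of q p] qp pq p by auto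
        thus ?thesis using p 2 c u dv' by (auto simp: \<phi>_def)
      next
        case 3
        thus ?thesis using p d_step[of p q] \<open>p \<in> W\<close> pq by (auto simp: \<phi>_def W_def)
      qed
    qed
  qed
  moreover have "y \<notin> C" using xy c by blast
  ultimately show ?thesis using xy by (simp add: \<phi>_def)
qed

text \<open>The walk \<open>k\<close> guarantees that the pair counts at all: infinite distances do
  not enter the diameter.\<close>

lemma graph_diam_ge:
  assumes fin: "finite V" and k: "reach V E k x y" and far: "\<And>k. reach V E k x y \<Longrightarrow> d \<le> k"
  shows "d \<le> graph_diam V E"
proof -
  define A where "A = {the_enat (graph_dist V E x y) |x y. x \<in> V \<and> y \<in> V \<and> graph_dist V E x y < \<infinity>}"
  have "A \<subseteq> (\<lambda>(x, y). the_enat (graph_dist V E x y)) ` (V \<times> V)" by (auto simp: A_def)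
  hence finA: "finite A" by (rule finite_subset) (simp add: fin)
  have "graph_dist V E x y < \<infinity>" unfolding graph_dist_finite_iff using k by (rule exI)
  then obtain i where i: "graph_dist V E x y = enat i" by auto
  hence "d \<le> i" using far[of i] by (simp add: graph_dist_le_iff[symmetric])
  moreover have "the_enat (graph_dist V E x y) \<in> A"
    unfolding A_def mem_Collect_eq using reach_in[OF k] i by (intro exI[of _ x] exI[of _ y]) auto
  hence "i \<le> Max A" using finA i by simp
  ultimately show ?thesis unfolding graph_diam_def A_def[symmetric] by simp
qed

text \<open>\<open>branch n w h k0 v u\<close>: removing the bridge between \<open>v\<close> and \<open>u\<close> splits off a finite branch
  of height \<open>h\<close>. That \<open>v\<close> has exactly \<open>k0\<close> other neighbours makes it likely that \<open>v\<close> is in the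
  giant component (\<open>big_side\<close>).\<close>

definition dead_end :: "nat \<Rightarrow> nat \<Rightarrow> nat set \<Rightarrow> nat set \<Rightarrow> nat set set \<Rightarrow> bool" where
  "dead_end k0 v F U E \<longleftrightarrow> nbrs E F U = {} \<and> card (nbrs E {v} U) = k0"

definition branch :: "nat \<Rightarrow> nat \<Rightarrow> nat \<Rightarrow> nat \<Rightarrow> nat \<Rightarrow> nat \<Rightarrow> nat set set \<Rightarrow> bool" where
  "branch n w h k0 v u E \<longleftrightarrow> {v, u} \<in> E \<and>
     explore_avoiding v {1..<w} (dead_end k0 v) h {u} ({1..n} - {v, u}) E"

definition region :: "nat \<Rightarrow> nat \<Rightarrow> nat \<Rightarrow> nat \<Rightarrow> nat set set \<Rightarrow> nat set" where
  "region n h v u E = (\<Union>i\<le>h. layer E i {u} ({1..n} - {v, u}))"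

text \<open>The layers around \<open>v\<close> are taken in the graph without the branch, so this
  condition inspects other edges than the branch itself.\<close>

definition big_side :: "nat \<Rightarrow> nat \<Rightarrow> nat \<Rightarrow> nat \<Rightarrow> nat \<Rightarrow> nat \<Rightarrow> nat set set \<Rightarrow> bool" where
  "big_side n h w T v u E \<longleftrightarrow>
     (\<exists>i\<le>T. w \<le> card (layer E i {v} (unexplored E h {u} ({1..n} - {v, u}))))"

section \<open>From explored branches to hanging ones\<close>

lemma reach_union_layers:
  assumes "i \<le> m" "x \<in> layer E i {a} U"
  shows "reach (\<Union>j\<le>m. layer E j {a} U) E i a x"
  using assms
proof (induction i arbitrary: x)
  case 0
  thus ?case by (auto intro!: reach_refl)
next
  case (Suc i)
  obtain f where f: "f \<in> layer E i {a} U" "{x, f} \<in> E"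
    using Suc.prems unfolding layer_Suc nbrs_def by blast
  have "reach (\<Union>j\<le>m. layer E j {a} U) E i a f" using Suc.prems(1) f(1) by (intro Suc.IH) auto
  moreover have "{f, x} \<in> E" using f(2) by (simp add: insert_commute)
  moreover have "x \<in> (\<Union>j\<le>m. layer E j {a} U)" using Suc.prems by blast
  ultimately show ?case by (rule reach_step)
qed

lemma unexplored_region:
  assumes "v \<noteq> u" shows "unexplored E h {u} ({1..n} - {v, u}) = {1..n} - {v} - region n h v u E"
proof -
  have "{..h} = insert 0 {1..h}" by auto
  hence "region n h v u E = insert u (\<Union>i\<in>{1..h}. layer E i {u} ({1..n} - {v, u}))"
    unfolding region_def by simp
  thus ?thesis unfolding unexplored_eq by auto
qed

lemma branchD:
  assumes "branch n w h k0 v u E"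
  shows "{v, u} \<in> E"
    "\<And>i. i \<le> h \<Longrightarrow> card (layer E i {u} ({1..n} - {v, u})) \<in> {1..<w}"
    "nbrs E (layer E h {u} ({1..n} - {v, u})) (unexplored E h {u} ({1..n} - {v, u})) = {}"
    "card (nbrs E {v} (unexplored E h {u} ({1..n} - {v, u}))) = k0"
    "\<And>i f. 1 \<le> i \<Longrightarrow> i \<le> h \<Longrightarrow> f \<in> layer E i {u} ({1..n} - {v, u}) \<Longrightarrow> {v, f} \<notin> E"
  using assms unfolding branch_def explore_avoiding_iff explore_iff dead_end_def
  by (simp_all del: insert_iff)

lemma card_region:
  assumes "branch n w h k0 v u E"
  shows "card (region n h v u E) < (h + 1) * w"
proof -
  have "card (region n h v u E) \<le> (\<Sum>i\<le>h. card (layer E i {u} ({1..n} - {v, u})))"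
    unfolding region_def by (rule card_UN_le) simp
  also have "\<dots> < (\<Sum>i\<le>h. w)"
    by (rule sum_strict_mono) (use branchD(2)[OF assms] in auto)
  finally show ?thesis by simp
qed

text \<open>The level of a vertex is its layer index. The condition \<open>dead_end\<close> blocks
  exits from the top layer, maximality of layers blocks those from lower ones, and the avoiding
  condition leaves \<open>u\<close> as the only neighbour of \<open>v\<close>.\<close>

lemma branch_hanging:
  assumes br: "branch n w h k0 v u E" and vu: "v \<in> {1..n}" "u \<in> {1..n}" "v \<noteq> u"
  shows "\<exists>lev. hanging {1..n} E h v u (region n h v u E) lev"
proof -
  let ?U = "{1..n} - {v, u}"
  define C where "C = region n h v u E"
  define lev where "lev = (\<lambda>x. LEAST i. x \<in> layer E i {u} ?U)"
  have dj: "{u} \<inter> ?U = {}" by auto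
  have inC: "x \<in> C \<longleftrightarrow> (\<exists>i\<le>h. x \<in> layer E i {u} ?U)" for x
    by (auto simp: C_def region_def)
  have lev: "x \<in> layer E (lev x) {u} ?U" "lev x \<le> h" if xC: "x \<in> C" for x
  proof -
    obtain i where i: "i \<le> h" "x \<in> layer E i {u} ?U" using xC inC by blast
    show "x \<in> layer E (lev x) {u} ?U" unfolding lev_def using i(2) by (rule LeastI)
    have "lev x \<le> i" unfolding lev_def using i(2) by (rule Least_le)
    thus "lev x \<le> h" using i by simp
  qed
  have lev_le: "lev x \<le> i" if "x \<in> layer E i {u} ?U" for x i
    unfolding lev_def using that by (rule Least_le)
  have lev_u: "lev u = 0" using lev_le[of u 0] by simp
  have next_layer: "y \<in> layer E (Suc i) {u} ?U"
    if "x \<in> layer E i {u} ?U" "{x, y} \<in> E" "y \<in> unexplored E i {u} ?U" for x y i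
    using that unfolding layer_Suc nbrs_def by (auto simp: insert_commute)
  have unexp: "y \<in> unexplored E i {u} ?U \<or> lev y \<le> i" if y: "y \<in> insert u ?U" for y i
  proof (cases "y = u")
    case False
    show ?thesis
    proof (rule disjCI)
      assume *: "\<not> lev y \<le> i"
      have "y \<notin> layer E j {u} ?U" if "j \<le> i" for j using lev_le[of y j] * that by auto
      thus "y \<in> unexplored E i {u} ?U" unfolding unexplored_eq using y False by auto
    qed
  qed (simp add: lev_u)
  have CV: "C \<subseteq> insert u ?U"
  proof
    fix x assume "x \<in> C"
    then obtain i where "i \<le> h" "x \<in> layer E i {u} ?U" using inC by blast
    thus "x \<in> insert u ?U" using layer_subset[of i E "{u}" ?U] by (cases "i = 0") auto
  qed
  have uC: "u \<in> C" unfolding inC by (intro exI[of _ 0]) simp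
  have exits: "x = u \<and> y = v" if x: "x \<in> C" and y: "y \<in> {1..n} - C" and e: "{x, y} \<in> E" for x y
  proof -
    have "y = v"
    proof (rule ccontr)
      assume "y \<noteq> v"
      hence yU: "y \<in> ?U" using y uC by auto
      have yh: "y \<in> unexplored E i {u} ?U" if "i \<le> h" for i
        unfolding unexplored_eq using yU y that by (auto simp: inC)
      show False
      proof (cases "lev x = h")
        case True
        hence "y \<in> nbrs E (layer E h {u} ?U) (unexplored E h {u} ?U)"
          using yh[of h] lev(1)[OF x] e unfolding nbrs_def by (auto simp: insert_commute)
        thus False using branchD(3)[OF br] by simp
      next
        case False
        hence "Suc (lev x) \<le> h" using lev(2)[OF x] by simp
        moreover have "y \<in> layer E (Suc (lev x)) {u} ?U"
          by (rule next_layer[OF lev(1)[OF x] e yh[OF lev(2)[OF x]]])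
        ultimately have "y \<in> C" unfolding inC by blast
        thus False using y by simp
      qed
    qed
    moreover have "x = u"
    proof (cases "lev x = 0")
      case True thus ?thesis using lev(1)[OF x] by simp
    next
      case False
      hence "1 \<le> lev x" by simp
      from branchD(5)[OF br this lev(2)[OF x] lev(1)[OF x]] show ?thesis
        using e \<open>y = v\<close> by (simp add: insert_commute)
    qed
    ultimately show ?thesis by simp
  qed
  have top: "\<exists>x\<in>C. lev x = h"
  proof -
    have "layer E h {u} ?U \<noteq> {}" using branchD(2)[OF br, of h] by auto
    then obtain x where x: "x \<in> layer E h {u} ?U" by blast
    hence xC: "x \<in> C" unfolding inC by blast
    have "\<not> lev x < h" using layer_disjoint[OF dj, of "lev x" h E] x lev(1)[OF xC] by blast
    hence "lev x = h" using lev(2)[OF xC] by simp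
    thus ?thesis using xC by blast
  qed
  have step: "lev y \<le> lev x + 1" if "x \<in> C" "y \<in> C" "{x, y} \<in> E" for x y
  proof -
    have "y \<in> insert u ?U" using CV that(2) by blast
    from unexp[OF this, of "lev x"] show ?thesis
      using next_layer[OF lev(1)[OF that(1)] that(3)] lev_le[of y "Suc (lev x)"] by auto
  qed
  have rch: "reach C E (lev x) u x" if "x \<in> C" for x
    unfolding C_def region_def using lev[OF that] by (intro reach_union_layers)
  have "C \<subseteq> {1..n}" "v \<notin> C" using CV vu by auto
  hence "hanging {1..n} E h v u C lev"
    unfolding hanging_def using uC vu branchD(1)[OF br] lev_u lev(2) rch top step exits by blast
  thus ?thesis unfolding C_def by blast
qed

lemma big_side_set:
  assumes big: "big_side n h w T v u E" and vu: "v \<in> {1..n}" "v \<noteq> u" "v \<notin> region n h v u E"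
  shows "\<exists>A. A \<subseteq> {1..n} - region n h v u E \<and> v \<in> A \<and> (\<forall>x\<in>A. \<exists>k. reach A E k v x) \<and> w \<le> card A"
proof -
  let ?R = "unexplored E h {u} ({1..n} - {v, u})"
  define A where "A = (\<Union>j\<le>T. layer E j {v} ?R)"
  obtain i where i: "i \<le> T" "w \<le> card (layer E i {v} ?R)" using big unfolding big_side_def by blast
  have R: "?R \<subseteq> {1..n} - region n h v u E" unfolding unexplored_region[OF vu(2)] by auto
  have sub: "A \<subseteq> {1..n} - region n h v u E"
  proof
    fix x assume "x \<in> A"
    then obtain j where "x \<in> layer E j {v} ?R" by (auto simp: A_def)
    thus "x \<in> {1..n} - region n h v u E"
      using layer_subset[of j E "{v}" ?R] R vu by (cases "j = 0") auto
  qed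
  have "finite A" using finite_subset[OF sub] by simp
  hence "card (layer E i {v} ?R) \<le> card A" using i by (intro card_mono) (auto simp: A_def)
  moreover have "v \<in> A" unfolding A_def by (auto intro!: bexI[of _ 0])
  moreover have "\<exists>k. reach A E k v x" if x: "x \<in> A" for x
  proof -
    obtain j where "j \<le> T" "x \<in> layer E j {v} ?R" using x by (auto simp: A_def)
    from reach_union_layers[OF this] show ?thesis unfolding A_def by (rule exI)
  qed
  ultimately show ?thesis using sub i by (intro exI[of _ A]) auto
qed

lemma reach_mono_set: "reach A E k x y \<Longrightarrow> A \<subseteq> B \<Longrightarrow> reach B E k x y"
  unfolding reach_def is_walk_def by blast

text \<open>If all layers before extinction were smaller than \<open>w\<close>, the component of
  \<open>v\<close> would have at most \<open>T * w\<close> vertices and could not contain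
  \<open>A\<close>.\<close>

lemma big_set_hits:
  assumes A: "A \<subseteq> {1..n}" "\<And>x. x \<in> A \<Longrightarrow> \<exists>k. reach A E k v x" "T * w < card A"
    and i: "i \<le> T" "shell n E v i = {}"
  shows "\<exists>j<i. w \<le> card (shell n E v j)"
proof (rule ccontr)
  assume no: "\<not> ?thesis"
  have "A \<subseteq> (\<Union>j<i. shell n E v j)"
  proof
    fix x assume "x \<in> A"
    then obtain k where "reach A E k v x" using A(2) by blast
    from reach_layer[OF reach_mono_set[OF this A(1)]]
    obtain j where j: "x \<in> shell n E v j" unfolding shell_def by blast
    have "j < i"
    proof (rule ccontr)
      assume "\<not> j < i"
      hence "shell n E v j = {}"
        using i(2) layer_empty_mono[of E i "{v}" "{1..n} - {v}" j] unfolding shell_def by simp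
      thus False using j by simp
    qed
    thus "x \<in> (\<Union>j<i. shell n E v j)" using j by blast
  qed
  hence "card A \<le> card (\<Union>j<i. shell n E v j)" by (intro card_mono) (auto simp: finite_shell)
  also have "\<dots> \<le> (\<Sum>j<i. card (shell n E v j))" by (rule card_UN_le) simp
  also have "\<dots> \<le> (\<Sum>j<i. w)" using no by (intro sum_mono) (auto simp: not_le less_imp_le)
  also have "\<dots> \<le> T * w" using i by simp
  finally show False using A(3) by simp
qed

text \<open>Both branches as a single exploration: first around \<open>u\<close> without either
  anchor, then around \<open>u'\<close> in what remains, then a condition \<open>P\<close> on the
  leftover vertices. This serves upper bounds only, so the requirement to avoid the anchors is not
  repeated.\<close>

definition joint_branch :: "nat \<Rightarrow> nat \<Rightarrow> nat \<Rightarrow> (nat set \<Rightarrow> nat set set \<Rightarrow> bool) \<Rightarrow>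
    nat \<Rightarrow> nat \<Rightarrow> nat \<Rightarrow> nat \<Rightarrow> nat set set \<Rightarrow> bool" where
  "joint_branch n w h P v u v' u' E \<longleftrightarrow> {v, u} \<in> E \<and> {v', u'} \<in> E \<and>
     explore {1..<w} (\<lambda>F U E. nbrs E F U = {} \<and>
       explore {1..<w} (\<lambda>F' U' E. nbrs E F' U' = {}
           \<and> P U' E) h {u'} U E) h {u} ({1..n} - {v, v', u, u'}) E"

text \<open>Disjointness of the branches and anchors lets \<open>layer_restrict\<close> replace each
  exploration by the one in the smaller vertex set.\<close>

lemma joint_branchI:
  assumes a: "branch n w h k0 v u E" and b: "branch n w h k0 v' u' E"
    and vu: "v \<noteq> u" "v' \<noteq> u'"
    and dj: "region n h v u E \<inter> region n h v' u' E
        = {}" "v \<notin> region n h v' u' E" "v' \<notin> region n h v u E"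
    and P: "P ({1..n} - {v, v'} - region n h v u E - region n h v' u' E) E"
  shows "joint_branch n w h P v u v' u' E"
proof -
  let ?V = "{1..n}" and ?C = "region n h v u E" and ?C' = "region n h v' u' E"
  let ?U = "?V - {v, u}" and ?U' = "?V - {v', u'}" and ?W = "?V - {v, v', u, u'}"
  have uC: "u \<in> ?C" "u' \<in> ?C'" by (auto simp: region_def intro!: bexI[of _ 0])
  have U0: "?W \<subseteq> ?U" by auto
  have sub: "layer E i {u} ?U \<subseteq> ?W" if "1 \<le> i" "i \<le> h" for i
  proof -
    have "layer E i {u} ?U \<subseteq> ?C" using that by (auto simp: region_def)
    moreover have "layer E i {u} ?U \<subseteq> ?U" using that by (intro layer_subset) simp
    ultimately show ?thesis using dj uC by blast
  qed
  have eq: "layer E i {u} ?W = layer E i {u} ?U" "unexplored E i {u} ?W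
      = unexplored E i {u} ?U \<inter> ?W"
    if "i \<le> h" for i
    using layer_restrict[OF U0 sub that] by auto
  define R where "R = unexplored E h {u} ?W"
  have R: "R = ?V - {v, v', u'} - ?C"
    unfolding R_def eq(2)[OF le_refl] unexplored_region[OF vu(1)] using uC by auto
  have sub': "layer E i {u'} ?U' \<subseteq> R" if "1 \<le> i" "i \<le> h" for i
  proof -
    have "layer E i {u'} ?U' \<subseteq> ?C'" using that by (auto simp: region_def)
    moreover have "layer E i {u'} ?U' \<subseteq> ?U'" using that by (intro layer_subset) simp
    ultimately show ?thesis using dj uC unfolding R by blast
  qed
  have RU': "R \<subseteq> ?U'" unfolding R by auto
  have eq': "layer E i {u'} R = layer E i {u'} ?U'" "unexplored E i {u'} R
      = unexplored E i {u'} ?U' \<inter> R"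
    if "i \<le> h" for i
    using layer_restrict[OF RU' sub' that] by auto
  have R2: "unexplored E h {u'} R = ?V - {v, v'} - ?C - ?C'"
    unfolding eq'(2)[OF le_refl] unexplored_region[OF vu(2)] unfolding R using uC by auto
  have n1: "nbrs E (layer E h {u} ?W) R = {}"
    using branchD(3)[OF a] unfolding R_def eq[OF le_refl] nbrs_def by blast
  have n2: "nbrs E (layer E h {u'} R) (unexplored E h {u'} R) = {}"
    using branchD(3)[OF b] unfolding eq'[OF le_refl] nbrs_def by blast
  have c1: "\<forall>i\<le>h. card (layer E i {u} ?W) \<in> {1..<w}" using branchD(2)[OF a] eq(1) by simp
  have c2: "\<forall>i\<le>h. card (layer E i {u'} R) \<in> {1..<w}" using branchD(2)[OF b] eq'(1) by simp
  have P': "P (unexplored E h {u'} R) E" unfolding R2 by (rule P)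
  show ?thesis
    unfolding joint_branch_def explore_iff R_def[symmetric]
    using branchD(1)[OF a] branchD(1)[OF b] n1 n2 c1 c2 P' by blast
qed

text \<open>The only outside neighbour of the second branch is \<open>v'\<close>. If
  \<open>v\<close> is neither equal nor adjacent to \<open>v'\<close>, deleting that branch and its
  anchor removes no neighbour of \<open>v\<close>.\<close>

lemma branch_degree:
  assumes a: "branch n w h k0 v u E" and b: "hanging {1..n} E h v' u' (region n h v' u' E) lev"
    and vu: "v \<in> {1..n}" "v \<noteq> u" "v \<noteq> v'" "{v, v'} \<notin> E" and dj: "v \<notin> region n h v' u' E"
  shows "card (nbrs E {v} ({1..n} - {v, v'} - region n h v u E - region n h v' u' E)) = k0"
proof -
  let ?R = "unexplored E h {u} ({1..n} - {v, u})"
  have R: "?R = {1..n} - {v} - region n h v u E" by (rule unexplored_region[OF vu(2)])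
  have "nbrs E {v} ?R = nbrs E {v} ({1..n} - {v, v'} - region n h v u E - region n h v' u' E)"
  proof (intro equalityI subsetI)
    fix y assume "y \<in> nbrs E {v} ?R"
    hence y: "y \<in> ?R" "{y, v} \<in> E" by (auto simp: nbrs_def)
    have "y \<noteq> v'" using vu y by (auto simp: insert_commute)
    moreover have "y \<notin> region n h v' u' E"
    proof
      assume "y \<in> region n h v' u' E"
      hence "v = v'" using hangingD(11)[OF b _ vu(1) dj y(2)] by blast
      thus False using vu by simp
    qed
    ultimately show "y \<in> nbrs E {v} ({1..n} - {v, v'} - region n h v u E - region n h v' u' E)"
      using y unfolding R nbrs_def by auto
  next
    fix y assume "y \<in> nbrs E {v} ({1..n} - {v, v'} - region n h v u E - region n h v' u' E)"
    thus "y \<in> nbrs E {v} ?R" unfolding R nbrs_def by auto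
  qed
  with branchD(4)[OF a] show ?thesis by simp
qed

lemma depends_on_explore_gen:
  assumes "edges_within (F \<union> U) \<subseteq> D" "F \<inter> U = {}"
    and "\<And>F' U'. F' \<subseteq> F \<union> U \<Longrightarrow> U' \<subseteq> U \<Longrightarrow> F' \<inter> U' = {} \<Longrightarrow> depends_on (Q F' U') D"
  shows "depends_on (explore S Q t F U) D"
  using assms
proof (induction t arbitrary: F U)
  case 0
  have "depends_on (\<lambda>E. card F \<in> S \<and> Q F U E) D"
    by (intro depends_on_conj depends_on_const 0) (use 0 in auto)
  moreover have "explore S Q 0 F U = (\<lambda>E. card F \<in> S \<and> Q F U E)" by (simp add: fun_eq_iff)
  ultimately show ?case by simp
next
  case (Suc t)
  have "depends_on (explore S Q t F' (U - F')) D" if "F' \<subseteq> U" for F'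
  proof (rule Suc.IH)
    have "edges_within (F' \<union> (U - F')) \<subseteq> edges_within (F \<union> U)"
      by (rule edges_within_mono) (use that in auto)
    thus "edges_within (F' \<union> (U - F')) \<subseteq> D" using Suc.prems(1) by blast
    show "depends_on (Q F'' U') D"
      if "F'' \<subseteq> F' \<union> (U - F')" "U' \<subseteq> U - F'" "F'' \<inter> U' = {}" for F'' U'
      by (rule Suc.prems(3)) (use that \<open>F' \<subseteq> U\<close> in auto)
  qed auto
  hence "depends_on (\<lambda>E. card F \<in> S \<and> explore S Q t (nbrs E F U) (U - nbrs E F U) E) D"
    by (intro depends_on_conj depends_on_const
         depends_on_bind_nbrs[where A = "\<lambda>F' E. explore S Q t F' (U - F') E"]
         order_trans[OF crossing_subset_within Suc.prems(1)])
  moreover have "explore S Q (Suc t) F U = (\<lambda>E. card F \<in> S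
      \<and> explore S Q t (nbrs E F U) (U - nbrs E F U) E)"
    by (simp add: fun_eq_iff)
  ultimately show ?case by simp
qed

section \<open>Probabilities of one and of two branches\<close>

lemma bp_iter_scale: "bp_iter l S (\<lambda>j. a * g j) t k = a * bp_iter l S g t k"
  by (induction t arbitrary: k) (simp_all add: sum_distrib_left mult_ac)

text \<open>Probability that the Poisson process with one ancestor has height exactly
  \<open>h\<close> and all generations smaller than \<open>w\<close>; \<open>exp (- (l * j))\<close>
  is the chance that the last generation has no children.\<close>

definition bp_height :: "real \<Rightarrow> nat \<Rightarrow> nat \<Rightarrow> real" where
  "bp_height l w h = bp_iter l {1..<w} (\<lambda>j. exp (- (l * real j))) h 1"

lemma bp_height_nonneg: "0 \<le> l \<Longrightarrow> 2 \<le> w \<Longrightarrow> 0 \<le> bp_height l w h"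
  unfolding bp_height_def by (rule bp_iter_nonneg) auto

lemma pois_0: "pois (l * k) 0 = exp (- (l * k))"
  by (simp add: pois_def)

lemma prob_card_nbrs_upper:
  fixes l :: real
  assumes l: "0 \<le> l" "l \<le> real n" and n: "0 < n"
    and F: "F \<subseteq> {1..n}" "U \<subseteq> {1..n}" "F \<inter> U = {}" "n \<le> card U + budget n" "card F \<le> budget n" "j
        \<le> budget n"
  shows "gnp_prob n (l / n) (\<lambda>E. card (nbrs E F U) = j) \<le> distortion l n * pois (l * card F) j"
proof -
  have p: "0 \<le> l / n" "l / n \<le> 1" using l n by auto
  have cU: "card U \<le> n" using F(2) card_mono[of "{1..n}" U] by simp
  have "gnp_prob n (l / n) (\<lambda>E. card (nbrs E F U) = j) = nbr_card_prob (l / n) (card U) (card F) j"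
    by (rule gnp_prob_card_nbrs[OF F(1-3) p])
  also have "\<dots> \<le> exp (2 * l * (budget n)\<^sup>2 / n) * pois (l * card F) j"
    by (rule nbr_card_prob_upper[OF l n cU F(4-6)])
  also have "\<dots> \<le> distortion l n * pois (l * card F) j"
    using l by (intro mult_right_mono exp_le_distortion pois_nonneg) auto
  finally show ?thesis .
qed

lemma prob_card_nbrs_lower:
  fixes l :: real
  assumes l: "0 \<le> l" "2 * l * budget n \<le> n" "4 * budget n \<le> n" and n: "0 < n" and b: "0 < budget n"
    and F: "F \<subseteq> {1..n}" "U \<subseteq> {1..n}" "F \<inter> U = {}" "n \<le> card U + budget n" "card F \<le> budget n" "j
        \<le> budget n"
  shows "pois (l * card F) j / distortion l n \<le> gnp_prob n (l / n) (\<lambda>E. card (nbrs E F U) = j)"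
proof -
  have "l * 1 \<le> l * budget n" using l b by (intro mult_left_mono) auto
  hence p: "0 \<le> l / n" "l / n \<le> 1" using l n by auto
  have cU: "card U \<le> n" using F(2) card_mono[of "{1..n}" U] by simp
  have "pois (l * card F) j / distortion l n = exp (- ((4 + 2 * l
      + 2 * l\<^sup>2) * (budget n)\<^sup>2 / n)) * pois (l * card F) j"
    by (simp add: distortion_def exp_minus field_simps)
  also have "\<dots> \<le> nbr_card_prob (l / n) (card U) (card F) j"
    by (rule nbr_card_prob_lower[OF l n b cU F(4-6)])
  also have "\<dots> = gnp_prob n (l / n) (\<lambda>E. card (nbrs E F U) = j)"
    by (rule gnp_prob_card_nbrs[OF F(1-3) p, symmetric])
  finally show ?thesis .
qed

text \<open>One complete branch followed by an event \<open>\<Psi>\<close> on the unexplored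
  vertices and \<open>X\<close>, which is independent of it. The powers of \<open>distortion\<close>
  stand for \<open>h\<close> layers and the empty layer after them.\<close>

lemma dead_stage_prob:
  fixes l s :: real
  assumes l: "0 \<le> l" "l \<le> real n" and n: "0 < n" and w: "2 \<le> w" "w \<le> budget n" "c \<le> budget n"
    and s: "0 \<le> s"
    and dep: "\<And>U. U \<inter> X = {} \<Longrightarrow> depends_on (\<Psi> U) (edges_within (U \<union> X))"
    and \<Psi>: "\<And>U. U \<subseteq> {1..n} \<Longrightarrow> U \<inter> X = {} \<Longrightarrow> n \<le> card U + c \<Longrightarrow> gnp_prob n (l / n) (\<Psi> U) \<le> s"
    and U: "u \<in> {1..n}" "U \<subseteq> {1..n}" "u \<notin> U" "insert u U \<inter> X = {}" "n + h * w \<le> card U + c"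
  shows "gnp_prob n (l / n) (explore {1..<w} (\<lambda>F U E. nbrs E F U = {} \<and> \<Psi> U E) h {u} U)
     \<le> distortion l n ^ (h + 1) * bp_height l w h * s"
proof -
  let ?D = "distortion l n" and ?\<kappa> = "exp (2 * l * (budget n)\<^sup>2 / n)"
  let ?Q = "\<lambda>F U E. nbrs E F U = {} \<and> \<Psi> U E"
  have D: "1 \<le> ?D" using l(1) by (rule distortion_ge_1)
  have "gnp_prob n (l / n) (explore {1..<w} ?Q h {u} U) \<le>
     ?\<kappa> ^ h * bp_iter l {1..<w} (\<lambda>j. (?D * s) * exp (- (l * real j))) h (card {u})"
  proof (rule explore_prob_upper[where w = w and c = c and X = X])
    show "depends_on (?Q F U) (edges_within (F \<union> U \<union> X))" if "F \<inter> U = {}" "(F \<union> U) \<inter> X = {}" for F U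
    proof (intro depends_on_conj)
      show "depends_on (\<lambda>E. nbrs E F U = {}) (edges_within (F \<union> U \<union> X))"
        using depends_on_nbrs[of "\<lambda>A. A = {}" F U]
        by (rule depends_on_mono) (auto simp: crossing_def edges_within_def)
      show "depends_on (\<Psi> U) (edges_within (F \<union> U \<union> X))"
        by (rule depends_on_mono[OF dep]) (use that in \<open>auto intro!: edges_within_mono\<close>)
    qed
    fix F U assume F: "F \<subseteq> {1..n}" "U \<subseteq> {1..n}" "F \<inter> U = {}" "(F \<union> U) \<inter> X
        = {}" "card F \<in> {1..<w}" "n \<le> card U + c"
    have finU: "finite U" using F finite_subset by blast
    have "gnp_prob n (l / n) (\<lambda>E. nbrs E F U = {} \<and> \<Psi> U E) =
       gnp_prob n (l / n) (\<lambda>E. nbrs E F U = {}) * gnp_prob n (l / n) (\<Psi> U)"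
    proof (rule gnp_prob_indep[OF depends_on_nbrs[of "\<lambda>A. A = {}" F U] dep])
      show "crossing F U \<inter> edges_within (U \<union> X) = {}"
        using edges_within_subset_compl[of "U \<union> X" F U] F(3,4) by blast
    qed (use F in auto)
    also have "gnp_prob n (l / n) (\<lambda>E. nbrs E F U = {})
        = gnp_prob n (l / n) (\<lambda>E. card (nbrs E F U) = 0)"
      using finite_subset[OF nbrs_subset finU] by (intro gnp_prob_cong) simp
    also have "\<dots> * gnp_prob n (l / n) (\<Psi> U) \<le> (?D * pois (l * card F) 0) * s"
      using l n w F s D by (intro mult_mono prob_card_nbrs_upper \<Psi>) (auto simp: pois_nonneg)
    finally show "gnp_prob n (l / n) (\<lambda>E. nbrs E F U = {} \<and> \<Psi> U E) \<le> ?D * s * exp (- (l * card F))"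
      by (simp add: pois_0 mult_ac)
  qed (use l n w U s D in auto)
  also have "\<dots> = ?\<kappa> ^ h * (?D * s * bp_height l w h)"
    by (simp add: bp_iter_scale bp_height_def)
  also have "\<dots> \<le> ?D ^ h * (?D * s * bp_height l w h)"
    using l s D bp_height_nonneg[OF l(1) w(1)]
    by (intro mult_right_mono power_mono exp_le_distortion) auto
  finally show ?thesis by (simp add: mult_ac)
qed

text \<open>The two bridges and the two stages use disjoint sets of edges: \<open>D0\<close>
  contains every edge read by the explorations and neither bridge. A common anchor
  \<open>v = v'\<close> is permitted.\<close>

lemma joint_branch_prob:
  fixes l s :: real
  assumes l: "0 \<le> l" "l \<le> real n" and n: "0 < n" and w: "2 \<le> w" "2 * h * w + w + 5 \<le> budget n"
    and s: "0 \<le> s"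
    and dep: "\<And>U. U \<inter> {v, v'} = {} \<Longrightarrow> depends_on (P U) (edges_within (U \<union> {v, v'}))"
    and P: "\<And>U. U \<subseteq> {1..n} \<Longrightarrow> U \<inter> {v, v'} = {} \<Longrightarrow> n \<le> card U + budget n
        \<Longrightarrow> gnp_prob n (l / n) (P U) \<le> s"
    and V: "{v, u, v', u'} \<subseteq> {1..n}" "v \<noteq> u" "v' \<noteq> u'" "u \<noteq> u'" "u \<noteq> v'" "u' \<noteq> v"
  shows "gnp_prob n (l / n) (joint_branch n w h P v u v' u')
     \<le> (l / n)\<^sup>2 * (distortion l n ^ (2 * h + 2) * (bp_height l w h)\<^sup>2 * s)"
proof -
  let ?D = "distortion l n" and ?W = "{1..n} - {v, v', u, u'}"
  have p: "0 \<le> l / n" "l / n \<le> 1" using l n by auto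
  have D: "1 \<le> ?D" using l(1) by (rule distortion_ge_1)
  have \<beta>: "0 \<le> bp_height l w h" using l w by (intro bp_height_nonneg) auto
  define Q2 where "Q2 = (\<lambda>F U E. nbrs E F U = {} \<and> P U E)"
  define \<Psi> where "\<Psi> = (\<lambda>U. explore {1..<w} Q2 h {u'} U)"
  define B0 where "B0 = explore {1..<w} (\<lambda>F U E. nbrs E F U = {} \<and> \<Psi> U E) h {u} ?W"
  have J: "joint_branch n w h P v u v' u' = (\<lambda>E. {v, u} \<in> E \<and> ({v', u'} \<in> E \<and> B0 E))"
    by (simp add: joint_branch_def B0_def \<Psi>_def Q2_def fun_eq_iff)
  have nb: "depends_on (\<lambda>E. nbrs E F U = {}) D" if "crossing F U \<subseteq> D" for F U D
    using depends_on_nbrs[of "\<lambda>A. A = {}" F U] that by (rule depends_on_mono)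
  have dep2: "depends_on (\<Psi> U) D"
    if "edges_within ({u'} \<union> U) \<subseteq> D" "edges_within (U \<union> {v, v'}) \<subseteq> D" "u' \<notin> U" "U \<inter> {v, v'}
        = {}" for U D
    unfolding \<Psi>_def
  proof (rule depends_on_explore_gen)
    fix F' U' assume F': "F' \<subseteq> {u'} \<union> U" "U' \<subseteq> U" "F' \<inter> U' = {}"
    have "edges_within (F' \<union> U') \<subseteq> edges_within ({u'} \<union> U)"
      by (rule edges_within_mono) (use F' in auto)
    moreover have "edges_within (U' \<union> {v, v'}) \<subseteq> edges_within (U \<union> {v, v'})"
      by (rule edges_within_mono) (use F' in auto)
    ultimately show "depends_on (Q2 F' U') D"
      unfolding Q2_def using crossing_subset_within[of F' U'] that F'
      by (intro depends_on_conj nb depends_on_mono[OF dep[of U']]) auto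
  qed (use that in auto)
  define D0 where "D0 = edges_within ({u} \<union> ?W) \<union> edges_within ({u'} \<union> ?W) \<union> edges_within (?W \<union>
      {v, v'})"
  have depB: "depends_on B0 D0"
    unfolding B0_def
  proof (rule depends_on_explore_gen)
    fix F' U' assume F': "F' \<subseteq> {u} \<union> ?W" "U' \<subseteq> ?W" "F' \<inter> U' = {}"
    have s1: "edges_within (F' \<union> U') \<subseteq> edges_within ({u} \<union> ?W)"
      by (rule edges_within_mono) (use F' in auto)
    have s2: "edges_within ({u'} \<union> U') \<subseteq> edges_within ({u'} \<union> ?W)"
      by (rule edges_within_mono) (use F' in auto)
    have s3: "edges_within (U' \<union> {v, v'}) \<subseteq> edges_within (?W \<union> {v, v'})"
      by (rule edges_within_mono) (use F' in auto)
    show "depends_on (\<lambda>E. nbrs E F' U' = {} \<and> \<Psi> U' E) D0"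
    proof (intro depends_on_conj nb dep2)
      show "crossing F' U' \<subseteq> D0" using crossing_subset_within[of F' U'] s1 unfolding D0_def by blast
      show "edges_within ({u'} \<union> U') \<subseteq> D0" using s2 unfolding D0_def by blast
      show "edges_within (U' \<union> {v, v'}) \<subseteq> D0" using s3 unfolding D0_def by blast
    qed (use F' in auto)
  qed (auto simp: D0_def)
  have vu: "{v, u} \<notin> D0" "{v', u'} \<notin> D0" "{v, u} \<noteq> {v', u'}"
    using V by (auto simp: D0_def edges_within_def doubleton_eq_iff)
  have "gnp_prob n (l / n) (\<lambda>E. {v', u'} \<in> E \<and> B0 E) = (l / n) * gnp_prob n (l / n) B0"
    using gnp_prob_indep[OF depends_on_edge[of "{v', u'}" "{{v', u'}}"] depB, of n "l / n"] vu V p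
    by (simp add: gnp_prob_edge doubleton_possible_edge)
  moreover have "depends_on (\<lambda>E. {v', u'} \<in> E \<and> B0 E) (insert {v', u'} D0)"
    by (intro depends_on_conj depends_on_edge depends_on_mono[OF depB]) auto
  hence "gnp_prob n (l / n) (joint_branch n w h P v u v' u') =
      (l / n) * gnp_prob n (l / n) (\<lambda>E. {v', u'} \<in> E \<and> B0 E)"
    unfolding J
    using gnp_prob_indep[OF depends_on_edge[of "{v, u}" "{{v, u}}"], of _ _ n "l / n"] vu V p
    by (simp add: gnp_prob_edge doubleton_possible_edge)
  ultimately have eq: "gnp_prob n (l / n) (joint_branch n w h P v u v' u')
      = (l / n)\<^sup>2 * gnp_prob n (l / n) B0"
    by (simp add: power2_eq_square)
  have cW: "n \<le> card ?W + 4"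
  proof -
    have "card {1..n} - card {v, v', u, u'} \<le> card ?W" by (rule diff_card_le_card_Diff) simp
    moreover have "card {v, v', u, u'} \<le> 4" by (simp add: card_insert_if)
    ultimately show ?thesis by simp
  qed
  have "gnp_prob n (l / n) B0 \<le> ?D ^ (h + 1) * bp_height l w h * (?D ^ (h
      + 1) * bp_height l w h * s)"
    unfolding B0_def
  proof (rule dead_stage_prob[OF l n w(1), where X = "{v, v', u'}" and c = "h * w + 4"])
    show "depends_on (\<Psi> U) (edges_within (U \<union> {v, v', u'}))" if "U \<inter> {v, v', u'} = {}" for U
      by (rule dep2) (use that in \<open>auto intro!: edges_within_mono\<close>)
    fix U assume U: "U \<subseteq> {1..n}" "U \<inter> {v, v', u'} = {}" "n \<le> card U + (h * w + 4)"
    show "gnp_prob n (l / n) (\<Psi> U) \<le> ?D ^ (h + 1) * bp_height l w h * s"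
      unfolding \<Psi>_def Q2_def
    proof (rule dead_stage_prob[OF l n w(1), where X = "{v, v'}" and c = "2 * h * w + 4"])
      show "n + h * w \<le> card U + (2 * h * w + 4)" using U by simp
      show "gnp_prob n (l / n) (P U) \<le> s"
        if "U \<subseteq> {1..n}" "U \<inter> {v, v'} = {}" "n \<le> card U + (2 * h * w + 4)" for U
        using that w by (intro P) auto
    qed (use w s dep U V in auto)
  next
    show "n + h * w \<le> card ?W + (h * w + 4)" using cW by simp
  qed (use w s V D \<beta> in auto)
  also have "\<dots> = ?D ^ (2 * h + 2) * (bp_height l w h)\<^sup>2 * s"
  proof -
    have "?D ^ (2 * h + 2) = ?D ^ (h + 1) * ?D ^ (h + 1)"
        by (simp only: power_add[symmetric]) (simp add: mult_2)
    thus ?thesis by (simp only: power2_eq_square mult_ac)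
  qed
  finally have "gnp_prob n (l / n) B0 \<le> \<dots>" .
  thus ?thesis unfolding eq by (intro mult_left_mono) auto
qed

lemma depends_on_dead_end:
  assumes "F \<inter> U = {}" "v \<notin> F \<union> U"
  shows "depends_on (dead_end k0 v F U) (edges_within (F \<union> U) \<union> edges_within (insert v U))"
proof -
  have "depends_on (\<lambda>E. nbrs E F U = {} \<and> card (nbrs E {v} U)
      = k0) (edges_within (F \<union> U) \<union> edges_within (insert v U))"
  proof (rule depends_on_conj)
    show "depends_on (\<lambda>E. nbrs E F U = {}) (edges_within (F \<union> U) \<union> edges_within (insert v U))"
      using depends_on_nbrs[of "\<lambda>A. A = {}" F U]
      by (rule depends_on_mono) (use crossing_subset_within[of F U] in blast)
    show "depends_on (\<lambda>E. card (nbrs E {v} U)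
        = k0) (edges_within (F \<union> U) \<union> edges_within (insert v U))"
      using depends_on_nbrs[of "\<lambda>A. card A = k0" "{v}" U]
      by (rule depends_on_mono) (use crossing_subset_within[of "{v}" U] in auto)
  qed
  thus ?thesis by (simp add: dead_end_def[abs_def])
qed

lemma edge_explore_avoiding:
  assumes V: "v \<in> {1..n}" "u \<in> {1..n}" "v \<noteq> u" and p: "0 \<le> p" "p \<le> 1"
    and dep: "\<And>F U. F \<inter> U = {} \<Longrightarrow> v \<notin> F \<union> U \<Longrightarrow>
      depends_on (Q F U) (edges_within (F \<union> U) \<union> edges_within (insert v U))"
  shows "gnp_prob n p (\<lambda>E. {v, u} \<in> E \<and> explore_avoiding v S Q h {u} ({1..n} - {v, u}) E) =
     p * gnp_prob n p (explore_avoiding v S Q h {u} ({1..n} - {v, u}))"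
proof -
  have "depends_on (explore_avoiding v S Q h {u} ({1..n} - {v, u}))
      (edges_within ({u} \<union> ({1..n} - {v, u})) \<union> edges_within (insert v ({1..n} - {v, u})))"
    by (rule depends_on_explore_avoiding[OF dep]) (use V in auto)
  from gnp_prob_indep[OF depends_on_edge[of "{v, u}" "{{v, u}}"] this, of n p]
  show ?thesis using V p by (auto simp: edges_within_def gnp_prob_edge doubleton_possible_edge)
qed

text \<open>The powers of \<open>distortion\<close> count \<open>h\<close> layers, the empty layer
  and the \<open>k0\<close> further neighbours of \<open>v\<close>;
  \<open>(1 - l / n) ^ (w * h)\<close> is the cost of keeping all layers away from
  \<open>v\<close>.\<close>

lemma branch_prob_lower:
  fixes l :: real
  assumes l: "0 \<le> l" "2 * l * budget n \<le> n" "4 * budget n \<le> n" and n: "0 < n"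
    and w: "2 \<le> w" "h * w + w + 2 \<le> budget n" "k0 \<le> budget n"
    and V: "v \<in> {1..n}" "u \<in> {1..n}" "v \<noteq> u"
  shows "(l / n) * ((1 - l / n) ^ (w * h) / distortion l n ^ (h
      + 2) * (bp_height l w h * pois l k0))
     \<le> gnp_prob n (l / n) (branch n w h k0 v u)"
proof -
  let ?D = "distortion l n" and ?b = "budget n"
  have b: "0 < ?b" using w by simp
  have D: "1 \<le> ?D" using l(1) by (rule distortion_ge_1)
  have "l * 1 \<le> l * ?b" using l b by (intro mult_left_mono) auto
  hence p: "0 \<le> l / n" "l / n \<le> 1" using l n by auto
  let ?\<kappa> = "exp (- ((4 + 2 * l + 2 * l\<^sup>2) * ?b\<^sup>2 / n))"
  have \<kappa>: "?\<kappa> = 1 / ?D" by (simp add: distortion_def exp_minus inverse_eq_divide)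
  let ?g = "\<lambda>j. (pois l k0 / ?D\<^sup>2) * exp (- (l * real j))"
  have "((1 - l / n) ^ w * ?\<kappa>) ^ h * bp_iter l {1..<w} ?g h (card {u}) \<le>
     gnp_prob n (l / n) (explore_avoiding v {1..<w} (dead_end k0 v) h {u} ({1..n} - {v, u}))"
  proof (rule explore_prob_lower[OF l n b, where w = w and c = "h * w + 2"])
    fix F U assume F: "F \<subseteq> {1..n}" "U \<subseteq> {1..n}" "F \<inter> U = {}" "v \<notin> F \<union> U" "card F \<in> {1..<w}" "n
        \<le> card U + (h * w + 2)"
    have finU: "finite U" using F finite_subset by blast
    have "?g (card F) = (pois (l * card F) 0 / ?D) * (pois (l * card {v}) k0 / ?D)"
      by (simp add: pois_0 power2_eq_square)
    also have "\<dots> \<le> gnp_prob n (l / n) (\<lambda>E. card (nbrs E F U)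
        = 0) * gnp_prob n (l / n) (\<lambda>E. card (nbrs E {v} U) = k0)"
      using l n b F w V D by (intro mult_mono prob_card_nbrs_lower) (auto simp: pois_nonneg)
    also have "gnp_prob n (l / n) (\<lambda>E. card (nbrs E F U) = 0) = gnp_prob n (l / n) (\<lambda>E. nbrs E F U
        = {})"
      using finite_subset[OF nbrs_subset finU] by (intro gnp_prob_cong) simp
    also have "\<dots> * gnp_prob n (l / n) (\<lambda>E. card (nbrs E {v} U) = k0)
        = gnp_prob n (l / n) (dead_end k0 v F U)"
      unfolding dead_end_def
    proof (rule gnp_prob_indep[symmetric, OF depends_on_nbrs[of "\<lambda>A. A
        = {}" F U] depends_on_nbrs[of "\<lambda>A. card A = k0" "{v}" U]])
      show "crossing F U \<inter> crossing {v} U = {}"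
        using F(3,4) by (auto simp: crossing_def doubleton_eq_iff)
    qed
    finally show "?g (card F) \<le> gnp_prob n (l / n) (dead_end k0 v F U)" .
  next
    show "n + h * w \<le> card ({1..n} - {v, u}) + (h * w + 2)"
      using V by (simp add: card_Diff_subset)
  qed (use l n w V D depends_on_dead_end in \<open>auto simp: pois_nonneg\<close>)
  also have "((1 - l / n) ^ w * ?\<kappa>) ^ h * bp_iter l {1..<w} ?g h (card {u}) =
     (1 - l / n) ^ (w * h) / ?D ^ (h + 2) * (bp_height l w h * pois l k0)"
    unfolding \<kappa> bp_iter_scale bp_height_def power_mult
    by (simp add: power_mult_distrib power_add power_divide power2_eq_square mult_ac)
  finally have le: "(1 - l / n) ^ (w * h) / ?D ^ (h + 2) * (bp_height l w h * pois l k0) \<le>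
     gnp_prob n (l / n) (explore_avoiding v {1..<w} (dead_end k0 v) h {u} ({1..n} - {v, u}))" .
  have "gnp_prob n (l / n) (branch n w h k0 v u) =
     (l / n) * gnp_prob n (l / n) (explore_avoiding v {1..<w} (dead_end k0 v) h {u} ({1..n} - {v,
         u}))"
    unfolding branch_def[abs_def] by (rule edge_explore_avoiding[OF V p]) (rule depends_on_dead_end)
  with mult_left_mono[OF le p(1)] show ?thesis by simp
qed

text \<open>If the side of \<open>v\<close> stays small, the descendants of its \<open>k0\<close>
  neighbours stay below \<open>w'\<close> for \<open>T\<close> further steps, which costs
  \<open>exp 1 * x ^ k0\<close>. So a large \<open>k0\<close> makes a small side unlikely relative
  to the branch itself. The extra step in \<open>Suc T\<close> leads from \<open>v\<close> to these
  neighbours.\<close>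

lemma small_side_prob:
  fixes l :: real
  assumes l: "0 \<le> l" "l \<le> real n" and n: "0 < n"
    and w: "2 \<le> w" "h * w + w + k0 + T * w' + 2 \<le> budget n" "k0 < w'" "w' \<le> budget n"
    and x: "(pgf l ^^ T) (exp (- (1 / real w'))) \<le> x"
    and V: "v \<in> {1..n}" "u \<in> {1..n}" "v \<noteq> u"
  shows "gnp_prob n (l / n) (\<lambda>E. branch n w h k0 v u E \<and> \<not> big_side n h w' (Suc T) v u E)
     \<le> (l / n) * (distortion l n ^ (h + T + 2) * (bp_height l w h * pois l k0 * (exp 1 * x ^ k0)))"
proof -
  let ?D = "distortion l n"
  have p: "0 \<le> l / n" "l / n \<le> 1" using l n by auto
  have D: "1 \<le> ?D" using l(1) by (rule distortion_ge_1)
  have x0: "0 \<le> x" using pgf_iter_nonneg[where x = "exp (- (1 / real w'))" and l = l and t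
      = T] x by simp
  define \<Psi> where "\<Psi> = (\<lambda>U E. card (nbrs E {v} U) = k0
      \<and> (\<forall>i\<in>{..Suc T}. card (layer E i {v} U) < w'))"
  define Q where "Q = (\<lambda>F U E. nbrs E F U = {} \<and> \<Psi> U E)"
  have dep\<Psi>: "depends_on (\<Psi> U) (edges_within (insert v U))" for U
    unfolding \<Psi>_def
  proof (intro depends_on_conj depends_on_ball)
    show "depends_on (\<lambda>E. card (nbrs E {v} U) = k0) (edges_within (insert v U))"
      using depends_on_nbrs[of "\<lambda>A. card A = k0" "{v}" U]
      by (rule depends_on_mono) (use crossing_subset_within[of "{v}" U] in auto)
    show "depends_on (\<lambda>E. card (layer E i {v} U) < w') (edges_within (insert v U))" for i
      using depends_on_layer[of "\<lambda>A _. card A < w'" i "{v}" U] by simp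
  qed
  have depQ: "depends_on (Q F U) (edges_within (F \<union> U) \<union> edges_within (insert v U))" for F U
    unfolding Q_def
  proof (rule depends_on_conj)
    show "depends_on (\<lambda>E. nbrs E F U = {}) (edges_within (F \<union> U) \<union> edges_within (insert v U))"
      using depends_on_nbrs[of "\<lambda>A. A = {}" F U]
      by (rule depends_on_mono) (use crossing_subset_within[of F U] in blast)
  qed (rule depends_on_mono[OF dep\<Psi>], blast)
  have "gnp_prob n (l / n) (\<lambda>E. branch n w h k0 v u E \<and> \<not> big_side n h w' (Suc T) v u E) \<le>
     gnp_prob n (l / n) (\<lambda>E. {v, u} \<in> E \<and> explore_avoiding v {1..<w} Q h {u} ({1..n} - {v, u}) E)"
    unfolding branch_def big_side_def explore_avoiding_iff explore_iff dead_end_def Q_def \<Psi>_def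
    by (rule gnp_prob_mono) (auto simp del: layer.simps unexplored.simps)
  also have "\<dots> = (l / n) * gnp_prob n (l / n) (explore_avoiding v {1..<w} Q h {u} ({1..n} - {v,
      u}))"
    by (rule edge_explore_avoiding[OF V p depQ])
  also have "\<dots> \<le> (l / n) * gnp_prob n (l / n) (explore {1..<w} Q h {u} ({1..n} - {v, u}))"
    using p by (intro mult_left_mono gnp_prob_mono) (auto simp: explore_avoiding_iff)
  also have "\<dots> \<le> (l / n) * (?D ^ (h + 1) * bp_height l w h * (?D * pois l k0 * (?D ^ T * (exp 1 *
      x ^ k0))))"
    unfolding Q_def
  proof (intro mult_left_mono dead_stage_prob[OF l n w(1), where X = "{v}" and c = "h * w
      + 2"] p(1))
    show "depends_on (\<Psi> U) (edges_within (U \<union> {v}))" for U using dep\<Psi>[of U] by simp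
    show "n + h * w \<le> card ({1..n} - {v, u}) + (h * w + 2)"
      using V by (simp add: card_Diff_subset)
    fix U assume U: "U \<subseteq> {1..n}" "U \<inter> {v} = {}" "n \<le> card U + (h * w + 2)"
    have finU: "finite U" using U finite_subset by blast
    have vU: "{v} \<subseteq> {1..n}" "{v} \<inter> U = {}" using U V by auto
    have "gnp_prob n (l / n) (\<Psi> U) \<le> gnp_prob n (l / n) (\<lambda>E. card (nbrs E {v} U) = k0 \<and>
        explore {..<w'} (\<lambda>_ _ _. True) T (nbrs E {v} U) (U - nbrs E {v} U) E)"
    proof (rule gnp_prob_mono)
      fix E assume *: "\<Psi> U E"
      have "card (layer E i (nbrs E {v} U) (U - nbrs E {v} U)) < w'" if "i \<le> T" for i
        using * that unfolding \<Psi>_def by (metis Suc_le_mono atMost_iff layer.simps(2))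
      thus "card (nbrs E {v} U) = k0 \<and> explore {..<w'} (\<lambda>_ _ _. True) T (nbrs E {v} U) (U - nbrs E
          {v} U) E"
        using * unfolding \<Psi>_def explore_iff by simp
    qed
    also have "\<dots> \<le> gnp_prob n (l / n) (\<lambda>E. card (nbrs E {v} U) = k0) * (?D ^ T * (exp 1 * x ^ k0))"
    proof (rule gnp_prob_step_mult[OF vU(1) U(1) vU(2) p, where P = "\<lambda>F'. card F' = k0"
          and A = "\<lambda>F' E. explore {..<w'} (\<lambda>_ _ _. True) T F' (U - F') E"])
      fix F' assume F': "F' \<subseteq> U"
      have "depends_on (explore {..<w'} (\<lambda>_ _ _. True) T F' (U - F')) (edges_within (F' \<union> (U - F')
          \<union> {}))"
        by (rule depends_on_explore) auto
      thus "depends_on (explore {..<w'} (\<lambda>_ _ _. True) T F' (U - F')) (- crossing {v} U)"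
        by (rule depends_on_mono[OF _ edges_within_subset_compl]) (use F' vU in blast)
      assume c: "card F' = k0"
      have "gnp_prob n (l / n) (explore {..<w'} (\<lambda>_ _ _. True) T F' (U - F')) \<le>
         exp (2 * l * (budget n)\<^sup>2 / n) ^ T * bp_iter l {..<w'} (\<lambda>_. 1) T (card F')"
      proof (rule explore_prob_upper[where X = "{}" and w = w' and c = "h * w + 2 + k0 + T * w'"])
        have "card (U - F') = card U - card F'"
          using F' finU by (simp add: card_Diff_subset finite_subset)
        thus "n + T * w' \<le> card (U - F') + (h * w + 2 + k0 + T * w')" using U c by simp
      qed (use l n w U F' c in auto)
      also have "bp_iter l {..<w'} (\<lambda>_. 1) T (card F')
          \<le> exp 1 * (pgf l ^^ T) (exp (- (1 / real w'))) ^ card F'"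
        by (rule bp_iter_le_power) (use l w c exp_one_power_ge in auto)
      also have "\<dots> \<le> exp 1 * x ^ k0"
        unfolding c using x by (intro mult_left_mono power_mono pgf_iter_nonneg) auto
      also have "exp (2 * l * (budget n)\<^sup>2 / n) ^ T \<le> ?D ^ T"
        by (intro power_mono exp_le_distortion l) auto
      finally show "gnp_prob n (l / n) (explore {..<w'} (\<lambda>_ _ _. True) T F' (U - F'))
          \<le> ?D ^ T * (exp 1 * x ^ k0)"
        using x0 by (simp add: mult_left_mono mult_right_mono)
    qed
    also have "\<dots> \<le> (?D * pois (l * card {v}) k0) * (?D ^ T * (exp 1 * x ^ k0))"
      using l n U vU w D x0 by (intro mult_right_mono prob_card_nbrs_upper) auto
    finally show "gnp_prob n (l / n) (\<Psi> U) \<le> ?D * pois l k0 * (?D ^ T * (exp 1 * x ^ k0))" by simp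
  qed (use l n w V D x0 in \<open>auto simp: pois_nonneg\<close>)
  also have "\<dots> = (l / n) * (?D ^ (h + T + 2) * (bp_height l w h * pois l k0 * (exp 1 * x ^ k0)))"
    by (simp add: power_add mult_ac)
  finally show ?thesis .
qed

text \<open>First moment: each step multiplies the expected size of the layer by at most
  \<open>l\<close>, and each vertex of a layer is adjacent to \<open>y\<close> with probability
  \<open>l / n\<close>.\<close>

lemma layer_hit_prob:
  fixes l :: real
  assumes l: "0 \<le> l" "l \<le> real n" and n: "0 < n"
    and F: "F \<subseteq> {1..n}" "U \<subseteq> {1..n}" "F \<inter> U = {}" "y \<in> {1..n}" "y \<notin> F"
  shows "gnp_prob n (l / n) (\<lambda>E. y \<in> layer E (Suc i) F U) \<le> card F * (l / n * l ^ i)"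
  using F
proof (induction i arbitrary: F U)
  have p: "0 \<le> l / n" "l / n \<le> 1" using l n by auto
  have single: "gnp_prob n (l / n) (\<lambda>E. z \<in> nbrs E F U) \<le> card F * (l / n)"
    if "F \<subseteq> {1..n}" "z \<in> {1..n}" "z \<notin> F" for z F and U :: "nat set"
  proof -
    have finF: "finite F" using that finite_subset by blast
    have "gnp_prob n (l / n) (\<lambda>E. z \<in> nbrs E F U) \<le> gnp_prob n (l / n) (\<lambda>E. \<exists>f\<in>F. {z, f} \<in> E)"
      by (rule gnp_prob_mono) (auto simp: nbrs_def)
    also have "\<dots> \<le> (\<Sum>f\<in>F. gnp_prob n (l / n) (\<lambda>E. {z, f} \<in> E))" by (rule gnp_prob_Bex[OF finF])
    also have "\<dots> = (\<Sum>f\<in>F. l / n)"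
      by (intro sum.cong refl gnp_prob_edge doubleton_possible_edge) (use that p in auto)
    finally show ?thesis by simp
  qed
  {
    case 0
    thus ?case using single[of F y U] by simp
  next
    case (Suc i)
    have finU: "finite U" using Suc.prems finite_subset by blast
    let ?w = "\<lambda>F'. (1 - (1 - l / n) ^ card F) ^ card F' * ((1 - l / n) ^ card F) ^ (card U - card
        F')"
    have w: "0 \<le> ?w F'" for F' using p by (simp add: power_le_one)
    have cU: "card U \<le> n" using Suc.prems(2) card_mono[of "{1..n}" U] by simp
    have "gnp_prob n (l / n) (\<lambda>E. y \<in> layer E (Suc (Suc i)) F U) =
        gnp_prob n (l / n) (\<lambda>E. y \<in> layer E (Suc i) (nbrs E F U) (U - nbrs E F U))" by simp
    also have "\<dots> = (\<Sum>F'\<in>Pow U. ?w F' * gnp_prob n (l / n) (\<lambda>E. y \<in> layer E (Suc i) F' (U - F')))"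
    proof (rule gnp_prob_step[OF Suc.prems(1-3) p, where A
        = "\<lambda>F' E. y \<in> layer E (Suc i) F' (U - F')"])
      fix F' assume F': "F' \<subseteq> U"
      have "depends_on (\<lambda>E. y \<in> layer E (Suc i) F' (U - F')) (edges_within (F' \<union> (U - F')))"
        by (rule depends_on_layer[of "\<lambda>A _. y \<in> A"])
      thus "depends_on (\<lambda>E. y \<in> layer E (Suc i) F' (U - F')) (- crossing F U)"
        by (rule depends_on_mono[OF _ edges_within_subset_compl]) (use F' Suc.prems in blast)
    qed
    also have "\<dots> \<le> (\<Sum>F'\<in>Pow U. ?w F' * (card F' * (l / n * l ^ i)))"
    proof (intro sum_mono mult_left_mono w)
      fix F' assume F': "F' \<in> Pow U"
      show "gnp_prob n (l / n) (\<lambda>E. y \<in> layer E (Suc i) F' (U - F')) \<le> card F' * (l / n * l ^ i)"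
      proof (cases "y \<in> F'")
        case True
        have "y \<notin> layer E (Suc i) F' (U - F')" for E
          using layer_subset[of "Suc i" E F' "U - F'"] True by auto
        hence "gnp_prob n (l / n) (\<lambda>E. y \<in> layer E (Suc i) F' (U - F')) = 0"
            by (intro gnp_prob_eq_0) auto
        thus ?thesis using p l by simp
      next
        case False
        thus ?thesis using F' Suc.prems by (intro Suc.IH) auto
      qed
    qed
    also have "\<dots> = (\<Sum>F'\<in>Pow U. ?w F' * card F') * (l / n * l ^ i)"
      by (simp only: sum_distrib_right mult.assoc)
    finally have e1: "gnp_prob n (l / n) (\<lambda>E. y \<in> layer E (Suc (Suc i)) F U) \<le>
        (\<Sum>F'\<in>Pow U. ?w F' * card F') * (l / n * l ^ i)" .
    have "(\<Sum>F'\<in>Pow U. ?w F' * card F') = (\<Sum>z\<in>U. gnp_prob n (l / n) (\<lambda>E. z \<in> nbrs E F U))"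
    proof -
      have "(\<Sum>z\<in>U. gnp_prob n (l / n) (\<lambda>E. z \<in> nbrs E F U)) =
         (\<Sum>z\<in>U. \<Sum>F'\<in>Pow U. ?w F' * gnp_prob n (l / n) (\<lambda>E. z \<in> F'))"
        by (intro sum.cong refl gnp_prob_step[OF Suc.prems(1-3) p, where A = "\<lambda>F' E. _ \<in> F'"]) simp
      also have "\<dots> = (\<Sum>F'\<in>Pow U. ?w F' * (\<Sum>z\<in>U. gnp_prob n (l / n) (\<lambda>E. z \<in> F')))"
        by (subst sum.swap) (simp add: sum_distrib_left)
      also have "\<dots> = (\<Sum>F'\<in>Pow U. ?w F' * card F')"
      proof (intro sum.cong refl arg_cong2[where f = "(*)"])
        fix F' assume F': "F' \<in> Pow U"
        have "(\<Sum>z\<in>U. gnp_prob n (l / n) (\<lambda>E. z \<in> F')) = (\<Sum>z\<in>U. if z \<in> F' then 1 else 0)"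
          by (intro sum.cong refl) auto
        also have "\<dots> = card (U \<inter> F')" using finU by (simp add: sum.If_cases)
        also have "U \<inter> F' = F'" using F' by auto
        finally show "(\<Sum>z\<in>U. gnp_prob n (l / n) (\<lambda>E. z \<in> F')) = card F'" .
      qed
      finally show ?thesis ..
    qed
    also have "\<dots> \<le> (\<Sum>z\<in>U. card F * (l / n))"
      by (intro sum_mono single) (use Suc.prems in auto)
    also have "\<dots> = card U * (card F * (l / n))" by simp
    also have "\<dots> \<le> n * (card F * (l / n))"
      using cU by (intro mult_right_mono mult_nonneg_nonneg p(1)) auto
    also have "\<dots> = card F * l" using n by simp
    finally have "(\<Sum>F'\<in>Pow U. ?w F' * card F') * (l / n * l ^ i) \<le> (card F * l) * (l / n * l ^ i)"
      by (rule mult_right_mono) (use p l in simp)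
    also have "\<dots> = card F * (l / n * l ^ Suc i)" by simp
    finally show ?case using e1 by (simp del: layer.simps)
  }
qed

subsection \<open>The lower bound\<close>

text \<open>Chebyshev's inequality bounds the probability that fewer than half of the expected number
  of events occur; otherwise at least \<open>m\<^sup>2 / 8\<close> ordered pairs occur, and Markov's inequality
  applies to the pairs for which \<open>B\<close> holds.\<close>

lemma second_moment:
  fixes n :: nat and p :: real and I :: "'i set" and A :: "'i \<Rightarrow> nat set set \<Rightarrow> bool" and B :: "'i \<Rightarrow>
      'i \<Rightarrow> nat set set \<Rightarrow> bool"
  defines "m \<equiv> \<Sum>i\<in>I. gnp_prob n p (A i)"
  assumes I: "finite I" and m: "8 \<le> m"
  shows "gnp_prob n p (\<lambda>E. \<forall>i\<in>I. \<forall>j\<in>I. i \<noteq> j \<longrightarrow> A i E \<longrightarrow> A j E \<longrightarrow> B i j E) \<le>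
    4 * ((\<Sum>i\<in>I. \<Sum>j\<in>I. gnp_prob n p (\<lambda>E. A i E \<and> A j E)) - m\<^sup>2) / m\<^sup>2 +
    8 * (\<Sum>i\<in>I. \<Sum>j\<in>I - {i}. gnp_prob n p (\<lambda>E. A i E \<and> A j E \<and> B i j E)) / m\<^sup>2"
proof -
  let ?e = "measure_pmf.expectation (gnp n p)"
  have int: "integrable (measure_pmf (gnp n p)) f" for f :: "nat set set \<Rightarrow> real"
    by (rule integrable_measure_pmf_finite) (rule finite_set_pmf_gnp)
  have pr: "gnp_prob n p X = ?e (\<lambda>E. of_bool (X E))" for X
  proof -
    have "gnp_prob n p X = ?e (indicator {E. X E})" by (simp add: gnp_prob_def)
    also have "(indicator {E. X E} :: _ \<Rightarrow> real) = (\<lambda>E. of_bool (X E))"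
      by (auto simp: indicator_def fun_eq_iff)
    finally show ?thesis .
  qed
  define N :: "nat set set \<Rightarrow> real" where "N = (\<lambda>E. \<Sum>i\<in>I. of_bool (A i E))"
  define Bc :: "nat set set \<Rightarrow> real" where "Bc = (\<lambda>E. \<Sum>i\<in>I. \<Sum>j\<in>I - {i}. of_bool (A i E \<and> A j E
      \<and> B i j E))"
  define F where "F = (\<lambda>E. \<forall>i\<in>I. \<forall>j\<in>I. i \<noteq> j \<longrightarrow> A i E \<longrightarrow> A j E \<longrightarrow> B i j E)"
  have N2: "(N E)\<^sup>2 = (\<Sum>i\<in>I. \<Sum>j\<in>I. of_bool (A i E \<and> A j E))" for E
    unfolding N_def power2_eq_square sum_product by (intro sum.cong refl) auto
  have point: "of_bool (F E) \<le> 4 / m\<^sup>2 * ((N E)\<^sup>2 - 2 * m * N E + m\<^sup>2) + 8 / m\<^sup>2 * Bc E" for E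
  proof (cases "F E")
    case True
    have "(N E)\<^sup>2 = (\<Sum>i\<in>I. of_bool (A i E) + (\<Sum>j\<in>I - {i}. of_bool (A i E \<and> A j E)))"
    proof (unfold N2, intro sum.cong refl)
      fix i assume "i \<in> I"
      from sum.remove[OF I this, of "\<lambda>j. of_bool (A i E \<and> A j E)"]
      show "(\<Sum>j\<in>I. of_bool (A i E \<and> A j E) :: real) = of_bool (A i E)
          + (\<Sum>j\<in>I - {i}. of_bool (A i E \<and> A j E))"
        by (simp only: conj_absorb)
    qed
    also have "\<dots> = N E + (\<Sum>i\<in>I. \<Sum>j\<in>I - {i}. of_bool (A i E \<and> A j E))"
      by (simp add: sum.distrib N_def)
    also have "(\<Sum>i\<in>I. \<Sum>j\<in>I - {i}. of_bool (A i E \<and> A j E)) = Bc E"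
      unfolding Bc_def using True unfolding F_def by (intro sum.cong refl) auto
    finally have Bc: "Bc E = (N E)\<^sup>2 - N E" by simp
    have sq: "(N E)\<^sup>2 - 2 * m * N E + m\<^sup>2 = (N E - m)\<^sup>2"
        by (simp add: power2_eq_square algebra_simps)
    have "1 \<le> 4 / m\<^sup>2 * (N E - m)\<^sup>2 + 8 / m\<^sup>2 * Bc E"
    proof (cases "N E \<le> m / 2")
      case True
      have "(m / 2)\<^sup>2 \<le> (m - N E)\<^sup>2" using True m by (intro power_mono) auto
      hence "1 \<le> 4 / m\<^sup>2 * (N E - m)\<^sup>2"
        using m by (simp add: field_simps power2_eq_square)
      moreover have "0 \<le> Bc E" unfolding Bc_def by (intro sum_nonneg) auto
      hence "0 \<le> 8 / m\<^sup>2 * Bc E" by (intro mult_nonneg_nonneg) auto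
      ultimately show ?thesis by linarith
    next
      case False
      \<comment> \<open>Once at least two events occur, the \<open>N * (N - 1)\<close> ordered pairs
        amount to at least half of \<open>N ^ 2\<close>; this is where \<open>m >= 8\<close>
        enters.\<close>
      hence N: "m / 2 \<le> N E" "2 \<le> N E" using m by auto
      have "2 * N E \<le> N E * N E" using N by (intro mult_right_mono) auto
      hence "(N E)\<^sup>2 / 2 \<le> Bc E" unfolding Bc by (simp add: power2_eq_square)
      moreover have "(m / 2)\<^sup>2 \<le> (N E)\<^sup>2" using N m by (intro power_mono) auto
      ultimately have "m\<^sup>2 / 8 \<le> Bc E" by (simp add: power2_eq_square)
      hence "1 \<le> 8 / m\<^sup>2 * Bc E" using m by (simp add: field_simps)
      moreover have "0 \<le> 4 / m\<^sup>2 * (N E - m)\<^sup>2" by simp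
      ultimately show ?thesis by linarith
    qed
    thus ?thesis using True sq by simp
  next
    case False
    have "0 \<le> Bc E" unfolding Bc_def by (intro sum_nonneg) auto
    moreover have "(N E)\<^sup>2 - 2 * m * N E + m\<^sup>2 = (N E - m)\<^sup>2"
        by (simp add: power2_eq_square algebra_simps)
    ultimately show ?thesis using False by simp
  qed
  have eN: "?e N = m" unfolding N_def m_def pr
      by (subst Bochner_Integration.integral_sum) (auto intro: int)
  have eN2: "?e (\<lambda>E. (N E)\<^sup>2) = (\<Sum>i\<in>I. \<Sum>j\<in>I. gnp_prob n p (\<lambda>E. A i E \<and> A j E))"
    unfolding N2 pr by (simp add: Bochner_Integration.integral_sum int)
  have eB: "?e Bc = (\<Sum>i\<in>I. \<Sum>j\<in>I - {i}. gnp_prob n p (\<lambda>E. A i E \<and> A j E \<and> B i j E))"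
    unfolding Bc_def pr by (simp add: Bochner_Integration.integral_sum int)
  have "gnp_prob n p F \<le> ?e (\<lambda>E. 4 / m\<^sup>2 * ((N E)\<^sup>2 - 2 * m * N E + m\<^sup>2) + 8 / m\<^sup>2 * Bc E)"
    unfolding pr by (intro integral_mono int point)
  also have "\<dots> = 4 / m\<^sup>2 * (?e (\<lambda>E. (N E)\<^sup>2) - 2 * m * ?e N + m\<^sup>2) + 8 / m\<^sup>2 * ?e Bc"
    by (simp add: int Bochner_Integration.integral_add Bochner_Integration.integral_diff)
  also have "\<dots> = 4 * (?e (\<lambda>E. (N E)\<^sup>2) - m\<^sup>2) / m\<^sup>2 + 8 * ?e Bc / m\<^sup>2"
  proof -
    have "x - 2 * m * m + m\<^sup>2 = x - m\<^sup>2" for x by (simp add: power2_eq_square)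
    thus ?thesis unfolding eN by simp
  qed
  finally show ?thesis unfolding eN2 eB F_def .
qed

section \<open>Pairs of good branches\<close>

definition good_branch :: "nat \<Rightarrow> nat \<Rightarrow> nat \<Rightarrow> nat \<Rightarrow> nat \<Rightarrow> nat \<Rightarrow> nat \<times> nat \<Rightarrow> nat set set \<Rightarrow> bool" where
  "good_branch n w h k0 w' T a E \<longleftrightarrow> branch n w h k0 (fst a) (snd a) E
      \<and> big_side n h w' T (fst a) (snd a) E"

definition close_branches :: "nat \<Rightarrow> nat \<Rightarrow> nat \<Rightarrow> nat \<times> nat \<Rightarrow> nat \<times> nat \<Rightarrow> nat set set \<Rightarrow> bool" where
  "close_branches n h r a b E \<longleftrightarrow>
     reach ({1..n} - region n h (fst a) (snd a) E - region n h (fst b) (snd b) E) E r (fst a) (fst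
         b)"

definition anchors :: "nat \<Rightarrow> (nat \<times> nat) set" where
  "anchors n = {a \<in> {1..n} \<times> {1..n}. fst a \<noteq> snd a}"

lemma finite_anchors: "finite (anchors n)"
  unfolding anchors_def by (rule finite_subset[of _ "{1..n} \<times> {1..n}"]) auto

lemma card_anchors: "card (anchors n) = n * n - n"
proof -
  have "anchors n = {1..n} \<times> {1..n} - (\<lambda>x. (x, x)) ` {1..n}" by (auto simp: anchors_def)
  moreover have "card ((\<lambda>x. (x, x)) ` {1..n}) = n" by (subst card_image) (auto simp: inj_on_def)
  moreover have "(\<lambda>x. (x, x)) ` {1..n} \<subseteq> {1..n} \<times> {1..n}" by auto
  ultimately show ?thesis by (simp add: card_Diff_subset)
qed

text \<open>Since a branch has fewer than \<open>(h + 1) * w <= w'\<close> vertices, the far side of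
  either bridge is larger than the other branch, as \<open>hanging_compatible\<close>
  requires.\<close>

lemma good_branches_compatible:
  assumes a: "good_branch n w h k0 w' T (v, u) E" and b: "good_branch n w h k0 w' T (v', u') E"
    and ab: "(v, u) \<in> anchors n" "(v', u') \<in> anchors n" "(v, u) \<noteq> (v', u')" and w: "(h + 1) * w
        \<le> w'"
  obtains lev lev' A A' where
    "hanging {1..n} E h v u (region n h v u E) lev" "hanging {1..n} E h v' u' (region n h v' u' E)
        lev'"
    "region n h v u E \<inter> region n h v' u' E = {}" "v \<notin> region n h v' u' E" "v' \<notin> region n h v u E"
    "u \<noteq> u'" "u \<noteq> v'" "u' \<noteq> v"
    "A \<subseteq> {1..n}" "\<And>x. x \<in> A \<Longrightarrow> \<exists>k. reach A E k v x" "w' \<le> card A"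
    "A' \<subseteq> {1..n}" "\<And>x. x \<in> A' \<Longrightarrow> \<exists>k. reach A' E k v' x" "w' \<le> card A'"
proof -
  let ?C = "region n h v u E" and ?C' = "region n h v' u' E"
  have V: "v \<in> {1..n}" "u \<in> {1..n}" "v \<noteq> u" "v' \<in> {1..n}" "u' \<in> {1..n}" "v' \<noteq> u'"
    using ab by (auto simp: anchors_def)
  have br: "branch n w h k0 v u E" "branch n w h k0 v' u' E"
    and big: "big_side n h w' T v u E" "big_side n h w' T v' u' E"
    using a b by (auto simp: good_branch_def)
  obtain lev where lev: "hanging {1..n} E h v u ?C lev"
      using branch_hanging[OF br(1) V(1-3)] by blast
  obtain lev' where lev': "hanging {1..n} E h v' u' ?C' lev'"
      using branch_hanging[OF br(2) V(4-6)] by blast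
  obtain A where A: "A \<subseteq> {1..n} - ?C" "v \<in> A" "\<forall>x\<in>A. \<exists>k. reach A E k v x" "w' \<le> card A"
    using big_side_set[OF big(1) V(1,3) hangingD(4)[OF lev]] by blast
  obtain A' where A': "A' \<subseteq> {1..n} - ?C'" "v' \<in> A'" "\<forall>x\<in>A'. \<exists>k. reach A' E k v' x" "w' \<le> card A'"
    using big_side_set[OF big(2) V(4,6) hangingD(4)[OF lev']] by blast
  have cC: "card ?C' < card A" "card ?C < card A'"
    using card_region[OF br(1)] card_region[OF br(2)] w A(4) A'(4) by auto
  have comp: "?C \<inter> ?C' = {} \<and> v \<notin> ?C' \<and> v' \<notin> ?C"
    by (rule hanging_compatible[OF lev lev' _ A(1,2) _ cC(1) A'(1,2) _ cC(2) ab(3)]) (use A(3)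
        A'(3) in auto)
  have "u \<in> ?C" "u' \<in> ?C'" by (rule hangingD(2)[OF lev], rule hangingD(2)[OF lev'])
  hence "u \<noteq> u'" "u \<noteq> v'" "u' \<noteq> v" using comp by blast+
  moreover have "A \<subseteq> {1..n}" "A' \<subseteq> {1..n}" using A(1) A'(1) by auto
  ultimately show thesis
    using that[OF lev lev'] comp A(3,4) A'(3,4) by blast
qed

text \<open>Both parts are instances of \<open>gen\<close> with different conditions
  \<open>P\<close> on the leftover vertices. The first is sharp up to \<open>1 + o(1)\<close> when
  \<open>v\<close> and \<open>v'\<close> differ, as the variance needs. The second gives up the
  factor \<open>(pois l k0) ^ 2\<close>, which is made good by taking \<open>r\<close> smaller by a
  constant.\<close>

lemma pair_prob:
  fixes l :: real
  assumes l: "0 \<le> l" "l \<le> real n" and n: "0 < n" and w: "2 \<le> w" "2 * h * w + w + 5 \<le> budget n" "(h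
      + 1) * w \<le> w'"
    and k0: "k0 \<le> budget n"
    and ab: "(v, u) \<in> anchors n" "(v', u') \<in> anchors n" "(v, u) \<noteq> (v', u')"
  defines "Z \<equiv> (l / n)\<^sup>2 * (distortion l n ^ (2 * h + 2) * (bp_height l w h)\<^sup>2)"
  shows "gnp_prob n (l / n) (\<lambda>E. good_branch n w h k0 w' T (v, u) E
      \<and> good_branch n w h k0 w' T (v', u') E)
      \<le> Z * (if v = v' then 1 else l / n + (distortion l n * pois l k0)\<^sup>2)"
    and "gnp_prob n (l / n) (\<lambda>E. good_branch n w h k0 w' T (v, u) E
        \<and> good_branch n w h k0 w' T (v', u') E \<and>
        close_branches n h r (v, u) (v', u') E)
      \<le> Z * (if v = v' then 1 else (\<Sum>i<r. l / n * l ^ i))"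
proof -
  have V: "v \<in> {1..n}" "u \<in> {1..n}" "v \<noteq> u" "v' \<in> {1..n}" "u' \<in> {1..n}" "v' \<noteq> u'"
    using ab by (auto simp: anchors_def)
  have p: "0 \<le> l / n" "l / n \<le> 1" using l n by auto
  have D: "1 \<le> distortion l n" using l(1) by (rule distortion_ge_1)
  have Z: "0 \<le> Z" using D bp_height_nonneg[OF l(1) w(1)] by (simp add: Z_def)
  let ?A = "\<lambda>E. good_branch n w h k0 w' T (v, u) E \<and> good_branch n w h k0 w' T (v', u') E"
  let ?U = "\<lambda>E. {1..n} - {v, v'} - region n h v u E - region n h v' u' E"
  have gen: "gnp_prob n (l / n) (\<lambda>E. ?A E \<and> X E) \<le> Z * s"
    if XP: "\<And>E lev lev'. ?A E \<Longrightarrow> X E \<Longrightarrow> hanging {1..n} E h v u (region n h v u E) lev \<Longrightarrow>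
          hanging {1..n} E h v' u' (region n h v' u' E) lev' \<Longrightarrow>
          v \<notin> region n h v' u' E \<Longrightarrow> v' \<notin> region n h v u E \<Longrightarrow> P (?U E) E"
      and dep: "\<And>U. U \<inter> {v, v'} = {} \<Longrightarrow> depends_on (P U) (edges_within (U \<union> {v, v'}))"
      and P: "\<And>U. U \<subseteq> {1..n} \<Longrightarrow> U \<inter> {v, v'} = {} \<Longrightarrow> n \<le> card U + budget n
          \<Longrightarrow> gnp_prob n (l / n) (P U) \<le> s"
      and s: "0 \<le> s"
    for X P s
  proof (cases "u \<noteq> u' \<and> u \<noteq> v' \<and> u' \<noteq> v")
    case True
    have "gnp_prob n (l / n) (\<lambda>E. ?A E \<and> X E) \<le> gnp_prob n (l / n) (joint_branch n w h P v u v' u')"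
    proof (rule gnp_prob_mono)
      fix E assume E: "?A E \<and> X E"
      show "joint_branch n w h P v u v' u' E"
      proof (rule good_branches_compatible[OF conjunct1[OF conjunct1[OF E]] conjunct2[OF
          conjunct1[OF E]] ab w(3)])
        fix lev lev'
        assume *: "hanging {1..n} E h v u (region n h v u E) lev" "hanging {1..n} E h v' u'
            (region n h v' u' E) lev'"
          "region n h v u E \<inter> region n h v' u' E
              = {}" "v \<notin> region n h v' u' E" "v' \<notin> region n h v u E"
        show ?thesis
        proof (rule joint_branchI[OF _ _ V(3,6) *(3-5)])
          show "P (?U E) E" using XP[OF _ _ *(1,2,4,5)] E by blast
        qed (use E in \<open>auto simp: good_branch_def\<close>)
      qed
    qed
    also have "\<dots> \<le> (l / n)\<^sup>2 * (distortion l n ^ (2 * h + 2) * (bp_height l w h)\<^sup>2 * s)"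
      by (rule joint_branch_prob[OF l n w(1,2) s dep P]) (use V True in auto)
    finally show ?thesis by (simp add: Z_def mult_ac)
  next
    case False
    have "gnp_prob n (l / n) (\<lambda>E. ?A E \<and> X E) = 0"
    proof (rule gnp_prob_eq_0)
      fix E
      show "\<not> (?A E \<and> X E)"
      proof
        assume E: "?A E \<and> X E"
        show False
          by (rule good_branches_compatible[OF conjunct1[OF conjunct1[OF E]] conjunct2[OF
              conjunct1[OF E]] ab w(3)])
             (use False in blast)
      qed
    qed
    thus ?thesis using Z s by simp
  qed
  have triv: "gnp_prob n (l / n) (\<lambda>E. ?A E \<and> X E) \<le> Z * 1" for X
    by (rule gen[where P = "\<lambda>_ _. True"]) auto
  show "gnp_prob n (l / n) ?A \<le> Z * (if v = v' then 1 else l / n + (distortion l n * pois l k0)\<^sup>2)"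
  proof (cases "v = v'")
    case True
    thus ?thesis using triv[of "\<lambda>_. True"] by simp
  next
    case False
    \<comment> \<open>Unless the anchors are adjacent, both degree conditions carry over to the
      leftover vertices, where they are independent.\<close>
    let ?P = "\<lambda>U E. {v, v'} \<in> E \<or> (card (nbrs E {v} U) = k0 \<and> card (nbrs E {v'} U) = k0)"
    have "gnp_prob n (l / n) (\<lambda>E. ?A E \<and> True) \<le> Z * (l / n + (distortion l n * pois l k0)\<^sup>2)"
    proof (rule gen[where P = ?P])
      fix E lev lev'
      assume *: "?A E" "hanging {1..n} E h v u (region n h v u E) lev"
        "hanging {1..n} E h v' u' (region n h v' u' E) lev'" "v \<notin> region n h v' u' E" "v' \<notin> region
            n h v u E"
      have br: "branch n w h k0 v u E" "branch n w h k0 v' u' E" using *(1)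
          by (auto simp: good_branch_def)
      have "card (nbrs E {v} (?U E)) = k0 \<and> card (nbrs E {v'} (?U E)) = k0" if "{v, v'} \<notin> E"
      proof
        show "card (nbrs E {v} (?U E)) = k0"
          by (rule branch_degree[OF br(1) *(3) V(1,3) False that *(4)])
        have "{v', v} \<notin> E" using that by (simp add: insert_commute)
        hence "card (nbrs E {v'} ({1..n} - {v', v} - region n h v' u' E - region n h v u E)) = k0"
          using False by (intro branch_degree[OF br(2) *(2) V(4,6) _ _ *(5)]) auto
        moreover have "{1..n} - {v', v} - region n h v' u' E - region n h v u E = ?U E" by auto
        ultimately show "card (nbrs E {v'} (?U E)) = k0" by simp
      qed
      thus "?P (?U E) E" by blast
    next
      fix U :: "nat set" assume U: "U \<inter> {v, v'} = {}"
      have nb: "depends_on (\<lambda>E. card (nbrs E {x} U) = k0) (edges_within (U \<union> {v, v'}))"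
          if "x \<in> {v, v'}" for x
        using depends_on_nbrs[of "\<lambda>A. card A = k0" "{x}" U]
        by (rule depends_on_mono) (use that in \<open>auto simp: crossing_def edges_within_def\<close>)
      show "depends_on (?P U) (edges_within (U \<union> {v, v'}))"
        by (intro depends_on_disj depends_on_conj nb depends_on_edge) (auto simp: edges_within_def)
      assume U1: "U \<subseteq> {1..n}" "n \<le> card U + budget n"
      have "gnp_prob n (l / n) (?P U) \<le> gnp_prob n (l / n) (\<lambda>E. {v, v'} \<in> E) +
          gnp_prob n (l / n) (\<lambda>E. card (nbrs E {v} U) = k0 \<and> card (nbrs E {v'} U) = k0)"
        by (rule gnp_prob_disj)
      also have "gnp_prob n (l / n) (\<lambda>E. {v, v'} \<in> E) = l / n"
        using V False p by (intro gnp_prob_edge doubleton_possible_edge) auto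
      also have "gnp_prob n (l / n) (\<lambda>E. card (nbrs E {v} U) = k0 \<and> card (nbrs E {v'} U) = k0) =
         gnp_prob n (l / n) (\<lambda>E. card (nbrs E {v} U)
             = k0) * gnp_prob n (l / n) (\<lambda>E. card (nbrs E {v'} U) = k0)"
        by (rule gnp_prob_indep[OF depends_on_nbrs[of "\<lambda>A. card A
            = k0" "{v}" U] depends_on_nbrs[of "\<lambda>A. card A = k0" "{v'}" U]])
           (use U False in \<open>auto simp: crossing_def doubleton_eq_iff\<close>)
      also have "\<dots> \<le> (distortion l n * pois (l * card {v}) k0) * (distortion l n * pois (l * card
          {v'}) k0)"
        using l n U U1 V k0 w D by (intro mult_mono prob_card_nbrs_upper) (auto simp: pois_nonneg)
      finally show "gnp_prob n (l / n) (?P U) \<le> l / n + (distortion l n * pois l k0)\<^sup>2"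
        by (simp add: power2_eq_square)
    qed (use p in auto)
    thus ?thesis using False by simp
  qed
  show "gnp_prob n (l / n) (\<lambda>E. good_branch n w h k0 w' T (v, u) E
      \<and> good_branch n w h k0 w' T (v', u') E \<and>
        close_branches n h r (v, u) (v', u') E) \<le> Z * (if v = v' then 1 else (\<Sum>i<r. l / n * l ^ i))"
  proof (cases "v = v'")
    case True
    thus ?thesis using triv[of "close_branches n h r (v, u) (v', u')"] by (simp add: conj_assoc)
  next
    case False
    \<comment> \<open>The vertex \<open>v'\<close> is put back among the unexplored ones; a walk
      outside the branches then places it in one of the layers 1 to \<open>r\<close> around
      \<open>v\<close>.\<close>
    let ?P = "\<lambda>U E. \<exists>i\<in>{..<r}. v' \<in> layer E (Suc i) {v} (insert v' U)"
    have "gnp_prob n (l / n) (\<lambda>E. ?A E \<and> close_branches n h r (v, u) (v', u') E)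
        \<le> Z * (\<Sum>i<r. l / n * l ^ i)"
    proof (rule gen[where P = ?P])
      fix E lev lev'
      assume *: "close_branches n h r (v, u) (v', u') E" "hanging {1..n} E h v u (region n h v u
          E) lev"
        "hanging {1..n} E h v' u' (region n h v' u' E) lev'" "v \<notin> region n h v' u' E" "v' \<notin> region
            n h v u E"
      let ?W = "{1..n} - region n h v u E - region n h v' u' E"
      have "reach ?W E r v v'" using *(1) by (simp add: close_branches_def)
      from reach_layer[OF this] obtain j where j: "j \<le> r" "v' \<in> layer E j {v} (?W - {v})" by blast
      have "?W - {v} = insert v' (?U E)"
        using V False *(5) hangingD(4)[OF *(3)] by auto
      moreover have "j \<noteq> 0" using j False by (intro notI) simp
      then obtain i where "j = Suc i" by (cases j) auto
      ultimately show "?P (?U E) E" using j by (intro bexI[of _ i]) (auto simp del: layer.simps)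
    next
      fix U :: "nat set" assume U: "U \<inter> {v, v'} = {}"
      have dl: "depends_on (\<lambda>E. v' \<in> layer E (Suc i) {v} (insert v' U)) (edges_within (U \<union> {v,
          v'}))" for i
        using depends_on_layer[of "\<lambda>A _. v' \<in> A" "Suc i" "{v}" "insert v' U"]
        by (rule depends_on_mono) (auto intro!: edges_within_mono)
      have "depends_on (\<lambda>E. \<not> (\<forall>i\<in>{..<r}. \<not> v' \<in> layer E (Suc i) {v} (insert v' U))) (edges_within
          (U \<union> {v, v'}))"
        by (intro depends_on_not depends_on_ball dl)
      thus "depends_on (?P U) (edges_within (U \<union> {v, v'}))" by (simp del: layer.simps)
      assume U1: "U \<subseteq> {1..n}"
      have "gnp_prob n (l / n) (?P U) \<le> (\<Sum>i\<in>{..<r}. gnp_prob n (l / n) (\<lambda>E. v' \<in> layer E (Suc i)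
          {v} (insert v' U)))"
        by (rule gnp_prob_Bex) simp
      also have "\<dots> \<le> (\<Sum>i\<in>{..<r}. real (card {v}) * (l / n * l ^ i))"
        using l n V U U1 False by (intro sum_mono layer_hit_prob) auto
      finally show "gnp_prob n (l / n) (?P U) \<le> (\<Sum>i<r. l / n * l ^ i)" by simp
    qed (use p l in \<open>auto intro!: sum_nonneg\<close>)
    thus ?thesis using False by (simp add: conj_assoc)
  qed
qed

text \<open>At most \<open>n ^ 3\<close> pairs share their first vertex, so these contribute a lower
  order than the \<open>n ^ 4\<close> pairs in total.\<close>

lemma sum_anchor_pairs_le:
  fixes X Y :: real
  assumes "0 \<le> X" "0 \<le> Y"
  shows "(\<Sum>a\<in>anchors n. \<Sum>b\<in>anchors n - {a}. if fst a = fst b then X else Y) \<le> (real n)^3 * X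
      + (real n)^4 * Y"
proof -
  let ?f = "\<lambda>v v'. if v = v' then X else Y"
  have "(\<Sum>a\<in>anchors n. \<Sum>b\<in>anchors n - {a}. ?f (fst a) (fst b)) \<le>
     (\<Sum>a\<in>{1..n} \<times> {1..n}. \<Sum>b\<in>{1..n} \<times> {1..n}. ?f (fst a) (fst b))"
    using assms by (intro sum_mono2 order_trans[OF sum_mono sum_mono2] order_refl)
      (auto simp: anchors_def intro!: sum_mono2 sum_nonneg)
  also have "\<dots> = (\<Sum>v\<in>{1..n}. \<Sum>u\<in>{1..n}. \<Sum>v'\<in>{1..n}. \<Sum>u'\<in>{1..n}. ?f v v')"
    by (simp add: sum.cartesian_product')
  also have "\<dots> = (real n)\<^sup>2 * (\<Sum>v\<in>{1..n}. \<Sum>v'\<in>{1..n}. ?f v v')"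
    by (simp add: sum_distrib_left[symmetric] power2_eq_square mult_ac)
  also have "(\<Sum>v\<in>{1..n}. \<Sum>v'\<in>{1..n}. ?f v v') \<le> (\<Sum>v\<in>{1..n}. X + n * Y)"
  proof (intro sum_mono)
    fix v assume v: "v \<in> {1..n}"
    have "(\<Sum>v'\<in>{1..n}. ?f v v') = X + (\<Sum>v'\<in>{1..n} - {v}. Y)"
      using v by (subst sum.remove[of _ v]) auto
    also have "\<dots> \<le> X + n * Y" using assms v by (auto intro!: mult_right_mono)
    finally show "(\<Sum>v'\<in>{1..n}. ?f v v') \<le> X + n * Y" .
  qed
  also have "(real n)\<^sup>2 * (\<Sum>v\<in>{1..n}. X + n * Y) = (real n)^3 * X + (real n)^4 * Y"
    by (simp add: algebra_simps eval_nat_numeral)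
  finally show ?thesis by (simp add: mult_left_mono)
qed

lemma good_branch_prob_lower:
  fixes l x :: real
  assumes l: "0 \<le> l" "l \<le> real n" "2 * l * budget n \<le> n" "4 * budget n \<le> n" and n: "0 < n"
    and w: "2 \<le> w" "h * w + w + k0 + T * w' + 2 \<le> budget n" "k0 < w'" "w' \<le> budget n"
    and x: "(pgf l ^^ T) (exp (- (1 / real w'))) \<le> x"
    and a: "a \<in> anchors n"
  shows "(l / n) * (bp_height l w h * pois l k0) *
     ((1 - l / n) ^ (w * h) / distortion l n ^ (h + 2) - distortion l n ^ (h + T
         + 2) * (exp 1 * x ^ k0))
     \<le> gnp_prob n (l / n) (good_branch n w h k0 w' (Suc T) a)"
proof -
  obtain v u where vu: "a = (v, u)" "v \<in> {1..n}" "u \<in> {1..n}" "v \<noteq> u"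
    using a by (cases a) (auto simp: anchors_def)
  let ?S = "\<lambda>E. branch n w h k0 v u E \<and> \<not> big_side n h w' (Suc T) v u E"
  have "(l / n) * ((1 - l / n) ^ (w * h) / distortion l n ^ (h + 2) * (bp_height l w h * pois l k0))
     \<le> gnp_prob n (l / n) (branch n w h k0 v u)"
    using l n w vu by (intro branch_prob_lower) auto
  moreover have "gnp_prob n (l / n) ?S \<le>
     (l / n) * (distortion l n ^ (h + T + 2) * (bp_height l w h * pois l k0 * (exp 1 * x ^ k0)))"
    using l n w x vu by (intro small_side_prob) auto
  moreover have "gnp_prob n (l / n) (branch n w h k0 v u) - gnp_prob n (l / n) ?S \<le>
     gnp_prob n (l / n) (\<lambda>E. branch n w h k0 v u E \<and> \<not> ?S E)"
    by (rule gnp_prob_diff)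
  moreover have "\<dots> \<le> gnp_prob n (l / n) (good_branch n w h k0 w' (Suc T) a)"
    by (rule gnp_prob_mono) (auto simp: good_branch_def vu)
  moreover have "(l / n) * (bp_height l w h * pois l k0) *
     ((1 - l / n) ^ (w * h) / distortion l n ^ (h + 2) - distortion l n ^ (h + T
         + 2) * (exp 1 * x ^ k0)) =
     (l / n) * ((1 - l / n) ^ (w * h) / distortion l n ^ (h + 2) * (bp_height l w h * pois l k0)) -
     (l / n) * (distortion l n ^ (h + T + 2) * (bp_height l w h * pois l k0 * (exp 1 * x ^ k0)))"
    by (simp add: right_diff_distrib mult_ac)
  ultimately show ?thesis by linarith
qed

text \<open>The large sides make the explorations from both anchors reach size \<open>w\<close>, so
  the anchors are connected and the tips of the branches have finite distance;
  \<open>hanging_distance\<close> bounds it from below.\<close>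

lemma diam_ge_of_far_branches:
  assumes w: "2 \<le> w" and ev: "\<not> thin_event n w H E" "\<not> jump_event n w W H E"
      "\<not> separated_event n w W H (\<lambda>_ _. r0) E"
    and ab: "a \<in> anchors n" "b \<in> anchors n" "a \<noteq> b"
    and good: "good_branch n w h k0 ((H + 1) * w) T a E" "good_branch n w h k0 ((H + 1) * w) T b E"
    and h: "h \<le> H" and far: "\<not> close_branches n h r a b E"
  shows "2 * h + r + 3 \<le> graph_diam {1..n} E"
proof -
  obtain v u v' u' where vu: "a = (v, u)" "b = (v', u')" by (metis surj_pair)
  have hw: "(h + 1) * w \<le> (H + 1) * w" using h by (intro mult_right_mono) auto
  let ?V = "{1..n}" and ?C = "region n h v u E" and ?C' = "region n h v' u' E"
  show ?thesis
  proof (rule good_branches_compatible[OF good[unfolded vu] ab[unfolded vu] hw])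
    fix lev lev' A A'
    assume ha: "hanging ?V E h v u ?C lev" and hb: "hanging ?V E h v' u' ?C' lev'"
      and dj: "?C \<inter> ?C' = {}" "v \<notin> ?C'" "v' \<notin> ?C"
      and A: "A \<subseteq> ?V" "\<And>x. x \<in> A \<Longrightarrow> \<exists>k. reach A E k v x" "(H + 1) * w \<le> card A"
      and A': "A' \<subseteq> ?V" "\<And>x. x \<in> A' \<Longrightarrow> \<exists>k. reach A' E k v' x" "(H + 1) * w \<le> card A'"
    have cA: "H * w < card A" "H * w < card A'" using A(3) A'(3) w by (auto simp: algebra_simps)
    have V: "v \<in> ?V" "v' \<in> ?V" by (rule hangingD(3)[OF ha], rule hangingD(3)[OF hb])
    obtain k where k: "reach ?V E k v v'"
      using hits_connected[OF w ev V big_set_hits[OF A(1,2) cA(1)] big_set_hits[OF A'(1,2) cA(2)]]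
          by blast
    obtain x where x: "x \<in> ?C" "lev x = h" using hangingD(9)[OF ha] by blast
    obtain y where y: "y \<in> ?C'" "lev' y = h" using hangingD(9)[OF hb] by blast
    have uV: "u \<in> ?V" "u' \<in> ?V" using hangingD(1,2)[OF ha] hangingD(1,2)[OF hb] by auto
    have "reach ?V E (lev x) u x"
      by (rule reach_mono_set[OF hangingD(7)[OF ha x(1)] hangingD(1)[OF ha]])
    from reach_trans[OF reach_edge[OF hangingD(5)[OF ha] V(1) uV(1)] this]
    have vx: "reach ?V E (1 + lev x) v x" .
    have "reach ?V E (lev' y) u' y"
      by (rule reach_mono_set[OF hangingD(7)[OF hb y(1)] hangingD(1)[OF hb]])
    from reach_trans[OF reach_edge[OF hangingD(5)[OF hb] V(2) uV(2)] this]
    have vy: "reach ?V E (1 + lev' y) v' y" .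
    have xy: "reach ?V E ((1 + lev x) + k + (1 + lev' y)) x y"
      by (rule reach_trans[OF reach_trans[OF reach_sym[OF vx] k] vy])
    have far': "\<not> reach (?V - ?C - ?C') E r v v'" using far by (simp add: close_branches_def vu)
    show ?thesis
      by (rule graph_diam_ge[OF _ xy hanging_distance[OF ha hb dj far' x y]]) auto
  qed
qed

text \<open>In units of \<open>\<epsilon> * m\<^sup>2\<close>, the variance is at most
  \<open>1 + 6\<close> and \<open>SB\<close> at most 2; this gives
  \<open>4 * 7 + 8 * 2 = 44\<close>.\<close>

lemma variance_arithmetic:
  fixes m \<mu> \<epsilon> S2 SB :: real
  assumes \<epsilon>: "0 < \<epsilon>" "\<epsilon> \<le> 1/4" and m: "\<mu> * (1 - \<epsilon>) \<le> m" "1 / \<epsilon> \<le> m" and \<mu>: "0 \<le> \<mu>"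
    and S: "S2 \<le> m + \<mu>\<^sup>2 * (1 + \<epsilon>)" "SB \<le> \<mu>\<^sup>2 * \<epsilon>"
  shows "4 * (S2 - m\<^sup>2) / m\<^sup>2 + 8 * SB / m\<^sup>2 \<le> 44 * \<epsilon>"
proof -
  have m0: "0 < m" using m(2) \<epsilon> by (smt (verit) divide_pos_pos)
  have "(\<mu> * (1 - \<epsilon>))\<^sup>2 \<le> m\<^sup>2" using m(1) \<mu> \<epsilon> by (intro power_mono) auto
  hence *: "\<mu>\<^sup>2 * (1 - \<epsilon>)\<^sup>2 \<le> m\<^sup>2" by (simp add: power_mult_distrib)
  have "\<epsilon> * \<epsilon> \<le> \<epsilon> * (1 / 4)" using \<epsilon> by (intro mult_left_mono) auto
  have "0 \<le> \<epsilon> * (3 - 11 * \<epsilon> + 6 * \<epsilon>\<^sup>2)" using \<epsilon>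
      by (intro mult_nonneg_nonneg) (auto intro: add_nonneg_nonneg)
  hence e1: "1 + \<epsilon> \<le> (1 + 6 * \<epsilon>) * (1 - \<epsilon>)\<^sup>2" by (simp add: algebra_simps power2_eq_square)
  have "(3 / 4)\<^sup>2 \<le> (1 - \<epsilon>)\<^sup>2" using \<epsilon> by (intro power_mono) auto
  hence e2: "1 \<le> 2 * (1 - \<epsilon>)\<^sup>2" by (simp add: power2_eq_square)
  have "\<mu>\<^sup>2 * (1 + \<epsilon>) \<le> \<mu>\<^sup>2 * ((1 + 6 * \<epsilon>) * (1 - \<epsilon>)\<^sup>2)" using e1 by (intro mult_left_mono) auto
  also have "\<dots> = (1 + 6 * \<epsilon>) * (\<mu>\<^sup>2 * (1 - \<epsilon>)\<^sup>2)" by simp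
  also have "\<dots> \<le> (1 + 6 * \<epsilon>) * m\<^sup>2" using * \<epsilon> by (intro mult_left_mono) auto
  finally have a: "\<mu>\<^sup>2 * (1 + \<epsilon>) \<le> (1 + 6 * \<epsilon>) * m\<^sup>2" .
  have "\<mu>\<^sup>2 * 1 \<le> \<mu>\<^sup>2 * (2 * (1 - \<epsilon>)\<^sup>2)" using e2 by (intro mult_left_mono) auto
  hence "\<mu>\<^sup>2 \<le> 2 * m\<^sup>2" using * by simp
  hence b: "\<mu>\<^sup>2 * \<epsilon> \<le> 2 * m\<^sup>2 * \<epsilon>" using \<epsilon> by (intro mult_right_mono) auto
  have "1 \<le> \<epsilon> * m" using m(2) \<epsilon> by (simp add: field_simps)
  hence "1 * m \<le> \<epsilon> * m * m" using m0 by (intro mult_right_mono) auto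
  hence c: "m \<le> \<epsilon> * m\<^sup>2" by (simp add: power2_eq_square mult_ac)
  have "4 * (S2 - m\<^sup>2) + 8 * SB \<le> 44 * \<epsilon> * m\<^sup>2" using S a b c by (simp add: algebra_simps)
  thus ?thesis using m0 by (simp add: add_divide_distrib[symmetric] divide_le_eq)
qed

text \<open>The constants are chosen in the order \<open>\<epsilon>\<close>, \<open>k0\<close>,
  \<open>K2\<close>, \<open>K\<close>: first the tolerance, then a degree that makes small sides
  rare, then the reductions of the distance between anchors and of the branch height, both of which
  must compensate the price \<open>\<tau>\<close> of that degree.\<close>

lemma diam_lower_tail:
  fixes l ls :: real
  assumes l: "1 < l" and ls: "0 < ls" "ls < 1" and q: "pgf l (ls / l) = ls / l" and \<eta>: "0 < \<eta>"
  shows "\<exists>C. \<forall>\<^sub>F n in sequentially. gnp_prob n (l / n) (\<lambda>E.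
     \<not> log l n + 2 * (ln n / ln (1 / ls)) - real C \<le> graph_diam {1..n} E) \<le> \<eta>"
proof -
  have l0: "0 < l" "0 \<le> l" using l by auto
  have ll: "0 < ln l" using l by simp
  have lls: "0 < ln (1 / ls)" using ls by simp
  have q01: "0 < ls / l" "ls / l < 1" using l ls by (auto simp: field_simps)
  define a where "a = ln (l / ls)"
  have a: "0 < a" unfolding a_def using l ls by (intro ln_gt_zero) (simp add: less_divide_eq)
  have ea: "exp (- a) = ls / l" using l0 ls by (simp add: a_def exp_minus)
  define \<epsilon> where "\<epsilon> = min (1 / 4) (\<eta> / 88)"
  define \<delta> where "\<delta> = \<epsilon> / 8"
  have \<epsilon>: "0 < \<epsilon>" "\<epsilon> \<le> 1 / 4" "44 * \<epsilon> \<le> \<eta> / 2" using \<eta> by (auto simp: \<epsilon>_def)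
  have \<delta>: "0 < \<delta>" "\<delta> \<le> 1 / 32" using \<epsilon> by (auto simp: \<delta>_def)
  define M where "M = nat \<lceil>2 * (l + 1)\<rceil>"
  have M: "2 * (l + 1) \<le> real M" unfolding M_def using l by linarith
  obtain K0 where K0: "\<forall>\<^sub>F n in sequentially. gnp_prob n (l / n) (\<lambda>E.
     thin_event n (width n) (horizon l ls K0 n) E \<or>
     jump_event n (width n) (M * width n) (horizon l ls K0 n) E \<or>
     separated_event n (width n) (M * width n) (horizon l ls K0 n) (\<lambda>_ _. n) E) \<le> \<eta> / 2"
    using connected_tail[OF l ls q M, of "\<eta> / 2"] \<eta> by auto
  obtain x where x: "ls / l < x" "x < 1"
    "\<And>w m. 1 \<le> w \<Longrightarrow> w \<le> l ^ m \<Longrightarrow> (pgf l ^^ m) (exp (- (1 / w))) \<le> x"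
    using pgf_iter_escape[OF l q01(2)] by blast
  have x0: "0 < x" using x q01 by simp
  obtain k0 where k0: "exp 1 * x ^ k0 \<le> \<delta>" using exists_power_le[OF x0 x(2) _ \<delta>(1), of "exp 1"] by
      auto
  define \<tau> where "\<tau> = pois l k0"
  have \<tau>: "0 < \<tau>" unfolding \<tau>_def by (rule pois_pos) fact
  \<comment> \<open>Shortening \<open>r\<close> by \<open>K2\<close> makes close pairs rare even
    relative to the factor \<open>\<tau>\<^sup>2\<close> that the bound for them does not
    contain.\<close>
  obtain K2 where K2: "l / (l - 1) * (1 / l) ^ K2 \<le> \<delta> * \<tau>\<^sup>2"
    using exists_power_le[of "1 / l" "l / (l - 1)" "\<delta> * \<tau>\<^sup>2"] l \<delta> \<tau> by auto
  obtain c where c: "0 < c" "\<And>h. c * (l * (ls / l)) ^ h \<le> (pgf l ^^ Suc h) 0 - (pgf l ^^ h) 0"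
    using extinction_gap_lower[OF l0(1) q q01(1)] l ls by auto
  \<comment> \<open>Lowering the height by \<open>K\<close> multiplies the expected number of
    branches by \<open>ls ^ (- K)\<close>, enough for the second moment method.\<close>
  obtain K where K: "2 * max 8 (1 / \<epsilon>) * ls ^ K \<le> l * \<tau> * (c * ls / 2)"
    using exists_power_le[OF ls, of "2 * max 8 (1 / \<epsilon>)" "l * \<tau> * (c * ls / 2)"] l \<tau> c ls by auto
  have "\<forall>\<^sub>F n::nat in sequentially. 2 \<le> ln n"
    "\<forall>\<^sub>F n::nat in sequentially. l \<le> n"
    "\<forall>\<^sub>F n::nat in sequentially. ln ((ln n ^ 2 + 1) * (ln n ^ 5 + 1)) / ln l + 1 \<le> ln n"
    "\<forall>\<^sub>F n::nat in sequentially. 2 * (ln n ^ 2 * (ln n ^ 5 + 1)) + (ln n ^ 5 + 1) + 5 + k0 +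
        ln n * ((ln n ^ 2 + 1) * (ln n ^ 5 + 1)) + (ln n ^ 2 + 1) * (ln n ^ 5 + 1) \<le> ln n ^ 9"
    "\<forall>\<^sub>F n::nat in sequentially. k0 + 1 \<le> ln n ^ 5"
    "\<forall>\<^sub>F n::nat in sequentially. 2 * l * (ln n ^ 9 + 1) \<le> n \<and> 4 * (ln n ^ 9 + 1) \<le> n"
    "\<forall>\<^sub>F n::nat in sequentially. (ln n ^ 5 + 1) * ln n ^ 2 * (l / n) \<le> \<delta>"
    "\<forall>\<^sub>F n::nat in sequentially. 1 / n \<le> \<delta> \<and> (1 + l) / (n * \<tau>\<^sup>2) \<le> \<delta>"
    "\<forall>\<^sub>F n::nat in sequentially. n * (ln n ^ 2 * exp (- (a * ln n ^ 5))) \<le> c * ls / 2"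
    "\<forall>\<^sub>F n::nat in sequentially. K \<le> ln n / ln (1 / ls) \<and> K2 + 1 \<le> ln n / ln l"
    subgoal by real_asymp
    subgoal by real_asymp
    subgoal using ll by real_asymp
    subgoal by real_asymp
    subgoal by real_asymp
    subgoal using l by (intro eventually_conj) real_asymp+
    subgoal using \<delta> by real_asymp
    subgoal using \<delta> \<tau> by (intro eventually_conj) real_asymp+
    subgoal using a c ls by real_asymp
    subgoal using ll lls by (intro eventually_conj) real_asymp+
    done
  hence "\<forall>\<^sub>F n in sequentially. gnp_prob n (l / n) (\<lambda>E.
     \<not> log l n + 2 * (ln n / ln (1 / ls)) - real (2 * K + K2) \<le> graph_diam {1..n} E) \<le> \<eta>"
    using K0 horizon_small[OF l ls, of K0 M] distortion_power_le[OF l0(1) \<delta>(1)]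
  proof eventually_elim
    case (elim n)
    define L where "L = ln (real n)"
    define w where "w = width n"
    define H where "H = horizon l ls K0 n"
    \<comment> \<open>Large enough to exceed every branch of height at most \<open>H\<close> and to
      force a layer of size \<open>w\<close> within radius \<open>H\<close>.\<close>
    define w' where "w' = (H + 1) * w"
    define T where "T = nat \<lceil>log l w'\<rceil>"
    define h where "h = extinction_time ls n - K"
    define r where "r = nat \<lfloor>log l n\<rfloor> - K2"
    define D where "D = distortion l n"
    define \<beta> where "\<beta> = bp_height l w h"
    define p where "p = l / n"
    have n0: "0 < n" using elim(1) by (cases "n = 0") auto
    have L2: "2 \<le> L" using elim(1) by (simp add: L_def)
    have L1: "1 \<le> ln (real n)" using elim(1) by simp
    have w2: "2 \<le> w" unfolding w_def using elim(1) by (rule width_ge_2)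
    have wL: "L ^ 5 \<le> w" "w \<le> L ^ 5 + 1" unfolding w_def L_def using width_bounds[OF L1] by auto
    have bL: "L ^ 9 \<le> budget n" "budget n \<le> L ^ 9 + 1" unfolding L_def
        using budget_bounds[OF L1] by auto
    have HL: "H \<le> L ^ 2" using elim(12) by (simp add: H_def L_def)
    have hH: "h \<le> H" by (simp add: h_def H_def horizon_def)
    hence hL: "h \<le> L ^ 2" using HL by linarith
    have w'L: "real w' \<le> (L ^ 2 + 1) * (L ^ 5 + 1)"
      unfolding w'_def of_nat_mult using HL wL by (intro mult_mono) auto
    have ww': "w \<le> w'" by (simp add: w'_def)
    have w'1: "1 \<le> real w'" using ww' w2 by simp
    have lgw': "0 \<le> log l w'" using l w'1 by simp
    have "log l w' \<le> ln ((L ^ 2 + 1) * (L ^ 5 + 1)) / ln l"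
      unfolding log_def using ll w'L w'1 by (intro divide_right_mono) (auto intro!: ln_mono)
    moreover have "T \<le> log l w' + 1" unfolding T_def using lgw' by linarith
    ultimately have TL: "T \<le> L" using elim(3) unfolding L_def by linarith
    have "log l w' \<le> T" unfolding T_def by linarith
    hence w'T: "w' \<le> l ^ T" using l w'1 by (simp add: log_le_iff powr_realpow)
    have hw: "real (h * w) \<le> L ^ 2 * (L ^ 5 + 1)"
      unfolding of_nat_mult using hL wL by (intro mult_mono) auto
    have Tw': "real (T * w') \<le> L * ((L ^ 2 + 1) * (L ^ 5 + 1))"
      unfolding of_nat_mult using TL w'L L2 by (intro mult_mono) auto
    have e4: "2 * (L ^ 2 * (L ^ 5 + 1)) + (L ^ 5 + 1) + 5 + k0 +
        L * ((L ^ 2 + 1) * (L ^ 5 + 1)) + (L ^ 2 + 1) * (L ^ 5 + 1) \<le> L ^ 9"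
      using elim(4) by (simp add: L_def)
    have "0 \<le> L * ((L ^ 2 + 1) * (L ^ 5 + 1))" "0 \<le> (L ^ 2 + 1) * (L ^ 5 + 1)" "0 \<le> L ^ 2 * (L ^ 5
        + 1)" "0 \<le> L ^ 5"
      using L2 by auto
    note nn = this
    have "real (2 * h * w + w + 5) = 2 * real (h * w) + real w + 5" by simp
    hence "real (2 * h * w + w + 5) \<le> budget n" using hw wL bL e4 nn by linarith
    hence B1: "2 * h * w + w + 5 \<le> budget n" by (simp only: of_nat_le_iff)
    have "real (h * w + w + k0 + T * w' + 2) = real (h * w) + real w + real k0 + real (T * w')
        + 2" by simp
    hence "real (h * w + w + k0 + T * w' + 2) \<le> budget n" using hw wL bL e4 nn Tw' by linarith
    hence B2: "h * w + w + k0 + T * w' + 2 \<le> budget n" by (simp only: of_nat_le_iff)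
    have "real w' \<le> budget n" using w'L bL e4 nn by linarith
    hence B3: "w' \<le> budget n" by simp
    have "real (k0 + 1) \<le> real w" using elim(5) wL by (simp add: L_def)
    hence B4: "k0 < w'" using ww' by simp
    have lb: "2 * l * budget n \<le> n" "4 * budget n \<le> n"
    proof -
      have "2 * l * budget n \<le> 2 * l * (L ^ 9 + 1)" using bL l by (intro mult_left_mono) auto
      thus "2 * l * budget n \<le> n" using elim(6) by (simp add: L_def)
      have "real (4 * budget n) \<le> n" using elim(6) bL by (simp add: L_def)
      thus "4 * budget n \<le> n" by (simp only: of_nat_le_iff)
    qed
    have D1: "1 \<le> D" unfolding D_def by (rule distortion_ge_1) (use l in simp)
    have Dk: "D ^ k \<le> 1 + \<delta>" if "real k \<le> 9 * L ^ 2" for k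
      using elim(13) that by (simp add: D_def L_def)
    have "2 * L \<le> L * L" using L2 by (intro mult_right_mono) auto
    hence LL: "2 * L \<le> L ^ 2" by (simp add: power2_eq_square)
    have Da: "D ^ (h + 2) \<le> 1 + \<delta>" "D ^ (h + T + 2) \<le> 1 + \<delta>" "D ^ (2 * h + 2) \<le> 1 + \<delta>" "D ^ (2 * h
        + 2) * D ^ 2 \<le> 1 + \<delta>"
      unfolding power_add[symmetric] by (rule Dk; use hL TL LL L2 in simp)+
    have p: "0 \<le> p" "p \<le> 1" using elim(2) n0 l by (auto simp: p_def)
    have \<beta>0: "0 \<le> \<beta>" unfolding \<beta>_def by (rule bp_height_nonneg) (use l w2 in auto)
    define \<mu> where "\<mu> = n * l * \<beta> * \<tau>"
    have \<mu>0: "0 \<le> \<mu>" using l \<beta>0 \<tau> by (simp add: \<mu>_def)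
    have np: "n * p = l" using n0 by (simp add: p_def)

    \<comment> \<open>\<open>\<mu>\<close> is the Poisson value of the expected number of good
      branches: about \<open>n ^ 2\<close> anchors, each with probability
      \<open>l / n * \<beta> * \<tau>\<close>. In the lower bound for \<open>\<beta>\<close> the
      error \<open>h * (ls / l) ^ w\<close> is superpolynomially small because
      \<open>w >= ln n ^ 5\<close>.\<close>
    have \<mu>_big: "2 * max 8 (1 / \<epsilon>) \<le> \<mu>"
    proof -
      have Ke: "K \<le> extinction_time ls n" 
        using extinction_time_bounds(1)[OF ls n0] elim(10) by linarith
      have b1: "c * ls ^ h - h * (ls / l) ^ w \<le> \<beta>"
        using bp_iter_extinct_lower[OF l0(2) q less_imp_le[OF q01(1)] less_imp_le[OF q01(2)], of 1
            h w] c(2)[of h] l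
        unfolding \<beta>_def bp_height_def by (simp del: funpow.simps)
      have b2: "ls / ls ^ K \<le> n * ls ^ h"
      proof -
        have "ls powr (ln n / ln (1 / ls) + 1) \<le> ls powr extinction_time ls n"
          using extinction_time_bounds(2)[OF ls n0] ls by (intro powr_mono') auto
        also have "\<dots> = ls ^ extinction_time ls n" using ls by (simp add: powr_realpow)
        also have "\<dots> = ls ^ h * ls ^ K" using Ke by (simp add: h_def power_add[symmetric])
        finally have "ls powr (ln n / ln (1 / ls) + 1) \<le> ls ^ h * ls ^ K" .
        moreover have "ls powr (ln n / ln (1 / ls) + 1) = ls / n"
        proof -
          have "ln (1 / ls) = - ln ls" using ls by (simp add: ln_div)
          hence "ls powr (ln n / ln (1 / ls)) = exp (- ln n)" using ls lls by (simp add: powr_def)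
          also have "\<dots> = 1 / n" using n0 by (simp add: exp_minus inverse_eq_divide)
          finally show ?thesis using ls by (simp add: powr_add)
        qed
        ultimately have "ls / n \<le> ls ^ h * ls ^ K" by linarith
        thus ?thesis using n0 ls by (simp add: field_simps)
      qed
      have b3: "n * (h * (ls / l) ^ w) \<le> c * ls / 2"
      proof -
        have "(ls / l) ^ w = exp (- (a * w))"
          by (simp add: ea[symmetric] exp_of_nat_mult[symmetric] mult.commute)
        also have "\<dots> \<le> exp (- (a * L ^ 5))" using a wL by simp
        finally have "n * (h * (ls / l) ^ w) \<le> n * (L ^ 2 * exp (- (a * L ^ 5)))"
          using hL q01 by (intro mult_left_mono mult_mono) auto
        thus ?thesis using elim(9) by (simp add: L_def)
      qed
      have "ls ^ K \<le> 1" using ls by (simp add: power_le_one)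
      hence "c * ls / 2 \<le> c * ls / 2 / ls ^ K" using c ls by (simp add: field_simps)
      moreover have "c * (ls / ls ^ K) = 2 * (c * ls / 2 / ls ^ K)" by simp
      ultimately have "c * ls / 2 / ls ^ K \<le> c * (ls / ls ^ K) - c * ls / 2" by linarith
      also have "\<dots> \<le> c * (n * ls ^ h) - n * (h * (ls / l) ^ w)"
        using b2 b3 c by (intro diff_mono mult_left_mono) auto
      also have "\<dots> = n * (c * ls ^ h - h * (ls / l) ^ w)" by (simp add: algebra_simps)
      also have "\<dots> \<le> n * \<beta>" using b1 by (intro mult_left_mono) auto
      finally have "l * \<tau> * (c * ls / 2 / ls ^ K) \<le> l * \<tau> * (n * \<beta>)" using l \<tau>
          by (intro mult_left_mono) auto
      moreover have "2 * max 8 (1 / \<epsilon>) \<le> l * \<tau> * (c * ls / 2 / ls ^ K)"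
        using K ls by (simp add: field_simps)
      ultimately show ?thesis by (simp add: \<mu>_def mult_ac)
    qed

    let ?A = "good_branch n w h k0 w' (Suc T)" and ?B = "close_branches n h r"
    define m where "m = (\<Sum>i\<in>anchors n. gnp_prob n p (?A i))"
    define Z where "Z = p\<^sup>2 * (D ^ (2 * h + 2) * \<beta>\<^sup>2)"
    have Z0: "0 \<le> Z" using D1 by (simp add: Z_def)
    have m_ge: "\<mu> * (1 - \<epsilon>) \<le> m"
    proof -
      define \<rho> where "\<rho> = (1 - p) ^ (w * h) / D ^ (h + 2) - D ^ (h + T + 2) * (exp 1 * x ^ k0)"
      \<comment> \<open>One \<open>\<delta>\<close> is lost by avoiding the anchor, one by the
        distortion, and two by branches with a small side.\<close>
      have \<rho>: "1 - 4 * \<delta> \<le> \<rho>"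
      proof -
        have "1 + real (w * h) * (- p) \<le> (1 + (- p)) ^ (w * h)"
          by (rule Bernoulli_inequality) (use p in simp)
        moreover have "real (w * h) * p \<le> (L ^ 5 + 1) * L ^ 2 * p"
          unfolding of_nat_mult using wL hL p by (intro mult_right_mono mult_mono) auto
        ultimately have 1: "1 - \<delta> \<le> (1 - p) ^ (w * h)" using elim(7) by (simp add: L_def p_def)
        have "(1 - 2 * \<delta>) * D ^ (h + 2) \<le> (1 - 2 * \<delta>) * (1 + \<delta>)" using Da \<delta>
            by (intro mult_left_mono) auto
        also have "\<dots> \<le> 1 - \<delta>" using \<delta> by (simp add: algebra_simps)
        finally have "(1 - 2 * \<delta>) * D ^ (h + 2) \<le> (1 - p) ^ (w * h)" using 1 by linarith
        hence 2: "1 - 2 * \<delta> \<le> (1 - p) ^ (w * h) / D ^ (h + 2)" using D1 by (simp add: field_simps)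
        have "D ^ (h + T + 2) * (exp 1 * x ^ k0) \<le> (1 + \<delta>) * \<delta>"
          using Da k0 \<delta> x0 by (intro mult_mono) auto
        also have "\<dots> \<le> 2 * \<delta>" using \<delta> by (intro mult_right_mono) auto
        finally show ?thesis using 2 by (simp add: \<rho>_def)
      qed
      have each: "p * (\<beta> * \<tau>) * \<rho> \<le> gnp_prob n p (?A i)" if "i \<in> anchors n" for i
        unfolding p_def \<beta>_def \<tau>_def \<rho>_def D_def
      proof (rule good_branch_prob_lower)
        show "(pgf l ^^ T) (exp (- (1 / real w'))) \<le> x" by (rule x(3)[OF w'1 w'T])
      qed (use l elim(2) lb n0 w2 B2 B3 B4 that in auto)
      have "\<mu> * (1 - \<epsilon>) \<le> \<mu> * ((1 - \<delta>) * (1 - 4 * \<delta>))"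
        using \<mu>0 \<delta> by (intro mult_left_mono) (auto simp: \<delta>_def algebra_simps)
      also have "\<dots> \<le> \<mu> * ((1 - 1 / n) * \<rho>)"
        using \<mu>0 \<delta> \<rho> elim(8) n0 by (intro mult_left_mono mult_mono) auto
      also have "\<dots> = real (card (anchors n)) * (p * (\<beta> * \<tau>) * \<rho>)"
      proof -
        have "real (card (anchors n)) = (n * (1 - 1 / n)) * real n"
          using n0 by (simp add: card_anchors of_nat_diff algebra_simps)
        moreover have "\<mu> * ((1 - 1 / n) * \<rho>) = ((n * (1 - 1 / n)) * real n) * (p * (\<beta> * \<tau>) * \<rho>)"
          unfolding \<mu>_def np[symmetric] by (simp only: mult_ac)
        ultimately show ?thesis by simp
      qed
      also have "\<dots> = (\<Sum>i\<in>anchors n. p * (\<beta> * \<tau>) * \<rho>)" by simp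
      also have "\<dots> \<le> m" unfolding m_def by (intro sum_mono each)
      finally show ?thesis .
    qed
    have m_big: "max 8 (1 / \<epsilon>) \<le> m"
    proof -
      have "\<mu> * (1 / 2) \<le> \<mu> * (1 - \<epsilon>)" using \<epsilon> \<mu>0 by (intro mult_left_mono) auto
      thus ?thesis using m_ge \<mu>_big by linarith
    qed
    have hw': "(h + 1) * w \<le> w'" unfolding w'_def using hH by (intro mult_right_mono) auto
    have k0b: "k0 \<le> budget n" using B2 by simp
    \<comment> \<open>Puts all pair sums in units of \<open>\<mu>\<^sup>2\<close>, so that a bound
      \<open>n ^ 4 * \<tau>\<^sup>2\<close> for \<open>X\<close> means asymptotic
      independence.\<close>
    have Zn: "Z * X = \<mu>\<^sup>2 * (D ^ (2 * h + 2) * (X / (real n ^ 4 * \<tau>\<^sup>2)))" for X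
      using n0 \<tau> by (simp add: Z_def \<mu>_def np[symmetric] field_simps eval_nat_numeral)
    have pairs: "(\<Sum>i\<in>anchors n. \<Sum>j\<in>anchors n - {i}. f i j) \<le> Z * (real n ^ 3 + real n ^ 4 * y)"
      if f: "\<And>v u v' u'. (v, u) \<in> anchors n \<Longrightarrow> (v', u') \<in> anchors n \<Longrightarrow> (v, u) \<noteq> (v', u') \<Longrightarrow>
          f (v, u) (v', u') \<le> Z * (if v = v' then 1 else y)" and y: "0 \<le> y" for f y
    proof -
      have "(\<Sum>i\<in>anchors n. \<Sum>j\<in>anchors n - {i}. f i j) \<le>
         (\<Sum>i\<in>anchors n. \<Sum>j\<in>anchors n - {i}. if fst i = fst j then Z else Z * y)"
      proof (intro sum_mono)
        fix i j assume "i \<in> anchors n" "j \<in> anchors n - {i}"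
        thus "f i j \<le> (if fst i = fst j then Z else Z * y)"
          using f[of "fst i" "snd i" "fst j" "snd j"] by (auto split: if_splits)
      qed
      also have "\<dots> \<le> real n ^ 3 * Z + real n ^ 4 * (Z * y)"
        using Z0 y by (intro sum_anchor_pairs_le) auto
      finally show ?thesis by (simp add: algebra_simps)
    qed
    have S2: "(\<Sum>i\<in>anchors n. \<Sum>j\<in>anchors n. gnp_prob n p (\<lambda>E. ?A i E \<and> ?A j E)) \<le> m + \<mu>\<^sup>2 * (1 + \<epsilon>)"
    proof -
      have "(\<Sum>i\<in>anchors n. \<Sum>j\<in>anchors n. gnp_prob n p (\<lambda>E. ?A i E \<and> ?A j E)) =
         (\<Sum>i\<in>anchors n. gnp_prob n p (?A i) + (\<Sum>j\<in>anchors n - {i}. gnp_prob n p (\<lambda>E. ?A i E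
             \<and> ?A j E)))"
      proof (intro sum.cong refl)
        fix i assume "i \<in> anchors n"
        from sum.remove[OF finite_anchors this, of "\<lambda>j. gnp_prob n p (\<lambda>E. ?A i E \<and> ?A j E)"]
        show "(\<Sum>j\<in>anchors n. gnp_prob n p (\<lambda>E. ?A i E \<and> ?A j E)) =
          gnp_prob n p (?A i) + (\<Sum>j\<in>anchors n - {i}. gnp_prob n p (\<lambda>E. ?A i E \<and> ?A j E))" by simp
      qed
      also have "\<dots> = m + (\<Sum>i\<in>anchors n. \<Sum>j\<in>anchors n - {i}. gnp_prob n p (\<lambda>E. ?A i E \<and> ?A j E))"
        by (simp add: sum.distrib m_def)
      also have "(\<Sum>i\<in>anchors n. \<Sum>j\<in>anchors n - {i}. gnp_prob n p (\<lambda>E. ?A i E \<and> ?A j E)) \<le>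
         Z * (real n ^ 3 + real n ^ 4 * (p + (D * \<tau>)\<^sup>2))"
      proof (rule pairs)
        fix v u v' u' assume ab: "(v, u) \<in> anchors n" "(v', u') \<in> anchors n" "(v, u) \<noteq> (v', u')"
        show "gnp_prob n p (\<lambda>E. ?A (v, u) E \<and> ?A (v', u') E) \<le> Z * (if v = v' then 1 else p
            + (D * \<tau>)\<^sup>2)"
          unfolding p_def Z_def D_def \<beta>_def \<tau>_def
          by (rule pair_prob(1)[OF l0(2) elim(2) n0 w2 B1 hw' k0b ab])
      qed (use p in simp)
      also have "\<dots> = \<mu>\<^sup>2 * (D ^ (2 * h + 2) * ((1 + l) / (n * \<tau>\<^sup>2)) + D ^ (2 * h + 2) * D\<^sup>2)"
        unfolding Zn using n0 \<tau> by (simp add: np[symmetric] field_simps eval_nat_numeral)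
      also have "\<dots> \<le> \<mu>\<^sup>2 * ((1 + \<delta>) * \<delta> + (1 + \<delta>))"
        using Da elim(8) \<delta> l \<tau> by (intro mult_left_mono add_mono mult_mono) auto
      also have "\<dots> \<le> \<mu>\<^sup>2 * (1 + \<epsilon>)"
      proof (intro mult_left_mono)
        have "\<delta> * \<delta> \<le> 1 * \<delta>" using \<delta> by (intro mult_right_mono) auto
        moreover have "\<epsilon> = 8 * \<delta>" by (simp add: \<delta>_def)
        ultimately show "(1 + \<delta>) * \<delta> + (1 + \<delta>) \<le> 1 + \<epsilon>" using \<delta> by (simp add: algebra_simps)
      qed simp
      finally show ?thesis by simp
    qed
    have r_le: "l ^ r \<le> n * (1 / l) ^ K2"
    proof -
      have "K2 + 1 \<le> log l n" using elim(10) by (simp add: log_def)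
      hence "int K2 \<le> \<lfloor>log l n\<rfloor>" by linarith
      hence "real (r + K2) \<le> log l n" unfolding r_def by linarith
      hence "l powr real (r + K2) \<le> l powr log l n" using l by (intro powr_mono) auto
      hence "l ^ (r + K2) \<le> n" using l n0 by (simp add: powr_realpow del: of_nat_add)
      thus ?thesis using l by (simp add: power_add power_divide field_simps)
    qed
    define \<Delta> where "\<Delta> = (\<Sum>i<r. l / n * l ^ i)"
    have \<Delta>: "0 \<le> \<Delta>" "\<Delta> \<le> \<delta> * \<tau>\<^sup>2"
    proof -
      show "0 \<le> \<Delta>" unfolding \<Delta>_def using l by (intro sum_nonneg) auto
      have "\<Delta> = l / n * (\<Sum>i<r. l ^ i)" by (simp add: \<Delta>_def sum_distrib_left)
      also have "(\<Sum>i<r. l ^ i) = (l ^ r - 1) / (l - 1)" using l by (simp add: geometric_sum)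
      also have "l / n * \<dots> \<le> l / n * (n * (1 / l) ^ K2 / (l - 1))"
        using r_le l by (intro mult_left_mono divide_right_mono) auto
      also have "\<dots> = l / (l - 1) * (1 / l) ^ K2" using n0 by simp
      finally show "\<Delta> \<le> \<delta> * \<tau>\<^sup>2" using K2 by linarith
    qed
    have SB: "(\<Sum>i\<in>anchors n. \<Sum>j\<in>anchors n - {i}. gnp_prob n p (\<lambda>E. ?A i E \<and> ?A j E \<and> ?B i j E))
        \<le> \<mu>\<^sup>2 * \<epsilon>"
    proof -
      have "(\<Sum>i\<in>anchors n. \<Sum>j\<in>anchors n - {i}. gnp_prob n p (\<lambda>E. ?A i E \<and> ?A j E \<and> ?B i j E)) \<le>
         Z * (real n ^ 3 + real n ^ 4 * \<Delta>)"
      proof (rule pairs[OF _ \<Delta>(1)])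
        fix v u v' u' assume ab: "(v, u) \<in> anchors n" "(v', u') \<in> anchors n" "(v, u) \<noteq> (v', u')"
        show "gnp_prob n p (\<lambda>E. ?A (v, u) E \<and> ?A (v', u') E \<and> ?B (v, u) (v', u') E) \<le> Z * (if v
            = v' then 1 else \<Delta>)"
          unfolding p_def Z_def D_def \<beta>_def \<Delta>_def
          by (rule pair_prob(2)[OF l0(2) elim(2) n0 w2 B1 hw' k0b ab])
      qed
      also have "\<dots> = \<mu>\<^sup>2 * (D ^ (2 * h + 2) * (1 / (n * \<tau>\<^sup>2) + \<Delta> / \<tau>\<^sup>2))"
        unfolding Zn using n0 \<tau> by (simp add: field_simps eval_nat_numeral)
      also have "\<dots> \<le> \<mu>\<^sup>2 * ((1 + \<delta>) * (\<delta> + \<delta>))"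
      proof (intro mult_left_mono mult_mono add_mono)
        have "1 / (n * \<tau>\<^sup>2) \<le> (1 + l) / (n * \<tau>\<^sup>2)" using l by (intro divide_right_mono) auto
        thus "1 / (n * \<tau>\<^sup>2) \<le> \<delta>" using elim(8) by linarith
        show "\<Delta> / \<tau>\<^sup>2 \<le> \<delta>" using \<Delta> \<tau> by (simp add: divide_le_eq)
      qed (use Da \<delta> \<Delta> \<tau> in auto)
      also have "\<dots> \<le> \<mu>\<^sup>2 * \<epsilon>"
      proof (intro mult_left_mono)
        have "\<delta> * \<delta> \<le> 1 * \<delta>" using \<delta> by (intro mult_right_mono) auto
        moreover have "\<epsilon> = 8 * \<delta>" by (simp add: \<delta>_def)
        ultimately show "(1 + \<delta>) * (\<delta> + \<delta>) \<le> \<epsilon>" using \<delta> by (simp add: algebra_simps)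
      qed simp
      finally show ?thesis .
    qed
    let ?F = "\<lambda>E. \<forall>i\<in>anchors n. \<forall>j\<in>anchors n. i \<noteq> j \<longrightarrow> ?A i E \<longrightarrow> ?A j E \<longrightarrow> ?B i j E"
    have "gnp_prob n p ?F \<le>
        4 * ((\<Sum>i\<in>anchors n. \<Sum>j\<in>anchors n. gnp_prob n p (\<lambda>E. ?A i E \<and> ?A j E)) - m\<^sup>2) / m\<^sup>2 +
        8 * (\<Sum>i\<in>anchors n. \<Sum>j\<in>anchors n - {i}. gnp_prob n p (\<lambda>E. ?A i E \<and> ?A j E \<and> ?B i j E)) / m\<^sup>2"
      unfolding m_def by (rule second_moment[OF finite_anchors]) (use m_big in \<open>simp add: m_def\<close>)
    also have "\<dots> \<le> 44 * \<epsilon>"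
      by (rule variance_arithmetic[OF \<epsilon>(1,2) m_ge _ \<mu>0 S2 SB]) (use m_big in simp)
    finally have F: "gnp_prob n p ?F \<le> \<eta> / 2" using \<epsilon>(3) by linarith
    let ?G = "\<lambda>E. thin_event n w H E \<or> jump_event n w (M * w) H E
        \<or> separated_event n w (M * w) H (\<lambda>_ _. n) E"
    have "gnp_prob n p (\<lambda>E. \<not> log l n + 2 * (ln n / ln (1 / ls)) - real (2 * K + K2)
        \<le> graph_diam {1..n} E) \<le>
       gnp_prob n p (\<lambda>E. ?F E \<or> ?G E)"
    proof (rule gnp_prob_mono, rule ccontr)
      fix E
      assume small: "\<not> log l n + 2 * (ln n / ln (1 / ls)) - real (2 * K + K2) \<le> graph_diam {1..n} E"
        and no: "\<not> (?F E \<or> ?G E)"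
      then obtain i j where ij: "i \<in> anchors n" "j \<in> anchors n" "i \<noteq> j" "?A i E" "?A j E" "\<not> ?B i
          j E" by blast
      have "2 * h + r + 3 \<le> graph_diam {1..n} E"
        by (rule diam_ge_of_far_branches[OF w2 _ _ _ ij(1-3) ij(4,5)[unfolded w'_def] hH ij(6)])
            (use no in blast)+
      moreover have "ln n / ln (1 / ls) - K \<le> h"
        using extinction_time_bounds(1)[OF ls n0] unfolding h_def by linarith
      moreover have "log l n - 1 - K2 \<le> r" unfolding r_def by linarith
      ultimately show False using small by simp
    qed
    also have "\<dots> \<le> gnp_prob n p ?F + gnp_prob n p ?G" by (rule gnp_prob_disj)
    also have "gnp_prob n p ?G \<le> \<eta> / 2" using elim(11) by (simp add: p_def w_def H_def)
    finally show ?case using F by (simp add: p_def)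
  qed
  thus ?thesis by blast
qed

theorem theorem1p1:
  fixes l ls :: real
  assumes "l > 1" and "ls < 1" and "ls * exp (- ls) = l * exp (- l)"
  shows "bigO_prob (\<lambda>n. measure_pmf (gnp n (l / real n)))
           (\<lambda>n E. real (graph_diam {1..n} E)
                    - (ln (real n) / ln l + 2 * (ln (real n) / ln (1 / ls))))
           (\<lambda>n. 1)"
  unfolding bigO_prob_def
proof (intro allI impI)
  fix \<eta> :: real assume \<eta>: "0 < \<eta>"
  have l: "1 < l" by fact
  have "0 < ls * exp (- ls)" using assms(1,3) by simp
  hence ls: "0 < ls" "ls < 1" using assms(2) by (auto simp: zero_less_mult_iff)
  \<comment> \<open>The equation relating \<open>ls\<close> and \<open>l\<close> says exactly that
    \<open>ls / l\<close>, the extinction probability, is a fixed point of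
    \<open>pgf l\<close>.\<close>
  have q: "pgf l (ls / l) = ls / l"
  proof -
    have "l * (ls / l - 1) = ls - l" using l by (simp add: field_simps)
    moreover have "exp (ls - l) = ls / l"
      using assms(3) l by (simp add: exp_diff exp_minus field_simps)
    ultimately show ?thesis by (simp add: pgf_def)
  qed
  define t where "t = (\<lambda>n. ln (real n) / ln l + 2 * (ln (real n) / ln (1 / ls)))"
  have log: "log l (real n) + 2 * (ln n / ln (1 / ls)) = t n" for n by (simp add: t_def log_def)
  obtain C1 where C1: "\<forall>\<^sub>F n in sequentially. gnp_prob n (l / n) (\<lambda>E.
     \<not> graph_diam {1..n} E \<le> nat \<lceil>t n\<rceil> + C1) \<le> \<eta> / 2"
    using diam_upper_tail[OF l ls q, of "\<eta> / 2"] \<eta> unfolding log by auto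
  obtain C2 where C2: "\<forall>\<^sub>F n in sequentially. gnp_prob n (l / n) (\<lambda>E.
     \<not> t n - real C2 \<le> graph_diam {1..n} E) \<le> \<eta> / 2"
    using diam_lower_tail[OF l ls q, of "\<eta> / 2"] \<eta> unfolding log by auto
  \<comment> \<open>The additional 1 absorbs the ceiling in the upper bound.\<close>
  define C where "C = real C1 + real C2 + 1"
  have "\<forall>\<^sub>F n in sequentially. gnp_prob n (l / n) (\<lambda>E. C < \<bar>real (graph_diam {1..n} E) - t n\<bar>) \<le> \<eta>"
    using C1 C2 eventually_gt_at_top[of 0]
  proof eventually_elim
    case (elim n)
    have "0 \<le> t n"
      unfolding t_def using l ls elim(3) by (intro add_nonneg_nonneg mult_nonneg_nonneg
          divide_nonneg_nonneg) auto
    hence "gnp_prob n (l / n) (\<lambda>E. C < \<bar>real (graph_diam {1..n} E) - t n\<bar>) \<le>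
      gnp_prob n (l / n) (\<lambda>E. \<not> graph_diam {1..n} E \<le> nat \<lceil>t n\<rceil> + C1 \<or> \<not> t n - real C2
          \<le> graph_diam {1..n} E)"
      unfolding C_def by (intro gnp_prob_mono) linarith
    also have "\<dots> \<le> \<eta> / 2 + \<eta> / 2" by (intro order_trans[OF gnp_prob_disj] add_mono elim)
    finally show ?case by simp
  qed
  thus "\<exists>C. \<forall>\<^sub>F n in sequentially.
        measure_pmf.prob (gnp n (l / real n)) {E \<in> space (measure_pmf (gnp n (l / real n))).
          C * 1 < \<bar>real (graph_diam {1..n} E) - (ln (real n) / ln l
              + 2 * (ln (real n) / ln (1 / ls)))\<bar>} \<le> \<eta>"
    unfolding gnp_prob_def t_def by (intro exI[of _ C]) simp
qed

end
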